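(* Assume that for a.e. $(x,t)\in Q_T$ and all $\xi,\xi'\in\mathbb{R}^N$ the following hold: (i) $a(x,t,\xi)\cdot\xi\ge\alpha_1|\xi|^p$; (ii) $|a(x,t,\xi)|\le\beta_1\left[|\xi|^{p-1}+a_1(x,t)\right]$; (iii) $|H(x,t,\xi)|\le b(x,t)|\xi|^{\gamma}$ with $\gamma=p-\frac{N+p}{N+2}$ and $b\in L^{N+2}(Q_T)$; (iv) $\left(a(x,t,\xi)-a(x,t,\xi')\right)\cdot(\xi-\xi')\ge\alpha\left(\varepsilon+|\xi|+|\xi'|\right)^{p-2}|\xi-\xi'|^2$ (the right-hand side being read as $0$ when $\xi=\xi'$); (v) $|H(x,t,\xi)-H(x,t,\xi')|\le h(x,t)\left(\eta+|\xi|+|\xi'|\right)^{\sigma}|\xi-\xi'|$; where $\alpha_1,\beta_1,\alpha>0$ are constants, $a_1\in L^{p'}(Q_T)$, and either (A) $p>1$, $\frac{2N}{N+2}\le p<2$, $\varepsilon=0$, $h\in L^\infty(Q_T)$, $\eta>0$ and $\sigma\le\frac{p-2}{2}$, or (B) $\varepsilon>0$, $h\in L^r(Q_T)$ for some $r\ge N+2$, $\eta=0$, $0\le\sigma\le p\left(\frac1{N+2}-\frac1r\right)+\frac{p-2}{2}$ and $2\le p\le\frac{2r(N+2)}{r(N+2)+2(N+2)-2r}$. Let $f=f_0-\operatorname{div}F$ with $f_0\in L^{\left(\frac{p(N+2)}{N}\right)'}(Q_T)$ and $F\in (L^{p'}(Q_T))^N$. Let $u$ and $v$ be two weak solutions,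 with initial data $u(\cdot,0),v(\cdot,0)\in L^2(\Omega)$ respectively, of $$u_t-\operatorname{div}a(x,t,\nabla u)+H(x,t,\nabla u)=f\ \text{in }Q_T,\qquad u=0\ \text{on }\partial\Omega\times(0,T),$$ such that $u(x,0)\le v(x,0)$ a.e. in $\Omega$. Then $u\le v$ a.e. in $Q_T$.
   Context: $\Omega$ is a bounded open subset of $\mathbb{R}^N$, $N\ge2$, $T>0$, $Q_t:=\Omega\times(0,t)$ for $t\in(0,T]$. For an exponent $m>1$, $m'=m/(m-1)$. The functions $a:Q_T\times\mathbb{R}^N\to\mathbb{R}^N$ and $H:Q_T\times\mathbb{R}^N\to\mathbb{R}$ are Carathéodory functions (measurable in $(x,t)$, continuous in $\xi$). A weak solution with initial datum $u_0\in L^2(\Omega)$ is a measurable function $u\in C([0,T];L^2(\Omega))\cap L^p(0,T;W_0^{1,p}(\Omega))$ such that for every $t\in(0,T]$ $$\int_\Omega u(x,t)\psi(x,t)\,dx+\iint_{Q_t}\left[-u\psi_t+a(x,\tau,\nabla u)\cdot\nabla \psi+H(x,\tau,\nabla u)\psi\right]dx\,d\tau=\int_\Omega u_0(x)\psi(x,0)\,dx+\iint_{Q_t}\left(f_0\psi+F\cdot\nabla \psi\right)dx\,d\tau$$ for each $\psi\in W^{1,2}(0,T;L^2(\Omega))\cap L^p(0,T;W_0^{1,p}(\Omega))$. *)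

theory Defs
  imports "HOL-Analysis.Analysis"
begin

text \<open>
  Points of the cylinder are pairs \<open>(x, t)\<close>. Measurability and integrals are with respect to
  Lebesgue measure. Function classes consist of functions rather than classes modulo
  almost-everywhere equality.
\<close>

definition cylinder :: "'a set \<Rightarrow> real \<Rightarrow> ('a \<times> real) set" where
  "cylinder \<Omega> t = \<Omega> \<times> {0<..<t}"

definition conj_exp :: "real \<Rightarrow> real" where
  "conj_exp m = m / (m - 1)"

definition Lp :: "'a::euclidean_space set \<Rightarrow> real \<Rightarrow> ('a \<Rightarrow> 'b::euclidean_space) set" where
  "Lp S p = {f \<in> borel_measurable (lebesgue_on S).
               integrable (lebesgue_on S) (\<lambda>x. norm (f x) powr p)}"

definition Lp_norm :: "'a::euclidean_space set \<Rightarrow> real \<Rightarrow> ('a \<Rightarrow> 'b::euclidean_space) \<Rightarrow> real" where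
  "Lp_norm S p f = (LINT x|lebesgue_on S. norm (f x) powr p) powr (1 / p)"

definition Linf :: "'a::euclidean_space set \<Rightarrow> ('a \<Rightarrow> 'b::euclidean_space) set" where
  "Linf S = {f \<in> borel_measurable (lebesgue_on S).
               \<exists>C. AE x in lebesgue_on S. norm (f x) \<le> C}"

primrec C_k :: "nat \<Rightarrow> ('a::euclidean_space \<Rightarrow> real) \<Rightarrow> bool" where
  "C_k 0 f \<longleftrightarrow> continuous_on UNIV f"
| "C_k (Suc k) f \<longleftrightarrow> (\<forall>x. f differentiable (at x)) \<and>
                    (\<forall>v. C_k k (\<lambda>x. frechet_derivative f (at x) v))"

text \<open>Elements of \<open>C\<^sub>c\<^sup>\<infinity>(S)\<close>, for open \<open>S\<close>, are extended by zero to the whole space.\<close>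

definition Cc_inf :: "'a::euclidean_space set \<Rightarrow> ('a \<Rightarrow> real) set" where
  "Cc_inf S = {\<phi>. (\<forall>k. C_k k \<phi>) \<and> compact (closure {x. \<phi> x \<noteq> 0}) \<and> closure {x. \<phi> x \<noteq> 0} \<subseteq> S}"

definition grad :: "(real^'n \<Rightarrow> real) \<Rightarrow> real^'n \<Rightarrow> real^'n" where
  "grad \<phi> x = (\<chi> i. frechet_derivative \<phi> (at x) (axis i 1))"

text \<open>
  The predicates below relate a function to its weak gradient, which is determined only up to a
  null set.
\<close>

definition W1p :: "(real^'n) set \<Rightarrow> real \<Rightarrow> (real^'n \<Rightarrow> real) \<Rightarrow> (real^'n \<Rightarrow> real^'n) \<Rightarrow> bool" where
  "W1p \<Omega> p w Dw \<longleftrightarrow> w \<in> Lp \<Omega> p \<and> Dw \<in> Lp \<Omega> p \<and>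
     (\<forall>\<phi>\<in>Cc_inf \<Omega>. \<forall>i. (LINT x|lebesgue_on \<Omega>. w x * grad \<phi> x $ i)
                        = - (LINT x|lebesgue_on \<Omega>. Dw x $ i * \<phi> x))"

definition W1p_0 :: "(real^'n) set \<Rightarrow> real \<Rightarrow> (real^'n \<Rightarrow> real) \<Rightarrow> (real^'n \<Rightarrow> real^'n) \<Rightarrow> bool" where
  "W1p_0 \<Omega> p w Dw \<longleftrightarrow> W1p \<Omega> p w Dw \<and>
     (\<forall>e>0. \<exists>\<phi>\<in>Cc_inf \<Omega>. Lp_norm \<Omega> p (\<lambda>x. w x - \<phi> x) + Lp_norm \<Omega> p (\<lambda>x. Dw x - grad \<phi> x) < e)"

text \<open>
  \<open>L\<^sup>p(0,T; W\<^sub>0\<^sup>1\<^sup>,\<^sup>p(\<Omega>))\<close> as a space of measurable functions on the cylinder: almost every time slice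
  is in \<open>W\<^sub>0\<^sup>1\<^sup>,\<^sup>p(\<Omega>)\<close>, and the \<open>p\<close>-th power of its norm is integrable in time. By Tonelli the latter is
  the \<open>L\<^sup>p\<close> condition on \<open>w\<close> and on its spatial gradient \<open>Dw\<close> over the cylinder.
\<close>

definition Lp_W1p_0 ::
  "(real^'n) set \<Rightarrow> real \<Rightarrow> real \<Rightarrow> ((real^'n) \<times> real \<Rightarrow> real) \<Rightarrow> ((real^'n) \<times> real \<Rightarrow> real^'n) \<Rightarrow> bool"
where
  "Lp_W1p_0 \<Omega> T p w Dw \<longleftrightarrow> w \<in> Lp (cylinder \<Omega> T) p \<and> Dw \<in> Lp (cylinder \<Omega> T) p \<and>
     (AE t in lebesgue_on {0<..<T}. W1p_0 \<Omega> p (\<lambda>x. w (x, t)) (\<lambda>x. Dw (x, t)))"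

definition C_L2 :: "(real^'n) set \<Rightarrow> real \<Rightarrow> ((real^'n) \<times> real \<Rightarrow> real) \<Rightarrow> bool" where
  "C_L2 \<Omega> T w \<longleftrightarrow> (\<forall>t\<in>{0..T}. (\<lambda>x. w (x, t)) \<in> Lp \<Omega> 2) \<and>
     (\<forall>s\<in>{0..T}. ((\<lambda>t. Lp_norm \<Omega> 2 (\<lambda>x. w (x, t) - w (x, s))) \<longlongrightarrow> 0) (at s within {0..T}))"

text \<open>
  \<open>W\<^sup>1\<^sup>,\<^sup>2(0,T; L\<^sup>2(\<Omega>))\<close>, with weak time derivative \<open>wt\<close>. The \<open>L\<^sup>2(\<Omega>)\<close>-valued time integrals in the
  definition of the weak derivative are evaluated pointwise for almost every \<open>x\<close>. Each element of
  this space has a unique representative in \<open>C([0,T]; L\<^sup>2(\<Omega>))\<close>; \<open>w\<close> is required to be that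
  representative, so that its values at individual times, including \<open>0\<close> and \<open>T\<close>, make sense.
\<close>

definition W12_L2 ::
  "(real^'n) set \<Rightarrow> real \<Rightarrow> ((real^'n) \<times> real \<Rightarrow> real) \<Rightarrow> ((real^'n) \<times> real \<Rightarrow> real) \<Rightarrow> bool"
where
  "W12_L2 \<Omega> T w wt \<longleftrightarrow> w \<in> Lp (cylinder \<Omega> T) 2 \<and> wt \<in> Lp (cylinder \<Omega> T) 2 \<and>
     (\<forall>\<theta>\<in>Cc_inf {0<..<T}. AE x in lebesgue_on \<Omega>.
        (LINT t|lebesgue_on {0<..<T}. w (x, t) * deriv \<theta> t)
          = - (LINT t|lebesgue_on {0<..<T}. wt (x, t) * \<theta> t)) \<and>
     C_L2 \<Omega> T w"

definition caratheodory ::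
  "'a::euclidean_space set \<Rightarrow> ('a \<Rightarrow> 'b::euclidean_space \<Rightarrow> 'c::euclidean_space) \<Rightarrow> bool"
where
  "caratheodory S g \<longleftrightarrow> (\<forall>\<xi>. (\<lambda>z. g z \<xi>) \<in> borel_measurable (lebesgue_on S)) \<and>
     (AE z in lebesgue_on S. continuous_on UNIV (g z))"

text \<open>
  Weak solutions of \<open>u\<^sub>t - div a(x,t,\<nabla>u) + H(x,t,\<nabla>u) = f\<^sub>0 - div F\<close> with zero lateral boundary values
  and initial datum \<open>u0\<close>.
\<close>

definition weak_solution ::
  "(real^'n) set \<Rightarrow> real \<Rightarrow> real \<Rightarrow>
   ((real^'n) \<times> real \<Rightarrow> real^'n \<Rightarrow> real^'n) \<Rightarrow> ((real^'n) \<times> real \<Rightarrow> real^'n \<Rightarrow> real) \<Rightarrow>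
   ((real^'n) \<times> real \<Rightarrow> real) \<Rightarrow> ((real^'n) \<times> real \<Rightarrow> real^'n) \<Rightarrow>
   (real^'n \<Rightarrow> real) \<Rightarrow> ((real^'n) \<times> real \<Rightarrow> real) \<Rightarrow> bool"
where
  "weak_solution \<Omega> T p a H f0 F u0 u \<longleftrightarrow>
     u0 \<in> Lp \<Omega> 2 \<and> C_L2 \<Omega> T u \<and>
     (\<exists>Du. Lp_W1p_0 \<Omega> T p u Du \<and>
       (\<forall>t\<in>{0<..T}. \<forall>\<psi> \<psi>t D\<psi>. W12_L2 \<Omega> T \<psi> \<psi>t \<longrightarrow> Lp_W1p_0 \<Omega> T p \<psi> D\<psi> \<longrightarrow>
          (LINT x|lebesgue_on \<Omega>. u (x, t) * \<psi> (x, t))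
          + (LINT z|lebesgue_on (cylinder \<Omega> t).
               - (u z * \<psi>t z) + a z (Du z) \<bullet> D\<psi> z + H z (Du z) * \<psi> z)
          = (LINT x|lebesgue_on \<Omega>. u0 x * \<psi> (x, 0))
          + (LINT z|lebesgue_on (cylinder \<Omega> t). f0 z * \<psi> z + F z \<bullet> D\<psi> z)))"

end

theory Submission imports Defs begin

text \<open>
  Let \<open>w = u - v\<close>. Since \<open>w\<close> has no weak time derivative that could be paired with it, the difference of
  the two weak formulations between the times \<open>s - h\<close> and \<open>s\<close> is tested with the time-independent function
  \<open>b(w(\<cdot>,s))\<close>, where \<open>b\<close> is a smooth bounded increasing truncation of the positive part. Convexity of
  the primitive of \<open>b\<close> bounds the increment of the energy from above; averaging over \<open>s\<close> and letting
  \<open>h\<close> tend to \<open>0\<close> (translations are continuous in \<open>L\<^sup>p\<close>) gives the energy inequality for \<open>w\<^sup>+\<close>.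

  By (iv) and (v) the Hamiltonian term satisfies \<open>\<bar>K\<bar> w\<^sup>+ \<le> g A\<^sup>1\<^sup>/\<^sup>2 w\<^sup>+\<close>, where \<open>A\<close> is dominated by the
  dissipation and \<open>g\<close> is bounded in case (A) and in \<open>L\<^sup>N\<^sup>+\<^sup>2\<close> in case (B). In case (A), Gronwall applies directly.
  In case (B), \<open>\<epsilon> > 0\<close> and \<open>p \<ge> 2\<close> give \<open>A \<ge> c \<bar>\<nabla>w\<bar>\<^sup>2\<close>, and the Gagliardo-Nirenberg inequality bounds
  \<open>w\<^sup>+\<close> in \<open>L\<^sup>q\<close> with \<open>q = 2(N+2)/N\<close>, so the term is absorbed on time intervals on which the integral of
  \<open>g\<^sup>N\<^sup>+\<^sup>2\<close> is small.

  The Gagliardo-Nirenberg inequality itself comes from translations: \<open>\<parallel>f(\<cdot> + y) - f\<parallel>\<^sub>2 \<le> \<bar>y\<bar> \<parallel>\<nabla>f\<parallel>\<^sub>2\<close> yields a weak-type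
  bound on superlevel sets, which is summed over dyadic truncations of \<open>f\<close>.
\<close>

section \<open>Borel representatives and continuity of translations\<close>

text \<open>A priori the Hamiltonian difference is only an L^1 function, so test functions must be
  bounded. The limits are therefore taken in a fixed order: h tends to 0 for a bounded truncation,
  and only then does the truncation level tend to infinity, once the bound g A^(1/2) w^+ has shown
  that K w^+ is integrable. Truncations are smooth and vanish at 0 because W_0^{1,p} is the closure
  of test functions, and composition must map test functions to test functions. The test function is
  frozen at the later of the two times, where the tangent inequality has the right sign.

  In case (B) the exponents fit as follows. The power \<sigma> of the gradients splits into (p-2)/2,
  which is absorbed into A^(1/2), and a part of at most p (1/(N+2) - 1/r), which is what Hoelder's
  inequality between h in L^r and gradients in L^p allows for g in L^(N+2). Then g^2 and (w^+)^2 lie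
  in the dual spaces L^((N+2)/2) and L^((N+2)/N). The parameter in Young's inequality can be chosen
  so that the remainder is exactly linear in the energy bound Y, and so the Gronwall argument closes
  although the Gagliardo-Nirenberg inequality is not linear in Y.\<close>

lemma AE_lebesgue_on_iff:
  assumes "S \<in> sets borel"
  shows "(AE z in lebesgue_on S. P z) \<longleftrightarrow> (AE z in lborel. z \<in> S \<longrightarrow> P z)"
  using assms by (simp add: AE_restrict_space_iff AE_completion_iff)

text \<open>Translations and iterated integrals are handled over \<open>lborel\<close> on the whole
  space, where they apply to Borel functions, whereas the definitions speak of
  \<open>lebesgue_on\<close>. A Borel function that vanishes off S and agrees with f almost
  everywhere on S links the two, since neither extension by zero nor completion changes an
  integral.\<close>

lemma integrable_lebesgue_on_iff:
  fixes f :: "'a::euclidean_space \<Rightarrow> 'b::euclidean_space"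
  assumes S: "S \<in> sets borel" and f': "f' \<in> borel_measurable borel" "\<And>z. z \<notin> S \<Longrightarrow> f' z = 0"
    and ae: "AE z in lborel. z \<in> S \<longrightarrow> f' z = f z" and m: "f \<in> borel_measurable (lebesgue_on S)"
  shows "integrable (lebesgue_on S) f \<longleftrightarrow> integrable lborel f'"
    and "(LINT z|lebesgue_on S. f z) = (LINT z|lborel. f' z)"
proof -
  have S': "S \<in> sets lebesgue" using S by simp
  have f'm: "f' \<in> borel_measurable lborel" using f' by simp
  have f'l: "f' \<in> borel_measurable lebesgue" using f'm by (rule measurable_completion)
  have fm: "(\<lambda>x. indicator S x *\<^sub>R f x) \<in> borel_measurable lebesgue"
    using borel_measurable_restrict_space_iff[of S lebesgue f] S' m by simp
  have e: "AE x in lebesgue. indicator S x *\<^sub>R f x = f' x"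
    using ae f'(2) by (auto simp: AE_completion_iff indicator_def elim!: eventually_mono)
  have "integrable (lebesgue_on S) f \<longleftrightarrow> integrable lebesgue (\<lambda>x. indicator S x *\<^sub>R f x)"
    using integrable_restrict_space[of S lebesgue f] S' by simp
  also have "\<dots> \<longleftrightarrow> integrable lebesgue f'"
    by (rule integrable_cong_AE[OF fm f'l e])
  also have "\<dots> \<longleftrightarrow> integrable lborel f'" by (rule integrable_completion[OF f'm])
  finally show "integrable (lebesgue_on S) f \<longleftrightarrow> integrable lborel f'" .
  have "(LINT z|lebesgue_on S. f z) = (LINT z|lebesgue. indicator S z *\<^sub>R f z)"
    using integral_restrict_space[of S lebesgue f] S' by simp
  also have "\<dots> = (LINT z|lebesgue. f' z)" by (rule integral_cong_AE[OF fm f'l e])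
  also have "\<dots> = (LINT z|lborel. f' z)" by (rule integral_completion[OF f'm])
  finally show "(LINT z|lebesgue_on S. f z) = (LINT z|lborel. f' z)" .
qed

text \<open>The result on real functions measurable for the completion is applied to each coordinate
  of the zero extension. There are finitely many coordinates, so the exceptional null sets can be
  merged; multiplication by the indicator restores exact vanishing off S.\<close>

lemma lebesgue_on_borel_rep:
  fixes f :: "'a::euclidean_space \<Rightarrow> 'b::euclidean_space"
  assumes S: "S \<in> sets borel" and m: "f \<in> borel_measurable (lebesgue_on S)"
  obtains f' where "f' \<in> borel_measurable borel" "\<And>z. z \<notin> S \<Longrightarrow> f' z = 0"
    "AE z in lborel. z \<in> S \<longrightarrow> f' z = f z"
proof -
  have S': "S \<in> sets lebesgue" using S by simp
  have fm: "(\<lambda>x. indicator S x *\<^sub>R f x) \<in> borel_measurable lebesgue"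
    using borel_measurable_restrict_space_iff[of S lebesgue f] S' m by simp
  have "\<exists>g\<in>borel_measurable lborel. AE x in lborel. (indicator S x *\<^sub>R f x) \<bullet> i = g x" for i
    by (rule completion_ex_borel_measurable_real) (use fm in measurable)
  then obtain g where g: "\<And>i. g i \<in> borel_measurable lborel"
     "\<And>i. AE x in lborel. (indicator S x *\<^sub>R f x) \<bullet> i = g i x" by metis
  define f' where "f' x = indicator S x *\<^sub>R (\<Sum>i\<in>Basis. g i x *\<^sub>R i)" for x
  show ?thesis
  proof
    have [measurable]: "g i \<in> borel_measurable borel" for i using g(1)[of i] by simp
    show "f' \<in> borel_measurable borel" unfolding f'_def using S by measurable
    show "f' z = 0" if "z \<notin> S" for z using that by (simp add: f'_def)
    have "AE x in lborel. \<forall>i\<in>Basis. (indicator S x *\<^sub>R f x) \<bullet> i = g i x"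
      using g(2) by (simp add: AE_finite_all)
    then show "AE z in lborel. z \<in> S \<longrightarrow> f' z = f z"
    proof (eventually_elim, intro impI)
      fix x assume *: "\<forall>i\<in>Basis. (indicator S x *\<^sub>R f x) \<bullet> i = g i x" "x \<in> S"
      then have "g i x = f x \<bullet> i" if "i \<in> Basis" for i using that by force
      then have "(\<Sum>i\<in>Basis. g i x *\<^sub>R i) = (\<Sum>i\<in>Basis. (f x \<bullet> i) *\<^sub>R i)"
        by (intro sum.cong) auto
      then show "f' x = f x" using *(2) by (simp add: f'_def euclidean_representation)
    qed
  qed
qed

text \<open>\<open>AE_pair\<close> fixes the first coordinate, but time is the second one. Swapping
  the two quantifiers needs a measurable set, so the exceptional set is first enlarged to a Borel
  null set.\<close>

lemma AE_lborel_slices: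
  fixes P :: "'a::euclidean_space \<times> 'b::euclidean_space \<Rightarrow> bool"
  assumes "AE z in lborel. P z"
  shows "AE t in lborel. AE x in lborel. P (x, t)"
proof -
  obtain N where N: "{z. \<not> P z} \<subseteq> N" "N \<in> sets lborel" "emeasure lborel N = 0"
    using AE_E[OF assms] by auto
  have "AE z in lborel. z \<notin> N" using N by (intro AE_not_in) (auto simp: null_sets_def)
  then have "AE z in (lborel \<Otimes>\<^sub>M lborel :: ('a \<times> 'b) measure). z \<notin> N" by (subst lborel_prod)
  then have "AE z in (lborel \<Otimes>\<^sub>M lborel :: ('a \<times> 'b) measure). (fst z, snd z) \<notin> N" by simp
  moreover have "{z \<in> space (lborel \<Otimes>\<^sub>M lborel). (fst z, snd z) \<notin> N} \<in> sets (lborel \<Otimes>\<^sub>M lborel :: ('a \<times> 'b) measure)"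
    using N(2) by (subst lborel_prod, subst lborel_prod) (simp flip: Compl_eq)
  ultimately have "AE x in lborel. AE t in lborel. (x, t) \<notin> N"
    using lborel_pair.AE_pair[of "\<lambda>z. z \<notin> N"] by (simp add: lborel_prod)
  moreover have "{z \<in> space (lborel \<Otimes>\<^sub>M lborel). (fst z, snd z) \<notin> N} \<in> sets (lborel \<Otimes>\<^sub>M lborel :: ('a \<times> 'b) measure)"
    by fact
  ultimately have "AE t in lborel. AE x in lborel. (x, t) \<notin> N"
    using lborel_pair.AE_commute[of "\<lambda>x t. (x,t) \<notin> N"] by (simp add: )
  then show ?thesis
    by eventually_elim (use N(1) in \<open>auto elim!: eventually_mono\<close>)
qed

lemma AE_lborel_fst:
  fixes P :: "'a::euclidean_space \<Rightarrow> bool"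
  assumes "AE x in lborel. P x"
  shows "AE z in (lborel :: ('a \<times> 'b::euclidean_space) measure). P (fst z)"
proof -
  obtain N where N: "{z. \<not> P z} \<subseteq> N" "N \<in> sets lborel" "emeasure lborel N = 0"
    using AE_E[OF assms] by auto
  have "emeasure (lborel \<Otimes>\<^sub>M lborel) (N \<times> (UNIV :: 'b set)) = 0"
    using N by (subst lborel.emeasure_pair_measure_Times) auto
  then have "N \<times> UNIV \<in> null_sets (lborel :: ('a \<times> 'b) measure)"
    using N by (simp add: null_sets_def lborel_prod borel_Times)
  then have "AE z in (lborel :: ('a \<times> 'b) measure). z \<notin> N \<times> UNIV" by (rule AE_not_in)
  then show ?thesis by eventually_elim (use N in auto)
qed

lemma powr_add_le:
  fixes a b q :: real
  assumes "a \<ge> 0" "b \<ge> 0" "q \<ge> 0"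
  shows "(a + b) powr q \<le> 2 powr q * (a powr q + b powr q)"
proof -
  have "(a + b) powr q \<le> (2 * max a b) powr q" by (intro powr_mono2) (use assms in auto)
  also have "\<dots> = 2 powr q * max a b powr q" using assms by (simp add: powr_mult)
  also have "\<dots> \<le> 2 powr q * (a powr q + b powr q)" by (intro mult_left_mono) (auto simp: max_def)
  finally show ?thesis .
qed

text \<open>Young's inequality for k a and b / k, with the factors 1/p and 1/q dropped. The free
  parameter k is what later makes one of the two terms as small as required.\<close>

lemma Young_scaled:
  fixes a b p q k :: real
  assumes "p > 1" "q > 1" "1/p + 1/q = 1" "a \<ge> 0" "b \<ge> 0" "k > 0"
  shows "a * b \<le> k powr q * a powr q + k powr (-p) * b powr p"
proof -
  have pq: "1/q + 1/p = 1" using assms by simp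
  have "a * b = (k * a) * (b / k)" using assms by simp
  also have "\<dots> \<le> (k * a) powr q / q + (b / k) powr p / p"
    by (rule Youngs_inequality) (use assms pq in auto)
  also have "\<dots> \<le> (k * a) powr q + (b / k) powr p"
  proof -
    have "x / r \<le> x" if "x \<ge> 0" "r > 1" for x r :: real
      using that by (simp add: divide_le_eq mult_le_cancel_left1)
    then show ?thesis by (intro add_mono) (use assms in auto)
  qed
  also have "\<dots> = k powr q * a powr q + k powr (-p) * b powr p"
    using assms by (simp add: powr_mult powr_divide powr_minus field_simps)
  finally show ?thesis .
qed

section \<open>Continuity of translations in L^1 and in the pairing of L^q with L^p\<close>

lemma integrable_lborel_diff_right:
  fixes f :: "'a::euclidean_space \<Rightarrow> 'b::{banach, second_countable_topology}"
  assumes "f \<in> borel_measurable borel"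
  shows "integrable lborel (\<lambda>z. f (z - c)) \<longleftrightarrow> integrable lborel f"
    and "(LINT z|lborel. f (z - c)) = (LINT z|lborel. f z)"
proof -
  have "integrable lborel f \<longleftrightarrow> integrable (distr lborel borel ((+) (- c))) f"
    by (simp add: lborel_distr_plus)
  also have "\<dots> \<longleftrightarrow> integrable lborel (\<lambda>z. f (z - c))"
    using assms by (subst integrable_distr_eq) auto
  finally show "integrable lborel (\<lambda>z. f (z - c)) \<longleftrightarrow> integrable lborel f" by simp
  have "(LINT z|lborel. f z) = (LINT z|distr lborel borel ((+) (- c)). f z)"
    by (simp add: lborel_distr_plus)
  also have "\<dots> = (LINT z|lborel. f (z - c))"
    using assms by (subst integral_distr) auto
  finally show "(LINT z|lborel. f (z - c)) = (LINT z|lborel. f z)" by simp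
qed

lemma integrable_indicator_compact_approx:
  fixes A :: "'a::euclidean_space set"
  assumes A: "A \<in> sets borel" "emeasure lborel A < \<infinity>" and "e > 0"
  obtains K U where "compact K" "open U" "K \<subseteq> A" "A \<subseteq> U" "U - K \<in> sets borel"
    "emeasure lborel (U - K) < ennreal e"
proof -
  have [measurable]: "A \<in> sets borel" by fact
  \<comment> \<open>Inner regularity is available for finite measures, hence this restriction of
    \<open>lborel\<close> to A, written as a density.\<close>
  let ?M = "density lborel (indicator A)"
  have M: "emeasure ?M B = emeasure lborel (A \<inter> B)" if [measurable]: "B \<in> sets borel" for B
    by (simp add: emeasure_density nn_integral_indicator Int_commute flip: indicator_inter_arith)
  have "emeasure ?M A = (SUP K \<in> {K. K \<subseteq> A \<and> compact K}. emeasure ?M K)"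
    by (rule inner_regular) (use A M[of UNIV] in \<open>auto\<close>)
  then have S: "emeasure lborel A = (SUP K \<in> {K. K \<subseteq> A \<and> compact K}. emeasure lborel K)"
    using M[of A] by (simp add: M borel_compact Int_absorb1 cong: SUP_cong_simp)
  have "\<exists>K. K \<subseteq> A \<and> compact K \<and> emeasure lborel A < emeasure lborel K + ennreal (e/2)"
  proof (cases "emeasure lborel A = 0")
    case True then show ?thesis using \<open>e > 0\<close> by (intro exI[of _ "{}"]) auto
  next
    case False
    then have "emeasure lborel A - ennreal (e/2) < emeasure lborel A"
      using A(2) \<open>e > 0\<close> by (intro ennreal_between) (auto simp: zero_less_iff_neq_zero)
    then obtain K where K: "K \<subseteq> A" "compact K" "emeasure lborel A - ennreal (e/2) < emeasure lborel K"
      using S by (auto simp: less_SUP_iff)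
    then have "emeasure lborel A < emeasure lborel K + ennreal (e/2)"
      using A(2) \<open>e > 0\<close>
      by (cases "emeasure lborel A"; cases "emeasure lborel K")
         (auto simp: ennreal_minus ennreal_less_iff not_le[symmetric] simp flip: ennreal_plus intro!: ennreal_leI)
    then show ?thesis using K by blast
  qed
  then obtain K where K: "K \<subseteq> A" "compact K" "emeasure lborel A < emeasure lborel K + ennreal (e/2)" by blast
  have [measurable]: "K \<in> sets borel" using K(2) by (rule borel_compact)
  have AK: "emeasure lborel (A - K) < ennreal (e/2)"
  proof -
    have "emeasure lborel A = emeasure lborel K + emeasure lborel (A - K)"
      using K(1) plus_emeasure[of K lborel "A - K"] by (simp add: Un_absorb1)
    moreover have "emeasure lborel K < \<infinity>"
      using A(2) K(1) emeasure_mono[of K A lborel] by (simp add: le_less_trans)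
    ultimately show ?thesis using K(3) by (simp add: ennreal_add_left_cancel_less)
  qed
  obtain U where U: "open U" "A \<subseteq> U" "emeasure lborel (U - A) < ennreal (e/2)"
    using outer_regular_lborel[of A "e/2"] A \<open>e > 0\<close> by auto
  have [measurable]: "U \<in> sets borel" using U by simp
  have "emeasure lborel (U - K) \<le> emeasure lborel ((U - A) \<union> (A - K))"
    by (intro emeasure_mono) auto
  also have "\<dots> \<le> emeasure lborel (U - A) + emeasure lborel (A - K)"
    by (intro emeasure_subadditive) auto
  also have "\<dots> < ennreal (e/2) + ennreal (e/2)" by (rule add_strict_mono) (use U AK in auto)
  also have "\<dots> = ennreal e" using \<open>e > 0\<close> by (simp flip: ennreal_plus)
  finally show ?thesis using that K U by auto
qed

text \<open>Integrable functions arise from indicators by sums and dominated limits. For a set A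
  squeezed between a compact K and an open U, a small shift moves K inside U, so the indicator and
  its translate differ only on U - K or on the translate of U - K.\<close>

theorem L1_translation_tendsto:
  fixes f :: "'a::euclidean_space \<Rightarrow> 'b::euclidean_space"
  assumes "integrable lborel f"
  shows "((\<lambda>c. LINT z|lborel. norm (f (z - c) - f z)) \<longlongrightarrow> 0) (at 0)"
  using assms
proof (induct rule: integrable_induct)
  case (base A c)
  have A: "A \<in> sets borel" "emeasure lborel A < \<infinity>" using base by auto
  have [measurable]: "A \<in> sets borel" by fact
  show ?case
  proof (rule tendstoI)
    fix e :: real assume "e > 0"
    define e' where "e' = e / (3 * (norm c + 1))"
    have e': "e' > 0" using \<open>e > 0\<close> by (simp add: e'_def add_nonneg_pos)
    obtain K U where KU: "compact K" "open U" "K \<subseteq> A" "A \<subseteq> U" "U - K \<in> sets borel"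
      "emeasure lborel (U - K) < ennreal e'"
      using integrable_indicator_compact_approx[OF A e'] by blast
    have "\<exists>d>0. \<forall>c. norm c < d \<longrightarrow> (\<forall>x\<in>K. x + c \<in> U)"
    proof -
      obtain d where d: "d > 0" "(\<Union>x\<in>K. ball x d) \<subseteq> U"
        by (rule compact_subset_open_imp_ball_epsilon_subset[of K U]) (use KU in auto)
      then have "x + c \<in> U" if "norm c < d" "x \<in> K" for x c
        using that by (intro subsetD[OF d(2)]) (auto intro!: bexI[of _ x] simp: dist_norm)
      then show ?thesis using d(1) by blast
    qed
    then obtain d where d: "d > 0" "\<And>c x. norm c < d \<Longrightarrow> x \<in> K \<Longrightarrow> x + c \<in> U" by blast
    have [measurable]: "U - K \<in> sets borel" by fact
    have iUK: "integrable lborel (\<lambda>z. indicator (U - K) z :: real)"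
      using KU(6) by (simp add: integrable_real_indicator less_trans[OF _ ennreal_less_top])
    have iUKc: "integrable lborel (\<lambda>z. indicator (U - K) (z - h) :: real)" for h
      using iUK by (subst integrable_lborel_diff_right) auto
    have mUK: "measure lborel (U - K) < e'"
      using KU(6) e' unfolding measure_def by (cases "emeasure lborel (U - K)") (auto simp: ennreal_less_iff)
    have "(LINT z|lborel. norm (indicator A (z - h) *\<^sub>R c - indicator A z *\<^sub>R c)) < e" if h: "norm h < d" for h
    proof -
      have hm: "norm (-h) < d" using h by simp
      have "(LINT z|lborel. norm (indicator A (z - h) *\<^sub>R c - indicator A z *\<^sub>R c))
          \<le> (LINT z|lborel. norm c * (indicator (U - K) (z - h) + indicator (U - K) z))"
      proof (rule integral_mono')
        fix z
        show "norm (indicator A (z - h) *\<^sub>R c - indicator A z *\<^sub>R c)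
             \<le> norm c * (indicator (U - K) (z - h) + indicator (U - K) z)"
          using d(2)[OF h, of "z - h"] d(2)[OF hm, of z] KU(3,4)
          by (auto simp: indicator_def)
      qed (use iUK iUKc in auto)
      also have "\<dots> = norm c * (2 * measure lborel (U - K))"
        using iUK iUKc integrable_lborel_diff_right(2)[of "\<lambda>z. indicator (U - K) z :: real" h] by simp
      also have "\<dots> \<le> norm c * (2 * e')" using mUK by (intro mult_left_mono) auto
      also have "\<dots> < e"
      proof -
        have "e = 3 * (norm c + 1) * e'" by (simp add: e'_def add_nonneg_eq_0_iff)
        moreover have "0 < e' * (norm c + 3)" using e' by (simp add: add_nonneg_pos)
        ultimately show ?thesis by (simp add: algebra_simps)
      qed
      finally show ?thesis .
    qed
    then show "\<forall>\<^sub>F h in at 0. dist (LINT z|lborel. norm (indicator A (z - h) *\<^sub>R c - indicator A z *\<^sub>R c)) 0 < e"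
      using d(1) by (auto simp: eventually_at intro!: exI[of _ d])
  qed
next
  case (add f g)
  have [measurable]: "f \<in> borel_measurable borel" "g \<in> borel_measurable borel" using add by auto
  have 1: "integrable lborel (\<lambda>z. norm (f (z - c) - f z))" "integrable lborel (\<lambda>z. norm (g (z - c) - g z))" for c
    using add by (auto intro!: integrable_norm Bochner_Integration.integrable_diff simp: integrable_lborel_diff_right)
  have T: "((\<lambda>c. (LINT z|lborel. norm (f (z - c) - f z)) + (LINT z|lborel. norm (g (z - c) - g z))) \<longlongrightarrow> 0) (at 0)"
    using tendsto_add[OF add(2) add(4)] by simp
  have B: "norm (LINT z|lborel. norm (f (z - c) + g (z - c) - (f z + g z)))
     \<le> (LINT z|lborel. norm (f (z - c) - f z)) + (LINT z|lborel. norm (g (z - c) - g z))" for c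
  proof -
    have "(LINT z|lborel. norm (f (z - c) + g (z - c) - (f z + g z)))
      \<le> (LINT z|lborel. norm (f (z - c) - f z) + norm (g (z - c) - g z))"
      by (rule integral_mono') (use 1 norm_triangle_ineq in \<open>auto intro!: norm_diff_triangle_ineq\<close>)
    then show ?thesis using 1 by simp
  qed
  show ?case by (rule Lim_null_comparison[OF _ T]) (use B in auto)
next
  case (lim f s)
  have [measurable]: "f \<in> borel_measurable borel" "s i \<in> borel_measurable borel" for i using lim by auto
  \<comment> \<open>The induction scheme supplies approximations with norm at most twice that of f,
    hence the dominating function 3 |f|.\<close>
  have L: "(\<lambda>i. LINT z|lborel. norm (s i z - f z)) \<longlonglongrightarrow> (LINT z::'a|lborel. norm (0::'b))"
  proof (rule integral_dominated_convergence[where w = "\<lambda>z. 3 * norm (f z)"])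
    show "AE z in lborel. (\<lambda>i. norm (s i z - f z)) \<longlonglongrightarrow> norm (0::'b)"
      using lim(3) by (intro AE_I2 tendsto_norm) (auto simp: LIM_zero_iff)
    show "AE z in lborel. norm (norm (s i z - f z)) \<le> 3 * norm (f z)" for i
    proof (rule AE_I2)
      fix z :: 'a
      show "norm (norm (s i z - f z)) \<le> 3 * norm (f z)"
        using lim(4)[of z i] norm_triangle_ineq4[of "s i z" "f z"] by simp
    qed
  qed (use lim in auto)
  show ?case
  proof (rule tendstoI)
    fix e :: real assume "e > 0"
    have "\<forall>\<^sub>F i in sequentially. (LINT z|lborel. norm (s i z - f z)) < e/3"
      using order_tendstoD(2)[OF L, of "e/3"] \<open>e > 0\<close> by simp
    then obtain i where i: "(LINT z|lborel. norm (s i z - f z)) < e/3" by (auto simp: eventually_sequentially)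
    have ev: "\<forall>\<^sub>F c in at 0. (LINT z|lborel. norm (s i (z - c) - s i z)) < e/3"
      using order_tendstoD(2)[OF lim(2)[of i], of "e/3"] \<open>e > 0\<close> by simp
    show "\<forall>\<^sub>F c in at 0. dist (LINT z|lborel. norm (f (z - c) - f z)) 0 < e"
      using ev
    proof eventually_elim
      case (elim c)
      have i1: "integrable lborel (\<lambda>z. norm (s i z - f z))" using lim by auto
      have i2: "integrable lborel (\<lambda>z. norm (s i (z - c) - f (z - c)))"
        using i1 integrable_lborel_diff_right(1)[of "\<lambda>z. norm (s i z - f z)" c] by simp
      have i3: "integrable lborel (\<lambda>z. norm (s i (z - c) - s i z))"
        using lim(1)[of i] by (auto simp: integrable_lborel_diff_right)
      have "(LINT z|lborel. norm (f (z - c) - f z)) \<le>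
        (LINT z|lborel. norm (s i (z - c) - f (z - c)) + norm (s i (z - c) - s i z) + norm (s i z - f z))"
      proof (rule integral_mono')
        fix z
        have "norm (f (z - c) - f z) \<le> norm (f (z - c) - s i (z - c)) + norm (s i (z - c) - s i z) + norm (s i z - f z)"
          using norm_triangle_le[of "f (z - c) - s i (z - c)" "s i (z - c) - f z"]
            norm_triangle_ineq[of "s i (z - c) - s i z" "s i z - f z"] by (simp add: norm_triangle_le)
        then show "norm (f (z - c) - f z) \<le> norm (s i (z - c) - f (z - c)) + norm (s i (z - c) - s i z) + norm (s i z - f z)"
          by (simp add: norm_minus_commute)
      qed (use i1 i2 i3 in auto)
      also have "\<dots> = (LINT z|lborel. norm (s i z - f z)) + (LINT z|lborel. norm (s i (z - c) - s i z)) + (LINT z|lborel. norm (s i z - f z))"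
        using i1 i2 i3 integrable_lborel_diff_right(2)[of "\<lambda>z. norm (s i z - f z)" c] by simp
      also have "\<dots> < e" using i elim by simp
      finally show ?case by simp
    qed
  qed
qed

text \<open>Against a bounded g the pairing changes by at most B times the L^1 distance to the
  translate. This version serves the Hamiltonian term, which is known only in L^1.\<close>

lemma inner_translation_tendsto_bounded:
  fixes f g :: "'a::euclidean_space \<Rightarrow> 'b::euclidean_space"
  assumes f: "integrable lborel f" and g[measurable]: "g \<in> borel_measurable borel"
    and B: "\<And>z. norm (g z) \<le> B"
  shows "((\<lambda>c. LINT z|lborel. f (z - c) \<bullet> g z) \<longlongrightarrow> (LINT z|lborel. f z \<bullet> g z)) (at 0)"
proof -
  have [measurable]: "f \<in> borel_measurable borel" using f by auto
  have ifc: "integrable lborel (\<lambda>z. f (z - c))" for c using f by (simp add: integrable_lborel_diff_right)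
  have ig: "integrable lborel (\<lambda>z. h z \<bullet> g z)" if "integrable lborel h" for h :: "'a \<Rightarrow> 'b"
  proof (rule Bochner_Integration.integrable_bound[of _ "\<lambda>z. B * norm (h z)"])
    show "AE z in lborel. norm (h z \<bullet> g z) \<le> norm (B * norm (h z))"
    proof (rule AE_I2)
      fix z
      have "norm (h z \<bullet> g z) \<le> norm (h z) * norm (g z)" by (simp add: Cauchy_Schwarz_ineq2)
      also have "\<dots> \<le> norm (h z) * B" using B by (intro mult_left_mono) auto
      finally show "norm (h z \<bullet> g z) \<le> norm (B * norm (h z))" by (simp add: mult.commute)
    qed
  qed (use that in \<open>auto\<close>)
  have "((\<lambda>c. (LINT z|lborel. f (z - c) \<bullet> g z) - (LINT z|lborel. f z \<bullet> g z)) \<longlongrightarrow> 0) (at 0)"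
  proof (rule Lim_null_comparison)
    show "((\<lambda>c. B * (LINT z|lborel. norm (f (z - c) - f z))) \<longlongrightarrow> 0) (at 0)"
      using tendsto_mult[OF tendsto_const L1_translation_tendsto[OF f], of B] by simp
    show "\<forall>\<^sub>F c in at 0. norm ((LINT z|lborel. f (z - c) \<bullet> g z) - (LINT z|lborel. f z \<bullet> g z))
        \<le> B * (LINT z|lborel. norm (f (z - c) - f z))"
    proof (rule always_eventually, rule allI)
      fix c
      have "norm ((LINT z|lborel. f (z - c) \<bullet> g z) - (LINT z|lborel. f z \<bullet> g z))
        = norm (LINT z|lborel. (f (z - c) - f z) \<bullet> g z)"
        using ig[OF ifc[of c]] ig[OF f] by (simp add: inner_diff_left)
      also have "\<dots> \<le> (LINT z|lborel. norm ((f (z - c) - f z) \<bullet> g z))" by (rule integral_norm_bound)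
      also have "\<dots> \<le> (LINT z|lborel. B * norm (f (z - c) - f z))"
      proof (rule integral_mono')
        fix z
        have "norm ((f (z - c) - f z) \<bullet> g z) \<le> norm (f (z - c) - f z) * norm (g z)" by (simp add: Cauchy_Schwarz_ineq2)
        also have "\<dots> \<le> norm (f (z - c) - f z) * B" using B by (intro mult_left_mono) auto
        finally show "norm ((f (z - c) - f z) \<bullet> g z) \<le> B * norm (f (z - c) - f z)" by (simp add: mult.commute)
      next
        show "0 \<le> B * norm (f (z - c) - f z)" for z using order_trans[OF norm_ge_zero B[of z]] by simp
      qed (use f ifc in auto)
      finally show "norm ((LINT z|lborel. f (z - c) \<bullet> g z) - (LINT z|lborel. f z \<bullet> g z))
        \<le> B * (LINT z|lborel. norm (f (z - c) - f z))" by simp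
    qed
  qed
  then show ?thesis by (simp add: LIM_zero_iff)
qed

lemma integrable_inner_powr:
  fixes f g :: "'a \<Rightarrow> 'b::euclidean_space"
  assumes pq: "p > 1" "q > 1" "1/p + 1/q = 1"
    and [measurable]: "f \<in> borel_measurable M" "g \<in> borel_measurable M"
    and fq: "integrable M (\<lambda>z. norm (f z) powr q)" and gp: "integrable M (\<lambda>z. norm (g z) powr p)"
  shows "integrable M (\<lambda>z. norm (f z) * norm (g z))" "integrable M (\<lambda>z. f z \<bullet> g z)"
proof -
  show 1: "integrable M (\<lambda>z. norm (f z) * norm (g z))"
  proof (rule Bochner_Integration.integrable_bound[OF Bochner_Integration.integrable_add[OF fq gp]])
    show "AE z in M. norm (norm (f z) * norm (g z)) \<le> norm (norm (f z) powr q + norm (g z) powr p)"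
      using Young_scaled[OF pq, of "norm (f _)" "norm (g _)" 1] by auto
  qed measurable
  show "integrable M (\<lambda>z. f z \<bullet> g z)"
    by (rule Bochner_Integration.integrable_bound[OF 1]) (auto simp: Cauchy_Schwarz_ineq2)
qed

text \<open>Cutting g off at height n leaves a bounded part, settled by L^1 continuity, and a tail
  that is small in L^p. The tail is paired with f(z - c) - f(z), whose L^q integral is bounded
  uniformly in c.\<close>

lemma inner_translation_tendsto:
  fixes f g :: "'a::euclidean_space \<Rightarrow> 'b::euclidean_space"
  assumes pq: "p > 1" "q > 1" "1/p + 1/q = 1"
    and f: "integrable lborel f" and g[measurable]: "g \<in> borel_measurable borel"
    and fq: "integrable lborel (\<lambda>z. norm (f z) powr q)" and gp: "integrable lborel (\<lambda>z. norm (g z) powr p)"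
  shows "((\<lambda>c. LINT z|lborel. f (z - c) \<bullet> g z) \<longlongrightarrow> (LINT z|lborel. f z \<bullet> g z)) (at 0)"
proof (rule tendstoI)
  fix e :: real assume "e > 0"
  have [measurable]: "f \<in> borel_measurable borel" using f by auto
  \<comment> \<open>C bounds the integral of |f(z - c) - f(z)|^q for every c, and k makes the
    corresponding term of Young's inequality at most e/4.\<close>
  define C where "C = 2 * 2 powr q * (LINT z|lborel. norm (f z) powr q)"
  have C: "C \<ge> 0" unfolding C_def by (intro mult_nonneg_nonneg integral_nonneg_AE) auto
  define k where "k = (e / (4 * (C + 1))) powr (1/q)"
  have k: "k > 0" using \<open>e > 0\<close> C by (simp add: k_def)
  have "k powr q = e / (4 * (C + 1))" using pq \<open>e > 0\<close> C by (simp add: k_def powr_powr)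
  then have "k powr q * (C + 1) = e/4" using C by (simp add: field_simps del: distrib_left_numeral)
  moreover have "k powr q * C \<le> k powr q * (C + 1)" by (intro mult_left_mono) auto
  ultimately have kC: "k powr q * C \<le> e/4" by simp
  define gn where "gn n z = (if norm (g z) \<le> real n then g z else 0)" for n z
  have [measurable]: "gn n \<in> borel_measurable borel" for n unfolding gn_def by measurable
  have L: "(\<lambda>n. LINT z|lborel. norm (g z - gn n z) powr p) \<longlonglongrightarrow> (LINT z::'a|lborel. 0)"
  proof (rule integral_dominated_convergence[where w = "\<lambda>z. norm (g z) powr p"])
    show "AE z in lborel. (\<lambda>n. norm (g z - gn n z) powr p) \<longlonglongrightarrow> 0"
    proof (rule AE_I2)
      fix z
      have "\<forall>\<^sub>F n in sequentially. norm (g z) \<le> real n"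
        by (rule eventually_sequentiallyI[of "nat \<lceil>norm (g z)\<rceil>"]) linarith
      then have "\<forall>\<^sub>F n in sequentially. norm (g z - gn n z) powr p = 0"
        by eventually_elim (simp add: gn_def)
      then show "(\<lambda>n. norm (g z - gn n z) powr p) \<longlonglongrightarrow> 0" by (rule tendsto_eventually)
    qed
    show "AE z in lborel. norm (norm (g z - gn n z) powr p) \<le> norm (g z) powr p" for n
      by (auto simp: gn_def)
  qed (use gp in auto)
  have "(\<lambda>n. k powr (-p) * (LINT z|lborel. norm (g z - gn n z) powr p)) \<longlonglongrightarrow> 0"
    using tendsto_mult[OF tendsto_const L, of "k powr (-p)"] by simp
  then have "\<forall>\<^sub>F n in sequentially. k powr (-p) * (LINT z|lborel. norm (g z - gn n z) powr p) < e/4"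
    by (rule order_tendstoD(2)) (use \<open>e > 0\<close> in simp)
  then obtain n where n: "k powr (-p) * (LINT z|lborel. norm (g z - gn n z) powr p) < e/4"
    by (auto simp: eventually_sequentially)
  have ign: "integrable lborel (\<lambda>z. norm (g z - gn n z) powr p)"
    by (rule Bochner_Integration.integrable_bound[OF gp]) (auto simp: gn_def)
  have ignn: "integrable lborel (\<lambda>z. norm (gn n z) powr p)"
    by (rule Bochner_Integration.integrable_bound[OF gp]) (auto simp: gn_def)
  have fqc: "integrable lborel (\<lambda>z. norm (f (z - c)) powr q)" for c
    using fq integrable_lborel_diff_right(1)[of "\<lambda>z. norm (f z) powr q" c] by simp
  have T: "((\<lambda>c. LINT z|lborel. f (z - c) \<bullet> gn n z) \<longlongrightarrow> (LINT z|lborel. f z \<bullet> gn n z)) (at 0)"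
    by (rule inner_translation_tendsto_bounded[OF f, where B = "real n"]) (auto simp: gn_def)
  have ev: "\<forall>\<^sub>F c in at 0. dist (LINT z|lborel. f (z - c) \<bullet> gn n z) (LINT z|lborel. f z \<bullet> gn n z) < e/4"
    using tendstoD[OF T, of "e/4"] \<open>e > 0\<close> by simp
  show "\<forall>\<^sub>F c in at 0. dist (LINT z|lborel. f (z - c) \<bullet> g z) (LINT z|lborel. f z \<bullet> g z) < e"
    using ev
  proof eventually_elim
    case (elim c)
    have i1: "integrable lborel (\<lambda>z. f (z - c) \<bullet> g z)" "integrable lborel (\<lambda>z. f z \<bullet> g z)"
      "integrable lborel (\<lambda>z. f (z - c) \<bullet> gn n z)" "integrable lborel (\<lambda>z. f z \<bullet> gn n z)"
      by (rule integrable_inner_powr[OF pq]; use fq fqc gp ignn in simp)+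
    let ?D = "\<lambda>z. f (z - c) - f z"
    have Dq: "norm (?D z) powr q \<le> 2 powr q * (norm (f (z - c)) powr q + norm (f z) powr q)" for z
    proof -
      have "norm (?D z) powr q \<le> (norm (f (z - c)) + norm (f z)) powr q"
        by (intro powr_mono2) (use pq norm_triangle_ineq4 in auto)
      also have "\<dots> \<le> 2 powr q * (norm (f (z - c)) powr q + norm (f z) powr q)"
        by (rule powr_add_le) (use pq in auto)
      finally show ?thesis .
    qed
    have iDq: "integrable lborel (\<lambda>z. norm (?D z) powr q)"
      by (rule Bochner_Integration.integrable_bound[where f="\<lambda>z. 2 powr q * (norm (f (z - c)) powr q + norm (f z) powr q)"])
        (use Dq fq fqc in \<open>auto intro: order_trans[OF _ abs_ge_self]\<close>)
    have "(LINT z|lborel. f (z - c) \<bullet> g z) - (LINT z|lborel. f z \<bullet> g z)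
       - ((LINT z|lborel. f (z - c) \<bullet> gn n z) - (LINT z|lborel. f z \<bullet> gn n z))
       = (LINT z|lborel. ?D z \<bullet> (g z - gn n z))"
      using i1 by (simp add: inner_diff_left inner_diff_right)
    also have "\<bar>\<dots>\<bar> \<le> (LINT z|lborel. norm (?D z \<bullet> (g z - gn n z)))"
      using integral_norm_bound[of lborel "\<lambda>z. ?D z \<bullet> (g z - gn n z)"] by simp
    also have "\<dots> \<le> (LINT z|lborel. k powr q * norm (?D z) powr q + k powr (-p) * norm (g z - gn n z) powr p)"
    proof (rule integral_mono')
      fix z
      have "norm (?D z \<bullet> (g z - gn n z)) \<le> norm (?D z) * norm (g z - gn n z)" by (simp add: Cauchy_Schwarz_ineq2)
      also have "\<dots> \<le> k powr q * norm (?D z) powr q + k powr (-p) * norm (g z - gn n z) powr p"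
        by (rule Young_scaled[OF pq _ _ k]) auto
      finally show "norm (?D z \<bullet> (g z - gn n z)) \<le> \<dots>" .
    qed (use iDq ign in auto)
    also have "\<dots> = k powr q * (LINT z|lborel. norm (?D z) powr q) + k powr (-p) * (LINT z|lborel. norm (g z - gn n z) powr p)"
      using iDq ign by simp
    also have "\<dots> \<le> k powr q * C + e/4"
    proof -
      have "(LINT z|lborel. norm (?D z) powr q) \<le> (LINT z|lborel. 2 powr q * (norm (f (z - c)) powr q + norm (f z) powr q))"
        by (intro integral_mono') (use Dq fq fqc in auto)
      also have "\<dots> = C"
        using fq fqc[of c] integrable_lborel_diff_right(2)[of "\<lambda>z. norm (f z) powr q" c] by (simp add: C_def)
      finally show ?thesis using n by (intro add_mono mult_left_mono) auto
    qed
    finally show ?case using kC elim \<open>e > 0\<close> unfolding dist_real_def by linarith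
  qed
qed

section \<open>Smooth functions with compact support\<close>

lemma C_k_continuous: "C_k k f \<Longrightarrow> continuous_on UNIV f"
  by (cases k) (auto intro!: differentiable_imp_continuous_on simp: differentiable_on_def differentiable_at_withinI)

lemma C_k_SucI:
  fixes f :: "'a::euclidean_space \<Rightarrow> real"
  assumes "\<And>x. (f has_derivative f' x) (at x)" "\<And>v. C_k k (\<lambda>x. f' x v)"
  shows "C_k (Suc k) f"
proof -
  have "frechet_derivative f (at x) = f' x" for x
    using assms(1) by (rule frechet_derivative_at[symmetric])
  then show ?thesis using assms by (auto simp: differentiable_def)
qed

lemma C_k_SucD: "C_k (Suc k) f \<Longrightarrow> C_k k f"
proof (induction k arbitrary: f)
  case 0
  then show ?case using C_k_continuous[of "Suc 0" f] by simp
qed auto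

lemma C_k_SucE:
  assumes "C_k (Suc k) f"
  shows "(f has_derivative frechet_derivative f (at x)) (at x)" "C_k k (\<lambda>x. frechet_derivative f (at x) v)"
  using assms by (auto simp: frechet_derivative_works)

lemma C_k_const: "C_k k (\<lambda>x. c)"
proof (induction k arbitrary: c)
  case (Suc k)
  show ?case by (rule C_k_SucI[where f' = "\<lambda>x v. 0"]) (use Suc in auto)
qed simp

lemma C_k_add:
  assumes "C_k k f" "C_k k g" shows "C_k k (\<lambda>x. f x + g x)"
  using assms
proof (induction k arbitrary: f g)
  case (Suc k)
  show ?case
    by (rule C_k_SucI[where f' = "\<lambda>x v. frechet_derivative f (at x) v + frechet_derivative g (at x) v"])
      (use Suc in \<open>auto intro!: has_derivative_add C_k_SucE\<close>)
qed (auto intro: continuous_intros)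

lemma C_k_mult:
  fixes f g :: "'a::euclidean_space \<Rightarrow> real"
  assumes "C_k k f" "C_k k g" shows "C_k k (\<lambda>x. f x * g x)"
  using assms
proof (induction k arbitrary: f g)
  case (Suc k)
  show ?case
    by (rule C_k_SucI[where f' = "\<lambda>x v. f x * frechet_derivative g (at x) v + frechet_derivative f (at x) v * g x"])
      (use Suc in \<open>auto intro!: has_derivative_mult C_k_SucE C_k_add Suc.IH dest: C_k_SucD simp del: C_k.simps\<close>)
qed (auto intro: continuous_intros)

lemma C_k_diff:
  fixes f g :: "'a::euclidean_space \<Rightarrow> real"
  assumes "C_k k f" "C_k k g" shows "C_k k (\<lambda>x. f x - g x)"
  using C_k_add[OF assms(1) C_k_mult[OF C_k_const[of k "-1"] assms(2)]] by simp

lemma C_k_compose: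
  fixes f :: "'a::euclidean_space \<Rightarrow> real" and g :: "real \<Rightarrow> real"
  assumes "C_k k g" "C_k k f" shows "C_k k (\<lambda>x. g (f x))"
  using assms
proof (induction k arbitrary: f g)
  case 0
  then show ?case using continuous_on_compose2[of UNIV g UNIV f] by simp
next
  case (Suc k)
  \<comment> \<open>A derivative on the real line is multiplication by its value at 1. This turns
    the chain rule into a product, to which \<open>C_k_mult\<close> and the induction hypothesis
    apply.\<close>
  have lin: "frechet_derivative g (at y) h = h * frechet_derivative g (at y) 1" for y h
  proof -
    have "linear (frechet_derivative g (at y))"
      by (rule linear_frechet_derivative) (use Suc.prems(1) in auto)
    then show ?thesis using linear_cmul[of _ h 1] by fastforce
  qed
  show ?case
  proof (rule C_k_SucI[where f' = "\<lambda>x v. frechet_derivative f (at x) v * frechet_derivative g (at (f x)) 1"])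
    fix x
    have "((\<lambda>x. g (f x)) has_derivative (\<lambda>v. frechet_derivative g (at (f x)) (frechet_derivative f (at x) v))) (at x)"
      using Suc.prems by (intro has_derivative_compose[of f _ x UNIV g]) (auto simp flip: frechet_derivative_works)
    then show "((\<lambda>x. g (f x)) has_derivative (\<lambda>v. frechet_derivative f (at x) v * frechet_derivative g (at (f x)) 1)) (at x)"
      by (subst (asm) lin)
  next
    fix v
    show "C_k k (\<lambda>x. frechet_derivative f (at x) v * frechet_derivative g (at (f x)) 1)"
      by (intro C_k_mult Suc.IH[of "\<lambda>y. frechet_derivative g (at y) 1"] C_k_SucE C_k_SucD[OF Suc.prems(2)])
        (use Suc.prems in auto)
  qed
qed

lemma C_k_real_SucI:
  fixes f :: "real \<Rightarrow> real"
  assumes "\<And>x. (f has_real_derivative f' x) (at x)" "C_k k f'"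
  shows "C_k (Suc k) f"
  by (rule C_k_SucI[where f' = "\<lambda>x v. f' x * v"])
    (use assms in \<open>auto intro!: C_k_mult C_k_const simp: has_field_derivative_def\<close>)

lemma C_k_linear: "C_k k (\<lambda>x::real. c * x + d)"
  by (cases k) (auto intro!: continuous_intros C_k_real_SucI[where f' = "\<lambda>_. c"] C_k_const derivative_eq_intros simp del: C_k.simps(2))

lemma Cc_infI:
  assumes "\<And>k. C_k k f" "compact K" "K \<subseteq> S" "\<And>x. f x \<noteq> 0 \<Longrightarrow> x \<in> K"
  shows "f \<in> Cc_inf S"
proof -
  have sub: "closure {x. f x \<noteq> 0} \<subseteq> K"
    using assms by (intro closure_minimal) (auto intro: compact_imp_closed)
  then have "compact (closure {x. f x \<noteq> 0})"
    using assms(2) closed_closure by (metis compact_Int_closed inf.absorb_iff2)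
  then show ?thesis using assms sub unfolding Cc_inf_def by blast
qed

lemma Cc_infE:
  assumes "f \<in> Cc_inf S"
  shows "\<exists>K. compact K \<and> K \<subseteq> S \<and> (\<forall>x. f x \<noteq> 0 \<longrightarrow> x \<in> K)"
  using assms closure_subset[of "{x. f x \<noteq> 0}"] unfolding Cc_inf_def by blast

lemma Cc_inf_C_k: "f \<in> Cc_inf S \<Longrightarrow> C_k k f"
  unfolding Cc_inf_def by blast

lemma Cc_inf_diff:
  assumes "f \<in> Cc_inf S" "g \<in> Cc_inf S"
  shows "(\<lambda>x. f x - g x) \<in> Cc_inf S"
proof -
  obtain K where K: "compact K" "K \<subseteq> S" "\<And>x. f x \<noteq> 0 \<Longrightarrow> x \<in> K" using Cc_infE[OF assms(1)] by blast
  obtain L where L: "compact L" "L \<subseteq> S" "\<And>x. g x \<noteq> 0 \<Longrightarrow> x \<in> L" using Cc_infE[OF assms(2)] by blast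
  show ?thesis
  proof (rule Cc_infI)
    show "compact (K \<union> L)" using K L by auto
    show "C_k k (\<lambda>x. f x - g x)" for k
      by (rule C_k_diff) (use assms in \<open>auto intro: Cc_inf_C_k\<close>)
    show "x \<in> K \<union> L" if "f x - g x \<noteq> 0" for x
      using that K(3)[of x] L(3)[of x] by (cases "f x = 0") auto
  qed (use K L in auto)
qed

text \<open>The condition g 0 = 0 keeps the support inside that of f. This is why the truncations
  below are smooth and normalised to vanish at 0.\<close>

lemma Cc_inf_compose:
  assumes f: "f \<in> Cc_inf S" and g: "\<And>k. C_k k g" "g 0 = 0"
  shows "(\<lambda>x. g (f x)) \<in> Cc_inf S"
proof -
  obtain K where K: "compact K" "K \<subseteq> S" "\<And>x. f x \<noteq> 0 \<Longrightarrow> x \<in> K" using Cc_infE[OF f] by blast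
  show ?thesis
  proof (rule Cc_infI[OF _ K(1,2)])
    show "C_k k (\<lambda>x. g (f x))" for k
      by (rule C_k_compose[OF g(1) Cc_inf_C_k[OF f]])
    show "x \<in> K" if "g (f x) \<noteq> 0" for x using that K(3)[of x] g(2) by (cases "f x = 0") auto
  qed
qed

lemma Cc_inf_derivative:
  assumes "\<phi> \<in> Cc_inf S"
  shows "(\<phi> has_derivative frechet_derivative \<phi> (at x)) (at x)"
    "continuous_on UNIV (\<lambda>x. frechet_derivative \<phi> (at x) v)"
proof -
  have "C_k (Suc 0) \<phi>" using assms by (rule Cc_inf_C_k)
  then show "(\<phi> has_derivative frechet_derivative \<phi> (at x)) (at x)" by (rule C_k_SucE)
  show "continuous_on UNIV (\<lambda>x. frechet_derivative \<phi> (at x) v)"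
    using C_k_SucE(2)[OF \<open>C_k (Suc 0) \<phi>\<close>, of v] by (rule C_k_continuous)
qed

lemma Cc_inf_grad:
  fixes \<phi> :: "real^'n \<Rightarrow> real"
  assumes "\<phi> \<in> Cc_inf S"
  shows "(\<phi> has_derivative (\<lambda>h. grad \<phi> x \<bullet> h)) (at x)" "continuous_on UNIV (grad \<phi>)"
    "x \<notin> S \<Longrightarrow> \<phi> x = 0" "x \<notin> S \<Longrightarrow> grad \<phi> x = 0"
    "\<exists>R. \<forall>x. R < norm x \<longrightarrow> \<phi> x = 0 \<and> grad \<phi> x = 0" "continuous_on UNIV \<phi>"
proof -
  note d = Cc_inf_derivative[OF assms]
  interpret L: bounded_linear "frechet_derivative \<phi> (at x)" for x
    using d(1) by (rule has_derivative_bounded_linear)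
  have eq: "frechet_derivative \<phi> (at x) = (\<lambda>h. grad \<phi> x \<bullet> h)" for x
  proof
    fix h
    have "frechet_derivative \<phi> (at x) h = frechet_derivative \<phi> (at x) (\<Sum>i\<in>UNIV. (h $ i) *\<^sub>R axis i 1)"
      by (subst basis_expansion[symmetric, of h]) (simp add: scalar_mult_eq_scaleR)
    also have "\<dots> = (\<Sum>i\<in>UNIV. h $ i * frechet_derivative \<phi> (at x) (axis i 1))"
      by (simp add: L.sum L.scaleR)
    finally show "frechet_derivative \<phi> (at x) h = grad \<phi> x \<bullet> h"
      by (simp add: grad_def inner_vec_def mult.commute)
  qed
  show "(\<phi> has_derivative (\<lambda>h. grad \<phi> x \<bullet> h)) (at x)" using d(1)[of x] unfolding eq .
  show "continuous_on UNIV (grad \<phi>)" unfolding grad_def by (intro continuous_intros d(2))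
  show "continuous_on UNIV \<phi>"
    using has_derivative_continuous[OF d(1)] by (auto intro: continuous_at_imp_continuous_on)
  obtain K where K: "compact K" "K \<subseteq> S" "\<And>x. \<phi> x \<noteq> 0 \<Longrightarrow> x \<in> K" using Cc_infE[OF assms] by blast
  have z1: "\<phi> x = 0" if "x \<notin> K" for x using that K(3) by blast
  \<comment> \<open>The complement of K is open, so \<phi> vanishes in a whole neighbourhood of
    x.\<close>
  have z2: "grad \<phi> x = 0" if "x \<notin> K" for x
  proof -
    have "((\<lambda>_. 0) has_derivative (\<lambda>_. 0)) (at x)" by simp
    then have "(\<phi> has_derivative (\<lambda>_. 0)) (at x)"
      by (rule has_derivative_transform_within_open[OF _ open_Compl[OF compact_imp_closed[OF K(1)]]]) (use that z1 in auto)
    then have "frechet_derivative \<phi> (at x) = (\<lambda>_. 0)" by (rule frechet_derivative_at[symmetric])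
    then show ?thesis by (simp add: grad_def vec_eq_iff)
  qed
  show "x \<notin> S \<Longrightarrow> \<phi> x = 0" "x \<notin> S \<Longrightarrow> grad \<phi> x = 0" using z1 z2 K(2) by blast+
  obtain R where "\<forall>x\<in>K. norm x \<le> R" using compact_imp_bounded[OF K(1)] by (auto simp: bounded_iff)
  then show "\<exists>R. \<forall>x. R < norm x \<longrightarrow> \<phi> x = 0 \<and> grad \<phi> x = 0" using z1 z2 not_le by blast
qed

lemma grad_compose:
  fixes \<phi> :: "real^'n \<Rightarrow> real"
  assumes "\<phi> \<in> Cc_inf S" "(g has_real_derivative g') (at (\<phi> x))"
  shows "grad (\<lambda>x. g (\<phi> x)) x = g' *\<^sub>R grad \<phi> x"
proof -
  have "((\<lambda>x. g (\<phi> x)) has_derivative (\<lambda>h. g' * (grad \<phi> x \<bullet> h))) (at x)"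
    using assms(2) by (intro has_derivative_compose[OF Cc_inf_grad(1)[OF assms(1)]]) (simp add: has_field_derivative_def)
  then have "frechet_derivative (\<lambda>x. g (\<phi> x)) (at x) = (\<lambda>h. g' * (grad \<phi> x \<bullet> h))"
    by (rule frechet_derivative_at[symmetric])
  then show ?thesis by (simp add: grad_def vec_eq_iff inner_axis)
qed

lemma grad_diff:
  fixes \<phi> \<psi> :: "real^'n \<Rightarrow> real"
  assumes "\<phi> \<in> Cc_inf S" "\<psi> \<in> Cc_inf S"
  shows "grad (\<lambda>x. \<phi> x - \<psi> x) x = grad \<phi> x - grad \<psi> x"
proof -
  have "((\<lambda>x. \<phi> x - \<psi> x) has_derivative (\<lambda>h. grad \<phi> x \<bullet> h - grad \<psi> x \<bullet> h)) (at x)"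
    using assms by (intro has_derivative_diff Cc_inf_grad(1))
  then have "frechet_derivative (\<lambda>x. \<phi> x - \<psi> x) (at x) = (\<lambda>h. grad \<phi> x \<bullet> h - grad \<psi> x \<bullet> h)"
    by (rule frechet_derivative_at[symmetric])
  then show ?thesis by (simp add: grad_def vec_eq_iff inner_axis)
qed

section \<open>Smooth truncations of the positive part\<close>

definition logistic :: "real \<Rightarrow> real" where "logistic r = 1 / (1 + exp (- r))"

lemma logistic_deriv: "(logistic has_real_derivative logistic r * (1 - logistic r)) (at r)"
proof -
  have "1 + exp (- r) \<noteq> 0" by (smt (verit) exp_gt_zero)
  then show ?thesis unfolding logistic_def
    by (auto intro!: derivative_eq_intros simp: field_simps power2_eq_square)
qed

lemma logistic_bounds: "0 < logistic r" "logistic r < 1"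
  by (auto simp: logistic_def add_pos_pos)

lemma logistic_mono: "r \<le> s \<Longrightarrow> logistic r \<le> logistic s"
  by (auto simp: logistic_def field_simps add_pos_pos)

text \<open>The derivative is a polynomial in \<open>logistic\<close> itself, so each degree of
  smoothness yields the next.\<close>

lemma C_k_logistic: "C_k k logistic"
proof (induction k)
  case 0
  show ?case using logistic_deriv by (auto intro!: DERIV_continuous_on simp: has_field_derivative_at_within)
next
  case (Suc k)
  show ?case by (rule C_k_real_SucI[OF logistic_deriv]) (intro C_k_mult C_k_diff C_k_const Suc)
qed

text \<open>A primitive of \<open>logistic\<close>, and a smooth function within ln 2 of the
  positive part.\<close>

definition softplus :: "real \<Rightarrow> real" where "softplus r = ln (1 + exp r)"

lemma softplus_deriv: "(softplus has_real_derivative logistic r) (at r)"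
proof -
  have "1 + exp r > 0" by (simp add: add_pos_pos)
  moreover have "logistic r = exp r / (1 + exp r)"
    unfolding logistic_def by (simp add: exp_minus divide_simps add_pos_pos)
  ultimately show ?thesis unfolding softplus_def by (auto intro!: derivative_eq_intros)
qed

lemma C_k_softplus: "C_k k softplus"
proof (cases k)
  case 0
  then show ?thesis using softplus_deriv by (auto intro!: DERIV_continuous_on simp: has_field_derivative_at_within)
next
  case (Suc k')
  then show ?thesis using C_k_real_SucI[OF softplus_deriv C_k_logistic] by simp
qed

lemma softplus_bounds: "max 0 r \<le> softplus r" "softplus r \<le> max 0 r + ln 2"
proof -
  have "ln 1 \<le> ln (1 + exp r)" "ln (exp r) \<le> ln (1 + exp r)"
    by (subst ln_le_cancel_iff; simp add: add_pos_pos)+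
  then show "max 0 r \<le> softplus r" by (simp add: softplus_def)
  have "ln (1 + exp r) \<le> ln (2 * exp (max 0 r))"
    by (subst ln_le_cancel_iff) (auto simp: add_pos_pos max_def)
  then show "softplus r \<le> max 0 r + ln 2" by (simp add: softplus_def ln_mult)
qed

text \<open>A smooth version of min (max 0 r) n. Up to an error of order 1/n, softplus (n r) / n is
  the positive part, and subtracting softplus (n (r - n)) / n stops the growth at height n. The last
  two terms make the value at 0 exactly 0.\<close>

definition trunc :: "nat \<Rightarrow> real \<Rightarrow> real" where
  "trunc n r = (softplus (real n * r) - softplus (real n * r - real n * real n) - softplus 0 + softplus (- (real n * real n))) / n"

definition trunc' :: "nat \<Rightarrow> real \<Rightarrow> real" where
  "trunc' n r = logistic (real n * r) - logistic (real n * r - real n * real n)"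

lemma trunc_0 [simp]: "trunc n 0 = 0" by (simp add: trunc_def)

lemma trunc_deriv:
  assumes "n > 0"
  shows "(trunc n has_real_derivative trunc' n r) (at r)"
  using assms unfolding trunc_def trunc'_def
  by (auto intro!: derivative_eq_intros DERIV_chain2[OF softplus_deriv] simp: field_simps)

lemma trunc'_bounds: "0 \<le> trunc' n r" "trunc' n r \<le> 1"
proof -
  show "0 \<le> trunc' n r" unfolding trunc'_def by (simp add: logistic_mono)
  show "trunc' n r \<le> 1" using logistic_bounds[of "n*r"] logistic_bounds[of "n*r - n*n"] by (simp add: trunc'_def)
qed

lemma C_k_trunc: "C_k k (trunc n)"
proof -
  have 1: "C_k k (\<lambda>r. softplus (real n * r + d))" for d
    by (rule C_k_compose[OF C_k_softplus C_k_linear])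
  have "C_k k (\<lambda>r. (1 / real n) * (softplus (real n * r + 0) - softplus (real n * r + - (real n * real n))
      + (softplus (- (real n * real n)) - softplus 0)))" (is "C_k k ?f")
    by (rule C_k_mult[OF C_k_const C_k_add[OF C_k_diff[OF 1 1] C_k_const]])
  also have "?f = trunc n" by (rule ext) (simp add: trunc_def)
  finally show ?thesis .
qed

lemma continuous_trunc': "continuous_on UNIV (trunc' n)"
proof -
  have log: "continuous_on UNIV logistic" using C_k_logistic[of 0] by simp
  have "continuous_on UNIV (\<lambda>r. logistic (real n * r))"
    "continuous_on UNIV (\<lambda>r. logistic (real n * r - real n * real n))"
    by (rule continuous_on_compose2[OF log], auto intro!: continuous_intros)+
  then show ?thesis unfolding trunc'_def by (intro continuous_on_diff) auto
qed

lemma trunc_mono: "n > 0 \<Longrightarrow> r \<le> s \<Longrightarrow> trunc n r \<le> trunc n s"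
  by (rule DERIV_nonneg_imp_nondecreasing[of r s "trunc n"])
    (auto intro!: exI[of _ "trunc' n _"] trunc_deriv trunc'_bounds)

lemma softplus_mono: "r \<le> s \<Longrightarrow> softplus r \<le> softplus s"
  by (simp add: softplus_def add_pos_pos)

text \<open>Each softplus is within ln 2 <= 1 of a positive part and the sum is divided by n, so the
  errors are of order 1/n. The bound by n + 2 makes the test functions bounded; those by |r| and by
  max 0 r + 1 dominate the limits in n.\<close>

lemma trunc_bounds:
  assumes n: "n > 0"
  shows "trunc n r \<le> max 0 r + 1" "- 1 \<le> trunc n r" "\<bar>trunc n r\<bar> \<le> real n + 2" "\<bar>trunc n r\<bar> \<le> \<bar>r\<bar>"
    "r \<le> n \<Longrightarrow> \<bar>trunc n r - max 0 r\<bar> \<le> 2 / n"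
proof -
  have ln2: "ln 2 \<le> (1::real)" using ln_le_minus_one[of 2] by simp
  have s0: "softplus 0 = ln 2" by (simp add: softplus_def)
  let ?s = "softplus (real n * r) - softplus (real n * r - real n * real n) - softplus 0 + softplus (- (real n * real n))"
  have t: "n * trunc n r = ?s" using n by (simp add: trunc_def)
  have m: "max 0 (real n * r) = n * max 0 r" by (simp add: max_mult_distrib_left)
  have n1: "real n \<ge> 1" using n by simp
  have b: "0 \<le> softplus (- (real n * real n))" "softplus (- (real n * real n)) \<le> ln 2"
    "0 \<le> softplus (real n * r - real n * real n)" "softplus (real n * r - real n * real n) \<le> softplus (real n * r)"
    "softplus (real n * r) \<le> n * max 0 r + ln 2" "n * max 0 r \<le> softplus (real n * r)"
    "softplus (real n * r) \<le> softplus (real n * r - real n * real n) + real n * real n + ln 2"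
  proof -
    have aux: "max 0 (x - y) \<le> max 0 x" "max 0 x \<le> max 0 (x - y) + y" "0 \<le> max 0 (x - y)" "max 0 (- y) = 0"
      if "y \<ge> 0" for x y :: real using that by (auto simp: max_def)
    have nn: "0 \<le> real n * real n" by simp
    show "0 \<le> softplus (- (real n * real n))" "softplus (- (real n * real n)) \<le> ln 2"
      "0 \<le> softplus (real n * r - real n * real n)" "softplus (real n * r - real n * real n) \<le> softplus (real n * r)"
      "softplus (real n * r) \<le> n * max 0 r + ln 2" "n * max 0 r \<le> softplus (real n * r)"
      "softplus (real n * r) \<le> softplus (real n * r - real n * real n) + real n * real n + ln 2"
      using softplus_bounds[of "- (real n * real n)"] softplus_bounds[of "real n * r - real n * real n"] softplus_bounds[of "real n * r"] m
        softplus_mono[of "real n * r - real n * real n" "real n * r"] aux(1-3)[OF nn, of "real n * r"] aux(4)[OF nn] nn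
      by linarith+
  qed
  have "n * trunc n r \<le> n * max 0 r + 1" unfolding t using b s0 ln2 by linarith
  also have "\<dots> \<le> n * (max 0 r + 1)" using n1 by (simp add: algebra_simps)
  finally show 1: "trunc n r \<le> max 0 r + 1" using n by simp
  have "real n * (- 1) \<le> real n * trunc n r" unfolding t using b s0 ln2 n1 by linarith
  then show 2: "- 1 \<le> trunc n r" by (rule mult_left_le_imp_le) (use n in simp)
  have "real n * trunc n r \<le> real n * real n + 1" unfolding t using b s0 ln2 by linarith
  also have "\<dots> \<le> real n * (real n + 2)" using n1 by (simp add: algebra_simps)
  finally have t2: "trunc n r \<le> real n + 2" using n by simp
  show "\<bar>trunc n r\<bar> \<le> real n + 2" using t2 2 n1 by linarith
  show "\<bar>trunc n r - max 0 r\<bar> \<le> 2 / n" if "r \<le> n"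
  proof -
    have "n * r \<le> n * n" using that n by simp
    then have "softplus (real n * r - real n * real n) \<le> ln 2" using softplus_bounds[of "real n * r - real n * real n"] by simp
    then have "\<bar>n * trunc n r - n * max 0 r\<bar> \<le> 2" unfolding t using b s0 ln2 by linarith
    then have "n * \<bar>trunc n r - max 0 r\<bar> \<le> 2" by (simp add: abs_mult flip: right_diff_distrib)
    then show ?thesis using n by (simp add: field_simps)
  qed
  have "\<exists>z. trunc n r - trunc n 0 = r * trunc' n z"
  proof (cases "r = 0")
    case False
    then consider "r < 0" | "r > 0" by linarith
    then show ?thesis
    proof cases
      case 1
      then show ?thesis using MVT2[of r 0 "trunc n" "trunc' n"] trunc_deriv[OF n] by force
    next
      case 2
      then show ?thesis using MVT2[of 0 r "trunc n" "trunc' n"] trunc_deriv[OF n] by force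
    qed
  qed auto
  then obtain z where "trunc n r = r * trunc' n z" by auto
  then show "\<bar>trunc n r\<bar> \<le> \<bar>r\<bar>"
    using trunc'_bounds[of n z] by (simp add: abs_mult mult_left_le)
qed

lemma trunc_tendsto: "(\<lambda>n. trunc n r) \<longlonglongrightarrow> max 0 r"
proof -
  have "(\<lambda>n. trunc n r - max 0 r) \<longlonglongrightarrow> 0"
  proof (rule Lim_null_comparison)
    show "(\<lambda>n. 2 / real n) \<longlonglongrightarrow> 0" by (rule lim_const_over_n)
    show "\<forall>\<^sub>F n in sequentially. norm (trunc n r - max 0 r) \<le> 2 / real n"
    proof (rule eventually_sequentiallyI[of "nat \<lceil>\<bar>r\<bar>\<rceil> + 1"])
      fix n assume "nat \<lceil>\<bar>r\<bar>\<rceil> + 1 \<le> n"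
      then have "n > 0" "r \<le> n" by linarith+
      then show "norm (trunc n r - max 0 r) \<le> 2 / real n" using trunc_bounds(5) by simp
    qed
  qed
  then show ?thesis by (simp add: LIM_zero_iff)
qed

lemma logistic_minus_le: "x > 0 \<Longrightarrow> logistic (- x) \<le> 1 / x"
proof -
  assume x: "x > 0"
  have "x \<le> 1 + exp x" using exp_ge_add_one_self[of x] by linarith
  then have "1 / (1 + exp x) \<le> 1 / x" using x by (intro frac_le) auto
  then show ?thesis by (simp add: logistic_def)
qed

lemma logistic_minus: "logistic (- x) = 1 - logistic x"
  by (simp add: logistic_def exp_minus divide_simps add_pos_pos) (smt (verit) exp_gt_zero)

text \<open>The value 1/2 at 0 is the limit of \<open>trunc' n 0\<close>. With it the truncated
  gradients converge at every point, and nothing has to be known about the gradient on the set where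
  w = 0.\<close>

definition heaviside :: "real \<Rightarrow> real" where
  "heaviside r = (if r > 0 then 1 else if r = 0 then 1/2 else 0)"

lemma trunc'_tendsto: "(\<lambda>n. trunc' n r) \<longlonglongrightarrow> heaviside r"
proof -
  have neg: "(\<lambda>n. logistic (real n * s)) \<longlonglongrightarrow> 0" if "s < 0" for s :: real
  proof (rule Lim_null_comparison)
    show "(\<lambda>n. (1 / - s) / real n) \<longlonglongrightarrow> 0" by (rule lim_const_over_n)
    show "\<forall>\<^sub>F n in sequentially. norm (logistic (real n * s)) \<le> (1 / - s) / real n"
    proof (rule eventually_sequentiallyI[of 1])
      fix n :: nat assume "1 \<le> n"
      then have "0 < real n * (- s)" using that by (intro mult_pos_pos) auto
      from logistic_minus_le[OF this] show "norm (logistic (real n * s)) \<le> (1 / - s) / real n"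
        using logistic_bounds[of "real n * s"] by (simp add: field_simps)
    qed
  qed
  have pos: "(\<lambda>n. logistic (real n * s)) \<longlonglongrightarrow> 1" if "s > 0" for s :: real
  proof -
    have "(\<lambda>n. 1 - logistic (real n * (- s))) \<longlonglongrightarrow> 1 - 0"
      by (intro tendsto_diff tendsto_const neg) (use that in auto)
    then show ?thesis using logistic_minus[of "- (_ * s)"] by simp
  qed
  have 1: "(\<lambda>n. logistic (real n * r)) \<longlonglongrightarrow> heaviside r"
    using neg[of r] pos[of r] by (auto simp: heaviside_def logistic_def[of 0])
  \<comment> \<open>As soon as r <= n - 1 the argument is at most -n, so the cap at height n
    disappears in the limit.\<close>
  have 2: "(\<lambda>n. logistic (real n * r - real n * real n)) \<longlonglongrightarrow> 0"
  proof (rule Lim_null_comparison)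
    show "(\<lambda>n. 1 / real n) \<longlonglongrightarrow> 0" by (rule lim_const_over_n)
    show "\<forall>\<^sub>F n in sequentially. norm (logistic (real n * r - real n * real n)) \<le> 1 / real n"
    proof (rule eventually_sequentiallyI[of "nat \<lceil>\<bar>r\<bar>\<rceil> + 1"])
      fix n assume "nat \<lceil>\<bar>r\<bar>\<rceil> + 1 \<le> n"
      then have n: "n > 0" "r \<le> real n - 1" by linarith+
      then have "real n * r \<le> real n * (real n - 1)" by (intro mult_left_mono) auto
      then have "real n * r - real n * real n \<le> - real n" by (simp add: algebra_simps)
      then have "logistic (real n * r - real n * real n) \<le> logistic (- real n)" by (rule logistic_mono)
      also have "\<dots> \<le> 1 / real n" using n by (intro logistic_minus_le) auto
      finally show "norm (logistic (real n * r - real n * real n)) \<le> 1 / real n"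
        using logistic_bounds[of "real n * r - real n * real n"] by simp
    qed
  qed
  show ?thesis using tendsto_diff[OF 1 2] by (simp add: trunc'_def)
qed

lemma max_0_power2_deriv: "((\<lambda>x. (max 0 x)\<^sup>2) has_real_derivative 2 * max 0 x) (at x)"
proof -
  consider "x > 0" | "x < 0" | "x = 0" by linarith
  then show ?thesis
  proof cases
    case 1
    have "((\<lambda>x. x\<^sup>2) has_real_derivative 2 * x) (at x)" by (auto intro!: derivative_eq_intros)
    then have "((\<lambda>x. (max 0 x)\<^sup>2) has_real_derivative 2 * x) (at x)"
      by (rule has_field_derivative_transform_within_open[where S = "{0<..}"]) (use 1 in auto)
    then show ?thesis using 1 by simp
  next
    case 2
    have "((\<lambda>x. 0) has_real_derivative 0) (at x)" by simp
    then have "((\<lambda>x. (max 0 x)\<^sup>2) has_real_derivative 0) (at x)"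
      by (rule has_field_derivative_transform_within_open[where S = "{..<0}"]) (use 2 in auto)
    then show ?thesis using 2 by simp
  next
    case 3
    have "((\<lambda>h::real. (max 0 h)\<^sup>2 / h) \<longlongrightarrow> 0) (at 0)"
    proof (rule Lim_null_comparison)
      show "\<forall>\<^sub>F h::real in at 0. norm ((max 0 h)\<^sup>2 / h) \<le> \<bar>h\<bar>"
        by (rule always_eventually) (auto simp: max_def power2_eq_square)
      show "((\<lambda>h::real. \<bar>h\<bar>) \<longlongrightarrow> 0) (at 0)" by (intro tendsto_eq_intros) auto
    qed
    then show ?thesis using 3 by (simp add: DERIV_def)
  qed
qed

section \<open>Convex primitives of the truncations\<close>

lemma trunc_primitive_ex:
  assumes n: "n > 0"
  shows "\<exists>G. G 0 = 0 \<and> (\<forall>r. (G has_real_derivative trunc n r) (at r))"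
proof -
  have "continuous_on UNIV (trunc n)" using C_k_trunc[of 0] by simp
  then obtain F where F: "\<And>x. (F has_vector_derivative trunc n x) (at x)"
    using einterval_antiderivative[of "-\<infinity>" "\<infinity>" "trunc n"] by (auto simp: continuous_on_eq_continuous_at)
  show ?thesis
    by (intro exI[of _ "\<lambda>r. F r - F 0"])
      (use F in \<open>auto intro!: derivative_eq_intros simp: has_real_derivative_iff_has_vector_derivative\<close>)
qed

text \<open>For n > 0 the value at 0 and the derivative determine the function. Mean value arguments
  supply all estimates on it, while a closed form would involve the dilogarithm.\<close>

definition trunc_primitive :: "nat \<Rightarrow> real \<Rightarrow> real" where
  "trunc_primitive n = (SOME G. G 0 = 0 \<and> (\<forall>r. (G has_real_derivative trunc n r) (at r)))"

lemma trunc_primitive: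
  assumes n: "n > 0"
  shows "trunc_primitive n 0 = 0" "(trunc_primitive n has_real_derivative trunc n r) (at r)"
  using someI_ex[OF trunc_primitive_ex[OF n]] unfolding trunc_primitive_def by auto

lemma trunc_primitive_MVT:
  assumes n: "n > 0"
  shows "\<exists>z. min r s \<le> z \<and> z \<le> max r s \<and> trunc_primitive n r - trunc_primitive n s = (r - s) * trunc n z"
proof -
  consider "r = s" | "r < s" | "s < r" by linarith
  then show ?thesis
  proof cases
    case 2
    obtain z where "r < z" "z < s" "trunc_primitive n s - trunc_primitive n r = (s - r) * trunc n z"
      using MVT2[of r s "trunc_primitive n" "trunc n"] trunc_primitive[OF n] 2 by blast
    then show ?thesis by (intro exI[of _ z]) (auto simp: algebra_simps)
  next
    case 3
    obtain z where "s < z" "z < r" "trunc_primitive n r - trunc_primitive n s = (r - s) * trunc n z"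
      using MVT2[of s r "trunc_primitive n" "trunc n"] trunc_primitive[OF n] 3 by blast
    then show ?thesis by (intro exI[of _ z]) (auto simp: algebra_simps)
  qed auto
qed

text \<open>The tangent inequality of a convex function, which follows from the monotonicity of
  \<open>trunc n\<close>. In the application r is the value at the later time; the inequality
  replaces a chain rule in time.\<close>

lemma trunc_primitive_convex:
  assumes n: "n > 0"
  shows "trunc_primitive n r - trunc_primitive n s \<le> (r - s) * trunc n r"
proof -
  obtain z where z: "min r s \<le> z" "z \<le> max r s" "trunc_primitive n r - trunc_primitive n s = (r - s) * trunc n z"
    using trunc_primitive_MVT[OF n] by blast
  show ?thesis
  proof (cases "r \<le> s")
    case True
    then show ?thesis using z trunc_mono[OF n, of r z] by (simp add: mult_left_mono_neg)
  next
    case False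
    then show ?thesis using z trunc_mono[OF n, of z r] by (simp add: mult_left_mono)
  qed
qed

text \<open>The intermediate point lies between r and s, and |trunc n z| <= |z|. The bound is
  uniform in n and of the form from which continuity along curves in L^2 is derived.\<close>

lemma trunc_primitive_Lipschitz:
  assumes n: "n > 0"
  shows "\<bar>trunc_primitive n r - trunc_primitive n s\<bar> \<le> \<bar>r - s\<bar> * (\<bar>r\<bar> + \<bar>s\<bar>)"
proof -
  obtain z where z: "min r s \<le> z" "z \<le> max r s" "trunc_primitive n r - trunc_primitive n s = (r - s) * trunc n z"
    using trunc_primitive_MVT[OF n] by blast
  have "\<bar>trunc n z\<bar> \<le> \<bar>z\<bar>" by (rule trunc_bounds[OF n])
  also have "\<dots> \<le> \<bar>r\<bar> + \<bar>s\<bar>" using z(1,2) by (auto simp: min_def max_def split: if_splits)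
  finally show ?thesis unfolding z(3) abs_mult by (intro mult_left_mono) auto
qed

text \<open>The difference of the two primitives vanishes at 0 and has derivative
  \<open>trunc n x - max 0 x\<close>, which is at most 2/n in absolute value on [-n, n].\<close>

lemma trunc_primitive_tendsto: "(\<lambda>n. trunc_primitive n r) \<longlonglongrightarrow> (max 0 r)\<^sup>2 / 2"
proof -
  have "(\<lambda>n. trunc_primitive n r - (max 0 r)\<^sup>2 / 2) \<longlonglongrightarrow> 0"
  proof (rule Lim_null_comparison)
    show "(\<lambda>n. (2 * \<bar>r\<bar>) / real n) \<longlonglongrightarrow> 0" by (rule lim_const_over_n)
    show "\<forall>\<^sub>F n in sequentially. norm (trunc_primitive n r - (max 0 r)\<^sup>2 / 2) \<le> (2 * \<bar>r\<bar>) / real n"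
    proof (rule eventually_sequentiallyI[of "nat \<lceil>\<bar>r\<bar>\<rceil> + 1"])
      fix n assume "nat \<lceil>\<bar>r\<bar>\<rceil> + 1 \<le> n"
      then have n: "n > 0" "\<bar>r\<bar> \<le> n" by linarith+
      let ?Q = "\<lambda>x. trunc_primitive n x - (max 0 x)\<^sup>2 / 2"
      have "norm (?Q r - ?Q 0) \<le> 2 / real n * norm (r - 0)"
      proof (rule field_differentiable_bound)
        show "convex {- real n..real n}" by simp
        show "(?Q has_field_derivative (trunc n x - max 0 x)) (at x within {- real n..real n})" for x
          by (rule has_field_derivative_at_within)
            (use DERIV_diff[OF trunc_primitive(2)[OF n(1), of x] DERIV_cdivide[OF max_0_power2_deriv, of 2 x]] in simp)
        show "norm (trunc n x - max 0 x) \<le> 2 / real n" if "x \<in> {- real n..real n}" for x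
          using trunc_bounds(5)[OF n(1), of x] that by auto
      qed (use n in auto)
      then show "norm (?Q r) \<le> (2 * \<bar>r\<bar>) / real n" using trunc_primitive[OF n(1)] by simp
    qed
  qed
  then show ?thesis by (simp add: LIM_zero_iff)
qed

section \<open>Sobolev functions with zero trace\<close>

lemma LINT_translate_diff:
  fixes f :: "'a::euclidean_space \<Rightarrow> real"
  assumes "integrable lborel f"
  shows "(LINT x|lborel. f (x + y) - f x) = 0"
proof -
  have m: "f \<in> borel_measurable borel" using assms by auto
  have "integrable lborel (\<lambda>x. f (x + y))" "(LINT x|lborel. f (x + y)) = (LINT x|lborel. f x)"
    using integrable_lborel_diff_right[OF m, of "- y"] assms by auto
  then show ?thesis using assms by simp
qed

lemma integrable_Cc:
  fixes f :: "'a::euclidean_space \<Rightarrow> 'b::{banach, second_countable_topology}"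
  assumes "continuous_on UNIV f" and R: "\<And>x. R < norm x \<Longrightarrow> f x = 0"
  shows "integrable lborel f" "\<exists>B\<ge>0. \<forall>x. norm (f x) \<le> B"
proof -
  have eq: "f = (\<lambda>x. indicator (cball 0 R) x *\<^sub>R f x)"
    using R by (auto simp: indicator_def fun_eq_iff not_le)
  show "integrable lborel f"
    by (subst eq, rule borel_integrable_compact) (use assms(1) in \<open>auto intro: continuous_on_subset\<close>)
  have "compact (f ` cball 0 R)" using assms(1) by (intro compact_continuous_image) (auto intro: continuous_on_subset)
  then obtain B where B: "\<forall>x\<in>cball 0 R. norm (f x) \<le> B" using compact_imp_bounded by (fastforce simp: bounded_iff)
  have "norm (f x) \<le> max B 0" for x using B R[of x] by (cases "norm x \<le> R") (auto simp: le_max_iff_disj)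
  then show "\<exists>B\<ge>0. \<forall>x. norm (f x) \<le> B" by (intro exI[of _ "max B 0"]) auto
qed

text \<open>Differentiate the translation invariance of the integral.\<close>

lemma LINT_directional_derivative_0:
  fixes f :: "'a::euclidean_space \<Rightarrow> real" and D :: "'a \<Rightarrow> 'a"
  assumes d: "\<And>x. (f has_derivative (\<lambda>h. D x \<bullet> h)) (at x)" and cD: "continuous_on UNIV D"
    and R: "\<And>x. R < norm x \<Longrightarrow> f x = 0 \<and> D x = 0"
  shows "(LINT x|lborel. D x \<bullet> y) = 0"
proof -
  have cf: "continuous_on UNIV f" using has_derivative_continuous[OF d] by (auto intro: continuous_at_imp_continuous_on)
  have fm[measurable]: "f \<in> borel_measurable borel" using cf by (rule borel_measurable_continuous_onI)
  have Dm[measurable]: "D \<in> borel_measurable borel" using cD by (rule borel_measurable_continuous_onI)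
  obtain B where B: "\<And>x. norm (D x) \<le> B" using integrable_Cc(2)[OF cD, of R] R by blast
  have Lip: "\<bar>f x - f z\<bar> \<le> B * norm (x - z)" for x z
  proof -
    have "norm (f x - f z) \<le> B * norm (x - z)"
    proof (rule differentiable_bound[of UNIV f "\<lambda>x h. D x \<bullet> h"])
      show "onorm (\<lambda>h. D x \<bullet> h) \<le> B" for x
      proof (rule onorm_bound)
        show "0 \<le> B" using order_trans[OF norm_ge_zero B[of x]] .
        show "norm (D x \<bullet> h) \<le> B * norm h" for h
          using Cauchy_Schwarz_ineq2[of "D x" h] mult_right_mono[OF B[of x] norm_ge_zero[of h]] by simp
      qed
    qed (use d in auto)
    then show ?thesis by simp
  qed
  have int: "integrable lborel f" using integrable_Cc(1)[OF cf, of R] R by blast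
  define h where "h n = 1 / real (Suc n)" for n
  have h0: "h \<longlonglongrightarrow> 0" unfolding h_def by (rule lim_1_over_n[THEN LIMSEQ_Suc])
  have hp: "0 < h n" "h n \<le> 1" for n by (auto simp: h_def)
  \<comment> \<open>The gradient is continuous with compact support, so f is Lipschitz and the
    difference quotients are bounded. As h n <= 1, they vanish off the ball enlarged by |y|.\<close>
  have "(\<lambda>n. LINT x|lborel. (f (x + h n *\<^sub>R y) - f x) / h n) \<longlonglongrightarrow> (LINT x|lborel. D x \<bullet> y)"
  proof (rule integral_dominated_convergence[where w = "\<lambda>x. indicator (cball 0 (R + norm y)) x * (B * norm y)"])
    show "integrable lborel (\<lambda>x. indicator (cball 0 (R + norm y)) x * (B * norm y))"
      by (intro integrable_mult_left integrable_real_indicator) (use emeasure_bounded_finite[OF bounded_cball] in auto)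
    show "AE x in lborel. (\<lambda>n. (f (x + h n *\<^sub>R y) - f x) / h n) \<longlonglongrightarrow> D x \<bullet> y"
    proof (rule AE_I2)
      fix x
      have "((\<lambda>t. f (x + t *\<^sub>R y)) has_real_derivative D x \<bullet> y) (at 0)"
      proof -
        have g: "((\<lambda>t. x + t *\<^sub>R y) has_derivative (\<lambda>t. t *\<^sub>R y)) (at (0::real))"
          by (auto intro!: derivative_eq_intros)
        have "((\<lambda>t. f (x + t *\<^sub>R y)) has_derivative (\<lambda>t. D x \<bullet> (t *\<^sub>R y))) (at 0)"
          by (rule has_derivative_compose[OF g]) (use d[of x] in simp)
        then show ?thesis by (simp add: has_field_derivative_def mult_commute_abs)
      qed
      then have "((\<lambda>t. (f (x + t *\<^sub>R y) - f x) / t) \<longlongrightarrow> D x \<bullet> y) (at 0)"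
        by (simp add: DERIV_def)
      moreover have "filterlim h (at 0) sequentially"
        using h0 hp(1) by (auto simp: filterlim_at intro!: always_eventually) (metis less_irrefl)
      ultimately show "(\<lambda>n. (f (x + h n *\<^sub>R y) - f x) / h n) \<longlonglongrightarrow> D x \<bullet> y"
        by (rule filterlim_compose)
    qed
    show "AE x in lborel. norm ((f (x + h n *\<^sub>R y) - f x) / h n) \<le> indicator (cball 0 (R + norm y)) x * (B * norm y)" for n
    proof (rule AE_I2)
      fix x
      show "norm ((f (x + h n *\<^sub>R y) - f x) / h n) \<le> indicator (cball 0 (R + norm y)) x * (B * norm y)"
      proof (cases "norm x \<le> R + norm y")
        case True
        have "\<bar>f (x + h n *\<^sub>R y) - f x\<bar> \<le> B * (h n * norm y)"
          using Lip[of "x + h n *\<^sub>R y" x] hp(1)[of n] by simp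
        then show ?thesis using True hp(1)[of n] by (simp add: field_simps)
      next
        case False
        have "norm (h n *\<^sub>R y) \<le> norm y" using hp[of n] by (simp add: mult_left_le_one_le)
        then have "R < norm (x + h n *\<^sub>R y)" using False norm_diff_ineq[of x "h n *\<^sub>R y"] by linarith
        moreover have "R < norm x" using False norm_ge_zero[of y] by linarith
        ultimately show ?thesis using R False by simp
      qed
    qed
  qed (auto)
  moreover have "(LINT x|lborel. (f (x + h n *\<^sub>R y) - f x) / h n) = 0" for n
    using LINT_translate_diff[OF int, of "h n *\<^sub>R y"] by simp
  ultimately have "(\<lambda>n::nat. 0) \<longlonglongrightarrow> (LINT x|lborel. D x \<bullet> y)" by (simp only:)
  then show ?thesis by (simp add: LIMSEQ_const_iff)
qed

text \<open>The gradient of the product \<phi> \<psi> integrates to 0 by translation invariance, and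
  the product rule splits it into the two terms.\<close>

lemma Cc_inf_integration_by_parts:
  fixes \<phi> \<psi> :: "real^'n \<Rightarrow> real"
  assumes S: "S \<in> sets borel" and \<phi>: "\<phi> \<in> Cc_inf S" and \<psi>: "\<psi> \<in> Cc_inf S"
  shows "(LINT x|lebesgue_on S. \<phi> x * grad \<psi> x $ i) = - (LINT x|lebesgue_on S. grad \<phi> x $ i * \<psi> x)"
proof -
  note P = Cc_inf_grad[OF \<phi>] and Q = Cc_inf_grad[OF \<psi>]
  have [measurable]: "\<phi> \<in> borel_measurable borel" "\<psi> \<in> borel_measurable borel"
    "grad \<phi> \<in> borel_measurable borel" "grad \<psi> \<in> borel_measurable borel"
    using P(2,6) Q(2,6) by (auto intro: borel_measurable_continuous_onI)
  obtain R where R: "\<And>x. R < norm x \<Longrightarrow> \<phi> x = 0 \<and> grad \<phi> x = 0" using P(5) by blast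
  have 0: "(LINT x|lborel. (\<phi> x *\<^sub>R grad \<psi> x + \<psi> x *\<^sub>R grad \<phi> x) \<bullet> axis i 1) = 0"
  proof (rule LINT_directional_derivative_0[where f = "\<lambda>x. \<phi> x * \<psi> x"])
    show "((\<lambda>x. \<phi> x * \<psi> x) has_derivative (\<lambda>h. (\<phi> x *\<^sub>R grad \<psi> x + \<psi> x *\<^sub>R grad \<phi> x) \<bullet> h)) (at x)" for x
      by (rule has_derivative_eq_rhs[OF has_derivative_mult[OF P(1) Q(1)]]) (auto simp: inner_add_left)
    show "continuous_on UNIV (\<lambda>x. \<phi> x *\<^sub>R grad \<psi> x + \<psi> x *\<^sub>R grad \<phi> x)"
      using P Q by (intro continuous_intros)
    show "\<phi> x * \<psi> x = 0 \<and> \<phi> x *\<^sub>R grad \<psi> x + \<psi> x *\<^sub>R grad \<phi> x = 0" if "R < norm x" for x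
      using R[OF that] by simp
  qed
  have i1: "integrable lborel (\<lambda>x. \<phi> x * grad \<psi> x $ i)" "integrable lborel (\<lambda>x. grad \<phi> x $ i * \<psi> x)"
    by (rule integrable_Cc[where R=R]; use P Q R in \<open>auto intro!: continuous_intros\<close>)+
  have e: "(LINT x|lebesgue_on S. f x) = (LINT x|lborel. f x)"
    if "f \<in> borel_measurable borel" "\<And>x. x \<notin> S \<Longrightarrow> f x = 0" for f :: "real^'n \<Rightarrow> real"
    by (rule integrable_lebesgue_on_iff(2)[OF S]) (use that S in \<open>auto intro!: measurable_restrict_space1 measurable_completion\<close>)
  have "(LINT x|lborel. \<phi> x * grad \<psi> x $ i) + (LINT x|lborel. grad \<phi> x $ i * \<psi> x) = 0"
    using 0 i1 by (simp add: inner_axis inner_add_left mult.commute)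
  then show ?thesis using P(3) Q(3,4) i1[THEN borel_measurable_integrable] by (subst (1 2) e) auto
qed

section \<open>L^p on sets of finite measure, and approximation by test functions\<close>

lemma LpD:
  assumes "f \<in> Lp S p"
  shows "f \<in> borel_measurable (lebesgue_on S)" "integrable (lebesgue_on S) (\<lambda>x. norm (f x) powr p)"
  using assms by (auto simp: Lp_def)

lemma integrable_powr_diff:
  fixes f g :: "'a \<Rightarrow> 'b::euclidean_space"
  assumes [measurable]: "f \<in> borel_measurable M" "g \<in> borel_measurable M" and p: "p \<ge> 0"
    and i: "integrable M (\<lambda>x. norm (f x) powr p)" "integrable M (\<lambda>x. norm (g x) powr p)"
  shows "integrable M (\<lambda>x. norm (f x - g x) powr p)"
    "(LINT x|M. norm (f x - g x) powr p) \<le> 2 powr p * ((LINT x|M. norm (f x) powr p) + (LINT x|M. norm (g x) powr p))"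
proof -
  have b: "norm (f x - g x) powr p \<le> 2 powr p * (norm (f x) powr p + norm (g x) powr p)" for x
  proof -
    have "norm (f x - g x) powr p \<le> (norm (f x) + norm (g x)) powr p"
      by (intro powr_mono2) (use p norm_triangle_ineq4 in auto)
    also have "\<dots> \<le> 2 powr p * (norm (f x) powr p + norm (g x) powr p)"
      by (rule powr_add_le) (use p in auto)
    finally show ?thesis .
  qed
  show "integrable M (\<lambda>x. norm (f x - g x) powr p)"
    by (rule Bochner_Integration.integrable_bound[where f="\<lambda>x. 2 powr p * (norm (f x) powr p + norm (g x) powr p)"])
      (use b i in \<open>auto intro: order_trans[OF _ abs_ge_self]\<close>)
  have "(LINT x|M. norm (f x - g x) powr p) \<le> (LINT x|M. 2 powr p * (norm (f x) powr p + norm (g x) powr p))"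
    by (rule integral_mono') (use b i in auto)
  then show "(LINT x|M. norm (f x - g x) powr p) \<le> 2 powr p * ((LINT x|M. norm (f x) powr p) + (LINT x|M. norm (g x) powr p))"
    using i by simp
qed

lemma Lp_diff: "p \<ge> 0 \<Longrightarrow> f \<in> Lp S p \<Longrightarrow> g \<in> Lp S p \<Longrightarrow> (\<lambda>x. f x - g x) \<in> Lp S p"
  unfolding Lp_def using integrable_powr_diff(1)[of f "lebesgue_on S" g p] by auto

lemma Lp_bounded:
  fixes f :: "'a::euclidean_space \<Rightarrow> 'b::euclidean_space"
  assumes S: "S \<in> lmeasurable" and f[measurable]: "f \<in> borel_measurable (lebesgue_on S)"
    and B: "\<And>x. x \<in> S \<Longrightarrow> norm (f x) \<le> B" and p: "p \<ge> 0"
  shows "f \<in> Lp S p"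
proof -
  interpret finite_measure "lebesgue_on S" by (rule finite_measure_lebesgue_on[OF S])
  have "integrable (lebesgue_on S) (\<lambda>x. norm (f x) powr p)"
    by (rule integrable_const_bound[where B="B powr p"]) (use B p in \<open>auto intro!: powr_mono2 AE_I2\<close>)
  then show ?thesis by (simp add: Lp_def)
qed

text \<open>Pointwise |f| <= k + k^(1-p) |f|^p, by comparing |f| with k. With k free, this plays the
  role of Hoelder's inequality on a finite measure space.\<close>

lemma (in finite_measure) integrable_norm_of_powr:
  fixes f :: "'a \<Rightarrow> 'b::euclidean_space"
  assumes [measurable]: "f \<in> borel_measurable M" and p: "1 \<le> p"
    and i: "integrable M (\<lambda>x. norm (f x) powr p)"
  shows "integrable M f"
    "k > 0 \<Longrightarrow> (LINT x|M. norm (f x)) \<le> k * measure M (space M) + k powr (1 - p) * (LINT x|M. norm (f x) powr p)"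
proof -
  have b: "norm (f x) \<le> k + k powr (1 - p) * norm (f x) powr p" if k: "k > 0" for k x
  proof (cases "norm (f x) \<le> k")
    case True
    then show ?thesis by (simp add: add_increasing2)
  next
    case False
    then have "norm (f x) powr (1 - p) \<le> k powr (1 - p)" using k p by (intro powr_mono2') auto
    then have "norm (f x) powr (1 - p) * norm (f x) powr p \<le> k powr (1 - p) * norm (f x) powr p"
      by (intro mult_right_mono) auto
    moreover have "norm (f x) powr (1 - p) * norm (f x) powr p = norm (f x)"
      using False k by (simp flip: powr_add)
    ultimately show ?thesis using k by simp
  qed
  show 1: "integrable M f"
    by (rule Bochner_Integration.integrable_bound[where f="\<lambda>x. 1 + 1 powr (1 - p) * norm (f x) powr p"])
      (use b[of 1] i in auto)
  show "(LINT x|M. norm (f x)) \<le> k * measure M (space M) + k powr (1 - p) * (LINT x|M. norm (f x) powr p)"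
    if "k > 0"
  proof -
    have "(LINT x|M. norm (f x)) \<le> (LINT x|M. k + k powr (1 - p) * norm (f x) powr p)"
      by (rule integral_mono') (use b[OF that] 1 i order_trans[OF norm_ge_zero b[OF that]] in auto)
    then show ?thesis using i by (simp add: mult.commute)
  qed
qed

lemma (in finite_measure) L1_tendsto_of_Lp:
  fixes f :: "nat \<Rightarrow> 'a \<Rightarrow> 'b::euclidean_space"
  assumes m: "\<And>n. f n \<in> borel_measurable M" and p: "1 \<le> p"
    and i: "\<And>n. integrable M (\<lambda>x. norm (f n x) powr p)"
    and lim: "(\<lambda>n. LINT x|M. norm (f n x) powr p) \<longlonglongrightarrow> 0"
  shows "(\<lambda>n. LINT x|M. norm (f n x)) \<longlonglongrightarrow> 0"
proof (rule tendstoI)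
  fix e :: real assume e: "e > 0"
  define k where "k = e / (2 * (measure M (space M) + 1))"
  have k: "k > 0" using e by (simp add: k_def add_nonneg_pos)
  have "k * (measure M (space M) + 1) = e / 2" using measure_nonneg[of M "space M"] by (simp add: k_def divide_simps add_nonneg_eq_0_iff)
  then have km: "k * measure M (space M) < e / 2" using k by (simp add: algebra_simps)
  have "(\<lambda>n. k powr (1 - p) * (LINT x|M. norm (f n x) powr p)) \<longlonglongrightarrow> 0"
    using tendsto_mult[OF tendsto_const lim] by simp
  then have "\<forall>\<^sub>F n in sequentially. k powr (1 - p) * (LINT x|M. norm (f n x) powr p) < e / 2"
    by (rule order_tendstoD(2)) (use e in simp)
  then show "\<forall>\<^sub>F n in sequentially. dist (LINT x|M. norm (f n x)) 0 < e"
  proof eventually_elim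
    case (elim n)
    then show ?case using integrable_norm_of_powr(2)[OF m p i k, of n] km by simp
  qed
qed

lemma Cc_inf_Lp:
  fixes \<phi> :: "real^'n \<Rightarrow> real"
  assumes S: "S \<in> lmeasurable" and \<phi>: "\<phi> \<in> Cc_inf S" and p: "p \<ge> 0"
  shows "\<phi> \<in> Lp S p" "grad \<phi> \<in> Lp S p"
proof -
  note P = Cc_inf_grad[OF \<phi>]
  obtain R where R: "\<And>x. R < norm x \<Longrightarrow> \<phi> x = 0 \<and> grad \<phi> x = 0" using P(5) by blast
  have m: "f \<in> borel_measurable (lebesgue_on S)" if "continuous_on UNIV f" for f :: "real^'n \<Rightarrow> 'b::euclidean_space"
    by (rule measurable_restrict_space1, rule measurable_completion) (use that in \<open>auto intro: borel_measurable_continuous_onI\<close>)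
  obtain B where "\<forall>x. norm (\<phi> x) \<le> B" using integrable_Cc(2)[OF P(6), of R] R by blast
  then show "\<phi> \<in> Lp S p" using m[OF P(6)] by (intro Lp_bounded[OF S _ _ p]) auto
  obtain B where "\<forall>x. norm (grad \<phi> x) \<le> B" using integrable_Cc(2)[OF P(2), of R] R by blast
  then show "grad \<phi> \<in> Lp S p" using m[OF P(2)] by (intro Lp_bounded[OF S _ _ p]) auto
qed

lemma Lp_norm_lessD:
  assumes "Lp_norm S p f < e" "p > 0"
  shows "(LINT x|lebesgue_on S. norm (f x) powr p) < e powr p"
proof -
  let ?I = "LINT x|lebesgue_on S. norm (f x) powr p"
  have I: "?I \<ge> 0" by (rule integral_nonneg_AE) auto
  have "?I = (?I powr (1/p)) powr p" using I assms(2) by (simp add: powr_powr)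
  also have "\<dots> < e powr p"
    by (intro powr_less_mono2) (use assms in \<open>auto simp: Lp_norm_def\<close>)
  finally show ?thesis .
qed

lemma W1p_0_approx:
  fixes w :: "real^'n \<Rightarrow> real"
  assumes "W1p_0 \<Omega> p w Dw" "p \<ge> 1"
  obtains \<phi> where "\<And>k. \<phi> k \<in> Cc_inf \<Omega>"
    "(\<lambda>k. LINT x|lebesgue_on \<Omega>. norm (w x - \<phi> k x) powr p) \<longlonglongrightarrow> 0"
    "(\<lambda>k. LINT x|lebesgue_on \<Omega>. norm (Dw x - grad (\<phi> k) x) powr p) \<longlonglongrightarrow> 0"
proof -
  have "\<exists>\<phi>\<in>Cc_inf \<Omega>. Lp_norm \<Omega> p (\<lambda>x. w x - \<phi> x) + Lp_norm \<Omega> p (\<lambda>x. Dw x - grad \<phi> x) < 1 / real (Suc k)" for k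
    using assms(1) unfolding W1p_0_def by (simp del: of_nat_Suc)
  then obtain \<phi> where \<phi>: "\<And>k. \<phi> k \<in> Cc_inf \<Omega>"
    "\<And>k. Lp_norm \<Omega> p (\<lambda>x. w x - \<phi> k x) + Lp_norm \<Omega> p (\<lambda>x. Dw x - grad (\<phi> k) x) < 1 / real (Suc k)"
    by metis
  have nn: "Lp_norm S p f \<ge> 0" for S and f :: "real^'n \<Rightarrow> 'b::euclidean_space" by (simp add: Lp_norm_def)
  have lim: "(\<lambda>k. LINT x|lebesgue_on \<Omega>. norm (f k x) powr p) \<longlonglongrightarrow> 0"
    if f: "\<And>k. Lp_norm \<Omega> p (f k) < 1 / real (Suc k)" for f :: "nat \<Rightarrow> real^'n \<Rightarrow> 'b::euclidean_space"
  proof (rule Lim_null_comparison)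
    show "(\<lambda>k. 1 / real (Suc k)) \<longlonglongrightarrow> 0" by (rule lim_1_over_n[THEN LIMSEQ_Suc])
    have "norm (LINT x|lebesgue_on \<Omega>. norm (f k x) powr p) \<le> 1 / real (Suc k)" for k
    proof -
      have "(LINT x|lebesgue_on \<Omega>. norm (f k x) powr p) \<le> (1 / real (Suc k)) powr p"
        using Lp_norm_lessD[OF f] assms(2) by (simp add: less_imp_le)
      also have "\<dots> \<le> (1 / real (Suc k)) powr 1" using assms(2) by (intro powr_mono') auto
      finally show ?thesis by (simp add: integral_nonneg_AE)
    qed
    then show "\<forall>\<^sub>F k in sequentially. norm (LINT x|lebesgue_on \<Omega>. norm (f k x) powr p) \<le> 1 / real (Suc k)" by simp
  qed
  show ?thesis
  proof
    show "\<phi> k \<in> Cc_inf \<Omega>" for k by (rule \<phi>)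
    show "(\<lambda>k. LINT x|lebesgue_on \<Omega>. norm (w x - \<phi> k x) powr p) \<longlonglongrightarrow> 0"
      by (rule lim) (use \<phi>(2) nn in \<open>smt (verit)\<close>)
    show "(\<lambda>k. LINT x|lebesgue_on \<Omega>. norm (Dw x - grad (\<phi> k) x) powr p) \<longlonglongrightarrow> 0"
      by (rule lim) (use \<phi>(2) nn in \<open>smt (verit)\<close>)
  qed
qed

text \<open>The weak gradient identity holds for the approximating test functions by integration by
  parts. It passes to the limit because L^p convergence on a bounded set implies L^1 convergence,
  and the functions tested against are bounded together with their gradients.\<close>

lemma W1p_0_limitI:
  fixes w :: "real^'n \<Rightarrow> real"
  assumes \<Omega>: "open \<Omega>" "bounded \<Omega>" and p: "p \<ge> 1" and w: "w \<in> Lp \<Omega> p" "Dw \<in> Lp \<Omega> p"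
    and \<phi>: "\<And>k. \<phi> k \<in> Cc_inf \<Omega>"
    and lim: "(\<lambda>k. LINT x|lebesgue_on \<Omega>. norm (w x - \<phi> k x) powr p) \<longlonglongrightarrow> 0"
      "(\<lambda>k. LINT x|lebesgue_on \<Omega>. norm (Dw x - grad (\<phi> k) x) powr p) \<longlonglongrightarrow> 0"
  shows "W1p_0 \<Omega> p w Dw"
proof -
  let ?M = "lebesgue_on \<Omega>"
  have \<Omega>l: "\<Omega> \<in> lmeasurable" using \<Omega> by (simp add: bounded_set_imp_lmeasurable)
  have \<Omega>b: "\<Omega> \<in> sets borel" using \<Omega> by simp
  interpret finite_measure ?M by (rule finite_measure_lebesgue_on[OF \<Omega>l])
  note [measurable] = LpD(1)[OF w(1)] LpD(1)[OF w(2)]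
  have L: "\<phi> k \<in> Lp \<Omega> p" "grad (\<phi> k) \<in> Lp \<Omega> p" for k using Cc_inf_Lp[OF \<Omega>l \<phi>] p by auto
  note [measurable] = LpD(1)[OF L(1)] LpD(1)[OF L(2)]
  have d: "(\<lambda>x. w x - \<phi> k x) \<in> Lp \<Omega> p" "(\<lambda>x. Dw x - grad (\<phi> k) x) \<in> Lp \<Omega> p" for k
    using p w L by (auto intro: Lp_diff)
  have l1: "(\<lambda>k. LINT x|?M. norm (w x - \<phi> k x)) \<longlonglongrightarrow> 0"
    by (rule L1_tendsto_of_Lp[OF _ p LpD(2)[OF d(1)] lim(1)]) measurable
  have l2: "(\<lambda>k. LINT x|?M. norm (Dw x - grad (\<phi> k) x)) \<longlonglongrightarrow> 0"
    by (rule L1_tendsto_of_Lp[OF _ p LpD(2)[OF d(2)] lim(2)]) measurable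
  have iw: "integrable ?M w" "integrable ?M Dw" "integrable ?M (\<phi> k)" "integrable ?M (grad (\<phi> k))" for k
    using integrable_norm_of_powr(1)[OF _ p] LpD[OF w(1)] LpD[OF w(2)] LpD[OF L(1)] LpD[OF L(2)] by blast+
  have pass: "(\<lambda>k. LINT x|?M. f k x * g x) \<longlonglongrightarrow> (LINT x|?M. F x * g x)"
    if i: "integrable ?M F" "\<And>k. integrable ?M (f k)" and l: "(\<lambda>k. LINT x|?M. norm (F x - f k x)) \<longlonglongrightarrow> 0"
      and [measurable]: "g \<in> borel_measurable ?M" and B: "\<And>x. norm (g x) \<le> B"
    for F g :: "real^'n \<Rightarrow> real" and f B
  proof -
    have ig: "integrable ?M (\<lambda>x. h x * g x)" if "integrable ?M h" for h
      by (rule Bochner_Integration.integrable_bound[of _ "\<lambda>x. B * norm (h x)"])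
        (use that mult_left_mono[OF order_trans[OF B abs_ge_self] abs_ge_zero] in \<open>auto simp: abs_mult mult.commute[of B]\<close>)
    have "(\<lambda>k. (LINT x|?M. f k x * g x) - (LINT x|?M. F x * g x)) \<longlonglongrightarrow> 0"
    proof (rule Lim_null_comparison)
      show "(\<lambda>k. B * (LINT x|?M. norm (F x - f k x))) \<longlonglongrightarrow> 0"
        using tendsto_mult[OF tendsto_const l, of B] by simp
      have "norm ((LINT x|?M. f k x * g x) - (LINT x|?M. F x * g x)) \<le> B * (LINT x|?M. norm (F x - f k x))" for k
      proof -
        have "(LINT x|?M. f k x * g x) - (LINT x|?M. F x * g x) = (LINT x|?M. (f k x - F x) * g x)"
          using ig[OF i(1)] ig[OF i(2)[of k]] by (simp add: left_diff_distrib)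
        also have "norm \<dots> \<le> (LINT x|?M. norm ((f k x - F x) * g x))" by (rule integral_norm_bound)
        also have "\<dots> \<le> (LINT x|?M. B * norm (F x - f k x))"
        proof (rule integral_mono')
          fix x
          have "norm ((f k x - F x) * g x) = norm (F x - f k x) * norm (g x)" by (simp add: abs_mult abs_minus_commute)
          also have "\<dots> \<le> norm (F x - f k x) * B" using B by (intro mult_left_mono) auto
          finally show "norm ((f k x - F x) * g x) \<le> B * norm (F x - f k x)" by (simp add: mult.commute)
        next
          show "0 \<le> B * norm (F x - f k x)" for x using order_trans[OF norm_ge_zero B[of x]] by simp
        qed (use i in auto)
        finally show ?thesis by simp
      qed
      then show "\<forall>\<^sub>F k in sequentially. norm ((LINT x|?M. f k x * g x) - (LINT x|?M. F x * g x)) \<le> B * (LINT x|?M. norm (F x - f k x))"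
        by simp
    qed
    then show ?thesis by (simp add: LIM_zero_iff)
  qed
  have ibp: "(LINT x|?M. w x * grad \<psi> x $ i) = - (LINT x|?M. Dw x $ i * \<psi> x)" if \<psi>: "\<psi> \<in> Cc_inf \<Omega>" for \<psi> i
  proof -
    note P = Cc_inf_grad[OF \<psi>]
    have Lpsi: "\<psi> \<in> Lp \<Omega> p" "grad \<psi> \<in> Lp \<Omega> p" using Cc_inf_Lp[OF \<Omega>l \<psi>] p by auto
    note [measurable] = LpD(1)[OF Lpsi(1)] LpD(1)[OF Lpsi(2)]
    obtain R where R: "\<And>x. R < norm x \<Longrightarrow> \<psi> x = 0 \<and> grad \<psi> x = 0" using P(5) by blast
    obtain B where B: "\<And>x. norm (\<psi> x) \<le> B" using integrable_Cc(2)[OF P(6), of R] R by blast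
    obtain B' where B': "\<And>x. norm (grad \<psi> x) \<le> B'" using integrable_Cc(2)[OF P(2), of R] R by blast
    have c: "norm (v $ i) \<le> norm v" for v :: "real^'n" by (simp add: component_le_norm_cart)
    have 1: "(\<lambda>k. LINT x|?M. \<phi> k x * grad \<psi> x $ i) \<longlonglongrightarrow> (LINT x|?M. w x * grad \<psi> x $ i)"
    proof (rule pass[OF iw(1,3) l1])
      have "(\<lambda>v::real^'n. v $ i) \<in> borel_measurable borel"
        by (intro borel_measurable_continuous_onI continuous_intros)
      from measurable_compose[OF LpD(1)[OF Lpsi(2)] this]
      show "(\<lambda>x. grad \<psi> x $ i) \<in> borel_measurable ?M" .
    qed (use order_trans[OF c B'] in auto)
    have 2: "(\<lambda>k. LINT x|?M. grad (\<phi> k) x $ i * \<psi> x) \<longlonglongrightarrow> (LINT x|?M. Dw x $ i * \<psi> x)"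
    proof (rule pass[OF _ _ _ _ B])
      have ci: "integrable ?M (\<lambda>x. f x $ i)" if "integrable ?M f" for f :: "real^'n \<Rightarrow> real^'n"
        using that by (rule integrable_bounded_linear[OF bounded_linear_vec_nth])
      show "integrable ?M (\<lambda>x. Dw x $ i)" "integrable ?M (\<lambda>x. grad (\<phi> k) x $ i)" for k
        using iw(2) iw(4) by (auto intro: ci)
      show "(\<lambda>k. LINT x|?M. norm (Dw x $ i - grad (\<phi> k) x $ i)) \<longlonglongrightarrow> 0"
      proof (rule Lim_null_comparison[OF _ l2])
        have "norm (LINT x|?M. norm (Dw x $ i - grad (\<phi> k) x $ i)) \<le> (LINT x|?M. norm (Dw x - grad (\<phi> k) x))" for k
        proof -
          have "norm (LINT x|?M. norm (Dw x $ i - grad (\<phi> k) x $ i)) = (LINT x|?M. norm (Dw x $ i - grad (\<phi> k) x $ i))"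
            by (simp add: integral_nonneg_AE)
          also have "\<dots> \<le> (LINT x|?M. norm (Dw x - grad (\<phi> k) x))"
            by (rule integral_mono') (use iw(2) iw(4)[of k] c[of "Dw _ - grad (\<phi> k) _"] in auto)
          finally show ?thesis .
        qed
        then show "\<forall>\<^sub>F k in sequentially. norm (LINT x|?M. norm (Dw x $ i - grad (\<phi> k) x $ i)) \<le> (LINT x|?M. norm (Dw x - grad (\<phi> k) x))"
          by simp
      qed
    qed measurable
    have "(\<lambda>k. LINT x|?M. \<phi> k x * grad \<psi> x $ i) \<longlonglongrightarrow> - (LINT x|?M. Dw x $ i * \<psi> x)"
      using tendsto_minus[OF 2] Cc_inf_integration_by_parts[OF \<Omega>b \<phi> \<psi>] by simp
    then show ?thesis by (rule LIMSEQ_unique[OF 1])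
  qed
  have "\<exists>\<psi>\<in>Cc_inf \<Omega>. Lp_norm \<Omega> p (\<lambda>x. w x - \<psi> x) + Lp_norm \<Omega> p (\<lambda>x. Dw x - grad \<psi> x) < e" if "e > 0" for e
  proof -
    have z: "(\<lambda>k. (I k) powr (1/p)) \<longlonglongrightarrow> 0" if "I \<longlonglongrightarrow> 0" "\<And>k. I k \<ge> 0" for I :: "nat \<Rightarrow> real"
      using tendsto_powr'[OF that(1) tendsto_const[of "1/p"]] that(2) p by auto
    have "(\<lambda>k. Lp_norm \<Omega> p (\<lambda>x. w x - \<phi> k x) + Lp_norm \<Omega> p (\<lambda>x. Dw x - grad (\<phi> k) x)) \<longlonglongrightarrow> 0 + 0"
      unfolding Lp_norm_def by (intro tendsto_add z lim integral_nonneg_AE) auto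
    then have "\<forall>\<^sub>F k in sequentially. Lp_norm \<Omega> p (\<lambda>x. w x - \<phi> k x) + Lp_norm \<Omega> p (\<lambda>x. Dw x - grad (\<phi> k) x) < e"
      by (rule order_tendstoD(2)) (use that in simp)
    then show ?thesis using \<phi> by (auto simp: eventually_sequentially)
  qed
  then show ?thesis unfolding W1p_0_def W1p_def using w ibp by blast
qed

lemma W1p_0_Lp: "W1p_0 \<Omega> p w Dw \<Longrightarrow> w \<in> Lp \<Omega> p" "W1p_0 \<Omega> p w Dw \<Longrightarrow> Dw \<in> Lp \<Omega> p"
  by (auto simp: W1p_0_def W1p_def)

lemma W1p_0_diff:
  fixes u v :: "real^'n \<Rightarrow> real"
  assumes \<Omega>: "open \<Omega>" "bounded \<Omega>" and p: "p \<ge> 1" and u: "W1p_0 \<Omega> p u Du" and v: "W1p_0 \<Omega> p v Dv"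
  shows "W1p_0 \<Omega> p (\<lambda>x. u x - v x) (\<lambda>x. Du x - Dv x)"
proof -
  let ?M = "lebesgue_on \<Omega>"
  have \<Omega>l: "\<Omega> \<in> lmeasurable" using \<Omega> by (simp add: bounded_set_imp_lmeasurable)
  obtain \<phi> where \<phi>: "\<And>k. \<phi> k \<in> Cc_inf \<Omega>"
    "(\<lambda>k. LINT x|?M. norm (u x - \<phi> k x) powr p) \<longlonglongrightarrow> 0"
    "(\<lambda>k. LINT x|?M. norm (Du x - grad (\<phi> k) x) powr p) \<longlonglongrightarrow> 0"
    using W1p_0_approx[OF u p] by blast
  obtain \<psi> where \<psi>: "\<And>k. \<psi> k \<in> Cc_inf \<Omega>"
    "(\<lambda>k. LINT x|?M. norm (v x - \<psi> k x) powr p) \<longlonglongrightarrow> 0"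
    "(\<lambda>k. LINT x|?M. norm (Dv x - grad (\<psi> k) x) powr p) \<longlonglongrightarrow> 0"
    using W1p_0_approx[OF v p] by blast
  have lim: "(\<lambda>k. LINT x|?M. norm ((U x - V x) - (f k x - g k x)) powr p) \<longlonglongrightarrow> 0"
    if UV: "U \<in> Lp \<Omega> p" "V \<in> Lp \<Omega> p" "\<And>k. f k \<in> Lp \<Omega> p" "\<And>k. g k \<in> Lp \<Omega> p"
      and l: "(\<lambda>k. LINT x|?M. norm (U x - f k x) powr p) \<longlonglongrightarrow> 0"
        "(\<lambda>k. LINT x|?M. norm (V x - g k x) powr p) \<longlonglongrightarrow> 0"
    for U V :: "real^'n \<Rightarrow> 'b::euclidean_space" and f g
  proof (rule Lim_null_comparison)
    show "(\<lambda>k. 2 powr p * ((LINT x|?M. norm (U x - f k x) powr p) + (LINT x|?M. norm (V x - g k x) powr p))) \<longlonglongrightarrow> 0"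
      using tendsto_mult[OF tendsto_const tendsto_add[OF l]] by simp
    have "norm (LINT x|?M. norm ((U x - V x) - (f k x - g k x)) powr p)
       \<le> 2 powr p * ((LINT x|?M. norm (U x - f k x) powr p) + (LINT x|?M. norm (V x - g k x) powr p))" for k
    proof -
      have "(\<lambda>x. U x - f k x) \<in> Lp \<Omega> p" "(\<lambda>x. V x - g k x) \<in> Lp \<Omega> p"
        using UV p by (auto intro: Lp_diff)
      from integrable_powr_diff(2)[OF LpD(1)[OF this(1)] LpD(1)[OF this(2)] _ LpD(2)[OF this(1)] LpD(2)[OF this(2)]]
      show ?thesis using p by (simp add: integral_nonneg_AE algebra_simps)
    qed
    then show "\<forall>\<^sub>F k in sequentially. norm (LINT x|?M. norm ((U x - V x) - (f k x - g k x)) powr p)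
       \<le> 2 powr p * ((LINT x|?M. norm (U x - f k x) powr p) + (LINT x|?M. norm (V x - g k x) powr p))" by simp
  qed
  show ?thesis
  proof (rule W1p_0_limitI[OF \<Omega> p])
    show "(\<lambda>x. u x - v x) \<in> Lp \<Omega> p" "(\<lambda>x. Du x - Dv x) \<in> Lp \<Omega> p"
      using W1p_0_Lp[OF u] W1p_0_Lp[OF v] p by (auto intro: Lp_diff)
    show "(\<lambda>x. \<phi> k x - \<psi> k x) \<in> Cc_inf \<Omega>" for k by (intro Cc_inf_diff \<phi> \<psi>)
    show "(\<lambda>k. LINT x|?M. norm ((u x - v x) - (\<phi> k x - \<psi> k x)) powr p) \<longlonglongrightarrow> 0"
      using W1p_0_Lp[OF u] W1p_0_Lp[OF v] Cc_inf_Lp[OF \<Omega>l \<phi>(1)] Cc_inf_Lp[OF \<Omega>l \<psi>(1)] p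
      by (intro lim \<phi> \<psi>) auto
    show "(\<lambda>k. LINT x|?M. norm ((Du x - Dv x) - grad (\<lambda>x. \<phi> k x - \<psi> k x) x) powr p) \<longlonglongrightarrow> 0"
      unfolding grad_diff[OF \<phi>(1) \<psi>(1)]
      using W1p_0_Lp[OF u] W1p_0_Lp[OF v] Cc_inf_Lp[OF \<Omega>l \<phi>(1)] Cc_inf_Lp[OF \<Omega>l \<psi>(1)] p
      by (intro lim \<phi> \<psi>) auto
  qed
qed

text \<open>Passing to a subsequence adds convergence almost everywhere, on which Fatou's lemma and
  the chain rule below rely.\<close>

lemma W1p_0_approx_AE:
  fixes w :: "real^'n \<Rightarrow> real"
  assumes \<Omega>: "open \<Omega>" "bounded \<Omega>" and p: "p \<ge> 1" and w: "W1p_0 \<Omega> p w Dw"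
  obtains \<phi> where "\<And>k. \<phi> k \<in> Cc_inf \<Omega>" "AE x in lebesgue_on \<Omega>. (\<lambda>k. \<phi> k x) \<longlonglongrightarrow> w x"
    "(\<lambda>k. LINT x|lebesgue_on \<Omega>. norm (w x - \<phi> k x) powr p) \<longlonglongrightarrow> 0"
    "(\<lambda>k. LINT x|lebesgue_on \<Omega>. norm (Dw x - grad (\<phi> k) x) powr p) \<longlonglongrightarrow> 0"
proof -
  let ?M = "lebesgue_on \<Omega>"
  have \<Omega>l: "\<Omega> \<in> lmeasurable" using \<Omega> by (simp add: bounded_set_imp_lmeasurable)
  interpret finite_measure ?M by (rule finite_measure_lebesgue_on[OF \<Omega>l])
  obtain \<phi> where \<phi>: "\<And>k. \<phi> k \<in> Cc_inf \<Omega>"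
    "(\<lambda>k. LINT x|?M. norm (w x - \<phi> k x) powr p) \<longlonglongrightarrow> 0"
    "(\<lambda>k. LINT x|?M. norm (Dw x - grad (\<phi> k) x) powr p) \<longlonglongrightarrow> 0"
    using W1p_0_approx[OF w p] by blast
  have d: "(\<lambda>x. w x - \<phi> k x) \<in> Lp \<Omega> p" for k
    using W1p_0_Lp[OF w] Cc_inf_Lp[OF \<Omega>l \<phi>(1)] p by (auto intro: Lp_diff)
  have i: "integrable ?M (\<lambda>x. w x - \<phi> k x)" for k
    using integrable_norm_of_powr(1)[OF _ p] LpD[OF d] by blast
  have "(\<lambda>k. LINT x|?M. norm (w x - \<phi> k x)) \<longlonglongrightarrow> 0"
    by (rule L1_tendsto_of_Lp[OF LpD(1)[OF d] p LpD(2)[OF d] \<phi>(2)])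
  from tendsto_L1_AE_subseq[OF i this] obtain r :: "nat \<Rightarrow> nat" where
    r: "strict_mono r" "AE x in ?M. (\<lambda>k. w x - \<phi> (r k) x) \<longlonglongrightarrow> 0" by blast
  show ?thesis
  proof (rule that[of "\<lambda>k. \<phi> (r k)"])
    show "AE x in ?M. (\<lambda>k. \<phi> (r k) x) \<longlonglongrightarrow> w x"
      using r(2)
    proof eventually_elim
      case (elim x)
      from tendsto_diff[OF tendsto_const[of "w x"] elim] show ?case by simp
    qed
    show "(\<lambda>k. LINT x|?M. norm (w x - \<phi> (r k) x) powr p) \<longlonglongrightarrow> 0"
      using LIMSEQ_subseq_LIMSEQ[OF \<phi>(2) r(1)] by (simp add: o_def)
    show "(\<lambda>k. LINT x|?M. norm (Dw x - grad (\<phi> (r k)) x) powr p) \<longlonglongrightarrow> 0"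
      using LIMSEQ_subseq_LIMSEQ[OF \<phi>(3) r(1)] by (simp add: o_def)
  qed (rule \<phi>)
qed

text \<open>The functions g composed with \<phi> k are again test functions. The error in the
  gradient splits into the difference of \<open>g'\<close> at w and at \<phi> k times Dw, which
  tends to 0 by continuity and dominated convergence, and \<open>g'\<close> at \<phi> k times the
  error of the original gradients, where |g'| <= 1 suffices.\<close>

theorem W1p_0_compose:
  fixes w :: "real^'n \<Rightarrow> real"
  assumes \<Omega>: "open \<Omega>" "bounded \<Omega>" and p: "p \<ge> 1" and w: "W1p_0 \<Omega> p w Dw"
    and g: "\<And>k. C_k k g" "g 0 = 0" "\<And>r. (g has_real_derivative g' r) (at r)"
    and g': "\<And>r. \<bar>g' r\<bar> \<le> 1" "continuous_on UNIV g'"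
  shows "W1p_0 \<Omega> p (\<lambda>x. g (w x)) (\<lambda>x. g' (w x) *\<^sub>R Dw x)"
proof -
  let ?M = "lebesgue_on \<Omega>"
  have \<Omega>l: "\<Omega> \<in> lmeasurable" using \<Omega> by (simp add: bounded_set_imp_lmeasurable)
  obtain \<phi> where \<phi>: "\<And>k. \<phi> k \<in> Cc_inf \<Omega>" "AE x in ?M. (\<lambda>k. \<phi> k x) \<longlonglongrightarrow> w x"
    "(\<lambda>k. LINT x|?M. norm (w x - \<phi> k x) powr p) \<longlonglongrightarrow> 0"
    "(\<lambda>k. LINT x|?M. norm (Dw x - grad (\<phi> k) x) powr p) \<longlonglongrightarrow> 0"
    using W1p_0_approx_AE[OF \<Omega> p w] by blast
  have cg: "continuous_on UNIV g" using C_k_continuous[OF g(1)[of 0]] .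
  note [measurable] = borel_measurable_continuous_onI[OF cg] borel_measurable_continuous_onI[OF g'(2)]
  have wL: "w \<in> Lp \<Omega> p" "Dw \<in> Lp \<Omega> p" using W1p_0_Lp[OF w] .
  have L: "\<phi> k \<in> Lp \<Omega> p" "grad (\<phi> k) \<in> Lp \<Omega> p" for k using Cc_inf_Lp[OF \<Omega>l \<phi>(1)] p by auto
  note [measurable] = LpD(1)[OF wL(1)] LpD(1)[OF wL(2)] LpD(1)[OF L(1)] LpD(1)[OF L(2)]
  have Lip: "\<bar>g r - g s\<bar> \<le> \<bar>r - s\<bar>" for r s
  proof -
    have "norm (g r - g s) \<le> 1 * norm (r - s)"
      by (rule field_differentiable_bound[of UNIV g g']) (use g(3) g'(1) in auto)
    then show ?thesis by simp
  qed
  have gb: "\<bar>g r\<bar> \<le> \<bar>r\<bar>" for r using Lip[of r 0] g(2) by simp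
  have g'b: "norm (g' r *\<^sub>R v) \<le> norm v" for r and v :: "real^'n"
    using g'(1)[of r] by (simp add: mult_left_le_one_le)
  have gL: "(\<lambda>x. g (w x)) \<in> Lp \<Omega> p"
  proof -
    have "integrable ?M (\<lambda>x. norm (g (w x)) powr p)"
      by (rule Bochner_Integration.integrable_bound[OF LpD(2)[OF wL(1)]])
        (use gb p in \<open>auto intro!: powr_mono2\<close>)
    then show ?thesis by (simp add: Lp_def)
  qed
  have DgL: "(\<lambda>x. g' (w x) *\<^sub>R Dw x) \<in> Lp \<Omega> p"
  proof -
    have "integrable ?M (\<lambda>x. norm (g' (w x) *\<^sub>R Dw x) powr p)"
      by (rule Bochner_Integration.integrable_bound[OF LpD(2)[OF wL(2)]])
        (use g'b p in \<open>auto intro!: powr_mono2 simp del: norm_scaleR\<close>)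
    then show ?thesis by (simp add: Lp_def)
  qed
  have d: "(\<lambda>x. w x - \<phi> k x) \<in> Lp \<Omega> p" "(\<lambda>x. Dw x - grad (\<phi> k) x) \<in> Lp \<Omega> p" for k
    using p wL L by (auto intro: Lp_diff)
  show ?thesis
  proof (rule W1p_0_limitI[OF \<Omega> p gL DgL])
    show "(\<lambda>x. g (\<phi> k x)) \<in> Cc_inf \<Omega>" for k by (rule Cc_inf_compose[OF \<phi>(1) g(1,2)])
    show "(\<lambda>k. LINT x|?M. norm (g (w x) - g (\<phi> k x)) powr p) \<longlonglongrightarrow> 0"
    proof (rule Lim_null_comparison[OF _ \<phi>(3)])
      have "norm (LINT x|?M. norm (g (w x) - g (\<phi> k x)) powr p) \<le> (LINT x|?M. norm (w x - \<phi> k x) powr p)" for k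
      proof -
        have "(LINT x|?M. norm (g (w x) - g (\<phi> k x)) powr p) \<le> (LINT x|?M. norm (w x - \<phi> k x) powr p)"
          by (rule integral_mono') (use Lip p LpD(2)[OF d(1)] in \<open>auto intro!: powr_mono2\<close>)
        then show ?thesis by (simp add: integral_nonneg_AE)
      qed
      then show "\<forall>\<^sub>F k in sequentially. norm (LINT x|?M. norm (g (w x) - g (\<phi> k x)) powr p) \<le> (LINT x|?M. norm (w x - \<phi> k x) powr p)"
        by simp
    qed
    have gr: "grad (\<lambda>x. g (\<phi> k x)) x = g' (\<phi> k x) *\<^sub>R grad (\<phi> k) x" for k x
      by (rule grad_compose[OF \<phi>(1) g(3)])
    have i1: "integrable ?M (\<lambda>x. norm ((g' (w x) - g' (\<phi> k x)) *\<^sub>R Dw x) powr p)" for k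
    proof (rule Bochner_Integration.integrable_bound[where f="\<lambda>x. 2 powr p * norm (Dw x) powr p"])
      show "AE x in ?M. norm (norm ((g' (w x) - g' (\<phi> k x)) *\<^sub>R Dw x) powr p) \<le> norm (2 powr p * norm (Dw x) powr p)"
      proof (rule AE_I2)
        fix x
        have "\<bar>g' (w x) - g' (\<phi> k x)\<bar> \<le> 2" using g'(1)[of "w x"] g'(1)[of "\<phi> k x"] by linarith
        then have "norm ((g' (w x) - g' (\<phi> k x)) *\<^sub>R Dw x) powr p \<le> (2 * norm (Dw x)) powr p"
          using p by (intro powr_mono2) (auto intro: mult_right_mono)
        then show "norm (norm ((g' (w x) - g' (\<phi> k x)) *\<^sub>R Dw x) powr p) \<le> norm (2 powr p * norm (Dw x) powr p)"
          by (simp add: powr_mult)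
      qed
    qed (use LpD(2)[OF wL(2)] in auto)
    have i2: "integrable ?M (\<lambda>x. norm (g' (\<phi> k x) *\<^sub>R (grad (\<phi> k) x - Dw x)) powr p)" for k
    proof (rule Bochner_Integration.integrable_bound[OF LpD(2)[OF d(2)[of k]]])
      show "AE x in ?M. norm (norm (g' (\<phi> k x) *\<^sub>R (grad (\<phi> k) x - Dw x)) powr p) \<le> norm (norm (Dw x - grad (\<phi> k) x) powr p)"
      proof (rule AE_I2)
        fix x
        have "norm (g' (\<phi> k x) *\<^sub>R (grad (\<phi> k) x - Dw x)) \<le> norm (Dw x - grad (\<phi> k) x)"
          using g'b by (metis norm_minus_commute)
        then show "norm (norm (g' (\<phi> k x) *\<^sub>R (grad (\<phi> k) x - Dw x)) powr p) \<le> norm (norm (Dw x - grad (\<phi> k) x) powr p)"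
          using p by (simp add: powr_mono2 del: norm_scaleR)
      qed
    qed measurable
    have l1: "(\<lambda>k. LINT x|?M. norm ((g' (w x) - g' (\<phi> k x)) *\<^sub>R Dw x) powr p) \<longlonglongrightarrow> (LINT x|?M. 0)"
    proof (rule integral_dominated_convergence[where w="\<lambda>x. 2 powr p * norm (Dw x) powr p"])
      show "AE x in ?M. (\<lambda>k. norm ((g' (w x) - g' (\<phi> k x)) *\<^sub>R Dw x) powr p) \<longlonglongrightarrow> 0"
        using \<phi>(2)
      proof eventually_elim
        case (elim x)
        have "isCont g' (w x)" using g'(2) by (simp add: continuous_on_eq_continuous_at)
        from isCont_tendsto_compose[OF this elim]
        have "(\<lambda>k. norm ((g' (w x) - g' (\<phi> k x)) *\<^sub>R Dw x)) \<longlonglongrightarrow> norm ((g' (w x) - g' (w x)) *\<^sub>R Dw x)"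
          by (intro tendsto_intros)
        then have "(\<lambda>k. norm ((g' (w x) - g' (\<phi> k x)) *\<^sub>R Dw x)) \<longlonglongrightarrow> 0" by simp
        from tendsto_powr'[OF this tendsto_const[of p]] show ?case using p by auto
      qed
      show "AE x in ?M. norm (norm ((g' (w x) - g' (\<phi> k x)) *\<^sub>R Dw x) powr p) \<le> 2 powr p * norm (Dw x) powr p" for k
      proof (rule AE_I2)
        fix x
        have "\<bar>g' (w x) - g' (\<phi> k x)\<bar> \<le> 2" using g'(1)[of "w x"] g'(1)[of "\<phi> k x"] by linarith
        then have "norm ((g' (w x) - g' (\<phi> k x)) *\<^sub>R Dw x) powr p \<le> (2 * norm (Dw x)) powr p"
          using p by (intro powr_mono2) (auto intro: mult_right_mono)
        then show "norm (norm ((g' (w x) - g' (\<phi> k x)) *\<^sub>R Dw x) powr p) \<le> 2 powr p * norm (Dw x) powr p"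
          by (simp add: powr_mult)
      qed
    qed (use LpD(2)[OF wL(2)] in auto)
    show "(\<lambda>k. LINT x|?M. norm (g' (w x) *\<^sub>R Dw x - grad (\<lambda>x. g (\<phi> k x)) x) powr p) \<longlonglongrightarrow> 0"
      unfolding gr
    proof (rule Lim_null_comparison)
      show "(\<lambda>k. 2 powr p * ((LINT x|?M. norm ((g' (w x) - g' (\<phi> k x)) *\<^sub>R Dw x) powr p)
           + (LINT x|?M. norm (Dw x - grad (\<phi> k) x) powr p))) \<longlonglongrightarrow> 0"
        using tendsto_mult[OF tendsto_const tendsto_add[OF l1 \<phi>(4)]] by simp
      have "norm (LINT x|?M. norm (g' (w x) *\<^sub>R Dw x - g' (\<phi> k x) *\<^sub>R grad (\<phi> k) x) powr p)
        \<le> 2 powr p * ((LINT x|?M. norm ((g' (w x) - g' (\<phi> k x)) *\<^sub>R Dw x) powr p)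
           + (LINT x|?M. norm (Dw x - grad (\<phi> k) x) powr p))" for k
      proof -
        have "norm (LINT x|?M. norm (g' (w x) *\<^sub>R Dw x - g' (\<phi> k x) *\<^sub>R grad (\<phi> k) x) powr p)
          = (LINT x|?M. norm ((g' (w x) - g' (\<phi> k x)) *\<^sub>R Dw x - g' (\<phi> k x) *\<^sub>R (grad (\<phi> k) x - Dw x)) powr p)"
          by (simp add: integral_nonneg_AE algebra_simps)
        also have "\<dots> \<le> 2 powr p * ((LINT x|?M. norm ((g' (w x) - g' (\<phi> k x)) *\<^sub>R Dw x) powr p)
           + (LINT x|?M. norm (g' (\<phi> k x) *\<^sub>R (grad (\<phi> k) x - Dw x)) powr p))"
          by (rule integrable_powr_diff(2)[OF _ _ _ i1 i2]) (use p in auto)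
        also have "\<dots> \<le> 2 powr p * ((LINT x|?M. norm ((g' (w x) - g' (\<phi> k x)) *\<^sub>R Dw x) powr p)
           + (LINT x|?M. norm (Dw x - grad (\<phi> k) x) powr p))"
        proof -
          have "norm (g' (\<phi> k x) *\<^sub>R (grad (\<phi> k) x - Dw x)) \<le> norm (Dw x - grad (\<phi> k) x)" for x
            using g'b by (metis norm_minus_commute)
          then have "(LINT x|?M. norm (g' (\<phi> k x) *\<^sub>R (grad (\<phi> k) x - Dw x)) powr p) \<le> (LINT x|?M. norm (Dw x - grad (\<phi> k) x) powr p)"
            by (intro integral_mono' LpD(2)[OF d(2)] powr_mono2) (use p in auto)
          then show ?thesis by (intro mult_left_mono add_left_mono) auto
        qed
        finally show ?thesis .
      qed
      then show "\<forall>\<^sub>F k in sequentially. norm (LINT x|?M. norm (g' (w x) *\<^sub>R Dw x - g' (\<phi> k x) *\<^sub>R grad (\<phi> k) x) powr p)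
        \<le> 2 powr p * ((LINT x|?M. norm ((g' (w x) - g' (\<phi> k x)) *\<^sub>R Dw x) powr p)
           + (LINT x|?M. norm (Dw x - grad (\<phi> k) x) powr p))" by simp
    qed
  qed
qed

section \<open>The Gagliardo-Nirenberg inequality\<close>

lemma nn_integral_lborel_translate:
  fixes g :: "'a::euclidean_space \<Rightarrow> ennreal"
  assumes "g \<in> borel_measurable borel"
  shows "(\<integral>\<^sup>+x. g (x + c) \<partial>lborel) = (\<integral>\<^sup>+x. g x \<partial>lborel)"
proof -
  have "(\<integral>\<^sup>+x. g x \<partial>lborel) = (\<integral>\<^sup>+x. g x \<partial>distr lborel borel ((+) c))" by (simp add: lborel_distr_plus)
  also have "\<dots> = (\<integral>\<^sup>+x. g (x + c) \<partial>lborel)" using assms by (subst nn_integral_distr) (auto simp: add.commute)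
  finally show ?thesis by simp
qed

text \<open>The increment is the mean of the directional derivative along the segment from x to x +
  y, so its square is at most the mean of the squares. After integration in x every point of the
  segment contributes equally, by translation invariance.\<close>

lemma nn_integral_increment_le:
  fixes f :: "'a::euclidean_space \<Rightarrow> real" and D :: "'a \<Rightarrow> 'a"
  assumes d: "\<And>x. (f has_derivative (\<lambda>h. D x \<bullet> h)) (at x)" and cD: "continuous_on UNIV D"
  shows "(\<integral>\<^sup>+x. ennreal ((f (x + y) - f x)\<^sup>2) \<partial>lborel) \<le> ennreal ((norm y)\<^sup>2) * (\<integral>\<^sup>+x. ennreal ((norm (D x))\<^sup>2) \<partial>lborel)"
proof -
  have [measurable]: "D \<in> borel_measurable borel" using cD by (rule borel_measurable_continuous_onI)
  have pt: "ennreal ((f (x + y) - f x)\<^sup>2)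
     \<le> (\<integral>\<^sup>+t. ennreal ((norm y)\<^sup>2 * (norm (D (x + t *\<^sub>R y)))\<^sup>2) * indicator {0..1::real} t \<partial>lborel)" for x
  proof -
    define c where "c = f (x + y) - f x"
    define g where "g t = D (x + t *\<^sub>R y) \<bullet> y" for t
    have cont: "continuous_on UNIV (\<lambda>t. D (x + t *\<^sub>R y))"
      by (rule continuous_on_compose2[OF cD]) (auto intro!: continuous_intros)
    have cg: "isCont g t" for t unfolding g_def
      using cont by (intro continuous_intros) (simp add: continuous_on_eq_continuous_at)
    have dg: "((\<lambda>t. f (x + t *\<^sub>R y)) has_real_derivative g t) (at t)" for t
    proof -
      have "((\<lambda>t. x + t *\<^sub>R y) has_derivative (\<lambda>t. t *\<^sub>R y)) (at t)" by (auto intro!: derivative_eq_intros)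
      from has_derivative_compose[OF this d]
      show ?thesis by (simp add: has_field_derivative_def g_def mult_commute_abs)
    qed
    have F: "has_bochner_integral lborel (\<lambda>t. g t * indicator {0..1} t) (f (x + 1 *\<^sub>R y) - f (x + 0 *\<^sub>R y))"
      by (rule has_bochner_integral_FTC_Icc_real) (use dg cg in auto)
    then have F: "integrable lborel (\<lambda>t. g t * indicator {0..1} t)" "(LINT t|lborel. g t * indicator {0..1} t) = c"
      by (auto simp: has_bochner_integral_iff c_def)
    have i2: "integrable lborel (\<lambda>t. (norm y)\<^sup>2 * (norm (D (x + t *\<^sub>R y)))\<^sup>2 * indicator {0..1} t)"
      using borel_integrable_atLeastAtMost[of 0 1 "\<lambda>t. (norm y)\<^sup>2 * (norm (D (x + t *\<^sub>R y)))\<^sup>2"] cont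
      by (auto simp: continuous_on_eq_continuous_at intro!: continuous_intros)
    have i1: "integrable lborel (\<lambda>t::real. indicator {0..1} t :: real)" by (simp add: integrable_real_indicator)
    \<comment> \<open>Jensen's inequality for the square, from 2 c g - c^2 <= g^2 with c the
      integral of g.\<close>
    have "c\<^sup>2 = (LINT t|lborel. 2 * c * (g t * indicator {0..1} t) - c\<^sup>2 * indicator {0..1} t)"
      using F i1 by (simp add: power2_eq_square)
    also have "\<dots> \<le> (LINT t|lborel. (norm y)\<^sup>2 * (norm (D (x + t *\<^sub>R y)))\<^sup>2 * indicator {0..1} t)"
    proof (rule integral_mono)
      fix t
      have "2 * c * g t - c\<^sup>2 \<le> (g t)\<^sup>2" using zero_le_power2[of "g t - c"] by (simp add: power2_diff algebra_simps)
      also have "\<dots> \<le> (norm y)\<^sup>2 * (norm (D (x + t *\<^sub>R y)))\<^sup>2"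
        unfolding g_def using Cauchy_Schwarz_ineq2[of "D (x + t *\<^sub>R y)" y]
        by (metis abs_le_square_iff abs_mult abs_norm_cancel mult.commute power_mult_distrib)
      finally show "2 * c * (g t * indicator {0..1} t) - c\<^sup>2 * indicator {0..1} t \<le> (norm y)\<^sup>2 * (norm (D (x + t *\<^sub>R y)))\<^sup>2 * indicator {0..1} t"
        by (auto simp: indicator_def)
    qed (use F i1 i2 in auto)
    finally have "ennreal (c\<^sup>2) \<le> ennreal (LINT t|lborel. (norm y)\<^sup>2 * (norm (D (x + t *\<^sub>R y)))\<^sup>2 * indicator {0..1} t)"
      by (rule ennreal_leI)
    also have "\<dots> = (\<integral>\<^sup>+t. ennreal ((norm y)\<^sup>2 * (norm (D (x + t *\<^sub>R y)))\<^sup>2 * indicator {0..1} t) \<partial>lborel)"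
      by (rule nn_integral_eq_integral[symmetric]) (use i2 in auto)
    also have "\<dots> = (\<integral>\<^sup>+t. ennreal ((norm y)\<^sup>2 * (norm (D (x + t *\<^sub>R y)))\<^sup>2) * indicator {0..1} t \<partial>lborel)"
      by (intro nn_integral_cong) (auto simp: indicator_def)
    finally show ?thesis by (simp add: c_def)
  qed
  have "(\<integral>\<^sup>+x. ennreal ((f (x + y) - f x)\<^sup>2) \<partial>lborel)
    \<le> (\<integral>\<^sup>+x. \<integral>\<^sup>+t. ennreal ((norm y)\<^sup>2 * (norm (D (x + t *\<^sub>R y)))\<^sup>2) * indicator {0..1::real} t \<partial>lborel \<partial>lborel)"
    by (intro nn_integral_mono pt)
  also have "\<dots> = (\<integral>\<^sup>+t. \<integral>\<^sup>+x. ennreal ((norm y)\<^sup>2 * (norm (D (x + t *\<^sub>R y)))\<^sup>2) * indicator {0..1::real} t \<partial>lborel \<partial>lborel)"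
    by (rule lborel_pair.Fubini'[symmetric]) simp
  also have "\<dots> = (\<integral>\<^sup>+t. (ennreal ((norm y)\<^sup>2) * (\<integral>\<^sup>+x. ennreal ((norm (D x))\<^sup>2) \<partial>lborel)) * indicator {0..1::real} t \<partial>lborel)"
  proof (intro nn_integral_cong)
    fix t :: real
    have "(\<integral>\<^sup>+x. ennreal ((norm (D (x + t *\<^sub>R y)))\<^sup>2) \<partial>lborel) = (\<integral>\<^sup>+x. ennreal ((norm (D x))\<^sup>2) \<partial>lborel)"
      by (rule nn_integral_lborel_translate[of "\<lambda>x. ennreal ((norm (D x))\<^sup>2)"]) simp
    then show "(\<integral>\<^sup>+x. ennreal ((norm y)\<^sup>2 * (norm (D (x + t *\<^sub>R y)))\<^sup>2) * indicator {0..1::real} t \<partial>lborel)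
      = (ennreal ((norm y)\<^sup>2) * (\<integral>\<^sup>+x. ennreal ((norm (D x))\<^sup>2) \<partial>lborel)) * indicator {0..1::real} t"
      by (simp add: ennreal_mult' nn_integral_multc nn_integral_cmult)
  qed
  also have "\<dots> = ennreal ((norm y)\<^sup>2) * (\<integral>\<^sup>+x. ennreal ((norm (D x))\<^sup>2) \<partial>lborel)"
    by (subst nn_integral_cmult_indicator) auto
  finally show ?thesis .
qed

text \<open>Averaging over a cube of side \<open>l\<close>: where \<open>f \<ge> m\<close>, the mean of \<open>f\<^sup>2\<close> over the cube is too small for
  \<open>f\<close> to be close to its translates.\<close>

lemma superlevel_measure_le:
  fixes f :: "'a::euclidean_space \<Rightarrow> real" and D :: "'a \<Rightarrow> 'a" and l m :: real
  assumes d: "\<And>x. (f has_derivative (\<lambda>h. D x \<bullet> h)) (at x)" and cD: "continuous_on UNIV D"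
    and l: "l > 0" and lam: "m > 0"
    and A: "(\<integral>\<^sup>+x. ennreal ((f x)\<^sup>2) \<partial>lborel) \<le> ennreal (l ^ DIM('a) * (m\<^sup>2 / 4))"
  shows "ennreal (m\<^sup>2 / 4) * emeasure lborel {x. m \<le> f x}
    \<le> ennreal (DIM('a) * l\<^sup>2) * (\<integral>\<^sup>+x. ennreal ((norm (D x))\<^sup>2) \<partial>lborel)"
proof -
  have cf: "continuous_on UNIV f" using has_derivative_continuous[OF d] by (auto intro: continuous_at_imp_continuous_on)
  have [measurable]: "f \<in> borel_measurable borel" "D \<in> borel_measurable borel"
    using cf cD by (auto intro: borel_measurable_continuous_onI)
  define C where "C = cbox (0::'a) (l *\<^sub>R One)"
  let ?L = "l ^ DIM('a)"
  have [measurable]: "C \<in> sets borel" by (simp add: C_def)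
  have L: "?L > 0" using l by simp
  have eC: "emeasure lborel C = ennreal ?L"
    unfolding C_def using l by (subst emeasure_lborel_cbox_eq) (auto simp: prod_constant)
  have nC: "(norm y)\<^sup>2 \<le> real DIM('a) * l\<^sup>2" if "y \<in> C" for y
  proof -
    have "(norm y)\<^sup>2 = (\<Sum>b\<in>Basis. (y \<bullet> b)\<^sup>2)"
      unfolding power2_norm_eq_inner by (subst euclidean_inner) (simp add: power2_eq_square)
    also have "\<dots> \<le> (\<Sum>b\<in>(Basis::'a set). l\<^sup>2 :: real)"
      using that l by (intro sum_mono power_mono) (auto simp: C_def mem_box)
    finally show ?thesis by simp
  qed
  let ?I = "\<lambda>x. \<integral>\<^sup>+y. ennreal ((f (x + y) - f x)\<^sup>2) * indicator C y \<partial>lborel"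
  \<comment> \<open>Integrate m^2 <= 2 (f(x + y) - f(x))^2 + 2 f(x + y)^2 over the cube. By
    \<open>A\<close> the last term contributes at most half of the left side, so the increments
    account for the other half.\<close>
  have low: "ennreal (?L * (m\<^sup>2 / 4)) * indicator {x. m \<le> f x} x \<le> ?I x" for x
  proof (cases "m \<le> f x")
    case True
    have "ennreal (?L * m\<^sup>2) = (\<integral>\<^sup>+y. ennreal (m\<^sup>2) * indicator C y \<partial>lborel)"
      using L by (subst nn_integral_cmult_indicator) (auto simp: eC ennreal_mult' mult.commute)
    also have "\<dots> \<le> (\<integral>\<^sup>+y. 2 * (ennreal ((f (x + y) - f x)\<^sup>2) * indicator C y) + 2 * ennreal ((f (y + x))\<^sup>2) \<partial>lborel)"
    proof (intro nn_integral_mono)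
      fix y
      have "m\<^sup>2 \<le> (f x)\<^sup>2" using True lam by (intro power_mono) auto
      also have "\<dots> \<le> 2 * (f (x + y) - f x)\<^sup>2 + 2 * (f (x + y))\<^sup>2"
        using zero_le_power2[of "2 * f (x + y) - f x"] by (simp add: power2_eq_square algebra_simps)
      finally have "ennreal (m\<^sup>2) \<le> ennreal (2 * (f (x + y) - f x)\<^sup>2 + 2 * (f (x + y))\<^sup>2)" by (rule ennreal_leI)
      also have "\<dots> = 2 * ennreal ((f (x + y) - f x)\<^sup>2) + 2 * ennreal ((f (y + x))\<^sup>2)"
        by (simp add: ennreal_mult' add.commute)
      finally show "ennreal (m\<^sup>2) * indicator C y \<le> 2 * (ennreal ((f (x + y) - f x)\<^sup>2) * indicator C y) + 2 * ennreal ((f (y + x))\<^sup>2)"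
        by (auto simp: indicator_def)
    qed
    also have "\<dots> = 2 * ?I x + 2 * (\<integral>\<^sup>+y. ennreal ((f y)\<^sup>2) \<partial>lborel)"
      using nn_integral_lborel_translate[of "\<lambda>y. ennreal ((f y)\<^sup>2)" x]
      by (simp add: nn_integral_add nn_integral_cmult)
    also have "\<dots> \<le> 2 * ?I x + 2 * ennreal (?L * (m\<^sup>2 / 4))" by (intro add_mono mult_left_mono A) auto
    finally have "ennreal (?L * m\<^sup>2) \<le> 2 * ?I x + 2 * ennreal (?L * (m\<^sup>2 / 4))" .
    then have "ennreal (?L * (m\<^sup>2 / 4)) \<le> ?I x"
    proof (cases "?I x")
      case (real r)
      have e: "2 * ennreal r + 2 * ennreal X = ennreal (2 * r + 2 * X)" if "X \<ge> 0" for X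
        using that real(1) by (simp add: ennreal_plus[of "2 * r" "2 * X"] ennreal_mult')
      have "ennreal (?L * m\<^sup>2) \<le> ennreal (2 * r + 2 * (?L * (m\<^sup>2 / 4)))"
        using \<open>ennreal (?L * m\<^sup>2) \<le> 2 * ?I x + 2 * ennreal (?L * (m\<^sup>2 / 4))\<close> L
        unfolding real(2) by (subst (asm) e) auto
      then have "?L * m\<^sup>2 \<le> 2 * r + 2 * (?L * (m\<^sup>2 / 4))" using real L by (subst (asm) ennreal_le_iff) auto
      then have "?L * (m\<^sup>2 / 4) \<le> r" by (simp add: field_simps)
      then show ?thesis using real by (simp add: ennreal_leI)
    qed simp
    then show ?thesis using True by simp
  qed simp
  let ?G = "\<integral>\<^sup>+x. ennreal ((norm (D x))\<^sup>2) \<partial>lborel"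
  have "ennreal ?L * (ennreal (m\<^sup>2 / 4) * emeasure lborel {x. m \<le> f x})
     = (\<integral>\<^sup>+x. ennreal (?L * (m\<^sup>2 / 4)) * indicator {x. m \<le> f x} x \<partial>lborel)"
    using L ennreal_mult[of ?L "m\<^sup>2 / 4"]
    by (subst nn_integral_cmult_indicator) (auto simp: mult.assoc simp del: times_divide_eq_right)
  also have "\<dots> \<le> (\<integral>\<^sup>+x. ?I x \<partial>lborel)" by (intro nn_integral_mono low)
  also have "\<dots> = (\<integral>\<^sup>+y. \<integral>\<^sup>+x. ennreal ((f (x + y) - f x)\<^sup>2) * indicator C y \<partial>lborel \<partial>lborel)"
    by (rule lborel_pair.Fubini'[symmetric]) simp
  also have "\<dots> \<le> (\<integral>\<^sup>+y. (ennreal (DIM('a) * l\<^sup>2) * ?G) * indicator C y \<partial>lborel)"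
  proof (intro nn_integral_mono)
    fix y :: 'a
    have "(\<integral>\<^sup>+x. ennreal ((f (x + y) - f x)\<^sup>2) \<partial>lborel) \<le> ennreal (DIM('a) * l\<^sup>2) * ?G" if "y \<in> C"
      using nn_integral_increment_le[OF d cD, of y] nC[OF that]
      by (meson ennreal_leI mult_right_mono order_trans zero_le)
    then show "(\<integral>\<^sup>+x. ennreal ((f (x + y) - f x)\<^sup>2) * indicator C y \<partial>lborel)
       \<le> (ennreal (DIM('a) * l\<^sup>2) * ?G) * indicator C y"
      by (cases "y \<in> C") auto
  qed
  also have "\<dots> = ennreal ?L * (ennreal (DIM('a) * l\<^sup>2) * ?G)"
    by (subst nn_integral_cmult_indicator) (auto simp: eC mult.commute)
  finally show ?thesis
    by (subst (asm) ennreal_mult_le_mult_iff) (use l in auto)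
qed

section \<open>Weak-type bounds on dyadic bands and their summation\<close>

definition tent :: "real \<Rightarrow> real" where
  "tent r = 2 * max 0 (r - 1) - 4 * max 0 (r - 3/2) + 2 * max 0 (r - 2)"

text \<open>The primitive of the hat function \<open>tent\<close> on [1, 2]: it rises from 0 to 1/2,
  the area of the hat, and is constant outside that interval. It stands in for a piecewise linear
  cut-off because the superlevel bound asks for a continuous gradient.\<close>

definition ramp :: "real \<Rightarrow> real" where
  "ramp r = (max 0 (r - 1))\<^sup>2 - 2 * (max 0 (r - 3/2))\<^sup>2 + (max 0 (r - 2))\<^sup>2"

lemma ramp_deriv: "(ramp has_real_derivative tent r) (at r)"
proof -
  have s: "((\<lambda>r. (max 0 (r - c))\<^sup>2) has_real_derivative 2 * max 0 (r - c)) (at r)" for c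
  proof -
    have "((\<lambda>r. r - c) has_real_derivative 1) (at r)" by (auto intro!: derivative_eq_intros)
    from DERIV_chain2[OF max_0_power2_deriv this] show ?thesis by simp
  qed
  have "(ramp has_real_derivative 2 * max 0 (r - 1) - 2 * (2 * max 0 (r - 3/2)) + 2 * max 0 (r - 2)) (at r)"
    unfolding ramp_def by (intro DERIV_add DERIV_diff DERIV_cmult s)
  then show ?thesis by (simp add: tent_def)
qed

lemma tent_bounds: "0 \<le> tent r" "tent r \<le> 1" "r \<le> 1 \<Longrightarrow> tent r = 0" "2 \<le> r \<Longrightarrow> tent r = 0"
  by (auto simp: tent_def max_def)

lemma ramp_bounds: "2 \<le> r \<Longrightarrow> ramp r = 1/2" "\<bar>ramp r\<bar> \<le> \<bar>r\<bar>"
proof -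
  show "2 \<le> r \<Longrightarrow> ramp r = 1/2" by (auto simp: ramp_def max_def power2_eq_square algebra_simps)
  have "norm (ramp r - ramp 0) \<le> 1 * norm (r - 0)"
    by (rule field_differentiable_bound[of UNIV ramp tent]) (use ramp_deriv tent_bounds in auto)
  moreover have "ramp 0 = 0" by (simp add: ramp_def)
  ultimately show "\<bar>ramp r\<bar> \<le> \<bar>r\<bar>" by simp
qed

text \<open>The superlevel bound is applied to m ramp (f / m), whose gradient lives on the band m <=
  f < 2 m and which equals m / 2 where f >= 2 m. Confining the gradient to a band is the point: the
  bands for different powers of 2 are disjoint, so their contributions can be summed.\<close>

lemma superlevel_measure_le_localized:
  fixes f :: "'a::euclidean_space \<Rightarrow> real" and D :: "'a \<Rightarrow> 'a" and m A :: real
  defines "N \<equiv> real DIM('a)"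
  assumes d: "\<And>x. (f has_derivative (\<lambda>h. D x \<bullet> h)) (at x)" and cD: "continuous_on UNIV D"
    and m: "m > 0" and A: "(\<integral>\<^sup>+x. ennreal ((f x)\<^sup>2) \<partial>lborel) \<le> ennreal A" "A > 0"
  shows "ennreal (m powr (2 + 4 / N)) * emeasure lborel {x. 2 * m \<le> f x}
    \<le> ennreal (16 * N * (16 * A) powr (2 / N)) * (\<integral>\<^sup>+x\<in>{x. m \<le> f x \<and> f x < 2 * m}. ennreal ((norm (D x))\<^sup>2) \<partial>lborel)"
proof -
  have cf: "continuous_on UNIV f" using has_derivative_continuous[OF d] by (auto intro: continuous_at_imp_continuous_on)
  have [measurable]: "f \<in> borel_measurable borel" "D \<in> borel_measurable borel"
    using cf cD by (auto intro: borel_measurable_continuous_onI)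
  have N: "N > 0" by (simp add: N_def)
  \<comment> \<open>The side of the cube makes l^N (m/2)^2 / 4 equal to A, the threshold of the
    superlevel bound at level m/2. It brings the power m^(-4/N) into l^2, whence the exponent 2 +
    4/N.\<close>
  define l where "l = (16 * A / m\<^sup>2) powr (1 / N)"
  have l: "l > 0" using A m by (simp add: l_def)
  let ?X = "16 * A / m\<^sup>2"
  have X: "?X > 0" using A m by simp
  have lN: "l ^ DIM('a) = ?X"
  proof -
    have "l ^ DIM('a) = l powr N" using powr_realpow[OF l, of "DIM('a)"] by (simp add: N_def)
    also have "\<dots> = ?X powr (1 / N * N)" unfolding l_def by (rule powr_powr)
    also have "\<dots> = ?X powr 1" using N by simp
    also have "\<dots> = ?X" using X by (intro powr_one) simp
    finally show ?thesis .
  qed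
  have l2: "l\<^sup>2 = (16 * A) powr (2 / N) * m powr (- (4 / N))"
  proof -
    have "l\<^sup>2 = l powr 2" using l by simp
    also have "\<dots> = ?X powr (1 / N * 2)" unfolding l_def by (rule powr_powr)
    also have "\<dots> = (16 * A) powr (2 / N) / (m\<^sup>2) powr (2 / N)" using A(2) m by (simp add: powr_divide)
    also have "(m\<^sup>2) powr (2 / N) = (m powr 2) powr (2 / N)" using m by simp
    also have "\<dots> = m powr (2 * (2 / N))" by (rule powr_powr)
    finally show ?thesis by (simp add: powr_minus divide_inverse)
  qed
  let ?f = "\<lambda>x. m * ramp (f x / m)" and ?D = "\<lambda>x. tent (f x / m) *\<^sub>R D x"
  have df: "(?f has_derivative (\<lambda>h. ?D x \<bullet> h)) (at x)" for x
  proof -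
    have "((\<lambda>x. f x / m) has_derivative (\<lambda>h. (D x \<bullet> h) / m)) (at x)"
      using d m by (auto intro!: derivative_eq_intros)
    moreover have "(ramp has_derivative (\<lambda>h. tent (f x / m) * h)) (at (f x / m))"
      using ramp_deriv[of "f x / m"] by (simp add: has_field_derivative_def)
    ultimately have "((\<lambda>x. ramp (f x / m)) has_derivative (\<lambda>h. tent (f x / m) * ((D x \<bullet> h) / m))) (at x)"
      by (rule has_derivative_compose)
    from has_derivative_mult_right[OF this, of m] show ?thesis using m by (simp add: field_simps)
  qed
  have cDf: "continuous_on UNIV ?D"
    unfolding tent_def using cf cD m by (intro continuous_intros) auto
  have "(\<integral>\<^sup>+x. ennreal ((?f x)\<^sup>2) \<partial>lborel) \<le> (\<integral>\<^sup>+x. ennreal ((f x)\<^sup>2) \<partial>lborel)"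
  proof (intro nn_integral_mono ennreal_leI)
    fix x
    have "\<bar>?f x\<bar> \<le> \<bar>f x\<bar>" using ramp_bounds(2)[of "f x / m"] m by (simp add: abs_mult field_simps)
    then show "(?f x)\<^sup>2 \<le> (f x)\<^sup>2" by (simp add: abs_le_square_iff)
  qed
  also have "\<dots> \<le> ennreal A" by (rule A)
  also have "A = l ^ DIM('a) * ((m/2)\<^sup>2 / 4)" unfolding lN using m by (simp add: power2_eq_square)
  finally have "ennreal ((m/2)\<^sup>2 / 4) * emeasure lborel {x. m/2 \<le> ?f x}
    \<le> ennreal (DIM('a) * l\<^sup>2) * (\<integral>\<^sup>+x. ennreal ((norm (?D x))\<^sup>2) \<partial>lborel)"
    using m by (intro superlevel_measure_le[OF df cDf l]) auto
  also have "\<dots> \<le> ennreal (DIM('a) * l\<^sup>2) * (\<integral>\<^sup>+x\<in>{x. m \<le> f x \<and> f x < 2 * m}. ennreal ((norm (D x))\<^sup>2) \<partial>lborel)"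
  proof (intro mult_left_mono nn_integral_mono)
    fix x
    show "ennreal ((norm (?D x))\<^sup>2) \<le> ennreal ((norm (D x))\<^sup>2) * indicator {x. m \<le> f x \<and> f x < 2 * m} x"
    proof (cases "m \<le> f x \<and> f x < 2 * m")
      case True
      have "norm (?D x) \<le> norm (D x)" using tent_bounds[of "f x / m"] by (simp add: mult_left_le_one_le)
      then show ?thesis using True by (auto intro!: ennreal_leI power_mono)
    next
      case False
      then have "f x / m \<le> 1 \<or> 2 \<le> f x / m" using m by (auto simp: field_simps not_le not_less)
      then have "tent (f x / m) = 0" using tent_bounds(3,4) by blast
      then show ?thesis by simp
    qed
  qed auto
  finally have *: "ennreal ((m/2)\<^sup>2 / 4) * emeasure lborel {x. m/2 \<le> ?f x}
     \<le> ennreal (DIM('a) * l\<^sup>2) * (\<integral>\<^sup>+x\<in>{x. m \<le> f x \<and> f x < 2 * m}. ennreal ((norm (D x))\<^sup>2) \<partial>lborel)" (is "_ \<le> _ * ?G") .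
  have sub: "{x. 2 * m \<le> f x} \<subseteq> {x. m/2 \<le> ?f x}"
  proof (intro subsetI CollectI)
    fix x assume "x \<in> {x. 2 * m \<le> f x}"
    then have "2 \<le> f x / m" using m by (simp add: field_simps)
    then have "ramp (f x / m) = 1/2" by (rule ramp_bounds)
    then show "m / 2 \<le> m * ramp (f x / m)" by (simp only:)
  qed
  have [measurable]: "?f \<in> borel_measurable borel"
    using has_derivative_continuous[OF df] by (intro borel_measurable_continuous_onI) (auto intro: continuous_at_imp_continuous_on)
  have lev: "{x. m/2 \<le> ?f x} \<in> sets lborel" by measurable
  let ?c = "16 * m powr (4 / N)"
  have "ennreal (m powr (2 + 4 / N)) * emeasure lborel {x. 2 * m \<le> f x}
     \<le> ennreal (?c * ((m/2)\<^sup>2 / 4)) * emeasure lborel {x. m/2 \<le> ?f x}"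
  proof (intro mult_mono)
    have "m powr (2 + 4 / N) = ?c * ((m/2)\<^sup>2 / 4)"
      using m by (simp add: powr_add power2_eq_square field_simps)
    then show "ennreal (m powr (2 + 4 / N)) \<le> ennreal (?c * ((m/2)\<^sup>2 / 4))" by simp
    show "emeasure lborel {x. 2 * m \<le> f x} \<le> emeasure lborel {x. m/2 \<le> ?f x}"
      by (rule emeasure_mono[OF sub lev])
  qed auto
  also have "\<dots> = ennreal ?c * (ennreal ((m/2)\<^sup>2 / 4) * emeasure lborel {x. m/2 \<le> ?f x})"
    by (subst ennreal_mult) (auto simp: mult.assoc)
  also have "\<dots> \<le> ennreal ?c * (ennreal (DIM('a) * l\<^sup>2) * ?G)" by (intro mult_left_mono *) auto
  also have "\<dots> = ennreal (?c * (N * l\<^sup>2)) * ?G" by (subst ennreal_mult) (auto simp: mult.assoc N_def)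
  also have "?c * (N * l\<^sup>2) = 16 * N * (16 * A) powr (2 / N)"
    unfolding l2 using m by (simp add: powr_minus field_simps)
  finally show ?thesis .
qed

lemma dyadic_floor:
  fixes r :: real
  assumes "r > 0" "\<lfloor>log 2 r\<rfloor> = k"
  shows "2 powr real_of_int k \<le> r" "r < 2 powr (real_of_int k + 1)"
proof -
  have "real_of_int k \<le> log 2 r" "log 2 r < real_of_int k + 1" using assms by linarith+
  then show "2 powr real_of_int k \<le> r" "r < 2 powr (real_of_int k + 1)"
    using assms(1) by (auto simp: le_log_iff log_less_iff)
qed

text \<open>The factor 4^(2 + 4/N) comes from bounding f by 4 m on the band 2 m <= f < 4 m; the
  other factor is the constant of the localised bound with the power of A taken out.\<close>

definition gn_const :: "real \<Rightarrow> real" where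
  "gn_const N = 4 powr (2 + 4 / N) * (16 * N * 16 powr (2 / N))"

text \<open>Maz'ya's truncation argument, which turns weak-type bounds for gradients into strong
  ones: the integral over 2^(k+1) <= f < 2^(k+2) is controlled by the gradient on the band just
  below, 2^k <= f < 2^(k+1), and these bands are disjoint.\<close>

theorem Gagliardo_Nirenberg_Cc:
  fixes f :: "'a::euclidean_space \<Rightarrow> real" and D :: "'a \<Rightarrow> 'a" and A :: real
  defines "N \<equiv> real DIM('a)"
  assumes d: "\<And>x. (f has_derivative (\<lambda>h. D x \<bullet> h)) (at x)" and cD: "continuous_on UNIV D"
    and A: "(\<integral>\<^sup>+x. ennreal ((f x)\<^sup>2) \<partial>lborel) \<le> ennreal A" "A > 0"
  shows "(\<integral>\<^sup>+x. ennreal (max 0 (f x) powr (2 + 4 / N)) \<partial>lborel)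
    \<le> ennreal (gn_const N * A powr (2 / N)) * (\<integral>\<^sup>+x. ennreal ((norm (D x))\<^sup>2) \<partial>lborel)"
proof -
  have cf: "continuous_on UNIV f" using has_derivative_continuous[OF d] by (auto intro: continuous_at_imp_continuous_on)
  have [measurable]: "f \<in> borel_measurable borel" "D \<in> borel_measurable borel"
    using cf cD by (auto intro: borel_measurable_continuous_onI)
  have N: "N > 0" by (simp add: N_def)
  define q where "q = 2 + 4 / N"
  have q: "q > 0" using N by (simp add: q_def add_pos_pos)
  \<comment> \<open>Every integer exponent occurs, as f may be small or large;
    \<open>int_decode\<close> numbers them by naturals for the countable sum.\<close>
  define k where "k n = real_of_int (int_decode n)" for n
  define S where "S n = {x. 0 < f x \<and> \<lfloor>log 2 (f x)\<rfloor> = int_decode n}" for n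
  define B where "B n = {x. 0 < f x \<and> \<lfloor>log 2 (f x)\<rfloor> = int_decode n + 1}" for n
  have [measurable]: "S n \<in> sets borel" "B n \<in> sets borel" for n unfolding S_def B_def by measurable
  have disj: "disjoint_family S" "disjoint_family B"
    unfolding S_def B_def disjoint_family_on_def by (auto dest: int_decode_eq[THEN iffD1])
  have UB: "(\<Union>n. B n) = {x. 0 < f x}"
  proof -
    have "x \<in> B (int_encode (\<lfloor>log 2 (f x)\<rfloor> - 1))" if "0 < f x" for x using that by (simp add: B_def)
    then show ?thesis unfolding B_def by blast
  qed
  let ?G = "\<lambda>x. ennreal ((norm (D x))\<^sup>2)"
  let ?c = "16 * N * (16 * A) powr (2 / N)"
  have piece: "(\<integral>\<^sup>+x\<in>B n. ennreal (max 0 (f x) powr q) \<partial>lborel) \<le> ennreal (4 powr q * ?c) * (\<integral>\<^sup>+x\<in>S n. ?G x \<partial>lborel)" for n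
  proof -
    let ?m = "2 powr k n"
    have "(\<integral>\<^sup>+x\<in>B n. ennreal (max 0 (f x) powr q) \<partial>lborel)
       \<le> (\<integral>\<^sup>+x. ennreal ((4 * ?m) powr q) * indicator {x. 2 * ?m \<le> f x} x \<partial>lborel)"
    proof (intro nn_integral_mono)
      fix x
      show "ennreal (max 0 (f x) powr q) * indicator (B n) x \<le> ennreal ((4 * ?m) powr q) * indicator {x. 2 * ?m \<le> f x} x"
      proof (cases "x \<in> B n")
        case True
        then have x: "0 < f x" "\<lfloor>log 2 (f x)\<rfloor> = int_decode n + 1" by (auto simp: B_def)
        have "2 * ?m \<le> f x" "f x \<le> 4 * ?m"
          using dyadic_floor[OF x] by (auto simp: k_def powr_add)
        then show ?thesis using True x q by (auto intro!: ennreal_leI powr_mono2)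
      qed simp
    qed
    also have "\<dots> = ennreal (4 powr q * ?m powr q) * emeasure lborel {x. 2 * ?m \<le> f x}"
      by (subst nn_integral_cmult_indicator) (auto simp: powr_mult)
    also have "\<dots> = ennreal (4 powr q) * (ennreal (?m powr q) * emeasure lborel {x. 2 * ?m \<le> f x})"
      by (subst ennreal_mult) (auto simp: mult.assoc)
    also have "\<dots> \<le> ennreal (4 powr q) * (ennreal ?c * (\<integral>\<^sup>+x\<in>{x. ?m \<le> f x \<and> f x < 2 * ?m}. ?G x \<partial>lborel))"
      unfolding q_def N_def by (intro mult_left_mono superlevel_measure_le_localized[OF d cD _ A]) auto
    also have "\<dots> \<le> ennreal (4 powr q) * (ennreal ?c * (\<integral>\<^sup>+x\<in>S n. ?G x \<partial>lborel))"
    proof (rule mult_left_mono[OF mult_left_mono[OF nn_integral_mono]])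
      fix x
      have "x \<in> S n" if "?m \<le> f x" "f x < 2 * ?m"
      proof -
        have f: "0 < f x" using that(1) by (rule less_le_trans[rotated]) simp
        have "k n \<le> log 2 (f x)" "log 2 (f x) < k n + 1"
          using that f by (auto simp: le_log_iff log_less_iff powr_add)
        then have "\<lfloor>log 2 (f x)\<rfloor> = int_decode n" unfolding k_def by linarith
        then show ?thesis using f by (simp add: S_def)
      qed
      then show "?G x * indicator {x. ?m \<le> f x \<and> f x < 2 * ?m} x \<le> ?G x * indicator (S n) x"
        by (auto simp: indicator_def)
    qed auto
    also have "\<dots> = ennreal (4 powr q * ?c) * (\<integral>\<^sup>+x\<in>S n. ?G x \<partial>lborel)"
      by (subst ennreal_mult) (use N in \<open>auto simp: mult.assoc\<close>)
    finally show ?thesis .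
  qed
  have "(\<integral>\<^sup>+x. ennreal (max 0 (f x) powr q) \<partial>lborel) = (\<integral>\<^sup>+x\<in>(\<Union>n. B n). ennreal (max 0 (f x) powr q) \<partial>lborel)"
    unfolding UB by (intro nn_integral_cong) (auto simp: indicator_def)
  also have "\<dots> = (\<Sum>n. \<integral>\<^sup>+x\<in>B n. ennreal (max 0 (f x) powr q) \<partial>lborel)"
    by (rule nn_integral_disjoint_family) (use disj in auto)
  also have "\<dots> \<le> (\<Sum>n. ennreal (4 powr q * ?c) * (\<integral>\<^sup>+x\<in>S n. ?G x \<partial>lborel))"
    by (intro suminf_le piece summableI)
  also have "\<dots> = ennreal (4 powr q * ?c) * (\<Sum>n. \<integral>\<^sup>+x\<in>S n. ?G x \<partial>lborel)" by simp
  also have "(\<Sum>n. \<integral>\<^sup>+x\<in>S n. ?G x \<partial>lborel) = (\<integral>\<^sup>+x\<in>(\<Union>n. S n). ?G x \<partial>lborel)"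
    by (rule nn_integral_disjoint_family[symmetric]) (use disj in auto)
  also have "\<dots> \<le> (\<integral>\<^sup>+x. ?G x \<partial>lborel)" by (intro nn_integral_mono) (auto simp: indicator_def)
  finally have "(\<integral>\<^sup>+x. ennreal (max 0 (f x) powr q) \<partial>lborel) \<le> ennreal (4 powr q * ?c) * (\<integral>\<^sup>+x. ?G x \<partial>lborel)"
    by (simp add: mult_left_mono)
  also have "4 powr q * ?c = gn_const N * A powr (2 / N)"
    using A(2) by (simp add: gn_const_def q_def powr_mult)
  finally show ?thesis by (simp add: q_def)
qed

section \<open>From test functions to W_0^{1,p} and to positive parts\<close>

lemma powr_half_power2:
  assumes "0 \<le> (x::real)"
  shows "(x\<^sup>2) powr (p / 2) = x powr p"
proof (cases "x = 0")
  case False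
  then have "(x\<^sup>2) powr (p / 2) = (x powr 2) powr (p / 2)" using assms by simp
  also have "\<dots> = x powr (2 * (p / 2))" by (rule powr_powr)
  finally show ?thesis by simp
qed simp

lemma (in finite_measure) L2_of_Lp:
  fixes f :: "'a \<Rightarrow> 'b::euclidean_space"
  assumes [measurable]: "f \<in> borel_measurable M" and p: "2 \<le> p"
    and i: "integrable M (\<lambda>x. norm (f x) powr p)"
  shows "integrable M (\<lambda>x. (norm (f x))\<^sup>2)"
proof -
  have e: "norm ((norm (f x))\<^sup>2) powr (p / 2) = norm (f x) powr p" for x
    using powr_half_power2[of "norm (f x)" p] by simp
  show ?thesis
    by (rule integrable_norm_of_powr(1)[of _ "p / 2"]) (use p i in \<open>auto simp: e simp del: real_norm_def\<close>)
qed

lemma (in finite_measure) L2_tendsto_of_Lp: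
  fixes f :: "nat \<Rightarrow> 'a \<Rightarrow> 'b::euclidean_space"
  assumes m[measurable]: "\<And>n. f n \<in> borel_measurable M" and p: "2 \<le> p"
    and i: "\<And>n. integrable M (\<lambda>x. norm (f n x) powr p)"
    and lim: "(\<lambda>n. LINT x|M. norm (f n x) powr p) \<longlonglongrightarrow> 0"
  shows "(\<lambda>n. LINT x|M. (norm (f n x))\<^sup>2) \<longlonglongrightarrow> 0"
proof -
  have e: "norm ((norm (f n x))\<^sup>2) powr (p / 2) = norm (f n x) powr p" for n x
    using powr_half_power2[of "norm (f n x)" p] by simp
  have "(\<lambda>n. LINT x|M. norm ((norm (f n x))\<^sup>2)) \<longlonglongrightarrow> 0"
    by (rule L1_tendsto_of_Lp[where p = "p / 2"]) (use p i lim in \<open>auto simp: e simp del: real_norm_def\<close>)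
  then show ?thesis by simp
qed

lemma L2_le_of_approx:
  fixes f g :: "'a \<Rightarrow> 'b::euclidean_space"
  assumes [measurable]: "f \<in> borel_measurable M" "g \<in> borel_measurable M"
    and i: "integrable M (\<lambda>x. (norm (f x))\<^sup>2)" "integrable M (\<lambda>x. (norm (f x - g x))\<^sup>2)"
  shows "integrable M (\<lambda>x. (norm (g x))\<^sup>2)"
    "(LINT x|M. (norm (g x))\<^sup>2) \<le> 2 * (LINT x|M. (norm (f x))\<^sup>2) + 2 * (LINT x|M. (norm (f x - g x))\<^sup>2)"
proof -
  have b: "(norm (g x))\<^sup>2 \<le> 2 * (norm (f x))\<^sup>2 + 2 * (norm (f x - g x))\<^sup>2" for x
  proof -
    have "norm (g x) \<le> norm (f x) + norm (f x - g x)" using norm_triangle_ineq4[of "f x" "f x - g x"] by simp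
    then have "(norm (g x))\<^sup>2 \<le> (norm (f x) + norm (f x - g x))\<^sup>2" by (intro power_mono) auto
    also have "\<dots> \<le> 2 * (norm (f x))\<^sup>2 + 2 * (norm (f x - g x))\<^sup>2"
      using zero_le_power2[of "norm (f x) - norm (f x - g x)"] by (simp add: power2_eq_square algebra_simps)
    finally show ?thesis .
  qed
  show "integrable M (\<lambda>x. (norm (g x))\<^sup>2)"
    by (rule Bochner_Integration.integrable_bound[where f="\<lambda>x. 2 * (norm (f x))\<^sup>2 + 2 * (norm (f x - g x))\<^sup>2"])
      (use i b in auto)
  have "(LINT x|M. (norm (g x))\<^sup>2) \<le> (LINT x|M. 2 * (norm (f x))\<^sup>2 + 2 * (norm (f x - g x))\<^sup>2)"
    by (rule integral_mono') (use i b in auto)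
  then show "(LINT x|M. (norm (g x))\<^sup>2) \<le> 2 * (LINT x|M. (norm (f x))\<^sup>2) + 2 * (LINT x|M. (norm (f x - g x))\<^sup>2)"
    using i by simp
qed

lemma Gagliardo_Nirenberg_Cc_inf:
  fixes \<phi> :: "real^'n \<Rightarrow> real" and A :: real
  defines "N \<equiv> real CARD('n)"
  assumes S: "S \<in> sets borel" "S \<in> lmeasurable" and \<phi>: "\<phi> \<in> Cc_inf S"
    and A: "(LINT x|lebesgue_on S. (norm (\<phi> x))\<^sup>2) \<le> A" "A > 0"
  shows "(\<integral>\<^sup>+x. ennreal (max 0 (\<phi> x) powr (2 + 4 / N)) \<partial>lebesgue_on S)
    \<le> ennreal (gn_const N * A powr (2 / N) * (LINT x|lebesgue_on S. (norm (grad \<phi> x))\<^sup>2))"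
proof -
  note P = Cc_inf_grad[OF \<phi>]
  obtain R where R: "\<And>x. R < norm x \<Longrightarrow> \<phi> x = 0 \<and> grad \<phi> x = 0" using P(5) by blast
  have [measurable]: "\<phi> \<in> borel_measurable borel" "grad \<phi> \<in> borel_measurable borel"
    using P(2,6) by (auto intro: borel_measurable_continuous_onI)
  have e: "(LINT x|lebesgue_on S. f x) = (LINT x|lborel. f x)"
    if "f \<in> borel_measurable borel" "\<And>x. x \<notin> S \<Longrightarrow> f x = 0" for f :: "real^'n \<Rightarrow> real"
    by (rule integrable_lebesgue_on_iff(2)[OF S(1)]) (use that in \<open>auto intro!: measurable_restrict_space1 measurable_completion\<close>)
  have i: "integrable lborel (\<lambda>x. (norm (\<phi> x))\<^sup>2)" "integrable lborel (\<lambda>x. (norm (grad \<phi> x))\<^sup>2)"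
    by (rule integrable_Cc[where R=R]; use P R in \<open>auto intro!: continuous_intros\<close>)+
  have N: "N = real DIM(real^'n)" by (simp add: N_def)
  have "(\<integral>\<^sup>+x. ennreal (max 0 (\<phi> x) powr (2 + 4 / N)) \<partial>lebesgue_on S)
     \<le> (\<integral>\<^sup>+x. ennreal (max 0 (\<phi> x) powr (2 + 4 / N)) \<partial>lebesgue)"
    by (subst nn_integral_restrict_space) (use S in \<open>auto intro!: nn_integral_mono simp: indicator_def\<close>)
  also have "\<dots> = (\<integral>\<^sup>+x. ennreal (max 0 (\<phi> x) powr (2 + 4 / N)) \<partial>lborel)"
    by (rule nn_integral_completion)
  also have "\<dots> \<le> ennreal (gn_const N * A powr (2 / N)) * (\<integral>\<^sup>+x. ennreal ((norm (grad \<phi> x))\<^sup>2) \<partial>lborel)"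
    unfolding N
  proof (rule Gagliardo_Nirenberg_Cc[OF P(1,2)])
    have "(\<integral>\<^sup>+x. ennreal ((\<phi> x)\<^sup>2) \<partial>lborel) = ennreal (LINT x|lborel. (norm (\<phi> x))\<^sup>2)"
      using nn_integral_eq_integral[OF i(1)] by simp
    also have "\<dots> \<le> ennreal A" using A(1) e[of "\<lambda>x. (norm (\<phi> x))\<^sup>2"] P(3) by (auto intro!: ennreal_leI)
    finally show "(\<integral>\<^sup>+x. ennreal ((\<phi> x)\<^sup>2) \<partial>lborel) \<le> ennreal A" .
  qed (rule A)
  also have "(\<integral>\<^sup>+x. ennreal ((norm (grad \<phi> x))\<^sup>2) \<partial>lborel) = ennreal (LINT x|lebesgue_on S. (norm (grad \<phi> x))\<^sup>2)"
    using nn_integral_eq_integral[OF i(2)] e[of "\<lambda>x. (norm (grad \<phi> x))\<^sup>2"] P(4) by simp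
  also have "ennreal (gn_const N * A powr (2 / N)) * \<dots> = ennreal (gn_const N * A powr (2 / N) * (LINT x|lebesgue_on S. (norm (grad \<phi> x))\<^sup>2))"
    by (rule ennreal_mult[symmetric]) (auto simp: gn_const_def N_def intro!: integral_nonneg_AE)
  finally show ?thesis .
qed

text \<open>Fatou's lemma, in a form where the bounds on the approximants need hold only
  eventually.\<close>

lemma nn_integral_le_LIMSEQ:
  assumes [measurable]: "\<And>n. f n \<in> borel_measurable M"
    and lim: "AE x in M. (\<lambda>n. f n x) \<longlonglongrightarrow> g x"
    and b: "\<forall>\<^sub>F n in sequentially. (\<integral>\<^sup>+x. ennreal (f n x) \<partial>M) \<le> ennreal (B n)" and B: "B \<longlonglongrightarrow> B'"
  shows "(\<integral>\<^sup>+x. ennreal (g x) \<partial>M) \<le> ennreal B'"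
proof -
  have "(\<integral>\<^sup>+x. ennreal (g x) \<partial>M) = (\<integral>\<^sup>+x. liminf (\<lambda>n. ennreal (f n x)) \<partial>M)"
  proof (rule nn_integral_cong_AE)
    show "AE x in M. ennreal (g x) = liminf (\<lambda>n. ennreal (f n x))"
      using lim by eventually_elim (auto intro!: lim_imp_Liminf[symmetric] tendsto_ennrealI)
  qed
  also have "\<dots> \<le> liminf (\<lambda>n. \<integral>\<^sup>+x. ennreal (f n x) \<partial>M)" by (rule nn_integral_liminf) measurable
  also have "\<dots> \<le> liminf (\<lambda>n. ennreal (B n))" by (rule Liminf_mono[OF b])
  also have "\<dots> = ennreal B'" using B by (intro lim_imp_Liminf tendsto_ennrealI) auto
  finally show ?thesis .
qed

text \<open>The squared L^2 norm of the approximating test functions is at most twice that of w plus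
  a null sequence, so the strict inequality makes it eventually smaller than A. The same crude
  splitting gives the factor 2 in front of the gradient.\<close>

lemma Gagliardo_Nirenberg_W1p_0:
  fixes w :: "real^'n \<Rightarrow> real" and A :: real
  defines "N \<equiv> real CARD('n)"
  assumes \<Omega>: "open \<Omega>" "bounded \<Omega>" and p: "p \<ge> 2" and w: "W1p_0 \<Omega> p w Dw"
    and A: "2 * (LINT x|lebesgue_on \<Omega>. (norm (w x))\<^sup>2) < A"
  shows "(\<integral>\<^sup>+x. ennreal (max 0 (w x) powr (2 + 4 / N)) \<partial>lebesgue_on \<Omega>)
    \<le> ennreal (gn_const N * A powr (2 / N) * (2 * (LINT x|lebesgue_on \<Omega>. (norm (Dw x))\<^sup>2)))"
proof -
  let ?M = "lebesgue_on \<Omega>"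
  have \<Omega>l: "\<Omega> \<in> lmeasurable" using \<Omega> by (simp add: bounded_set_imp_lmeasurable)
  have \<Omega>b: "\<Omega> \<in> sets borel" using \<Omega> by simp
  interpret finite_measure ?M by (rule finite_measure_lebesgue_on[OF \<Omega>l])
  have p1: "p \<ge> 1" using p by simp
  obtain \<phi> where \<phi>: "\<And>k. \<phi> k \<in> Cc_inf \<Omega>" "AE x in ?M. (\<lambda>k. \<phi> k x) \<longlonglongrightarrow> w x"
    "(\<lambda>k. LINT x|?M. norm (w x - \<phi> k x) powr p) \<longlonglongrightarrow> 0"
    "(\<lambda>k. LINT x|?M. norm (Dw x - grad (\<phi> k) x) powr p) \<longlonglongrightarrow> 0"
    using W1p_0_approx_AE[OF \<Omega> p1 w] by blast
  have wL: "w \<in> Lp \<Omega> p" "Dw \<in> Lp \<Omega> p" using W1p_0_Lp[OF w] .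
  have L: "\<phi> k \<in> Lp \<Omega> p" "grad (\<phi> k) \<in> Lp \<Omega> p" for k using Cc_inf_Lp[OF \<Omega>l \<phi>(1)] p by auto
  note [measurable] = LpD(1)[OF wL(1)] LpD(1)[OF wL(2)] LpD(1)[OF L(1)] LpD(1)[OF L(2)]
  have d: "(\<lambda>x. w x - \<phi> k x) \<in> Lp \<Omega> p" "(\<lambda>x. Dw x - grad (\<phi> k) x) \<in> Lp \<Omega> p" for k
    using p wL L by (auto intro: Lp_diff)
  have l: "(\<lambda>k. LINT x|?M. (norm (w x - \<phi> k x))\<^sup>2) \<longlonglongrightarrow> 0"
    "(\<lambda>k. LINT x|?M. (norm (Dw x - grad (\<phi> k) x))\<^sup>2) \<longlonglongrightarrow> 0"
    by (rule L2_tendsto_of_Lp[OF LpD(1)[OF d(1)] p LpD(2)[OF d(1)] \<phi>(3)],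
        rule L2_tendsto_of_Lp[OF LpD(1)[OF d(2)] p LpD(2)[OF d(2)] \<phi>(4)])
  have i2: "integrable ?M (\<lambda>x. (norm (f x))\<^sup>2)" if "f \<in> Lp \<Omega> p" for f :: "real^'n \<Rightarrow> 'b::euclidean_space"
    by (rule L2_of_Lp[OF LpD(1)[OF that] p LpD(2)[OF that]])
  have bw: "(LINT x|?M. (norm (\<phi> k x))\<^sup>2) \<le> 2 * (LINT x|?M. (norm (w x))\<^sup>2) + 2 * (LINT x|?M. (norm (w x - \<phi> k x))\<^sup>2)" for k
    by (rule L2_le_of_approx(2)[OF _ _ i2[OF wL(1)] i2[OF d(1)]]) measurable
  have bD: "(LINT x|?M. (norm (grad (\<phi> k) x))\<^sup>2) \<le> 2 * (LINT x|?M. (norm (Dw x))\<^sup>2) + 2 * (LINT x|?M. (norm (Dw x - grad (\<phi> k) x))\<^sup>2)" for k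
    by (rule L2_le_of_approx(2)[OF _ _ i2[OF wL(2)] i2[OF d(2)]]) measurable
  have A0: "A > 0"
  proof -
    have "0 \<le> (LINT x|?M. (norm (w x))\<^sup>2)" by (rule integral_nonneg_AE) auto
    with A show ?thesis by linarith
  qed
  let ?c = "gn_const N * A powr (2 / N)"
  have c: "?c \<ge> 0" by (auto simp: gn_const_def N_def)
  show ?thesis
  proof (rule nn_integral_le_LIMSEQ)
    show "AE x in ?M. (\<lambda>k. max 0 (\<phi> k x) powr (2 + 4 / N)) \<longlonglongrightarrow> max 0 (w x) powr (2 + 4 / N)"
      using \<phi>(2)
    proof eventually_elim
      case (elim x)
      then have "(\<lambda>k. max 0 (\<phi> k x)) \<longlonglongrightarrow> max 0 (w x)" by (intro tendsto_intros)
      moreover have "2 + 4 / N > 0" by (simp add: N_def add_pos_pos)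
      ultimately show ?case by (intro tendsto_powr') auto
    qed
    have "(\<lambda>k. 2 * (LINT x|?M. (norm (w x))\<^sup>2) + 2 * (LINT x|?M. (norm (w x - \<phi> k x))\<^sup>2)) \<longlonglongrightarrow> 2 * (LINT x|?M. (norm (w x))\<^sup>2) + 2 * 0"
      by (intro tendsto_intros l)
    then have "\<forall>\<^sub>F k in sequentially. 2 * (LINT x|?M. (norm (w x))\<^sup>2) + 2 * (LINT x|?M. (norm (w x - \<phi> k x))\<^sup>2) < A"
      by (rule order_tendstoD(2)) (use A in simp)
    then show "\<forall>\<^sub>F k in sequentially. (\<integral>\<^sup>+x. ennreal (max 0 (\<phi> k x) powr (2 + 4 / N)) \<partial>?M)
      \<le> ennreal (?c * (2 * (LINT x|?M. (norm (Dw x))\<^sup>2) + 2 * (LINT x|?M. (norm (Dw x - grad (\<phi> k) x))\<^sup>2)))"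
    proof eventually_elim
      case (elim k)
      have "(LINT x|?M. (norm (\<phi> k x))\<^sup>2) \<le> A" using bw[of k] elim by linarith
      from Gagliardo_Nirenberg_Cc_inf[OF \<Omega>b \<Omega>l \<phi>(1) this A0]
      have "(\<integral>\<^sup>+x. ennreal (max 0 (\<phi> k x) powr (2 + 4 / N)) \<partial>?M) \<le> ennreal (?c * (LINT x|?M. (norm (grad (\<phi> k) x))\<^sup>2))"
        by (simp add: N_def)
      also have "\<dots> \<le> ennreal (?c * (2 * (LINT x|?M. (norm (Dw x))\<^sup>2) + 2 * (LINT x|?M. (norm (Dw x - grad (\<phi> k) x))\<^sup>2)))"
        by (intro ennreal_leI mult_left_mono bD c)
      finally show ?case .
    qed
    have "(\<lambda>k. ?c * (2 * (LINT x|?M. (norm (Dw x))\<^sup>2) + 2 * (LINT x|?M. (norm (Dw x - grad (\<phi> k) x))\<^sup>2)))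
      \<longlonglongrightarrow> ?c * (2 * (LINT x|?M. (norm (Dw x))\<^sup>2) + 2 * 0)" by (intro tendsto_intros l)
    then show "(\<lambda>k. ?c * (2 * (LINT x|?M. (norm (Dw x))\<^sup>2) + 2 * (LINT x|?M. (norm (Dw x - grad (\<phi> k) x))\<^sup>2)))
      \<longlonglongrightarrow> ?c * (2 * (LINT x|?M. (norm (Dw x))\<^sup>2))" by simp
  qed measurable
qed

lemma heaviside_bounds: "0 \<le> heaviside r" "heaviside r \<le> 1"
  by (auto simp: heaviside_def)

lemma measurable_heaviside [measurable]: "heaviside \<in> borel_measurable borel"
  unfolding heaviside_def by measurable

text \<open>The inequality is applied to the truncations of w. Their slope lies in [0, 1], so its
  square is at most the slope itself, which tends to \<open>heaviside\<close>. The constant 3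
  provides the strict inequality 2 Y < 3 Y that lets the truncated norms pass eventually.\<close>

theorem Gagliardo_Nirenberg_positive_part:
  fixes w :: "real^'n \<Rightarrow> real" and Y :: real
  defines "N \<equiv> real CARD('n)"
  assumes \<Omega>: "open \<Omega>" "bounded \<Omega>" and p: "p \<ge> 2" and w: "W1p_0 \<Omega> p w Dw"
    and Y: "(LINT x|lebesgue_on \<Omega>. (max 0 (w x))\<^sup>2) \<le> Y" "Y > 0"
  shows "(\<integral>\<^sup>+x. ennreal (max 0 (w x) powr (2 + 4 / N)) \<partial>lebesgue_on \<Omega>)
    \<le> ennreal (gn_const N * (3 * Y) powr (2 / N) * (2 * (LINT x|lebesgue_on \<Omega>. heaviside (w x) * (norm (Dw x))\<^sup>2)))"
proof -
  let ?M = "lebesgue_on \<Omega>"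
  have \<Omega>l: "\<Omega> \<in> lmeasurable" using \<Omega> by (simp add: bounded_set_imp_lmeasurable)
  interpret finite_measure ?M by (rule finite_measure_lebesgue_on[OF \<Omega>l])
  have p1: "p \<ge> 1" using p by simp
  have wL: "w \<in> Lp \<Omega> p" "Dw \<in> Lp \<Omega> p" using W1p_0_Lp[OF w] .
  note [measurable] = LpD(1)[OF wL(1)] LpD(1)[OF wL(2)]
  have i2: "integrable ?M (\<lambda>x. (norm (f x))\<^sup>2)" if "f \<in> Lp \<Omega> p" for f :: "real^'n \<Rightarrow> 'b::euclidean_space"
    by (rule L2_of_Lp[OF LpD(1)[OF that] p LpD(2)[OF that]])
  let ?n = Suc
  have W: "W1p_0 \<Omega> p (\<lambda>x. trunc (?n k) (w x)) (\<lambda>x. trunc' (?n k) (w x) *\<^sub>R Dw x)" for k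
    by (rule W1p_0_compose[OF \<Omega> p1 w C_k_trunc trunc_0 trunc_deriv])
      (use trunc'_bounds continuous_trunc' in auto)
  have ct: "trunc n \<in> borel_measurable borel" "trunc' n \<in> borel_measurable borel" for n
    using C_k_trunc[of 0 n] continuous_trunc' by (auto intro: borel_measurable_continuous_onI)
  note [measurable] = ct
  have l1: "(\<lambda>k. LINT x|?M. (norm (trunc (?n k) (w x)))\<^sup>2) \<longlonglongrightarrow> (LINT x|?M. (max 0 (w x))\<^sup>2)"
  proof (rule integral_dominated_convergence[where w="\<lambda>x. (norm (w x))\<^sup>2"])
    show "AE x in ?M. (\<lambda>k. (norm (trunc (?n k) (w x)))\<^sup>2) \<longlonglongrightarrow> (max 0 (w x))\<^sup>2"
    proof (rule AE_I2)
      fix x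
      have "(\<lambda>k. (norm (trunc (?n k) (w x)))\<^sup>2) \<longlonglongrightarrow> (norm (max 0 (w x)))\<^sup>2"
        by (intro tendsto_intros LIMSEQ_Suc trunc_tendsto)
      then show "(\<lambda>k. (norm (trunc (?n k) (w x)))\<^sup>2) \<longlonglongrightarrow> (max 0 (w x))\<^sup>2" by simp
    qed
    show "AE x in ?M. norm ((norm (trunc (?n k) (w x)))\<^sup>2) \<le> (norm (w x))\<^sup>2" for k
      using trunc_bounds(4)[of "?n k"] by (auto simp: abs_le_square_iff)
  qed (use i2[OF wL(1)] in auto)
  have l2: "(\<lambda>k. LINT x|?M. trunc' (?n k) (w x) * (norm (Dw x))\<^sup>2) \<longlonglongrightarrow> (LINT x|?M. heaviside (w x) * (norm (Dw x))\<^sup>2)"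
  proof (rule integral_dominated_convergence[where w="\<lambda>x. (norm (Dw x))\<^sup>2"])
    show "AE x in ?M. (\<lambda>k. trunc' (?n k) (w x) * (norm (Dw x))\<^sup>2) \<longlonglongrightarrow> heaviside (w x) * (norm (Dw x))\<^sup>2"
      by (intro AE_I2 tendsto_intros LIMSEQ_Suc trunc'_tendsto)
    show "AE x in ?M. norm (trunc' (?n k) (w x) * (norm (Dw x))\<^sup>2) \<le> (norm (Dw x))\<^sup>2" for k
      using trunc'_bounds[of "?n k"] by (auto simp: abs_mult mult_left_le_one_le)
  qed (use i2[OF wL(2)] in auto)
  let ?c = "gn_const N * (3 * Y) powr (2 / N)"
  have c: "?c \<ge> 0" by (auto simp: gn_const_def N_def)
  show ?thesis
  proof (rule nn_integral_le_LIMSEQ)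
    show "AE x in ?M. (\<lambda>k. max 0 (trunc (?n k) (w x)) powr (2 + 4 / N)) \<longlonglongrightarrow> max 0 (w x) powr (2 + 4 / N)"
    proof (rule AE_I2)
      fix x
      have "(\<lambda>k. max 0 (trunc (?n k) (w x))) \<longlonglongrightarrow> max 0 (max 0 (w x))"
        by (intro tendsto_intros LIMSEQ_Suc trunc_tendsto)
      moreover have "2 + 4 / N > 0" by (simp add: N_def add_pos_pos)
      ultimately show "(\<lambda>k. max 0 (trunc (?n k) (w x)) powr (2 + 4 / N)) \<longlonglongrightarrow> max 0 (w x) powr (2 + 4 / N)"
        by (intro tendsto_powr') auto
    qed
    have "(\<lambda>k. 2 * (LINT x|?M. (norm (trunc (?n k) (w x)))\<^sup>2)) \<longlonglongrightarrow> 2 * (LINT x|?M. (max 0 (w x))\<^sup>2)"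
      by (intro tendsto_intros l1)
    then have "\<forall>\<^sub>F k in sequentially. 2 * (LINT x|?M. (norm (trunc (?n k) (w x)))\<^sup>2) < 3 * Y"
      by (rule order_tendstoD(2)) (use Y in simp)
    then show "\<forall>\<^sub>F k in sequentially. (\<integral>\<^sup>+x. ennreal (max 0 (trunc (?n k) (w x)) powr (2 + 4 / N)) \<partial>?M)
      \<le> ennreal (?c * (2 * (LINT x|?M. trunc' (?n k) (w x) * (norm (Dw x))\<^sup>2)))"
    proof eventually_elim
      case (elim k)
      from Gagliardo_Nirenberg_W1p_0[OF \<Omega> p W elim]
      have "(\<integral>\<^sup>+x. ennreal (max 0 (trunc (?n k) (w x)) powr (2 + 4 / N)) \<partial>?M)
        \<le> ennreal (?c * (2 * (LINT x|?M. (norm (trunc' (?n k) (w x) *\<^sub>R Dw x))\<^sup>2)))" by (simp add: N_def)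
      also have "\<dots> \<le> ennreal (?c * (2 * (LINT x|?M. trunc' (?n k) (w x) * (norm (Dw x))\<^sup>2)))"
      proof (intro ennreal_leI mult_left_mono c)
        show "(LINT x|?M. (norm (trunc' (?n k) (w x) *\<^sub>R Dw x))\<^sup>2) \<le> (LINT x|?M. trunc' (?n k) (w x) * (norm (Dw x))\<^sup>2)"
        proof (rule integral_mono')
          show "integrable ?M (\<lambda>x. trunc' (?n k) (w x) * (norm (Dw x))\<^sup>2)"
            by (rule Bochner_Integration.integrable_bound[OF i2[OF wL(2)]])
              (use trunc'_bounds[of "?n k"] in \<open>auto simp: abs_mult mult_left_le_one_le\<close>)
          fix x
          show "0 \<le> trunc' (?n k) (w x) * (norm (Dw x))\<^sup>2" using trunc'_bounds[of "?n k"] by auto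
          have "(trunc' (?n k) (w x))\<^sup>2 \<le> trunc' (?n k) (w x)"
            using trunc'_bounds[of "?n k" "w x"] by (simp add: power2_eq_square mult_left_le)
          then show "(norm (trunc' (?n k) (w x) *\<^sub>R Dw x))\<^sup>2 \<le> trunc' (?n k) (w x) * (norm (Dw x))\<^sup>2"
            by (simp add: power_mult_distrib mult_right_mono)
        qed
      qed simp
      finally show ?case .
    qed
    show "(\<lambda>k. ?c * (2 * (LINT x|?M. trunc' (?n k) (w x) * (norm (Dw x))\<^sup>2)))
      \<longlonglongrightarrow> ?c * (2 * (LINT x|?M. heaviside (w x) * (norm (Dw x))\<^sup>2))" by (intro tendsto_intros l2)
  qed measurable
qed

section \<open>Caratheodory functions, time averages and small steps\<close>

lemma measurable_eq_AE_lebesgue_on: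
  fixes f g :: "'a::euclidean_space \<Rightarrow> 'b::euclidean_space"
  assumes S: "S \<in> sets borel" and f: "f \<in> borel_measurable (lebesgue_on S)" and ae: "AE x in lebesgue_on S. f x = g x"
  shows "g \<in> borel_measurable (lebesgue_on S)"
proof -
  have S': "S \<in> sets lebesgue" using S by simp
  have "(\<lambda>x. indicator S x *\<^sub>R f x) \<in> borel_measurable lebesgue"
    using borel_measurable_restrict_space_iff[of S lebesgue f] S' f by simp
  moreover have "AE x in lebesgue. indicator S x *\<^sub>R f x = indicator S x *\<^sub>R g x"
    using ae S' by (subst (asm) AE_restrict_space_iff) (auto elim!: eventually_mono simp: indicator_def)
  ultimately have "(\<lambda>x. indicator S x *\<^sub>R g x) \<in> borel_measurable lebesgue"
    by (rule borel_measurable_AE)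
  then show ?thesis using borel_measurable_restrict_space_iff[of S lebesgue g] S' by simp
qed

text \<open>For simple u the composite is a finite sum of measurable pieces; in general u is a
  pointwise limit of simple functions and continuity in \<xi> carries the limit. That continuity
  holds only for almost every z, so the completeness of Lebesgue measure enters.\<close>

theorem caratheodory_compose:
  fixes g :: "'a::euclidean_space \<Rightarrow> 'b::euclidean_space \<Rightarrow> 'c::euclidean_space"
  assumes S: "S \<in> sets borel" and g: "caratheodory S g" and u: "u \<in> borel_measurable (lebesgue_on S)"
  shows "(\<lambda>z. g z (u z)) \<in> borel_measurable (lebesgue_on S)"
proof -
  let ?M = "lebesgue_on S"
  obtain F where F: "\<And>i. simple_function ?M (F i)" "\<And>x. x \<in> S \<Longrightarrow> (\<lambda>i. F i x) \<longlonglongrightarrow> u x"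
    using borel_measurable_implies_sequence_metric[OF u, of 0] by auto
  have [measurable]: "(\<lambda>z. g z \<xi>) \<in> borel_measurable ?M" for \<xi> using g by (simp add: caratheodory_def)
  have c: "AE z in ?M. continuous_on UNIV (g z)" using g by (simp add: caratheodory_def)
  have m: "(\<lambda>z. g z (F i z)) \<in> borel_measurable ?M" for i
  proof -
    note sf = F(1)[of i]
    have "(\<lambda>z. \<Sum>y\<in>F i ` S. indicator (F i -` {y} \<inter> S) z *\<^sub>R g z y) \<in> borel_measurable ?M"
      using simple_functionD(2)[OF sf] by (intro borel_measurable_sum borel_measurable_scaleR borel_measurable_indicator) auto
    moreover have "(\<Sum>y\<in>F i ` S. indicator (F i -` {y} \<inter> S) z *\<^sub>R g z y) = g z (F i z)" if "z \<in> S" for z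
    proof -
      have "(\<Sum>y\<in>F i ` S. indicator (F i -` {y} \<inter> S) z *\<^sub>R g z y) = (\<Sum>y\<in>F i ` S. if y = F i z then g z y else 0)"
        using that by (intro sum.cong) (auto simp: indicator_def)
      also have "\<dots> = g z (F i z)" using that simple_functionD(1)[OF sf] by (subst sum.delta) auto
      finally show ?thesis .
    qed
    ultimately show ?thesis by (subst (asm) measurable_cong) auto
  qed
  define h where "h z = lim (\<lambda>i. g z (F i z))" for z
  have "h \<in> borel_measurable ?M" unfolding h_def using m by (rule borel_measurable_lim_metric)
  moreover have "AE z in ?M. h z = g z (u z)"
    using c AE_space
  proof eventually_elim
    case (elim z)
    then have "(\<lambda>i. g z (F i z)) \<longlonglongrightarrow> g z (u z)"
      using F(2)[of z] by (auto simp: continuous_on_eq_continuous_at intro: isCont_tendsto_compose)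
    then show ?case by (simp add: h_def limI)
  qed
  ultimately show ?thesis by (rule measurable_eq_AE_lebesgue_on[OF S])
qed

text \<open>Averaging the inequality with \<open>s' = s - h\<close> over \<open>s\<close> and letting \<open>h\<close> tend to \<open>0\<close> replaces the
  two-time kernel \<open>P r s\<close> by its values near the diagonal.\<close>

lemma time_averaging:
  fixes P :: "real \<Rightarrow> real \<Rightarrow> real" and a c :: "real \<Rightarrow> ennreal" and E :: "real \<Rightarrow> real"
  assumes P: "(\<lambda>(r, s). P r s) \<in> borel_measurable (borel \<Otimes>\<^sub>M borel)"
    and [measurable]: "a \<in> borel_measurable borel" "c \<in> borel_measurable borel"
    and ac: "(\<integral>\<^sup>+r. a r \<partial>lborel) < \<infinity>" "(\<integral>\<^sup>+s. c s \<partial>lborel) < \<infinity>"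
    and bound: "\<And>r s. ennreal \<bar>P r s\<bar> \<le> a r + c s"
    and E: "continuous_on {0..T} E" and s01: "0 < s0" "s0 < s1" "s1 \<le> T"
    and lim: "((\<lambda>\<rho>. LINT s|lborel. indicator {s0<..<s1} s * P (s - \<rho>) s) \<longlongrightarrow> B0) (at_right 0)"
    and ineq: "AE s in lborel. s \<in> {s0<..<s1} \<longrightarrow> (\<forall>s'. 0 < s' \<and> s' < s \<longrightarrow>
       E s - E s' + (LINT r|lborel. indicator {s'<..<s} r * P r s) \<le> 0)"
  shows "E s1 - E s0 + B0 \<le> 0"
proof -
  have Pm[measurable (raw)]: "(\<lambda>x. P (f x) (g x)) \<in> borel_measurable M"
    if "f \<in> borel_measurable M" "g \<in> borel_measurable M" for f g and M :: "'z measure"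
    using measurable_compose[OF measurable_Pair[OF that] P] by simp
  \<comment> \<open>E is frozen outside [0, T], so the shifted averages below are integrals of a
    function continuous on the whole line.\<close>
  define E' where "E' s = E (max 0 (min T s))" for s
  have E'c: "continuous_on UNIV E'"
    unfolding E'_def using s01 by (intro continuous_on_compose2[OF E]) (auto intro!: continuous_intros)
  have E'e: "E' s = E s" if "0 \<le> s" "s \<le> T" for s using that by (simp add: E'_def)
  have [measurable]: "E' \<in> borel_measurable borel" using E'c by (rule borel_measurable_continuous_onI)
  have iE': "integrable lborel (\<lambda>s. indicator {x<..<y} s * E' s)" for x y
  proof (rule Bochner_Integration.integrable_bound)
    show "integrable lborel (\<lambda>s. indicator {x..y} s *\<^sub>R E' s)"
      by (rule borel_integrable_compact) (use E'c in \<open>auto intro: continuous_on_subset\<close>)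
  qed (auto simp: indicator_def)
  have iI[simp]: "integrable lborel (indicator {x<..<y} :: real \<Rightarrow> real)" for x y :: real
    by (rule integrable_real_indicator) (cases "x \<le> y"; simp)+
  have main: "E s1 - E s0 + B0 \<le> 3 * e" if e: "e > 0" for e
  proof -
    define B where "B \<rho> = (LINT s|lborel. indicator {s0<..<s1} s * P (s - \<rho>) s)" for \<rho>
    have "\<forall>\<^sub>F \<rho> in at_right 0. B0 - e < B \<rho>"
      using order_tendstoD(1)[OF lim, of "B0 - e"] e by (simp add: B_def)
    then obtain h1 where h1: "h1 > 0" "\<And>\<rho>. 0 < \<rho> \<Longrightarrow> \<rho> < h1 \<Longrightarrow> B0 - e < B \<rho>"
      by (auto simp: eventually_at_right_field)
    have "\<exists>d>0. \<forall>x. \<bar>x - s\<bar> < d \<longrightarrow> \<bar>E' x - E' s\<bar> < e" for s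
    proof -
      have "isCont E' s" using E'c by (simp add: continuous_on_eq_continuous_at)
      then show ?thesis using e by (auto simp: continuous_at_eps_delta dist_real_def)
    qed
    then obtain d where d: "\<And>s. d s > 0" "\<And>s x. \<bar>x - s\<bar> < d s \<Longrightarrow> \<bar>E' x - E' s\<bar> < e" by metis
    \<comment> \<open>Small enough that B exceeds B0 - e on (0, h), that E varies by less than e
      within distance h of s0 and of s1, that s - h stays positive for s > s0, and that (s0 - h, s0)
      and (s1 - h, s1) do not overlap.\<close>
    define h where "h = Min {h1, s0/2, (s1 - s0)/2, d s0/2, d s1/2}"
    have h: "h > 0" "h \<le> h1" "h < s0" "h < s1 - s0" "h < d s0" "h < d s1"
      using h1 s01 d(1)[of s0] d(1)[of s1] unfolding h_def by (auto simp: min_less_iff_disj)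
    define \<Phi> where "\<Phi> s \<rho> = indicator {s0<..<s1} s * (indicator {0<..<h} \<rho> * P (s - \<rho>) s)" for s \<rho>
    have \<Phi>m[measurable]: "(\<lambda>(s, \<rho>). \<Phi> s \<rho>) \<in> borel_measurable (lborel \<Otimes>\<^sub>M lborel)"
      unfolding \<Phi>_def by measurable
    \<comment> \<open>Fubini's theorem needs joint integrability in s and \<rho>. The bound
      separates into a(s - \<rho>) and c(s), and the remaining variable runs over a bounded interval
      in each case.\<close>
    have int: "integrable (lborel \<Otimes>\<^sub>M lborel) (\<lambda>(s, \<rho>). \<Phi> s \<rho>)"
    proof (rule integrableI_bounded[OF \<Phi>m])
      have "(\<integral>\<^sup>+z. ennreal (norm (case z of (s, \<rho>) \<Rightarrow> \<Phi> s \<rho>)) \<partial>(lborel \<Otimes>\<^sub>M lborel))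
        = (\<integral>\<^sup>+s. \<integral>\<^sup>+\<rho>. ennreal \<bar>\<Phi> s \<rho>\<bar> \<partial>lborel \<partial>lborel)"
        by (subst lborel.nn_integral_fst[symmetric]) auto
      also have "\<dots> \<le> (\<integral>\<^sup>+s. ((\<integral>\<^sup>+r. a r \<partial>lborel) * indicator {s0<..<s1} s + ennreal h * c s) \<partial>lborel)"
      proof (intro nn_integral_mono)
        fix s :: real
        show "(\<integral>\<^sup>+\<rho>. ennreal \<bar>\<Phi> s \<rho>\<bar> \<partial>lborel) \<le> (\<integral>\<^sup>+r. a r \<partial>lborel) * indicator {s0<..<s1} s + ennreal h * c s"
        proof (cases "s \<in> {s0<..<s1}")
          case True
          have "(\<integral>\<^sup>+\<rho>. ennreal \<bar>\<Phi> s \<rho>\<bar> \<partial>lborel) \<le> (\<integral>\<^sup>+\<rho>. (a (s - \<rho>) + c s * indicator {0<..<h} \<rho>) \<partial>lborel)"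
            using bound by (intro nn_integral_mono) (auto simp: \<Phi>_def indicator_def)
          also have "\<dots> = (\<integral>\<^sup>+\<rho>. a (s - \<rho>) \<partial>lborel) + c s * ennreal h"
            using h by (simp add: nn_integral_add nn_integral_cmult_indicator)
          also have "(\<integral>\<^sup>+\<rho>. a (s - \<rho>) \<partial>lborel) = (\<integral>\<^sup>+r. a r \<partial>lborel)"
            using nn_integral_real_affine[of a "-1" s] by simp
          finally show ?thesis using True by (simp add: mult.commute)
        next
          case False
          then show ?thesis by (simp add: \<Phi>_def)
        qed
      qed
      also have "\<dots> = (\<integral>\<^sup>+r. a r \<partial>lborel) * ennreal (s1 - s0) + ennreal h * (\<integral>\<^sup>+s. c s \<partial>lborel)"
        using s01 by (simp add: nn_integral_add nn_integral_cmult nn_integral_cmult_indicator)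
      also have "\<dots> < \<infinity>" using ac by (simp add: ennreal_mult_less_top)
      finally show "(\<integral>\<^sup>+z. ennreal (norm (case z of (s, \<rho>) \<Rightarrow> \<Phi> s \<rho>)) \<partial>(lborel \<Otimes>\<^sub>M lborel)) < \<infinity>" .
    qed
    have Fub: "(LINT s|lborel. LINT \<rho>|lborel. \<Phi> s \<rho>) = (LINT \<rho>|lborel. LINT s|lborel. \<Phi> s \<rho>)"
      by (rule lborel_pair.Fubini_integral[OF int, symmetric])
    have i1: "integrable lborel (\<lambda>s. LINT \<rho>|lborel. \<Phi> s \<rho>)" using lborel_pair.integrable_fst[OF int] .
    have i2: "integrable lborel (\<lambda>\<rho>. LINT s|lborel. \<Phi> s \<rho>)" using lborel_pair.integrable_snd[OF int] .
    have B\<Phi>: "(LINT s|lborel. \<Phi> s \<rho>) = indicator {0<..<h} \<rho> * B \<rho>" for \<rho>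
    proof -
      have "(LINT s|lborel. \<Phi> s \<rho>) = (LINT s|lborel. indicator {0<..<h} \<rho> * (indicator {s0<..<s1} s * P (s - \<rho>) s))"
        by (simp add: \<Phi>_def mult.left_commute)
      then show ?thesis by (simp add: B_def)
    qed
    have low: "h * (B0 - e) \<le> (LINT \<rho>|lborel. LINT s|lborel. \<Phi> s \<rho>)"
    proof -
      have "h * (B0 - e) = (LINT \<rho>|lborel. indicator {0<..<h} \<rho> * (B0 - e))" using h by simp
      also have "\<dots> \<le> (LINT \<rho>|lborel. LINT s|lborel. \<Phi> s \<rho>)"
      proof (rule integral_mono)
        show "integrable lborel (\<lambda>\<rho>. indicator {0<..<h} \<rho> * (B0 - e))" by simp
        show "indicator {0<..<h} \<rho> * (B0 - e) \<le> (LINT s|lborel. \<Phi> s \<rho>)" for \<rho>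
          unfolding B\<Phi> using h1(2)[of \<rho>] h(2) by (auto simp: indicator_def less_imp_le)
      qed (rule i2)
      finally show ?thesis .
    qed
    \<comment> \<open>By translation, the integral of E(s) - E(s - h) over (s0, s1) collapses to the
      one over (s1 - h, s1) minus the one over (s0 - h, s0), hence to h (E s1 - E s0) up to 2 e
      h.\<close>
    let ?D = "\<lambda>s. indicator {s0<..<s1} s * (E' s - E' (s - h))"
    have iD: "integrable lborel ?D" "(LINT s|lborel. ?D s) = (LINT s|lborel. indicator {s0<..<s1} s * E' s) - (LINT s|lborel. indicator {s0-h<..<s1-h} s * E' s)"
    proof -
      have e: "indicator {s0<..<s1} s * E' (s - h) = indicator {s0-h<..<s1-h} (s - h) * E' (s - h)" for s
        by (simp add: indicator_def)
      have "integrable lborel (\<lambda>s. indicator {s0<..<s1} s * E' (s - h))"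
        "(LINT s|lborel. indicator {s0<..<s1} s * E' (s - h)) = (LINT s|lborel. indicator {s0-h<..<s1-h} s * E' s)"
        unfolding e using iE'[of "s0-h" "s1-h"]
          integrable_lborel_diff_right[of "\<lambda>s. indicator {s0-h<..<s1-h} s * E' s" h] by auto
      then show "integrable lborel ?D" "(LINT s|lborel. ?D s) = (LINT s|lborel. indicator {s0<..<s1} s * E' s) - (LINT s|lborel. indicator {s0-h<..<s1-h} s * E' s)"
        using iE'[of s0 s1] by (auto simp: right_diff_distrib)
    qed
    have up: "(LINT s|lborel. LINT \<rho>|lborel. \<Phi> s \<rho>) \<le> (LINT s|lborel. - ?D s)"
    proof (rule integral_mono_AE[OF i1])
      show "integrable lborel (\<lambda>s. - ?D s)" using iD by simp
      show "AE s in lborel. (LINT \<rho>|lborel. \<Phi> s \<rho>) \<le> - ?D s"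
        using ineq
      proof eventually_elim
        case (elim s)
        show ?case
        proof (cases "s \<in> {s0<..<s1}")
          case True
          have "(LINT \<rho>|lborel. \<Phi> s \<rho>) = (LINT \<rho>|lborel. indicator {s-h<..<s} (s - \<rho>) * P (s - \<rho>) s)"
            using True by (intro Bochner_Integration.integral_cong) (auto simp: \<Phi>_def indicator_def)
          also have "\<dots> = (LINT r|lborel. indicator {s-h<..<s} r * P r s)"
            using lborel_integral_real_affine[of "-1" "\<lambda>r. indicator {s-h<..<s} r * P r s" s] by simp
          also have "\<dots> \<le> - (E s - E (s - h))"
          proof -
            have "0 < s - h \<and> s - h < s" using True h s01 by auto
            with elim True show ?thesis by fastforce
          qed
          also have "E s - E (s - h) = E' s - E' (s - h)" using True h s01 by (simp add: E'e)
          finally show ?thesis using True by simp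
        next
          case False
          then show ?thesis by (simp add: \<Phi>_def)
        qed
      qed
    qed
    have "h * (E s1 - e) - h * (E s0 + e) \<le> (LINT s|lborel. ?D s)"
    proof -
      have "h * (E s1 - e) - h * (E s0 + e) = (LINT s|lborel. indicator {s1-h<..<s1} s * (E s1 - e) - indicator {s0-h<..<s0} s * (E s0 + e))"
        using h by simp
      also have "\<dots> \<le> (LINT s|lborel. indicator {s0<..<s1} s * E' s - indicator {s0-h<..<s1-h} s * E' s)"
      proof (rule integral_mono_AE)
        show "AE s in lborel. indicator {s1-h<..<s1} s * (E s1 - e) - indicator {s0-h<..<s0} s * (E s0 + e)
          \<le> indicator {s0<..<s1} s * E' s - indicator {s0-h<..<s1-h} s * E' s"
          using AE_lborel_singleton[of s0] AE_lborel_singleton[of "s1-h"]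
        proof eventually_elim
          case (elim s)
          have 1: "E s1 - e \<le> E' s" if "s1 - h < s" "s < s1"
            using d(2)[of s s1] that h s01 E'e[of s1] by (auto simp: abs_less_iff)
          have 2: "E' s \<le> E s0 + e" if "s0 - h < s" "s < s0"
            using d(2)[of s s0] that h s01 E'e[of s0] by (auto simp: abs_less_iff)
          show ?case using elim 1 2 h by (auto simp: indicator_def)
        qed
        show "integrable lborel (\<lambda>s. indicator {s1-h<..<s1} s * (E s1 - e) - indicator {s0-h<..<s0} s * (E s0 + e))" by simp
        show "integrable lborel (\<lambda>s. indicator {s0<..<s1} s * E' s - indicator {s0-h<..<s1-h} s * E' s)"
          using iE' by simp
      qed
      finally show ?thesis using iE' iD(2) by simp
    qed
    then have "h * (E s1 - e) - h * (E s0 + e) + h * (B0 - e) \<le> 0"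
      using low up iD Fub by simp
    then have "h * (E s1 - E s0 + B0 - 3 * e) \<le> 0" by (simp add: algebra_simps)
    then show ?thesis using h(1) by (simp add: mult_le_0_iff)
  qed
  show ?thesis
  proof (rule field_le_epsilon)
    fix e :: real assume "e > 0"
    then show "E s1 - E s0 + B0 \<le> 0 + e" using main[of "e/3"] by simp
  qed
qed

text \<open>On an interval where M varies by less than 1/2, let Y be the maximum of y, attained at
  x. The step from the left end, where y = 0, to x gives y x <= y x / 2. Uniform continuity of M
  provides one interval length that works throughout.\<close>

lemma gronwall_small_steps:
  fixes y M :: "real \<Rightarrow> real"
  assumes y: "continuous_on {0..T} y" "\<And>t. t \<in> {0..T} \<Longrightarrow> 0 \<le> y t" "y 0 = 0"
    and M: "continuous_on {0..T} M"
    and step: "\<And>s0 s1 Y. 0 < s0 \<Longrightarrow> s0 < s1 \<Longrightarrow> s1 \<le> T \<Longrightarrow> 0 < Y \<Longrightarrow> (\<And>s. s0 < s \<Longrightarrow> s < s1 \<Longrightarrow> y s \<le> Y)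
      \<Longrightarrow> y s1 \<le> y s0 + Y * (M s1 - M s0)"
    and t: "t \<in> {0..T}"
  shows "y t = 0"
proof -
  \<comment> \<open>The hypothesis concerns positive times; continuity extends it to s0 = 0, where
    the iteration starts.\<close>
  have step': "y s1 \<le> y s0 + Y * (M s1 - M s0)"
    if s: "0 \<le> s0" "s0 < s1" "s1 \<le> T" "0 < Y" and yY: "\<And>s. s0 < s \<Longrightarrow> s < s1 \<Longrightarrow> y s \<le> Y" for s0 s1 Y
  proof -
    have "(y \<longlongrightarrow> y s0) (at s0 within {s0<..<s1})" "(M \<longlongrightarrow> M s0) (at s0 within {s0<..<s1})"
      using y(1) M s by (auto simp: continuous_on_def intro!: tendsto_within_subset[where S = "{0..T}" and T = "{s0<..<s1}"])
    then have "((\<lambda>s. y s + Y * (M s1 - M s)) \<longlongrightarrow> y s0 + Y * (M s1 - M s0)) (at s0 within {s0<..<s1})"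
      by (intro tendsto_intros)
    moreover have "at s0 within {s0<..<s1} \<noteq> bot" using s by (simp add: at_within_eq_bot_iff)
    moreover have "\<forall>\<^sub>F s in at s0 within {s0<..<s1}. y s1 \<le> y s + Y * (M s1 - M s)"
      unfolding eventually_at_filter
      by (rule always_eventually) (use s yY in \<open>auto intro!: step\<close>)
    ultimately show ?thesis by (intro tendsto_lowerbound)
  qed
  have "uniformly_continuous_on {0..T} M" using M by (intro compact_uniformly_continuous) auto
  then obtain d where d: "d > 0" "\<And>x x'. x \<in> {0..T} \<Longrightarrow> x' \<in> {0..T} \<Longrightarrow> dist x' x < d \<Longrightarrow> dist (M x') (M x) < 1/2"
    unfolding uniformly_continuous_on_def by (metis half_gt_zero zero_less_one)
  \<comment> \<open>Steps of length d/2 keep any two points of a step at distance strictly below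
    d.\<close>
  have "\<forall>t\<in>{0..T}. t \<le> real k * (d/2) \<longrightarrow> y t = 0" for k
  proof (induction k)
    case 0
    then show ?case using y(3) by auto
  next
    case (Suc k)
    define s0 where "s0 = real k * (d/2)"
    have s0: "0 \<le> s0" using d by (simp add: s0_def)
    show ?case
    proof (intro ballI impI)
      fix t assume t: "t \<in> {0..T}" "t \<le> real (Suc k) * (d/2)"
      show "y t = 0"
      proof (cases "t \<le> s0")
        case True
        then show ?thesis using Suc t by (simp add: s0_def)
      next
        case False
        have t2: "t \<le> s0 + d/2" using t(2) by (simp add: s0_def algebra_simps)
        have "continuous_on {s0..t} y" using y(1) t s0 by (auto intro: continuous_on_subset)
        then obtain x where x: "x \<in> {s0..t}" "\<And>s. s \<in> {s0..t} \<Longrightarrow> y s \<le> y x"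
          using continuous_attains_sup[of "{s0..t}" y] False by auto
        have ys0: "y s0 = 0" using Suc s0 t False by (auto simp: s0_def)
        have "y x \<le> 0"
        proof (rule ccontr)
          assume pos: "\<not> y x \<le> 0"
          then have "s0 < x" using ys0 x(1) by (cases "x = s0") auto
          then have "y x \<le> y s0 + y x * (M x - M s0)"
            using pos x t s0 by (intro step') auto
          moreover have "dist (M x) (M s0) < 1/2"
            by (rule d(2)) (use x(1) t t2 s0 d(1) False in \<open>auto simp: dist_real_def\<close>)
          then have "M x - M s0 < 1/2" unfolding dist_real_def by linarith
          then have "y x * (M x - M s0) < y x * (1/2)" using pos by (intro mult_strict_left_mono) auto
          ultimately show False using ys0 pos by simp
        qed
        then show ?thesis using x(2)[of t] y(2)[OF t(1)] False by auto
      qed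
    qed
  qed
  moreover obtain k :: nat where "t / (d/2) \<le> real k" using real_arch_simple by blast
  then have "t \<le> real k * (d/2)" using d(1) by (simp add: field_simps)
  ultimately show ?thesis using t by blast
qed

section \<open>Test functions constant in time\<close>

lemma W1p_0_cong_AE:
  fixes w :: "real^'n \<Rightarrow> real"
  assumes \<Omega>: "open \<Omega>" "bounded \<Omega>" and p: "p \<ge> 0" and w: "W1p_0 \<Omega> p w Dw"
    and ae: "AE x in lebesgue_on \<Omega>. w x = w' x" "AE x in lebesgue_on \<Omega>. Dw x = Dw' x"
  shows "W1p_0 \<Omega> p w' Dw'"
proof -
  let ?M = "lebesgue_on \<Omega>"
  have \<Omega>b: "\<Omega> \<in> sets borel" using \<Omega> by simp
  have \<Omega>l: "\<Omega> \<in> lmeasurable" using \<Omega> by (simp add: bounded_set_imp_lmeasurable)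
  have m: "w \<in> borel_measurable ?M" "Dw \<in> borel_measurable ?M"
    using W1p_0_Lp[OF w] by (auto simp: Lp_def)
  have m': "w' \<in> borel_measurable ?M" "Dw' \<in> borel_measurable ?M"
    using measurable_eq_AE_lebesgue_on[OF \<Omega>b] m ae by auto
  note [measurable] = m m'
  have c: "(\<lambda>v::real^'n. v $ i) \<in> borel_measurable borel" for i
    by (intro borel_measurable_continuous_onI continuous_intros)
  have L: "w' \<in> Lp \<Omega> p" "Dw' \<in> Lp \<Omega> p"
  proof -
    have "AE x in ?M. norm (w' x) powr p = norm (w x) powr p" using ae(1) by eventually_elim simp
    then have "integrable ?M (\<lambda>x. norm (w' x) powr p) = integrable ?M (\<lambda>x. norm (w x) powr p)"
      by (intro integrable_cong_AE) auto
    then show "w' \<in> Lp \<Omega> p" using W1p_0_Lp[OF w] by (auto simp: Lp_def)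
    have "AE x in ?M. norm (Dw' x) powr p = norm (Dw x) powr p" using ae(2) by eventually_elim simp
    then have "integrable ?M (\<lambda>x. norm (Dw' x) powr p) = integrable ?M (\<lambda>x. norm (Dw x) powr p)"
      by (intro integrable_cong_AE) auto
    then show "Dw' \<in> Lp \<Omega> p" using W1p_0_Lp[OF w] by (auto simp: Lp_def)
  qed
  have e: "(LINT x|?M. w' x * grad \<phi> x $ i) = (LINT x|?M. w x * grad \<phi> x $ i)"
    "(LINT x|?M. Dw' x $ i * \<phi> x) = (LINT x|?M. Dw x $ i * \<phi> x)"
    "Lp_norm \<Omega> p (\<lambda>x. w' x - \<phi> x) = Lp_norm \<Omega> p (\<lambda>x. w x - \<phi> x)"
    "Lp_norm \<Omega> p (\<lambda>x. Dw' x - grad \<phi> x) = Lp_norm \<Omega> p (\<lambda>x. Dw x - grad \<phi> x)"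
    if "\<phi> \<in> Cc_inf \<Omega>" for \<phi> i
  proof -
    note [measurable] = LpD(1)[OF Cc_inf_Lp(1)[OF \<Omega>l that p]] LpD(1)[OF Cc_inf_Lp(2)[OF \<Omega>l that p]]
    have [measurable]: "(\<lambda>x. grad \<phi> x $ i) \<in> borel_measurable ?M" "(\<lambda>x. Dw x $ i) \<in> borel_measurable ?M"
      "(\<lambda>x. Dw' x $ i) \<in> borel_measurable ?M"
      by (rule measurable_compose[OF _ c], measurable)+
    have ae': "AE x in ?M. w' x * grad \<phi> x $ i = w x * grad \<phi> x $ i"
      "AE x in ?M. Dw' x $ i * \<phi> x = Dw x $ i * \<phi> x"
      "AE x in ?M. norm (w' x - \<phi> x) powr p = norm (w x - \<phi> x) powr p"
      "AE x in ?M. norm (Dw' x - grad \<phi> x) powr p = norm (Dw x - grad \<phi> x) powr p"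
      using ae(1) ae(2) ae(1) ae(2) by (eventually_elim, simp)+
    show "(LINT x|?M. w' x * grad \<phi> x $ i) = (LINT x|?M. w x * grad \<phi> x $ i)"
      "(LINT x|?M. Dw' x $ i * \<phi> x) = (LINT x|?M. Dw x $ i * \<phi> x)"
      by (rule integral_cong_AE[OF _ _ ae'(1)], measurable) (rule integral_cong_AE[OF _ _ ae'(2)], measurable)
    have "(LINT x|?M. norm (w' x - \<phi> x) powr p) = (LINT x|?M. norm (w x - \<phi> x) powr p)"
      "(LINT x|?M. norm (Dw' x - grad \<phi> x) powr p) = (LINT x|?M. norm (Dw x - grad \<phi> x) powr p)"
      by (rule integral_cong_AE[OF _ _ ae'(3)], measurable) (rule integral_cong_AE[OF _ _ ae'(4)], measurable)
    then show "Lp_norm \<Omega> p (\<lambda>x. w' x - \<phi> x) = Lp_norm \<Omega> p (\<lambda>x. w x - \<phi> x)"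
      "Lp_norm \<Omega> p (\<lambda>x. Dw' x - grad \<phi> x) = Lp_norm \<Omega> p (\<lambda>x. Dw x - grad \<phi> x)"
      by (simp_all add: Lp_norm_def)
  qed
  show ?thesis using w L e unfolding W1p_0_def W1p_def by simp
qed

lemma cylinder_borel: "open \<Omega> \<Longrightarrow> cylinder \<Omega> T \<in> sets borel"
  unfolding cylinder_def by (intro borel_open open_Times) auto

lemma mem_cylinder: "z \<in> cylinder \<Omega> T \<longleftrightarrow> fst z \<in> \<Omega> \<and> 0 < snd z \<and> snd z < T"
  by (cases z) (auto simp: cylinder_def)

lemma cylinder_lmeasurable:
  fixes \<Omega> :: "'a::euclidean_space set"
  assumes "open \<Omega>" "bounded \<Omega>" shows "cylinder \<Omega> T \<in> lmeasurable"
proof (rule bounded_set_imp_lmeasurable)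
  show "bounded (cylinder \<Omega> T)" unfolding cylinder_def using assms by (intro bounded_Times) auto
  show "cylinder \<Omega> T \<in> sets lebesgue" using cylinder_borel[OF assms(1)] by auto
qed

text \<open>By Tonelli, applied to a Borel representative, the integral over the cylinder is the
  integral over \<Omega> times the length of the time interval.\<close>

lemma Lp_fst:
  fixes f :: "'a::euclidean_space \<Rightarrow> 'b::euclidean_space"
  assumes \<Omega>: "open \<Omega>" and f: "f \<in> Lp \<Omega> p"
  shows "(\<lambda>z. f (fst z)) \<in> Lp (cylinder \<Omega> T) p"
proof -
  let ?Q = "cylinder \<Omega> T"
  have \<Omega>b: "\<Omega> \<in> sets borel" using \<Omega> by simp
  have Qb: "?Q \<in> sets borel" by (rule cylinder_borel[OF \<Omega>])
  obtain f' where f': "f' \<in> borel_measurable borel" "\<And>z. z \<notin> \<Omega> \<Longrightarrow> f' z = 0" "AE z in lborel. z \<in> \<Omega> \<longrightarrow> f' z = f z"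
    using lebesgue_on_borel_rep[OF \<Omega>b LpD(1)[OF f]] by blast
  note [measurable] = f'(1)
  have fst_m: "fst \<in> borel_measurable (borel :: ('a \<times> real) measure)"
    by (intro borel_measurable_continuous_onI continuous_intros)
  have snd_m: "snd \<in> borel_measurable (borel :: ('a \<times> real) measure)"
    by (intro borel_measurable_continuous_onI continuous_intros)
  note [measurable] = fst_m snd_m
  have ae: "AE z in lebesgue_on ?Q. f' (fst z) = f (fst z)"
    using AE_lborel_fst[OF f'(3), where 'b = real]
    by (subst AE_lebesgue_on_iff[OF Qb]) (auto simp: mem_cylinder elim!: eventually_mono)
  have m1: "(\<lambda>z. f' (fst z)) \<in> borel_measurable (lebesgue_on ?Q)"
    by (rule measurable_restrict_space1, rule measurable_completion) simp
  have m2: "(\<lambda>z. f (fst z)) \<in> borel_measurable (lebesgue_on ?Q)"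
    by (rule measurable_eq_AE_lebesgue_on[OF Qb m1 ae])
  have if': "integrable lborel (\<lambda>x. norm (f' x) powr p)"
  proof (subst integrable_lebesgue_on_iff(1)[OF \<Omega>b, symmetric])
    show "integrable (lebesgue_on \<Omega>) (\<lambda>x. norm (f x) powr p)" by (rule LpD[OF f])
    show "(\<lambda>x. norm (f x) powr p) \<in> borel_measurable (lebesgue_on \<Omega>)" using LpD(1)[OF f] by measurable
    show "AE z in lborel. z \<in> \<Omega> \<longrightarrow> norm (f' z) powr p = norm (f z) powr p"
      using f'(3) by eventually_elim auto
  qed (use f' in auto)
  have "integrable lborel (\<lambda>z. indicator {0<..<T} (snd z) * norm (f' (fst z)) powr p)"
  proof (rule integrableI_bounded)
    have "(\<integral>\<^sup>+z. ennreal (norm (indicator {0<..<T} (snd z) * norm (f' (fst z)) powr p)) \<partial>lborel)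
      = (\<integral>\<^sup>+x. \<integral>\<^sup>+t. ennreal (norm (f' x) powr p) * indicator {0<..<T} t \<partial>lborel \<partial>lborel)"
      by (subst lborel_prod[symmetric], subst lborel.nn_integral_fst[symmetric])
         (auto simp: indicator_def intro!: nn_integral_cong)
    also have "\<dots> = (\<integral>\<^sup>+x. ennreal (norm (f' x) powr p) * emeasure lborel {0<..<T} \<partial>lborel)"
      by (subst nn_integral_cmult_indicator) auto
    also have "\<dots> = (\<integral>\<^sup>+x. ennreal (norm (f' x) powr p) \<partial>lborel) * emeasure lborel {0<..<T}"
      by (rule nn_integral_multc) simp
    also have "\<dots> < \<infinity>"
    proof -
      have "emeasure lborel {0<..<T} < \<infinity>" by (cases "0 \<le> T") auto
      then show ?thesis using if' by (auto simp: integrable_iff_bounded ennreal_mult_less_top)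
    qed
    finally show "(\<integral>\<^sup>+z. ennreal (norm (indicator {0<..<T} (snd z) * norm (f' (fst z)) powr p)) \<partial>lborel) < \<infinity>" .
  qed measurable
  then have "integrable (lebesgue_on ?Q) (\<lambda>z. norm (f (fst z)) powr p)"
  proof (subst integrable_lebesgue_on_iff(1)[OF Qb])
    show "(\<lambda>z. indicator {0<..<T} (snd z) * norm (f' (fst z)) powr p) \<in> borel_measurable borel" by measurable
    show "indicator {0<..<T} (snd z) * norm (f' (fst z)) powr p = 0" if "z \<notin> ?Q" for z
      using that f'(2) by (auto simp: mem_cylinder indicator_def)
    show "AE z in lborel. z \<in> ?Q \<longrightarrow> indicator {0<..<T} (snd z) * norm (f' (fst z)) powr p = norm (f (fst z)) powr p"
      using AE_lborel_fst[OF f'(3), where 'b = real] by eventually_elim (auto simp: mem_cylinder)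
  qed (use m2 in measurable)
  then show ?thesis using m2 by (simp add: Lp_def)
qed

text \<open>The vanishing integral of a directional derivative, in dimension one. It is what makes 0
  the weak time derivative of a function constant in time.\<close>

lemma LINT_deriv_Cc_inf:
  assumes \<theta>: "\<theta> \<in> Cc_inf {0<..<T::real}"
  shows "(LINT t|lebesgue_on {0<..<T}. deriv \<theta> t) = 0"
proof -
  note d = Cc_inf_derivative[OF \<theta>]
  have fd: "frechet_derivative \<theta> (at x) = (\<lambda>h. deriv \<theta> x * h)" for x
  proof -
    have l: "linear (frechet_derivative \<theta> (at x))"
      using d(1)[of x] by (rule has_derivative_linear)
    have lin: "frechet_derivative \<theta> (at x) = (\<lambda>h. frechet_derivative \<theta> (at x) 1 * h)"
    proof
      show "frechet_derivative \<theta> (at x) h = frechet_derivative \<theta> (at x) 1 * h" for h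
        using linear_cmul[OF l, of h 1] by simp
    qed
    have "(\<theta> has_real_derivative frechet_derivative \<theta> (at x) 1) (at x)"
      using d(1)[of x] unfolding has_field_derivative_def by (subst (asm) lin)
    then have "deriv \<theta> x = frechet_derivative \<theta> (at x) 1" by (rule DERIV_imp_deriv)
    with lin show ?thesis by (simp only:)
  qed
  have c: "continuous_on UNIV (deriv \<theta>)" using d(2)[of 1] by (simp add: fd)
  obtain K where K: "compact K" "K \<subseteq> {0<..<T}" "\<And>x. \<theta> x \<noteq> 0 \<Longrightarrow> x \<in> K" using Cc_infE[OF \<theta>] by blast
  have z: "deriv \<theta> x = 0" if "x \<notin> K" for x
  proof -
    have "((\<lambda>_. 0) has_derivative (\<lambda>_. 0)) (at x)" by simp
    then have "(\<theta> has_derivative (\<lambda>_. 0)) (at x)"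
      by (rule has_derivative_transform_within_open[OF _ open_Compl[OF compact_imp_closed[OF K(1)]]]) (use that K(3) in auto)
    then have "frechet_derivative \<theta> (at x) = (\<lambda>_. 0)" by (rule frechet_derivative_at[symmetric])
    then show ?thesis using fd[of x] by (metis mult.right_neutral)
  qed
  have "(LINT x|lborel. deriv \<theta> x \<bullet> 1) = 0"
  proof (rule LINT_directional_derivative_0[OF _ c])
    show "(\<theta> has_derivative (\<lambda>h. deriv \<theta> x \<bullet> h)) (at x)" for x using d(1)[of x] by (simp add: fd)
    show "\<theta> x = 0 \<and> deriv \<theta> x = 0" if "\<bar>T\<bar> < norm x" for x
    proof -
      have "x \<notin> K" using that K(2) by force
      then show ?thesis using K(3) z by blast
    qed
  qed
  moreover have "(LINT t|lebesgue_on {0<..<T}. deriv \<theta> t) = (LINT t|lborel. deriv \<theta> t)"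
  proof (rule integrable_lebesgue_on_iff(2))
    show "deriv \<theta> \<in> borel_measurable borel" using c by (rule borel_measurable_continuous_onI)
    then show "deriv \<theta> \<in> borel_measurable (lebesgue_on {0<..<T})"
      by (intro measurable_restrict_space1 measurable_completion) simp
    show "deriv \<theta> z = 0" if "z \<notin> {0<..<T}" for z using z K(2) that by blast
  qed auto
  ultimately show ?thesis by simp
qed

lemma W12_L2_const:
  fixes \<phi> :: "real^'n \<Rightarrow> real"
  assumes \<Omega>: "open \<Omega>" and \<phi>: "\<phi> \<in> Lp \<Omega> 2"
  shows "W12_L2 \<Omega> T (\<lambda>z. \<phi> (fst z)) (\<lambda>_. 0)"
  using Lp_fst[OF \<Omega> \<phi>] \<phi> LINT_deriv_Cc_inf
  unfolding W12_L2_def C_L2_def by (auto simp: Lp_def Lp_norm_def)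

lemma Lp_W1p_0_const:
  fixes \<phi> :: "real^'n \<Rightarrow> real"
  assumes \<Omega>: "open \<Omega>" and \<phi>: "W1p_0 \<Omega> p \<phi> D\<phi>"
  shows "Lp_W1p_0 \<Omega> T p (\<lambda>z. \<phi> (fst z)) (\<lambda>z. D\<phi> (fst z))"
  using Lp_fst[OF \<Omega> W1p_0_Lp(1)[OF \<phi>]] Lp_fst[OF \<Omega> W1p_0_Lp(2)[OF \<phi>]] \<phi>
  unfolding Lp_W1p_0_def by simp

lemma integrable_lebesgue_on_mono:
  fixes f :: "'a::euclidean_space \<Rightarrow> 'b::euclidean_space"
  assumes "integrable (lebesgue_on S) f" "A \<in> sets borel" "S \<in> sets borel" "A \<subseteq> S"
  shows "integrable (lebesgue_on A) f"
proof -
  have "set_integrable lebesgue S f"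
    using assms integrable_restrict_space[of S lebesgue f] by (simp add: set_integrable_def)
  then have "set_integrable lebesgue A f" by (rule set_integrable_subset) (use assms in auto)
  then show ?thesis
    using assms integrable_restrict_space[of A lebesgue f] by (simp add: set_integrable_def)
qed

section \<open>Integrability of the flux and of the Hamiltonian\<close>

lemma powr_le_1_plus:
  fixes x q p :: real
  assumes "0 \<le> x" "0 \<le> q" "q \<le> p"
  shows "x powr q \<le> 1 + x powr p"
proof (cases "x \<le> 1")
  case True
  then have "x powr q \<le> 1" using assms powr_mono2[of q x 1] by simp
  then show ?thesis by (simp add: add_increasing2)
next
  case False
  then have "x powr q \<le> x powr p" using assms by (intro powr_mono) auto
  then show ?thesis by simp
qed

text \<open>Since (p - 1) \<open>conj_exp p\<close> = p, the conjugate power of the growth bound is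
  integrable. Absolute values are put on \<beta> and on the additive term so that their signs do not
  matter.\<close>

lemma flux_Lp:
  fixes a :: "'a::euclidean_space \<Rightarrow> 'b::euclidean_space \<Rightarrow> 'b"
  assumes Q: "Q \<in> sets borel" and p: "p > 1" and a: "caratheodory Q a"
    and a1: "a\<^sub>1 \<in> Lp Q (conj_exp p)"
    and gr: "AE z in lebesgue_on Q. \<forall>\<xi>. norm (a z \<xi>) \<le> \<beta> * (norm \<xi> powr (p - 1) + (a\<^sub>1 z::real))"
    and X: "X \<in> Lp Q p"
  shows "(\<lambda>z. a z (X z)) \<in> Lp Q (conj_exp p)"
proof -
  let ?q = "conj_exp p"
  have q: "?q > 0" "(p - 1) * ?q = p" using p by (auto simp: conj_exp_def)
  have m[measurable]: "(\<lambda>z. a z (X z)) \<in> borel_measurable (lebesgue_on Q)"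
    by (rule caratheodory_compose[OF Q a LpD(1)[OF X]])
  have "integrable (lebesgue_on Q) (\<lambda>z. norm (a z (X z)) powr ?q)"
  proof (rule Bochner_Integration.integrable_bound)
    show "integrable (lebesgue_on Q) (\<lambda>z. \<bar>\<beta>\<bar> powr ?q * (2 powr ?q * (norm (X z) powr p + norm (a\<^sub>1 z) powr ?q)))"
      using LpD(2)[OF X] LpD(2)[OF a1] by simp
    show "AE z in lebesgue_on Q. norm (norm (a z (X z)) powr ?q)
       \<le> norm (\<bar>\<beta>\<bar> powr ?q * (2 powr ?q * (norm (X z) powr p + norm (a\<^sub>1 z) powr ?q)))"
      using gr
    proof eventually_elim
      case (elim z)
      have "norm (a z (X z)) \<le> \<beta> * (norm (X z) powr (p - 1) + a\<^sub>1 z)" using elim by blast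
      also have "\<dots> \<le> \<bar>\<beta>\<bar> * (norm (X z) powr (p - 1) + \<bar>a\<^sub>1 z\<bar>)"
      proof -
        have "\<beta> * (norm (X z) powr (p - 1) + a\<^sub>1 z) \<le> \<bar>\<beta>\<bar> * \<bar>norm (X z) powr (p - 1) + a\<^sub>1 z\<bar>"
          using abs_ge_self[of "\<beta> * (norm (X z) powr (p - 1) + a\<^sub>1 z)"] by (simp add: abs_mult)
        also have "\<dots> \<le> \<bar>\<beta>\<bar> * (norm (X z) powr (p - 1) + \<bar>a\<^sub>1 z\<bar>)"
          using abs_triangle_ineq[of "norm (X z) powr (p - 1)" "a\<^sub>1 z"] by (intro mult_left_mono) auto
        finally show ?thesis .
      qed
      finally have "norm (a z (X z)) powr ?q \<le> (\<bar>\<beta>\<bar> * (norm (X z) powr (p - 1) + \<bar>a\<^sub>1 z\<bar>)) powr ?q"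
        using q by (intro powr_mono2) auto
      also have "\<dots> = \<bar>\<beta>\<bar> powr ?q * (norm (X z) powr (p - 1) + \<bar>a\<^sub>1 z\<bar>) powr ?q" by (rule powr_mult)
      also have "\<dots> \<le> \<bar>\<beta>\<bar> powr ?q * (2 powr ?q * ((norm (X z) powr (p - 1)) powr ?q + \<bar>a\<^sub>1 z\<bar> powr ?q))"
        using q by (intro mult_left_mono powr_add_le) auto
      also have "(norm (X z) powr (p - 1)) powr ?q = norm (X z) powr p" using q by (simp add: powr_powr)
      finally show ?case by (simp add: order_trans[OF _ abs_ge_self])
    qed
  qed measurable
  then show ?thesis using m by (simp add: Lp_def)
qed

text \<open>Young's inequality with exponent N + 2 on b and (N + 2)/(N + 1) on the power of the
  gradient. The latter becomes p - N/(N + 1), which lies below p, so it is integrable on a set of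
  finite measure.\<close>

lemma Hamiltonian_L1:
  fixes H :: "'a::euclidean_space \<Rightarrow> 'b::euclidean_space \<Rightarrow> real"
  assumes Q: "Q \<in> sets borel" "Q \<in> lmeasurable" and p: "p \<ge> 1" and N: "N > 0" and H: "caratheodory Q H"
    and b: "b \<in> Lp Q (N + 2)"
    and gr: "AE z in lebesgue_on Q. \<forall>\<xi>. \<bar>H z \<xi>\<bar> \<le> b z * norm \<xi> powr (p - (N + p) / (N + 2))"
    and X: "X \<in> Lp Q p"
  shows "integrable (lebesgue_on Q) (\<lambda>z. H z (X z))"
proof -
  interpret finite_measure "lebesgue_on Q" by (rule finite_measure_lebesgue_on[OF Q(2)])
  let ?g = "p - (N + p) / (N + 2)" and ?q = "(N + 2) / (N + 1)"
  have "?g = (p * (N + 1) - N) / (N + 2)" using N by (simp add: field_simps)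
  then have g: "?g * ?q = (p * (N + 1) - N) / (N + 1)" using N by simp
  have "p * (N + 1) \<ge> 1 * (N + 1)" using p N by (intro mult_right_mono) auto
  then have gb: "0 \<le> ?g * ?q" "?g * ?q \<le> p" unfolding g using N by (auto simp: field_simps)
  have pq: "N + 2 > 1" "?q > 1" "1 / (N + 2) + 1 / ?q = 1" using N by (auto simp: field_simps)
  have [measurable]: "(\<lambda>z. H z (X z)) \<in> borel_measurable (lebesgue_on Q)"
    by (rule caratheodory_compose[OF Q(1) H LpD(1)[OF X]])
  show ?thesis
  proof (rule Bochner_Integration.integrable_bound)
    show "integrable (lebesgue_on Q) (\<lambda>z. (1 + norm (X z) powr p) + norm (b z) powr (N + 2))"
      using LpD(2)[OF X] LpD(2)[OF b] by simp
    show "AE z in lebesgue_on Q. norm (H z (X z)) \<le> norm ((1 + norm (X z) powr p) + norm (b z) powr (N + 2))"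
      using gr
    proof eventually_elim
      case (elim z)
      have "norm (H z (X z)) \<le> b z * norm (X z) powr ?g" using elim by simp
      also have "\<dots> \<le> norm (X z) powr ?g * norm (b z)"
        by (subst mult.commute, intro mult_left_mono) auto
      also have "\<dots> \<le> (norm (X z) powr ?g) powr ?q + norm (b z) powr (N + 2)"
        using Young_scaled[OF pq, of "norm (X z) powr ?g" "norm (b z)" 1] by simp
      also have "(norm (X z) powr ?g) powr ?q = norm (X z) powr (?g * ?q)" by (rule powr_powr)
      also have "\<dots> \<le> 1 + norm (X z) powr p" by (rule powr_le_1_plus) (use gb in auto)
      finally show ?case by simp
    qed
  qed measurable
qed

section \<open>The energy inequality\<close>

lemma AE_lborel_snd_neq: "AE z in (lborel :: ('a::euclidean_space \<times> real) measure). snd z \<noteq> s"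
proof -
  have "emeasure (lborel \<Otimes>\<^sub>M lborel) ((UNIV :: 'a set) \<times> {s}) = 0"
    by (subst lborel.emeasure_pair_measure_Times) auto
  then have "(UNIV :: 'a set) \<times> {s} \<in> null_sets lborel"
    by (simp add: null_sets_def lborel_prod borel_Times)
  then have "AE z in lborel. z \<notin> (UNIV :: 'a set) \<times> {s}" by (rule AE_not_in)
  then show ?thesis by eventually_elim auto
qed

lemma LINT_iterated:
  fixes f :: "'a::euclidean_space \<times> real \<Rightarrow> real"
  assumes "integrable lborel f"
  shows "(LINT z|lborel. f z) = (LINT r|lborel. LINT x|lborel. f (x, r))"
proof -
  have "integrable (lborel \<Otimes>\<^sub>M lborel) (case_prod (\<lambda>x r. f (x, r)))" using assms by (simp add: lborel_prod)
  from lborel_pair.integral_snd[OF this] show ?thesis by (simp add: lborel_prod)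
qed

lemma nn_integral_iterated:
  fixes f :: "'a::euclidean_space \<times> real \<Rightarrow> ennreal"
  assumes "f \<in> borel_measurable borel"
  shows "(\<integral>\<^sup>+z. f z \<partial>lborel) = (\<integral>\<^sup>+r. \<integral>\<^sup>+x. f (x, r) \<partial>lborel \<partial>lborel)"
    "(\<lambda>r. \<integral>\<^sup>+x. f (x, r) \<partial>lborel) \<in> borel_measurable borel"
proof -
  have f: "f \<in> borel_measurable (lborel \<Otimes>\<^sub>M lborel)" using assms by (simp add: lborel_prod)
  then have f': "case_prod (\<lambda>x r. f (x, r)) \<in> borel_measurable (lborel \<Otimes>\<^sub>M lborel)" by simp
  show "(\<integral>\<^sup>+z. f z \<partial>lborel) = (\<integral>\<^sup>+r. \<integral>\<^sup>+x. f (x, r) \<partial>lborel \<partial>lborel)"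
    using lborel_pair.nn_integral_snd[OF f'] by (simp add: lborel_prod)
  have sw: "(\<lambda>p. (snd p, fst p)) \<in> (borel :: (real \<times> 'a) measure) \<rightarrow>\<^sub>M borel"
    by (intro borel_measurable_continuous_onI continuous_intros)
  have "(\<lambda>(r, x). f (x, r)) \<in> borel_measurable (borel \<Otimes>\<^sub>M borel)"
    unfolding borel_prod case_prod_beta using measurable_compose[OF sw assms] .
  then have "(\<lambda>(r, x). f (x, r)) \<in> borel_measurable (borel \<Otimes>\<^sub>M lborel)"
    by (subst measurable_cong_sets[OF sets_pair_measure_cong[OF refl sets_lborel] refl])
  from lborel.borel_measurable_nn_integral_fst[OF this]
  show "(\<lambda>r. \<integral>\<^sup>+x. f (x, r) \<partial>lborel) \<in> borel_measurable borel" by simp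
qed

lemma Lp_2:
  fixes f :: "'a::euclidean_space \<Rightarrow> real"
  shows "f \<in> Lp S 2 \<longleftrightarrow> f \<in> borel_measurable (lebesgue_on S) \<and> integrable (lebesgue_on S) (\<lambda>x. (f x)\<^sup>2)"
  by (simp add: Lp_def)

lemma Lp_norm_2_power2:
  fixes f :: "'a::euclidean_space \<Rightarrow> real"
  shows "(Lp_norm S 2 f)\<^sup>2 = (LINT x|lebesgue_on S. (f x)\<^sup>2)"
proof -
  have "0 \<le> (LINT x|lebesgue_on S. (f x)\<^sup>2)" by (rule integral_nonneg_AE) auto
  then show ?thesis by (simp add: Lp_norm_def powr_half_sqrt)
qed

text \<open>With A = |w(t) - w(s)| and B = |w(s)|, the difference is at most A (A + 2 B), and
  Young's inequality puts a small weight k on B^2. Both the truncated primitives and the squared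
  positive part are functions G of this kind.\<close>

lemma continuous_on_C_L2:
  fixes w :: "(real^'n) \<times> real \<Rightarrow> real" and G :: "real \<Rightarrow> real"
  assumes w: "C_L2 \<Omega> T w" and Gc: "continuous_on UNIV G" and G0: "G 0 = 0"
    and G: "\<And>r s. \<bar>G r - G s\<bar> \<le> \<bar>r - s\<bar> * (\<bar>r\<bar> + \<bar>s\<bar>)"
  shows "continuous_on {0..T} (\<lambda>t. LINT x|lebesgue_on \<Omega>. G (w (x, t)))"
    "t \<in> {0..T} \<Longrightarrow> integrable (lebesgue_on \<Omega>) (\<lambda>x. G (w (x, t)))"
proof -
  let ?M = "lebesgue_on \<Omega>"
  have Gm[measurable]: "G \<in> borel_measurable borel" using Gc by (rule borel_measurable_continuous_onI)
  have wL: "(\<lambda>x. w (x, t)) \<in> borel_measurable ?M" "integrable ?M (\<lambda>x. (w (x, t))\<^sup>2)" if "t \<in> {0..T}" for t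
    using w that by (auto simp: C_L2_def Lp_2)
  have iG: "integrable ?M (\<lambda>x. G (w (x, t)))" if t: "t \<in> {0..T}" for t
  proof (rule Bochner_Integration.integrable_bound[OF wL(2)[OF t]])
    show "(\<lambda>x. G (w (x, t))) \<in> borel_measurable ?M" using wL(1)[OF t] by measurable
    show "AE x in ?M. norm (G (w (x, t))) \<le> norm ((w (x, t))\<^sup>2)"
      using G[of _ 0] G0 by (auto simp: power2_eq_square)
  qed
  then show "t \<in> {0..T} \<Longrightarrow> integrable ?M (\<lambda>x. G (w (x, t)))" .
  show "continuous_on {0..T} (\<lambda>t. LINT x|?M. G (w (x, t)))"
    unfolding continuous_on_def
  proof (intro ballI tendstoI)
    fix s e :: real assume s: "s \<in> {0..T}" and e: "e > 0"
    define S where "S = (LINT x|?M. (w (x, s))\<^sup>2)"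
    have S: "S \<ge> 0" unfolding S_def by (rule integral_nonneg_AE) auto
    \<comment> \<open>Chosen so that k S is below e/2, where S is the squared L^2 norm of w at time
      s.\<close>
    define k where "k = e / (2 * (S + 1))"
    have k: "k > 0" using e S by (simp add: k_def)
    have aux: "A * (A + 2 * B) \<le> (1 + 1/k) * A\<^sup>2 + k * B\<^sup>2" for A B
    proof -
      have "0 \<le> (A - k * B)\<^sup>2 / k" using k by simp
      also have "\<dots> = A\<^sup>2 / k - 2 * A * B + k * B\<^sup>2" using k by (simp add: power2_eq_square field_simps)
      finally show ?thesis by (simp add: algebra_simps power2_eq_square)
    qed
    have "k * (S + 1) = e / 2" using S by (simp add: k_def field_simps)
    then have kS: "k * S < e / 2" using k by (simp add: algebra_simps)
    have "((\<lambda>t. (1 + 1/k) * (Lp_norm \<Omega> 2 (\<lambda>x. w (x, t) - w (x, s)))\<^sup>2) \<longlongrightarrow> (1 + 1/k) * 0\<^sup>2) (at s within {0..T})"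
      using w s by (intro tendsto_intros) (auto simp: C_L2_def)
    then have "\<forall>\<^sub>F t in at s within {0..T}. (1 + 1/k) * (Lp_norm \<Omega> 2 (\<lambda>x. w (x, t) - w (x, s)))\<^sup>2 < e / 2"
      by (rule order_tendstoD(2)) (use e in simp)
    moreover have "\<forall>\<^sub>F t in at s within {0..T}. t \<in> {0..T}" by (simp add: eventually_at_filter)
    ultimately show "\<forall>\<^sub>F t in at s within {0..T}. dist (LINT x|?M. G (w (x, t))) (LINT x|?M. G (w (x, s))) < e"
    proof eventually_elim
      case (elim t)
      note [measurable] = wL(1)[OF s] wL(1)[OF elim(2)]
      have id: "integrable ?M (\<lambda>x. (w (x, t) - w (x, s))\<^sup>2)"
      proof (rule Bochner_Integration.integrable_bound)
        show "integrable ?M (\<lambda>x. 2 * (w (x, t))\<^sup>2 + 2 * (w (x, s))\<^sup>2)" using wL(2)[OF s] wL(2)[OF elim(2)] by simp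
        have "(a - b)\<^sup>2 \<le> 2 * a\<^sup>2 + 2 * b\<^sup>2" for a b :: real
          using zero_le_power2[of "a + b"] by (simp add: power2_eq_square algebra_simps)
        then show "AE x in ?M. norm ((w (x, t) - w (x, s))\<^sup>2) \<le> norm (2 * (w (x, t))\<^sup>2 + 2 * (w (x, s))\<^sup>2)" by simp
      qed measurable
      have "\<bar>(LINT x|?M. G (w (x, t))) - (LINT x|?M. G (w (x, s)))\<bar> = \<bar>LINT x|?M. G (w (x, t)) - G (w (x, s))\<bar>"
        using iG[OF s] iG[OF elim(2)] by simp
      also have "\<dots> \<le> (LINT x|?M. \<bar>G (w (x, t)) - G (w (x, s))\<bar>)"
        using integral_norm_bound[of ?M "\<lambda>x. G (w (x, t)) - G (w (x, s))"] by simp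
      also have "\<dots> \<le> (LINT x|?M. (1 + 1/k) * (w (x, t) - w (x, s))\<^sup>2 + k * (w (x, s))\<^sup>2)"
      proof (rule integral_mono')
        show "integrable ?M (\<lambda>x. (1 + 1/k) * (w (x, t) - w (x, s))\<^sup>2 + k * (w (x, s))\<^sup>2)"
          using id wL(2)[OF s] by simp
        fix x
        show "0 \<le> (1 + 1/k) * (w (x, t) - w (x, s))\<^sup>2 + k * (w (x, s))\<^sup>2" using k by simp
        let ?a = "\<bar>w (x, t) - w (x, s)\<bar>" and ?b = "\<bar>w (x, s)\<bar>"
        have "\<bar>G (w (x, t)) - G (w (x, s))\<bar> \<le> ?a * (\<bar>w (x, t)\<bar> + ?b)" by (rule G)
        also have "\<dots> \<le> ?a * (?a + 2 * ?b)" by (intro mult_left_mono) auto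
        also have "\<dots> \<le> (1 + 1/k) * ?a\<^sup>2 + k * ?b\<^sup>2" by (rule aux)
        finally show "\<bar>G (w (x, t)) - G (w (x, s))\<bar> \<le> (1 + 1/k) * (w (x, t) - w (x, s))\<^sup>2 + k * (w (x, s))\<^sup>2" by simp
      qed
      also have "\<dots> = (1 + 1/k) * (Lp_norm \<Omega> 2 (\<lambda>x. w (x, t) - w (x, s)))\<^sup>2 + k * S"
        using id wL(2)[OF s] by (simp add: Lp_norm_2_power2 S_def)
      also have "\<dots> < e" using elim(1) kS by linarith
      finally show ?case by (simp add: dist_real_def)
    qed
  qed
qed

text \<open>If f is not integrable, its Bochner integral is 0 by convention and the bound is
  trivial. This covers the pairs of times at which the kernel below fails to be integrable.\<close>

lemma norm_LINT_le_nn_integral: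
  fixes f :: "'a \<Rightarrow> real"
  assumes "\<And>x. ennreal \<bar>f x\<bar> \<le> g x"
  shows "ennreal \<bar>LINT x|M. f x\<bar> \<le> (\<integral>\<^sup>+x. g x \<partial>M)"
proof (cases "integrable M f")
  case True
  have "ennreal \<bar>LINT x|M. f x\<bar> \<le> (\<integral>\<^sup>+x. ennreal \<bar>f x\<bar> \<partial>M)"
    using integral_norm_bound_ennreal[OF True] by simp
  also have "\<dots> \<le> (\<integral>\<^sup>+x. g x \<partial>M)" by (intro nn_integral_mono assms)
  finally show ?thesis .
qed (simp add: not_integrable_integral_eq)

text \<open>The difference \<open>w\<close> of two weak solutions: \<open>W\<close>, \<open>X\<close>, \<open>J\<close>, \<open>K\<close> are Borel representatives,
  extended by zero, of \<open>w\<close>, of its spatial gradient, and of the differences of the fluxes and of the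
  Hamiltonians. Only bounded time-independent test functions are needed.\<close>

locale parabolic_difference =
  fixes \<Omega> :: "(real^'n) set" and T p :: real and w W K :: "(real^'n) \<times> real \<Rightarrow> real"
    and X J :: "(real^'n) \<times> real \<Rightarrow> real^'n"
  assumes \<Omega>: "open \<Omega>" "bounded \<Omega>" and T: "T > 0" and p: "p > 1"
    and w: "C_L2 \<Omega> T w"
    and meas[measurable]: "W \<in> borel_measurable borel" "K \<in> borel_measurable borel"
      "X \<in> borel_measurable borel" "J \<in> borel_measurable borel"
    and off: "\<And>z. z \<notin> cylinder \<Omega> T \<Longrightarrow> W z = 0 \<and> K z = 0 \<and> X z = 0 \<and> J z = 0"
    and Xp: "integrable lborel (\<lambda>z. norm (X z) powr p)"
    and Jq: "integrable lborel (\<lambda>z. norm (J z) powr conj_exp p)"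
    and K1: "integrable lborel K"
    and slice: "AE t in lborel. 0 < t \<and> t < T \<longrightarrow>
      W1p_0 \<Omega> p (\<lambda>x. W (x, t)) (\<lambda>x. X (x, t)) \<and> (AE x in lebesgue_on \<Omega>. W (x, t) = w (x, t))"
    and weak: "\<And>\<phi> D\<phi> B t. \<lbrakk>\<phi> \<in> borel_measurable borel; D\<phi> \<in> borel_measurable borel; W1p_0 \<Omega> p \<phi> D\<phi>;
        \<And>x. \<bar>\<phi> x\<bar> \<le> B; 0 < t; t \<le> T\<rbrakk> \<Longrightarrow>
      (LINT x|lebesgue_on \<Omega>. w (x, t) * \<phi> x)
        + (LINT z|lborel. indicator {0<..<t} (snd z) * (J z \<bullet> D\<phi> (fst z) + K z * \<phi> (fst z)))
      = (LINT x|lebesgue_on \<Omega>. w (x, 0) * \<phi> x)"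
begin

definition trunc_energy :: "nat \<Rightarrow> real \<Rightarrow> real" where
  "trunc_energy n t = (LINT x|lebesgue_on \<Omega>. trunc_primitive n (w (x, t)))"

abbreviation (input) q where "q \<equiv> conj_exp p"

lemma pq: "p > 1" "q > 1" "1/p + 1/q = 1"
  using p by (auto simp: conj_exp_def field_simps)

lemma \<Omega>_meas: "\<Omega> \<in> sets borel" "\<Omega> \<in> lmeasurable"
  using \<Omega> by (auto simp: bounded_set_imp_lmeasurable)

lemma fst_snd_measurable [measurable]:
  "fst \<in> borel_measurable (borel :: ((real^'n) \<times> real) measure)"
  "snd \<in> borel_measurable (borel :: ((real^'n) \<times> real) measure)"
  by (intro borel_measurable_continuous_onI continuous_intros)+

lemma Pair_measurable [measurable]: "(\<lambda>x. (x, s)) \<in> borel \<rightarrow>\<^sub>M (borel :: ((real^'n) \<times> real) measure)"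
  by (intro borel_measurable_continuous_onI continuous_intros)

lemma cylinder_meas: "cylinder \<Omega> T \<in> sets borel" "emeasure lborel (cylinder \<Omega> T) < \<infinity>"
proof -
  show "cylinder \<Omega> T \<in> sets borel" by (rule cylinder_borel[OF \<Omega>(1)])
  have "bounded (cylinder \<Omega> T)" unfolding cylinder_def using \<Omega> by (intro bounded_Times) auto
  then show "emeasure lborel (cylinder \<Omega> T) < \<infinity>" by (rule emeasure_bounded_finite)
qed

lemma J1: "integrable lborel J"
proof (rule Bochner_Integration.integrable_bound)
  show "integrable lborel (\<lambda>z. indicator (cylinder \<Omega> T) z + norm (J z) powr q)"
    using Jq cylinder_meas by (auto simp: integrable_real_indicator)
  show "AE z in lborel. norm (J z) \<le> norm (indicator (cylinder \<Omega> T) z + norm (J z) powr q)"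
  proof (rule AE_I2)
    fix z
    show "norm (J z) \<le> norm (indicator (cylinder \<Omega> T) z + norm (J z) powr q)"
      using off[of z] powr_le_1_plus[of "norm (J z)" 1 q] pq by (cases "z \<in> cylinder \<Omega> T") auto
  qed
qed measurable

lemma L2_slice:
  assumes "t \<in> {0..T}"
  shows "(\<lambda>x. w (x, t)) \<in> borel_measurable (lebesgue_on \<Omega>)" "integrable (lebesgue_on \<Omega>) (\<lambda>x. (w (x, t))\<^sup>2)"
    "integrable (lebesgue_on \<Omega>) (\<lambda>x. w (x, t))"
proof -
  interpret finite_measure "lebesgue_on \<Omega>" by (rule finite_measure_lebesgue_on[OF \<Omega>_meas(2)])
  show 1: "(\<lambda>x. w (x, t)) \<in> borel_measurable (lebesgue_on \<Omega>)" "integrable (lebesgue_on \<Omega>) (\<lambda>x. (w (x, t))\<^sup>2)"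
    using w assms by (auto simp: C_L2_def Lp_2)
  show "integrable (lebesgue_on \<Omega>) (\<lambda>x. w (x, t))"
    by (rule integrable_norm_of_powr(1)[OF 1(1), of 2]) (use 1(2) in auto)
qed

lemma trunc_measurable [measurable]: "trunc n \<in> borel_measurable borel" "trunc' n \<in> borel_measurable borel"
  using C_k_trunc[of 0 n] continuous_trunc' by (auto intro: borel_measurable_continuous_onI)

context
  fixes n :: nat
  assumes n: "n > 0"
begin

definition \<Psi> where "\<Psi> z = trunc n (W z)"

definition D\<Psi> where "D\<Psi> z = trunc' n (W z) *\<^sub>R X z"

lemma \<Psi>_measurable [measurable]: "\<Psi> \<in> borel_measurable borel" "D\<Psi> \<in> borel_measurable borel"
  unfolding \<Psi>_def D\<Psi>_def by measurable

lemma \<Psi>_bound: "\<bar>\<Psi> z\<bar> \<le> real n + 2"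
  unfolding \<Psi>_def by (rule trunc_bounds[OF n])

lemma D\<Psi>_le: "norm (D\<Psi> z) \<le> norm (X z)"
  unfolding D\<Psi>_def using trunc'_bounds[of n "W z"] by (simp add: mult_left_le_one_le)

lemma D\<Psi>_Lp: "integrable lborel (\<lambda>z. norm (D\<Psi> z) powr p)"
proof (rule Bochner_Integration.integrable_bound[OF Xp])
  have "norm (D\<Psi> z) powr p \<le> norm (X z) powr p" for z
    using D\<Psi>_le[of z] p by (intro powr_mono2) auto
  then show "AE z in lborel. norm (norm (D\<Psi> z) powr p) \<le> norm (norm (X z) powr p)" by simp
qed measurable

lemma primitive_continuous: "continuous_on UNIV (trunc_primitive n)"
  by (rule DERIV_continuous_on[OF has_field_derivative_at_within[OF trunc_primitive(2)[OF n]]])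

lemmas trunc_primitive_C_L2 = continuous_on_C_L2[OF w primitive_continuous trunc_primitive(1)[OF n] trunc_primitive_Lipschitz[OF n]]

lemma trunc_energy_continuous: "continuous_on {0..T} (trunc_energy n)"
  unfolding trunc_energy_def by (rule trunc_primitive_C_L2)

lemma primitive_integrable: "t \<in> {0..T} \<Longrightarrow> integrable (lebesgue_on \<Omega>) (\<lambda>x. trunc_primitive n (w (x, t)))"
  by (rule trunc_primitive_C_L2)

text \<open>The weak form at time r against the test function frozen at time s. On the diagonal r =
  s it is the integrand of the energy inequality on one time slice.\<close>

definition kernel where
  "kernel r s = (LINT x|lborel. J (x, r) \<bullet> D\<Psi> (x, s) + K (x, r) * \<Psi> (x, s))"

text \<open>The weak forms at both times are tested with the same function, frozen at s, so their
  difference contains w(s) - w(s') multiplied by the truncation of w(s). The tangent inequality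
  bounds the change of energy by this product.\<close>

lemma two_time_inequality:
  assumes s: "0 < s" "s < T" and W1: "W1p_0 \<Omega> p (\<lambda>x. W (x, s)) (\<lambda>x. X (x, s))"
    and ae: "AE x in lebesgue_on \<Omega>. W (x, s) = w (x, s)" and s': "0 < s'" "s' < s"
  shows "trunc_energy n s - trunc_energy n s' + (LINT r|lborel. indicator {s'<..<s} r * kernel r s) \<le> 0"
proof -
  let ?M = "lebesgue_on \<Omega>"
  let ?\<phi> = "\<lambda>x. \<Psi> (x, s)" and ?D = "\<lambda>x. D\<Psi> (x, s)"
  have p1: "p \<ge> 1" using p by simp
  have W2: "W1p_0 \<Omega> p ?\<phi> ?D"
    unfolding \<Psi>_def D\<Psi>_def
    by (rule W1p_0_compose[OF \<Omega> p1 W1 C_k_trunc trunc_0 trunc_deriv[OF n] _ continuous_trunc'])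
      (use trunc'_bounds in auto)
  let ?F = "\<lambda>z. J z \<bullet> ?D (fst z) + K z * ?\<phi> (fst z)"
  have iF: "integrable lborel ?F"
  proof (rule Bochner_Integration.integrable_add)
    have "integrable lborel (\<lambda>z. norm (indicator (cylinder \<Omega> T) z *\<^sub>R ?D (fst z)) powr p)"
    proof (subst integrable_lebesgue_on_iff(1)[OF cylinder_meas(1), symmetric])
      show "integrable (lebesgue_on (cylinder \<Omega> T)) (\<lambda>z. norm (?D (fst z)) powr p)"
        by (rule LpD(2)[OF Lp_fst[OF \<Omega>(1) W1p_0_Lp(2)[OF W2]]])
      show "(\<lambda>z. norm (?D (fst z)) powr p) \<in> borel_measurable (lebesgue_on (cylinder \<Omega> T))"
        by (rule measurable_restrict_space1, rule measurable_completion) simp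
    qed (use cylinder_meas in auto)
    then have "integrable lborel (\<lambda>z. J z \<bullet> (indicator (cylinder \<Omega> T) z *\<^sub>R ?D (fst z)))"
      by (intro integrable_inner_powr(2)[OF pq _ _ Jq]) (use cylinder_meas in auto)
    moreover have "(\<lambda>z. J z \<bullet> (indicator (cylinder \<Omega> T) z *\<^sub>R ?D (fst z))) = (\<lambda>z. J z \<bullet> ?D (fst z))"
    proof
      show "J z \<bullet> (indicator (cylinder \<Omega> T) z *\<^sub>R ?D (fst z)) = J z \<bullet> ?D (fst z)" for z
        using off[of z] by (cases "z \<in> cylinder \<Omega> T") auto
    qed
    ultimately show "integrable lborel (\<lambda>z. J z \<bullet> ?D (fst z))" by (simp only:)
    show "integrable lborel (\<lambda>z. K z * ?\<phi> (fst z))"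
    proof (rule Bochner_Integration.integrable_bound)
      show "integrable lborel (\<lambda>z. (real n + 2) * \<bar>K z\<bar>)" using K1 by simp
      show "AE z in lborel. norm (K z * ?\<phi> (fst z)) \<le> norm ((real n + 2) * \<bar>K z\<bar>)"
        using \<Psi>_bound by (auto simp: abs_mult mult.commute[of "\<bar>K _\<bar>"] intro!: mult_right_mono)
    qed measurable
  qed
  have iI: "integrable lborel (\<lambda>z. indicator A (snd z) * ?F z)" if "A \<in> sets borel" for A :: "real set"
    by (rule Bochner_Integration.integrable_bound[OF iF]) (use that in \<open>auto simp: indicator_def\<close>)
  have Bd: "\<bar>?\<phi> x\<bar> \<le> real n + 2" for x by (rule \<Psi>_bound)
  have wk: "(LINT x|?M. w (x, t) * ?\<phi> x) + (LINT z|lborel. indicator {0<..<t} (snd z) * ?F z)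
      = (LINT x|?M. w (x, 0) * ?\<phi> x)" if "0 < t" "t \<le> T" for t
    by (rule weak[OF _ _ W2 Bd that]) measurable
  have "(LINT z|lborel. indicator {0<..<s} (snd z) * ?F z) - (LINT z|lborel. indicator {0<..<s'} (snd z) * ?F z)
     = (LINT z|lborel. indicator {0<..<s} (snd z) * ?F z - indicator {0<..<s'} (snd z) * ?F z)"
    by (rule Bochner_Integration.integral_diff[symmetric]; rule iI) auto
  also have "\<dots> = (LINT z|lborel. indicator {s'<..<s} (snd z) * ?F z)"
  proof (rule integral_cong_AE)
    show "AE z in lborel. indicator {0<..<s} (snd z) * ?F z - indicator {0<..<s'} (snd z) * ?F z = indicator {s'<..<s} (snd z) * ?F z"
      using AE_lborel_snd_neq[of s'] by eventually_elim (use s' in \<open>auto simp: indicator_def\<close>)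
  qed measurable
  also have "\<dots> = (LINT r|lborel. LINT x|lborel. indicator {s'<..<s} r * ?F (x, r))"
    using LINT_iterated[OF iI[of "{s'<..<s}"]] by simp
  also have "\<dots> = (LINT r|lborel. indicator {s'<..<s} r * kernel r s)" by (simp add: kernel_def)
  finally have diff: "(LINT x|?M. w (x, s) * ?\<phi> x) - (LINT x|?M. w (x, s') * ?\<phi> x)
     + (LINT r|lborel. indicator {s'<..<s} r * kernel r s) = 0"
    using wk[of s] wk[of s'] s s' by simp
  have st: "s \<in> {0..T}" "s' \<in> {0..T}" using s s' by auto
  have iw: "integrable ?M (\<lambda>x. w (x, t) * ?\<phi> x)" if "t \<in> {0..T}" for t
  proof (rule Bochner_Integration.integrable_bound)
    show "integrable ?M (\<lambda>x. (real n + 2) * \<bar>w (x, t)\<bar>)" using L2_slice(3)[OF that] by simp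
    have "?\<phi> \<in> borel_measurable ?M" using LpD(1)[OF W1p_0_Lp(1)[OF W2]] .
    then show "(\<lambda>x. w (x, t) * ?\<phi> x) \<in> borel_measurable ?M" using L2_slice(1)[OF that] by measurable
    show "AE x in ?M. norm (w (x, t) * ?\<phi> x) \<le> norm ((real n + 2) * \<bar>w (x, t)\<bar>)"
      using \<Psi>_bound by (auto simp: abs_mult mult.commute[of "\<bar>w _\<bar>"] intro!: mult_right_mono)
  qed
  have "trunc_energy n s - trunc_energy n s' = (LINT x|?M. trunc_primitive n (w (x, s)) - trunc_primitive n (w (x, s')))"
    unfolding trunc_energy_def using primitive_integrable st by simp
  also have "\<dots> \<le> (LINT x|?M. w (x, s) * ?\<phi> x - w (x, s') * ?\<phi> x)"
  proof (rule integral_mono_AE)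
    show "integrable ?M (\<lambda>x. trunc_primitive n (w (x, s)) - trunc_primitive n (w (x, s')))"
      using primitive_integrable st by simp
    show "integrable ?M (\<lambda>x. w (x, s) * ?\<phi> x - w (x, s') * ?\<phi> x)" using iw st by simp
    show "AE x in ?M. trunc_primitive n (w (x, s)) - trunc_primitive n (w (x, s')) \<le> w (x, s) * ?\<phi> x - w (x, s') * ?\<phi> x"
      using ae
    proof eventually_elim
      case (elim x)
      then have "?\<phi> x = trunc n (w (x, s))" by (simp add: \<Psi>_def)
      then show ?case using trunc_primitive_convex[OF n, of "w (x, s)" "w (x, s')"] by (simp add: left_diff_distrib)
    qed
  qed
  also have "\<dots> = (LINT x|?M. w (x, s) * ?\<phi> x) - (LINT x|?M. w (x, s') * ?\<phi> x)"
    by (rule Bochner_Integration.integral_diff[OF iw[OF st(1)] iw[OF st(2)]])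
  finally have "trunc_energy n s - trunc_energy n s' \<le> \<dots>" .
  from order_trans[OF add_right_mono[OF this] eq_refl[OF diff]] show ?thesis .
qed

text \<open>An instance of \<open>time_averaging\<close>. Young's inequality bounds the kernel by a
  function of r plus a function of s. The averages at lag \<rho> are pairings with J and K
  translated by (0, \<rho>), so they converge by the L^q continuity of translations for J and the
  L^1 continuity for K, where the test function is bounded.\<close>

theorem trunc_energy_inequality:
  assumes s: "0 < s0" "s0 < s1" "s1 \<le> T"
  shows "trunc_energy n s1 - trunc_energy n s0
    + (LINT z|lborel. indicator {s0<..<s1} (snd z) * (J z \<bullet> D\<Psi> z + K z * \<Psi> z)) \<le> 0"
proof -
  let ?I = "indicator {s0<..<s1} :: real \<Rightarrow> real"
  define a where "a = (\<lambda>r. \<integral>\<^sup>+x. ennreal (norm (J (x, r)) powr q + (real n + 2) * \<bar>K (x, r)\<bar>) \<partial>lborel)"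
  define c where "c = (\<lambda>s. \<integral>\<^sup>+x. ennreal (norm (D\<Psi> (x, s)) powr p) \<partial>lborel)"
  have fm: "(\<lambda>z. ennreal (norm (J z) powr q + (real n + 2) * \<bar>K z\<bar>)) \<in> borel_measurable borel"
    "(\<lambda>z. ennreal (norm (D\<Psi> z) powr p)) \<in> borel_measurable borel"
    using meas \<Psi>_measurable by (auto intro!: measurable_compose[OF _ measurable_ennreal])
  have am: "a \<in> borel_measurable borel" unfolding a_def by (rule nn_integral_iterated(2)[OF fm(1)])
  have cm: "c \<in> borel_measurable borel" unfolding c_def by (rule nn_integral_iterated(2)[OF fm(2)])
  have afin: "(\<integral>\<^sup>+r. a r \<partial>lborel) < \<infinity>"
  proof -
    have "(\<integral>\<^sup>+r. a r \<partial>lborel) = (\<integral>\<^sup>+z. ennreal (norm (J z) powr q + (real n + 2) * \<bar>K z\<bar>) \<partial>lborel)"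
      unfolding a_def by (rule nn_integral_iterated(1)[OF fm(1), symmetric])
    also have "\<dots> < \<infinity>"
    proof -
      have "integrable lborel (\<lambda>z. norm (J z) powr q + (real n + 2) * \<bar>K z\<bar>)" using Jq K1 by simp
      then show ?thesis by (simp add: integrable_iff_bounded)
    qed
    finally show ?thesis .
  qed
  have cfin: "(\<integral>\<^sup>+s. c s \<partial>lborel) < \<infinity>"
  proof -
    have "(\<integral>\<^sup>+s. c s \<partial>lborel) = (\<integral>\<^sup>+z. ennreal (norm (D\<Psi> z) powr p) \<partial>lborel)"
      unfolding c_def by (rule nn_integral_iterated(1)[OF fm(2), symmetric])
    also have "\<dots> < \<infinity>" using D\<Psi>_Lp by (simp add: integrable_iff_bounded)
    finally show ?thesis .
  qed
  have bound: "ennreal \<bar>kernel r s\<bar> \<le> a r + c s" for r s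
  proof -
    have "ennreal \<bar>kernel r s\<bar> \<le> (\<integral>\<^sup>+x. ennreal (norm (J (x, r)) powr q + (real n + 2) * \<bar>K (x, r)\<bar>) + ennreal (norm (D\<Psi> (x, s)) powr p) \<partial>lborel)"
      unfolding kernel_def
    proof (rule norm_LINT_le_nn_integral)
      fix x
      have "\<bar>J (x, r) \<bullet> D\<Psi> (x, s) + K (x, r) * \<Psi> (x, s)\<bar> \<le> norm (J (x, r)) * norm (D\<Psi> (x, s)) + \<bar>K (x, r)\<bar> * \<bar>\<Psi> (x, s)\<bar>"
        using Cauchy_Schwarz_ineq2[of "J (x, r)" "D\<Psi> (x, s)"] abs_triangle_ineq[of "J (x, r) \<bullet> D\<Psi> (x, s)" "K (x, r) * \<Psi> (x, s)"]
        by (simp add: abs_mult)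
      also have "\<dots> \<le> (norm (J (x, r)) powr q + norm (D\<Psi> (x, s)) powr p) + \<bar>K (x, r)\<bar> * (real n + 2)"
        using Young_scaled[OF pq, of "norm (J (x, r))" "norm (D\<Psi> (x, s))" 1] \<Psi>_bound
        by (intro add_mono mult_left_mono) auto
      also have "\<dots> = (norm (J (x, r)) powr q + (real n + 2) * \<bar>K (x, r)\<bar>) + norm (D\<Psi> (x, s)) powr p" by simp
      finally have le: "\<bar>J (x, r) \<bullet> D\<Psi> (x, s) + K (x, r) * \<Psi> (x, s)\<bar> \<le> \<dots>" .
      have "ennreal (A + B) = ennreal A + ennreal B" if "A \<ge> 0" "B \<ge> 0" for A B :: real
        using that by (rule ennreal_plus)
      from order_trans[OF ennreal_leI[OF le] eq_refl[OF this]]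
      show "ennreal \<bar>J (x, r) \<bullet> D\<Psi> (x, s) + K (x, r) * \<Psi> (x, s)\<bar>
        \<le> ennreal (norm (J (x, r)) powr q + (real n + 2) * \<bar>K (x, r)\<bar>) + ennreal (norm (D\<Psi> (x, s)) powr p)"
        by simp
    qed
    also have "\<dots> = a r + c s" unfolding a_def c_def by (rule nn_integral_add) measurable
    finally show ?thesis .
  qed
  have km: "(\<lambda>(r, s). kernel r s) \<in> borel_measurable (borel \<Otimes>\<^sub>M borel)"
  proof -
    have 1: "(\<lambda>y::(real \<times> real) \<times> (real^'n). (snd y, fst (fst y))) \<in> borel \<rightarrow>\<^sub>M borel"
      "(\<lambda>y::(real \<times> real) \<times> (real^'n). (snd y, snd (fst y))) \<in> borel \<rightarrow>\<^sub>M borel"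
      by (intro borel_measurable_continuous_onI continuous_intros)+
    have "(\<lambda>y. J (snd y, fst (fst y)) \<bullet> D\<Psi> (snd y, snd (fst y)) + K (snd y, fst (fst y)) * \<Psi> (snd y, snd (fst y)))
        \<in> borel_measurable (borel :: ((real \<times> real) \<times> (real^'n)) measure)"
      by (intro borel_measurable_add borel_measurable_inner borel_measurable_times;
          rule measurable_compose[OF 1(1)] measurable_compose[OF 1(2)]; measurable)
    then have "(\<lambda>(y, x). J (x, fst y) \<bullet> D\<Psi> (x, snd y) + K (x, fst y) * \<Psi> (x, snd y))
        \<in> borel_measurable ((borel \<Otimes>\<^sub>M borel) \<Otimes>\<^sub>M lborel)"
      by (simp add: borel_prod case_prod_beta cong: measurable_cong_sets)
    from lborel.borel_measurable_lebesgue_integral[OF this]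
    show ?thesis by (simp add: kernel_def case_prod_beta)
  qed
  have lim: "((\<lambda>\<rho>. LINT s|lborel. ?I s * kernel (s - \<rho>) s) \<longlongrightarrow>
      (LINT z|lborel. ?I (snd z) * (J z \<bullet> D\<Psi> z + K z * \<Psi> z))) (at_right 0)"
  proof -
    let ?D = "\<lambda>z. ?I (snd z) *\<^sub>R D\<Psi> z" and ?P = "\<lambda>z. ?I (snd z) * \<Psi> z"
    have iD: "integrable lborel (\<lambda>z. norm (?D z) powr p)"
      by (rule Bochner_Integration.integrable_bound[OF D\<Psi>_Lp]) (auto simp: indicator_def)
    have bP: "norm (?P z) \<le> real n + 2" for z using \<Psi>_bound[of z] by (auto simp: indicator_def)
    have t1: "((\<lambda>c. LINT z|lborel. J (z - c) \<bullet> ?D z) \<longlongrightarrow> (LINT z|lborel. J z \<bullet> ?D z)) (at 0)"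
      by (rule inner_translation_tendsto[OF pq J1 _ Jq iD]) measurable
    have t2: "((\<lambda>c. LINT z|lborel. K (z - c) \<bullet> ?P z) \<longlongrightarrow> (LINT z|lborel. K z \<bullet> ?P z)) (at 0)"
      by (rule inner_translation_tendsto_bounded[OF K1 _ bP]) measurable
    have fl: "filterlim (\<lambda>\<rho>::real. (0::real^'n, \<rho>)) (at 0) (at_right 0)"
      unfolding filterlim_at
    proof
      show "\<forall>\<^sub>F \<rho> in at_right (0::real). (0::real^'n, \<rho>) \<in> UNIV \<and> (0::real^'n, \<rho>) \<noteq> 0"
        by (auto simp: eventually_at_filter zero_prod_def)
      have "((\<lambda>\<rho>::real. (0::real^'n, \<rho>)) \<longlongrightarrow> (0, 0)) (at_right 0)" by (intro tendsto_intros)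
      then show "((\<lambda>\<rho>::real. (0::real^'n, \<rho>)) \<longlongrightarrow> 0) (at_right 0)" by (simp add: zero_prod_def)
    qed
    have iJ: "integrable lborel (\<lambda>z. J (z - c) \<bullet> ?D z)" for c
    proof (rule integrable_inner_powr(2)[OF pq _ _ _ iD])
      show "integrable lborel (\<lambda>z. norm (J (z - c)) powr q)"
        using Jq integrable_lborel_diff_right(1)[of "\<lambda>z. norm (J z) powr q" c] by simp
    qed measurable
    have iK: "integrable lborel (\<lambda>z. K (z - c) \<bullet> ?P z)" for c
    proof (rule Bochner_Integration.integrable_bound)
      show "integrable lborel (\<lambda>z. (real n + 2) * \<bar>K (z - c)\<bar>)"
        using K1 by (auto simp: integrable_lborel_diff_right)
      show "AE z in lborel. norm (K (z - c) \<bullet> ?P z) \<le> norm ((real n + 2) * \<bar>K (z - c)\<bar>)"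
      proof (rule AE_I2)
        fix z
        have "norm (K (z - c) \<bullet> ?P z) = \<bar>K (z - c)\<bar> * norm (?P z)" by (simp add: abs_mult)
        also have "\<dots> \<le> \<bar>K (z - c)\<bar> * (real n + 2)" by (intro mult_left_mono bP) simp
        finally show "norm (K (z - c) \<bullet> ?P z) \<le> norm ((real n + 2) * \<bar>K (z - c)\<bar>)" by (simp add: mult.commute)
      qed
    qed measurable
    have eq: "(LINT z|lborel. J (z - c) \<bullet> ?D z) + (LINT z|lborel. K (z - c) \<bullet> ?P z) = (LINT s|lborel. ?I s * kernel (s - \<rho>) s)"
      if c: "c = (0, \<rho>)" for c \<rho>
    proof -
      have "(LINT z|lborel. J (z - c) \<bullet> ?D z) + (LINT z|lborel. K (z - c) \<bullet> ?P z)
        = (LINT z|lborel. J (z - c) \<bullet> ?D z + K (z - c) \<bullet> ?P z)" using iJ iK by simp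
      also have "\<dots> = (LINT s|lborel. LINT x|lborel. J ((x, s) - c) \<bullet> ?D (x, s) + K ((x, s) - c) \<bullet> ?P (x, s))"
        by (rule LINT_iterated[OF Bochner_Integration.integrable_add[OF iJ iK]])
      also have "\<dots> = (LINT s|lborel. LINT x|lborel. ?I s * (J (x, s - \<rho>) \<bullet> D\<Psi> (x, s) + K (x, s - \<rho>) * \<Psi> (x, s)))"
        by (simp add: c algebra_simps)
      finally show ?thesis by (simp add: kernel_def)
    qed
    have "((\<lambda>\<rho>. (LINT z|lborel. J (z - (0, \<rho>)) \<bullet> ?D z) + (LINT z|lborel. K (z - (0, \<rho>)) \<bullet> ?P z)) \<longlongrightarrow>
        (LINT z|lborel. J z \<bullet> ?D z) + (LINT z|lborel. K z \<bullet> ?P z)) (at_right 0)"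
      by (intro tendsto_add filterlim_compose[OF t1 fl] filterlim_compose[OF t2 fl])
    moreover have "(LINT z|lborel. J z \<bullet> ?D z) + (LINT z|lborel. K z \<bullet> ?P z)
      = (LINT z|lborel. ?I (snd z) * (J z \<bullet> D\<Psi> z + K z * \<Psi> z))"
      using iJ[of 0] iK[of 0] by (simp add: algebra_simps flip: Bochner_Integration.integral_add)
    ultimately show ?thesis using eq by simp
  qed
  show ?thesis
  proof (rule time_averaging[OF km am cm afin cfin bound trunc_energy_continuous s lim])
    show "AE r in lborel. r \<in> {s0<..<s1} \<longrightarrow> (\<forall>s'. 0 < s' \<and> s' < r \<longrightarrow>
        trunc_energy n r - trunc_energy n s' + (LINT t|lborel. indicator {s'<..<r} t * kernel t r) \<le> 0)"
      using slice
    proof (eventually_elim, intro impI allI)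
      fix r s' assume *: "0 < r \<and> r < T \<longrightarrow> W1p_0 \<Omega> p (\<lambda>x. W (x, r)) (\<lambda>x. X (x, r)) \<and> (AE x in lebesgue_on \<Omega>. W (x, r) = w (x, r))"
        "r \<in> {s0<..<s1}" "0 < s' \<and> s' < r"
      then show "trunc_energy n r - trunc_energy n s' + (LINT t|lborel. indicator {s'<..<r} t * kernel t r) \<le> 0"
        using s by (intro two_time_inequality) auto
    qed
  qed
qed

end

end

section \<open>From truncations to the positive part\<close>

context parabolic_difference
begin

definition pos_energy :: "real \<Rightarrow> real" where
  "pos_energy t = (LINT x|lebesgue_on \<Omega>. (max 0 (w (x, t)))\<^sup>2)"

lemma max_0_power2_Lipschitz: "\<bar>(max 0 r)\<^sup>2 - (max 0 s)\<^sup>2\<bar> \<le> \<bar>r - s\<bar> * (\<bar>r\<bar> + \<bar>s\<bar>)" for r s :: real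
proof -
  have "(max 0 r)\<^sup>2 - (max 0 s)\<^sup>2 = (max 0 r - max 0 s) * (max 0 r + max 0 s)"
    by (simp add: power2_eq_square algebra_simps)
  moreover have "\<bar>max 0 r - max 0 s\<bar> \<le> \<bar>r - s\<bar>" "\<bar>max 0 r + max 0 s\<bar> \<le> \<bar>r\<bar> + \<bar>s\<bar>" by (auto simp: max_def)
  ultimately show ?thesis by (simp add: abs_mult mult_mono)
qed

lemma pos_energy_continuous: "continuous_on {0..T} pos_energy"
  and pos_part_integrable: "t \<in> {0..T} \<Longrightarrow> integrable (lebesgue_on \<Omega>) (\<lambda>x. (max 0 (w (x, t)))\<^sup>2)"
proof -
  have c: "continuous_on UNIV (\<lambda>r::real. (max 0 r)\<^sup>2)" by (intro continuous_intros)
  show "continuous_on {0..T} pos_energy"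
    unfolding pos_energy_def
    by (rule continuous_on_C_L2(1)[OF w c _ max_0_power2_Lipschitz]) simp
  show "t \<in> {0..T} \<Longrightarrow> integrable (lebesgue_on \<Omega>) (\<lambda>x. (max 0 (w (x, t)))\<^sup>2)"
    by (rule continuous_on_C_L2(2)[OF w c _ max_0_power2_Lipschitz]) simp_all
qed

lemma pos_energy_nonneg: "0 \<le> pos_energy t"
  unfolding pos_energy_def by (rule integral_nonneg_AE) auto

lemma trunc_energy_tendsto:
  assumes t: "t \<in> {0..T}"
  shows "(\<lambda>k. trunc_energy (Suc k) t) \<longlonglongrightarrow> pos_energy t / 2"
proof -
  have "(\<lambda>k. LINT x|lebesgue_on \<Omega>. trunc_primitive (Suc k) (w (x, t))) \<longlonglongrightarrow> (LINT x|lebesgue_on \<Omega>. (max 0 (w (x, t)))\<^sup>2 / 2)"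
  proof (rule integral_dominated_convergence[where w = "\<lambda>x. (w (x, t))\<^sup>2"])
    show "integrable (lebesgue_on \<Omega>) (\<lambda>x. (w (x, t))\<^sup>2)" by (rule L2_slice[OF t])
    show "(\<lambda>x. (max 0 (w (x, t)))\<^sup>2 / 2) \<in> borel_measurable (lebesgue_on \<Omega>)"
      using pos_part_integrable[OF t] by simp
    show "(\<lambda>x. trunc_primitive (Suc k) (w (x, t))) \<in> borel_measurable (lebesgue_on \<Omega>)" for k
      using primitive_integrable[of "Suc k" t] t by auto
    show "AE x in lebesgue_on \<Omega>. (\<lambda>k. trunc_primitive (Suc k) (w (x, t))) \<longlonglongrightarrow> (max 0 (w (x, t)))\<^sup>2 / 2"
      by (intro AE_I2 LIMSEQ_Suc trunc_primitive_tendsto)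
    have "\<bar>trunc_primitive (Suc k) r\<bar> \<le> r\<^sup>2" for k r
      using trunc_primitive_Lipschitz[of "Suc k" r 0] trunc_primitive(1)[of "Suc k"] by (simp add: power2_eq_square)
    then show "AE x in lebesgue_on \<Omega>. norm (trunc_primitive (Suc k) (w (x, t))) \<le> (w (x, t))\<^sup>2" for k by simp
  qed
  then show ?thesis by (simp add: trunc_energy_def pos_energy_def)
qed

text \<open>Dominated convergence in the truncation level. Since \<open>trunc n r\<close> is at most
  max 0 r + 1, integrability of K and of K w^+ gives the dominating function; the second is a
  hypothesis here, to be supplied by the structure conditions.\<close>

theorem energy_inequality:
  assumes KW: "integrable lborel (\<lambda>z. K z * max 0 (W z))" and s: "0 < s0" "s0 < s1" "s1 \<le> T"
  shows "pos_energy s1 / 2 - pos_energy s0 / 2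
    + (LINT z|lborel. indicator {s0<..<s1} (snd z) * (heaviside (W z) * (J z \<bullet> X z) + K z * max 0 (W z))) \<le> 0"
proof -
  let ?I = "indicator {s0<..<s1} :: real \<Rightarrow> real"
  have iJX: "integrable lborel (\<lambda>z. J z \<bullet> X z)" by (rule integrable_inner_powr(2)[OF pq _ _ Jq Xp]) measurable
  have l: "(\<lambda>k. LINT z|lborel. ?I (snd z) * (J z \<bullet> D\<Psi> (Suc k) z + K z * \<Psi> (Suc k) z)) \<longlonglongrightarrow>
      (LINT z|lborel. ?I (snd z) * (heaviside (W z) * (J z \<bullet> X z) + K z * max 0 (W z)))"
  proof (rule integral_dominated_convergence[where w = "\<lambda>z. \<bar>J z \<bullet> X z\<bar> + (\<bar>K z * max 0 (W z)\<bar> + \<bar>K z\<bar>)"])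
    show "integrable lborel (\<lambda>z. \<bar>J z \<bullet> X z\<bar> + (\<bar>K z * max 0 (W z)\<bar> + \<bar>K z\<bar>))"
      using iJX KW K1 by simp
    show "(\<lambda>z. ?I (snd z) * (heaviside (W z) * (J z \<bullet> X z) + K z * max 0 (W z))) \<in> borel_measurable lborel"
      by measurable
    show "(\<lambda>z. ?I (snd z) * (J z \<bullet> D\<Psi> (Suc k) z + K z * \<Psi> (Suc k) z)) \<in> borel_measurable lborel" for k
      unfolding D\<Psi>_def \<Psi>_def by measurable
    show "AE z in lborel. (\<lambda>k. ?I (snd z) * (J z \<bullet> D\<Psi> (Suc k) z + K z * \<Psi> (Suc k) z)) \<longlonglongrightarrow>
      ?I (snd z) * (heaviside (W z) * (J z \<bullet> X z) + K z * max 0 (W z))"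
    proof (rule AE_I2)
      fix z
      have "(\<lambda>k. ?I (snd z) * (trunc' (Suc k) (W z) * (J z \<bullet> X z) + K z * trunc (Suc k) (W z))) \<longlonglongrightarrow>
        ?I (snd z) * (heaviside (W z) * (J z \<bullet> X z) + K z * max 0 (W z))"
        by (intro tendsto_intros LIMSEQ_Suc trunc_tendsto trunc'_tendsto)
      then show "(\<lambda>k. ?I (snd z) * (J z \<bullet> D\<Psi> (Suc k) z + K z * \<Psi> (Suc k) z)) \<longlonglongrightarrow>
        ?I (snd z) * (heaviside (W z) * (J z \<bullet> X z) + K z * max 0 (W z))" by (simp add: D\<Psi>_def \<Psi>_def)
    qed
    show "AE z in lborel. norm (?I (snd z) * (J z \<bullet> D\<Psi> (Suc k) z + K z * \<Psi> (Suc k) z))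
      \<le> \<bar>J z \<bullet> X z\<bar> + (\<bar>K z * max 0 (W z)\<bar> + \<bar>K z\<bar>)" for k
    proof (rule AE_I2)
      fix z
      have 1: "\<bar>J z \<bullet> D\<Psi> (Suc k) z\<bar> \<le> \<bar>J z \<bullet> X z\<bar>"
        using trunc'_bounds[of "Suc k" "W z"] by (simp add: D\<Psi>_def abs_mult mult_left_le_one_le)
      have "\<bar>\<Psi> (Suc k) z\<bar> \<le> max 0 (W z) + 1"
        using trunc_bounds(1,2)[of "Suc k" "W z"] by (simp add: \<Psi>_def abs_le_iff)
      then have "\<bar>K z\<bar> * \<bar>\<Psi> (Suc k) z\<bar> \<le> \<bar>K z\<bar> * (max 0 (W z) + 1)" by (intro mult_left_mono) auto
      then have 2: "\<bar>K z * \<Psi> (Suc k) z\<bar> \<le> \<bar>K z * max 0 (W z)\<bar> + \<bar>K z\<bar>" by (simp add: abs_mult algebra_simps)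
      have "norm (?I (snd z) * (J z \<bullet> D\<Psi> (Suc k) z + K z * \<Psi> (Suc k) z)) \<le> \<bar>J z \<bullet> D\<Psi> (Suc k) z + K z * \<Psi> (Suc k) z\<bar>"
        by (simp add: indicator_def)
      also have "\<dots> \<le> \<bar>J z \<bullet> X z\<bar> + (\<bar>K z * max 0 (W z)\<bar> + \<bar>K z\<bar>)"
        using 1 2 abs_triangle_ineq[of "J z \<bullet> D\<Psi> (Suc k) z" "K z * \<Psi> (Suc k) z"] by linarith
      finally show "norm (?I (snd z) * (J z \<bullet> D\<Psi> (Suc k) z + K z * \<Psi> (Suc k) z)) \<le> \<bar>J z \<bullet> X z\<bar> + (\<bar>K z * max 0 (W z)\<bar> + \<bar>K z\<bar>)" .
    qed
  qed
  have st: "s0 \<in> {0..T}" "s1 \<in> {0..T}" using s by auto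
  show ?thesis
    by (rule LIMSEQ_le_const2[OF tendsto_add[OF tendsto_diff[OF trunc_energy_tendsto[OF st(2)] trunc_energy_tendsto[OF st(1)]] l]])
      (use trunc_energy_inequality[OF _ s] in auto)
qed

section \<open>Absorption of the Hamiltonian term\<close>

text \<open>The integral of \<open>g\<^sup>2 (w\<^sup>+)\<^sup>2\<close> is absorbed up to \<open>Y\<close> times a modulus that is small on short time intervals.\<close>

lemma pos_energy_zero:
  fixes A g :: "(real^'n) \<times> real \<Rightarrow> real" and M :: "real \<Rightarrow> real"
  assumes \<alpha>: "\<alpha> > 0" and [measurable]: "A \<in> borel_measurable borel" "g \<in> borel_measurable borel"
    and A: "\<And>z. 0 \<le> A z" "integrable lborel A" and g: "\<And>z. 0 \<le> g z"
    and J: "AE z in lborel. \<alpha> * A z \<le> J z \<bullet> X z" and K: "AE z in lborel. \<bar>K z\<bar> \<le> g z * sqrt (A z)"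
    and gW: "integrable lborel (\<lambda>z. (g z)\<^sup>2 * (max 0 (W z))\<^sup>2)"
    and M: "continuous_on {0..T} M"
    and absorb: "\<And>s0 s1 Y. \<lbrakk>0 < s0; s0 < s1; s1 \<le> T; 0 < Y; \<And>s. s0 < s \<Longrightarrow> s < s1 \<Longrightarrow> pos_energy s \<le> Y\<rbrakk> \<Longrightarrow>
      (LINT z|lborel. indicator {s0<..<s1} (snd z) * ((g z)\<^sup>2 * (max 0 (W z))\<^sup>2))
        \<le> \<alpha>\<^sup>2 * (LINT z|lborel. indicator {s0<..<s1} (snd z) * (heaviside (W z) * A z)) + Y * (M s1 - M s0)"
    and init: "pos_energy 0 = 0" and t: "t \<in> {0..T}"
  shows "pos_energy t = 0"
proof -
  \<comment> \<open>Young's inequality spends half of the dissipation \<alpha> A. The other half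
    pays for the \<alpha>^2 term on the right of \<open>absorb\<close>, which enters with the factor
    1/(2 \<alpha>), so nothing but the modulus remains.\<close>
  have Yg: "g z * sqrt (A z) * max 0 (W z) \<le> \<alpha> / 2 * (heaviside (W z) * A z) + 1 / (2 * \<alpha>) * ((g z)\<^sup>2 * (max 0 (W z))\<^sup>2)" for z
  proof (cases "W z > 0")
    case True
    have "0 \<le> (\<alpha> * sqrt (A z) - g z * W z)\<^sup>2 / (2 * \<alpha>)" using \<alpha> by simp
    also have "\<dots> = (\<alpha>\<^sup>2 * (sqrt (A z))\<^sup>2 - 2 * \<alpha> * (g z * sqrt (A z) * W z) + (g z)\<^sup>2 * (W z)\<^sup>2) / (2 * \<alpha>)"
      by (simp add: power2_eq_square algebra_simps)
    also have "\<dots> = \<alpha> / 2 * A z - g z * sqrt (A z) * W z + 1 / (2 * \<alpha>) * ((g z)\<^sup>2 * (W z)\<^sup>2)"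
      using \<alpha> A(1)[of z] by (simp add: field_simps power2_eq_square)
    finally show ?thesis using True by (simp add: heaviside_def)
  next
    case False
    then show ?thesis using \<alpha> A(1)[of z] heaviside_bounds(1)[of "W z"] by simp
  qed
  have i\<theta>A: "integrable lborel (\<lambda>z. heaviside (W z) * A z)"
    by (rule Bochner_Integration.integrable_bound[OF A(2)])
      (use A(1) heaviside_bounds in \<open>auto simp: abs_mult mult_left_le_one_le\<close>)
  have KW: "integrable lborel (\<lambda>z. K z * max 0 (W z))"
  proof (rule Bochner_Integration.integrable_bound)
    show "integrable lborel (\<lambda>z. \<alpha> / 2 * (heaviside (W z) * A z) + 1 / (2 * \<alpha>) * ((g z)\<^sup>2 * (max 0 (W z))\<^sup>2))"
      using i\<theta>A gW by simp
    show "AE z in lborel. norm (K z * max 0 (W z)) \<le> norm (\<alpha> / 2 * (heaviside (W z) * A z) + 1 / (2 * \<alpha>) * ((g z)\<^sup>2 * (max 0 (W z))\<^sup>2))"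
      using K
    proof eventually_elim
      case (elim z)
      have "norm (K z * max 0 (W z)) \<le> g z * sqrt (A z) * max 0 (W z)" using elim by (simp add: abs_mult mult_right_mono)
      with Yg[of z] show ?case by (simp only: real_norm_def)
    qed
  qed measurable
  have iJX: "integrable lborel (\<lambda>z. J z \<bullet> X z)" by (rule integrable_inner_powr(2)[OF pq _ _ Jq Xp]) measurable
  have iS: "integrable lborel (\<lambda>z. indicator S (snd z) * f z)"
    if "integrable lborel f" "S \<in> sets borel" for f :: "(real^'n) \<times> real \<Rightarrow> real" and S :: "real set"
    by (rule Bochner_Integration.integrable_bound[OF that(1)]) (use that in \<open>auto simp: indicator_def\<close>)
  show ?thesis
  proof (rule gronwall_small_steps[OF pos_energy_continuous pos_energy_nonneg init _ _ t])
    show "continuous_on {0..T} (\<lambda>s. M s / \<alpha>)" using M \<alpha> by (intro continuous_intros) auto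
    fix s0 s1 Y :: real
    assume s: "0 < s0" "s0 < s1" "s1 \<le> T" "0 < Y" and Y: "\<And>s. s0 < s \<Longrightarrow> s < s1 \<Longrightarrow> pos_energy s \<le> Y"
    let ?I = "indicator {s0<..<s1} :: real \<Rightarrow> real"
    let ?a = "LINT z|lborel. ?I (snd z) * (heaviside (W z) * A z)"
    let ?b = "LINT z|lborel. ?I (snd z) * ((g z)\<^sup>2 * (max 0 (W z))\<^sup>2)"
    let ?c = "LINT z|lborel. ?I (snd z) * (heaviside (W z) * (J z \<bullet> X z) + K z * max 0 (W z))"
    have "\<alpha> / 2 * ?a - 1 / (2 * \<alpha>) * ?b
      = (LINT z|lborel. \<alpha> / 2 * (?I (snd z) * (heaviside (W z) * A z)) - 1 / (2 * \<alpha>) * (?I (snd z) * ((g z)\<^sup>2 * (max 0 (W z))\<^sup>2)))"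
      using iS[OF i\<theta>A, of "{s0<..<s1}"] iS[OF gW, of "{s0<..<s1}"] by simp
    also have "\<dots> \<le> ?c"
    proof (rule integral_mono_AE)
      show "integrable lborel (\<lambda>z. \<alpha> / 2 * (?I (snd z) * (heaviside (W z) * A z)) - 1 / (2 * \<alpha>) * (?I (snd z) * ((g z)\<^sup>2 * (max 0 (W z))\<^sup>2)))"
        using iS[OF i\<theta>A, of "{s0<..<s1}"] iS[OF gW, of "{s0<..<s1}"] by simp
      have "integrable lborel (\<lambda>z. heaviside (W z) * (J z \<bullet> X z))"
        by (rule Bochner_Integration.integrable_bound[OF iJX])
          (use heaviside_bounds in \<open>auto simp: abs_mult mult_left_le_one_le\<close>)
      then show "integrable lborel (\<lambda>z. ?I (snd z) * (heaviside (W z) * (J z \<bullet> X z) + K z * max 0 (W z)))"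
        using KW by (intro iS) auto
      show "AE z in lborel. \<alpha> / 2 * (?I (snd z) * (heaviside (W z) * A z)) - 1 / (2 * \<alpha>) * (?I (snd z) * ((g z)\<^sup>2 * (max 0 (W z))\<^sup>2))
        \<le> ?I (snd z) * (heaviside (W z) * (J z \<bullet> X z) + K z * max 0 (W z))"
        using J K
      proof eventually_elim
        case (elim z)
        have 1: "heaviside (W z) * (\<alpha> * A z) \<le> heaviside (W z) * (J z \<bullet> X z)"
          using elim heaviside_bounds by (intro mult_left_mono) auto
        have "\<bar>K z * max 0 (W z)\<bar> \<le> g z * sqrt (A z) * max 0 (W z)" using elim by (simp add: abs_mult mult_right_mono)
        then have 2: "- (\<alpha> / 2 * (heaviside (W z) * A z) + 1 / (2 * \<alpha>) * ((g z)\<^sup>2 * (max 0 (W z))\<^sup>2)) \<le> K z * max 0 (W z)"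
          using Yg[of z] by linarith
        have "heaviside (W z) * (\<alpha> * A z) = 2 * (\<alpha> / 2 * (heaviside (W z) * A z))" by simp
        with 1 2 have "\<alpha> / 2 * (heaviside (W z) * A z) - 1 / (2 * \<alpha>) * ((g z)\<^sup>2 * (max 0 (W z))\<^sup>2)
          \<le> heaviside (W z) * (J z \<bullet> X z) + K z * max 0 (W z)" by linarith
        then show ?case by (auto simp: indicator_def)
      qed
    qed
    finally have c: "\<alpha> / 2 * ?a - 1 / (2 * \<alpha>) * ?b \<le> ?c" .
    have b: "?b \<le> \<alpha>\<^sup>2 * ?a + Y * (M s1 - M s0)" by (rule absorb[OF s Y])
    have "1 / (2 * \<alpha>) * ?b \<le> 1 / (2 * \<alpha>) * (\<alpha>\<^sup>2 * ?a + Y * (M s1 - M s0))"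
      using \<alpha> by (intro mult_left_mono b) auto
    also have "\<dots> = \<alpha> / 2 * ?a + (Y * (M s1 / \<alpha> - M s0 / \<alpha>)) / 2"
    proof -
      have "1 / (2 * \<alpha>) * (\<alpha>\<^sup>2 * u + Y * (v - v')) = \<alpha> / 2 * u + (Y * (v / \<alpha> - v' / \<alpha>)) / 2" for u v v'
        using \<alpha> by (simp add: field_simps power2_eq_square)
      then show ?thesis .
    qed
    finally have 1: "- ((Y * (M s1 / \<alpha> - M s0 / \<alpha>)) / 2) \<le> ?c" using c by linarith
    have 2: "pos_energy s1 / 2 - pos_energy s0 / 2 + ?c \<le> 0"
      by (rule energy_inequality[OF KW s(1-3)])
    have R: "y1 \<le> y0 + e" if "- (e / 2) \<le> d" "y1 / 2 - y0 / 2 + d \<le> 0" for y0 y1 d e :: real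
      using that by linarith
    show "pos_energy s1 \<le> pos_energy s0 + Y * (M s1 / \<alpha> - M s0 / \<alpha>)" by (rule R[OF 1 2])
  qed
qed

text \<open>The energy is defined through w, at every time, while gradients and iterated integrals
  belong to the Borel representative W. For almost every time the two agree on the slice.\<close>

lemma slice_pos_energy:
  "AE s in lborel. 0 < s \<and> s < T \<longrightarrow> W1p_0 \<Omega> p (\<lambda>x. W (x, s)) (\<lambda>x. X (x, s))
    \<and> pos_energy s = (LINT x|lebesgue_on \<Omega>. (max 0 (W (x, s)))\<^sup>2)
    \<and> (\<integral>\<^sup>+x. ennreal ((max 0 (W (x, s)))\<^sup>2) \<partial>lborel) = ennreal (pos_energy s)"
  using slice
proof (eventually_elim, intro impI)
  fix s assume *: "0 < s \<and> s < T \<longrightarrow> W1p_0 \<Omega> p (\<lambda>x. W (x, s)) (\<lambda>x. X (x, s)) \<and> (AE x in lebesgue_on \<Omega>. W (x, s) = w (x, s))"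
    "0 < s \<and> s < T"
  have st: "s \<in> {0..T}" using * by auto
  have Wm: "(\<lambda>x. W (x, s)) \<in> borel_measurable borel" using measurable_compose[OF Pair_measurable meas(1)] .
  have Wl: "(\<lambda>x. W (x, s)) \<in> borel_measurable (lebesgue_on \<Omega>)"
    by (rule measurable_restrict_space1, rule measurable_completion) (use Wm in simp)
  note [measurable] = Wm Wl L2_slice(1)[OF st]
  have ae: "AE x in lebesgue_on \<Omega>. (max 0 (w (x, s)))\<^sup>2 = (max 0 (W (x, s)))\<^sup>2"
    using * by (auto elim!: eventually_mono)
  have e: "pos_energy s = (LINT x|lebesgue_on \<Omega>. (max 0 (W (x, s)))\<^sup>2)"
    unfolding pos_energy_def by (rule integral_cong_AE[OF _ _ ae]) measurable
  have i: "integrable (lebesgue_on \<Omega>) (\<lambda>x. (max 0 (W (x, s)))\<^sup>2)"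
    by (rule integrable_cong_AE_imp[OF pos_part_integrable[OF st]]) (use ae in \<open>auto elim!: eventually_mono\<close>)
  have z: "W (x, s) = 0" if "x \<notin> \<Omega>" for x using off[of "(x, s)"] that by (auto simp: mem_cylinder)
  have b: "integrable (lebesgue_on \<Omega>) (\<lambda>x. (max 0 (W (x, s)))\<^sup>2) = integrable lborel (\<lambda>x. (max 0 (W (x, s)))\<^sup>2)"
    "(LINT x|lebesgue_on \<Omega>. (max 0 (W (x, s)))\<^sup>2) = (LINT x|lborel. (max 0 (W (x, s)))\<^sup>2)"
    by (rule integrable_lebesgue_on_iff[OF \<Omega>_meas(1)]; use z in \<open>simp; measurable\<close>)+
  have "(\<integral>\<^sup>+x. ennreal ((max 0 (W (x, s)))\<^sup>2) \<partial>lborel) = ennreal (pos_energy s)"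
    unfolding e b(2) by (rule nn_integral_eq_integral) (use i b(1) in auto)
  with * e show "W1p_0 \<Omega> p (\<lambda>x. W (x, s)) (\<lambda>x. X (x, s)) \<and> pos_energy s = (LINT x|lebesgue_on \<Omega>. (max 0 (W (x, s)))\<^sup>2)
    \<and> (\<integral>\<^sup>+x. ennreal ((max 0 (W (x, s)))\<^sup>2) \<partial>lborel) = ennreal (pos_energy s)" by blast
qed

lemma pos_energy_bounded: "\<exists>Y>0. \<forall>s\<in>{0..T}. pos_energy s \<le> Y"
proof -
  have "compact (pos_energy ` {0..T})" using pos_energy_continuous by (intro compact_continuous_image) auto
  then obtain B where B: "\<forall>y\<in>pos_energy ` {0..T}. norm y \<le> B" using compact_imp_bounded by (force simp: bounded_iff)
  have "pos_energy s \<le> \<bar>B\<bar> + 1" if "s \<in> {0..T}" for s using B that by force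
  then show ?thesis by (intro exI[of _ "\<bar>B\<bar> + 1"]) auto
qed

lemma nn_integral_time_slab:
  fixes f :: "(real^'n) \<times> real \<Rightarrow> real"
  assumes "f \<in> borel_measurable borel" "\<And>z. 0 \<le> f z"
  shows "(\<integral>\<^sup>+z. ennreal (indicator {s0<..<s1} (snd z) * f z) \<partial>lborel)
    = (\<integral>\<^sup>+s. indicator {s0<..<s1} s * (\<integral>\<^sup>+x. ennreal (f (x, s)) \<partial>lborel) \<partial>lborel)"
proof -
  note [measurable] = assms(1)
  have "(\<lambda>z. ennreal (indicator {s0<..<s1} (snd z) * f z)) \<in> borel_measurable borel"
    by (intro measurable_compose[OF _ measurable_ennreal]) measurable
  then have "(\<integral>\<^sup>+z. ennreal (indicator {s0<..<s1} (snd z) * f z) \<partial>lborel)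
     = (\<integral>\<^sup>+s. \<integral>\<^sup>+x. ennreal (indicator {s0<..<s1} s * f (x, s)) \<partial>lborel \<partial>lborel)"
    by (subst nn_integral_iterated(1)) simp_all
  also have "\<dots> = (\<integral>\<^sup>+s. indicator {s0<..<s1} s * (\<integral>\<^sup>+x. ennreal (f (x, s)) \<partial>lborel) \<partial>lborel)"
    by (intro nn_integral_cong) (simp add: indicator_def)
  finally show ?thesis .
qed

lemma LINT_le_of_nn_integral_le:
  fixes f :: "'z \<Rightarrow> real"
  assumes "f \<in> borel_measurable N" "\<And>z. 0 \<le> f z" "(\<integral>\<^sup>+z. ennreal (f z) \<partial>N) \<le> ennreal B" "0 \<le> B"
  shows "integrable N f" "(LINT z|N. f z) \<le> B"
proof -
  show 1: "integrable N f"
    using assms by (intro integrableI_bounded) (auto simp: le_less_trans[OF _ ennreal_less_top])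
  show "(LINT z|N. f z) \<le> B"
    using nn_integral_eq_integral[OF 1] assms by (simp add: ennreal_le_iff)
qed

lemma pos_part_L2_slab:
  assumes s: "0 \<le> s0" "s0 \<le> s1" "s1 \<le> T" and Y: "\<And>s. s0 < s \<Longrightarrow> s < s1 \<Longrightarrow> pos_energy s \<le> Y" "0 \<le> Y"
  shows "integrable lborel (\<lambda>z. indicator {s0<..<s1} (snd z) * (max 0 (W z))\<^sup>2)"
    "(LINT z|lborel. indicator {s0<..<s1} (snd z) * (max 0 (W z))\<^sup>2) \<le> Y * (s1 - s0)"
proof -
  have "(\<integral>\<^sup>+z. ennreal (indicator {s0<..<s1} (snd z) * (max 0 (W z))\<^sup>2) \<partial>lborel)
    = (\<integral>\<^sup>+s. indicator {s0<..<s1} s * (\<integral>\<^sup>+x. ennreal ((max 0 (W (x, s)))\<^sup>2) \<partial>lborel) \<partial>lborel)"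
    by (rule nn_integral_time_slab) auto
  also have "\<dots> \<le> (\<integral>\<^sup>+s. ennreal Y * indicator {s0<..<s1} s \<partial>lborel)"
  proof (rule nn_integral_mono_AE)
    show "AE s in lborel. indicator {s0<..<s1} s * (\<integral>\<^sup>+x. ennreal ((max 0 (W (x, s)))\<^sup>2) \<partial>lborel) \<le> ennreal Y * indicator {s0<..<s1} s"
      using slice_pos_energy
    proof eventually_elim
      case (elim s)
      show ?case
      proof (cases "s \<in> {s0<..<s1}")
        case True
        then have "(\<integral>\<^sup>+x. ennreal ((max 0 (W (x, s)))\<^sup>2) \<partial>lborel) = ennreal (pos_energy s)" using elim s by auto
        also have "\<dots> \<le> ennreal Y" using Y(1)[of s] True by (intro ennreal_leI) auto
        finally show ?thesis using True by simp
      qed simp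
    qed
  qed
  also have "\<dots> = ennreal (Y * (s1 - s0))"
    using s Y by (simp add: nn_integral_cmult_indicator ennreal_mult)
  finally have *: "(\<integral>\<^sup>+z. ennreal (indicator {s0<..<s1} (snd z) * (max 0 (W z))\<^sup>2) \<partial>lborel) \<le> ennreal (Y * (s1 - s0))" .
  have m: "(\<lambda>z. indicator {s0<..<s1} (snd z) * (max 0 (W z))\<^sup>2) \<in> borel_measurable lborel" by measurable
  show "integrable lborel (\<lambda>z. indicator {s0<..<s1} (snd z) * (max 0 (W z))\<^sup>2)"
    "(LINT z|lborel. indicator {s0<..<s1} (snd z) * (max 0 (W z))\<^sup>2) \<le> Y * (s1 - s0)"
    using LINT_le_of_nn_integral_le[OF m _ *] s Y by auto
qed

text \<open>The Gagliardo-Nirenberg inequality on almost every slice, integrated in time. The energy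
  is at most Y on the slab, so its power factors out; with the exponent 2 + 4/N the gradient enters
  squared, and time integration produces the dissipation.\<close>

lemma pos_part_Lq_slab:
  fixes A :: "(real^'n) \<times> real \<Rightarrow> real" and Y :: real
  defines "N \<equiv> real CARD('n)"
  assumes p2: "p \<ge> 2" and [measurable]: "A \<in> borel_measurable borel" and A: "\<And>z. 0 \<le> A z" "integrable lborel A"
    and c: "c > 0" "\<And>z. (norm (X z))\<^sup>2 \<le> c * A z"
    and s: "0 \<le> s0" "s0 \<le> s1" "s1 \<le> T" and Y: "\<And>s. s0 < s \<Longrightarrow> s < s1 \<Longrightarrow> pos_energy s \<le> Y" "0 < Y"
  shows "integrable lborel (\<lambda>z. indicator {s0<..<s1} (snd z) * max 0 (W z) powr (2 + 4 / N))"
    "(LINT z|lborel. indicator {s0<..<s1} (snd z) * max 0 (W z) powr (2 + 4 / N))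
      \<le> gn_const N * (3 * Y) powr (2 / N) * 2 * c * (LINT z|lborel. indicator {s0<..<s1} (snd z) * (heaviside (W z) * A z))"
proof -
  let ?k = "gn_const N * (3 * Y) powr (2 / N)"
  have k: "?k \<ge> 0" by (auto simp: gn_const_def N_def)
  interpret F: finite_measure "lebesgue_on \<Omega>" by (rule finite_measure_lebesgue_on[OF \<Omega>_meas(2)])
  have i\<theta>A: "integrable lborel (\<lambda>z. indicator {s0<..<s1} (snd z) * (heaviside (W z) * A z))"
    by (rule Bochner_Integration.integrable_bound[OF A(2)])
      (use A(1) heaviside_bounds in \<open>auto simp: abs_mult mult_left_le_one_le indicator_def\<close>)
  have sl: "(\<integral>\<^sup>+x. ennreal (max 0 (W (x, s)) powr (2 + 4 / N)) \<partial>lborel)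
      \<le> ennreal (?k * 2 * c) * (\<integral>\<^sup>+x. ennreal (heaviside (W (x, s)) * A (x, s)) \<partial>lborel)"
    if W1: "W1p_0 \<Omega> p (\<lambda>x. W (x, s)) (\<lambda>x. X (x, s))"
      and y: "(LINT x|lebesgue_on \<Omega>. (max 0 (W (x, s)))\<^sup>2) \<le> Y" for s
  proof -
    have Bm[measurable]: "(\<lambda>x. W (x, s)) \<in> borel_measurable borel" "(\<lambda>x. X (x, s)) \<in> borel_measurable borel"
      "(\<lambda>x. A (x, s)) \<in> borel_measurable borel"
      using measurable_compose[OF Pair_measurable meas(1)] measurable_compose[OF Pair_measurable meas(3)]
        measurable_compose[OF Pair_measurable assms(3)] by auto
    have z: "W (x, s) = 0" "X (x, s) = 0" if "x \<notin> \<Omega>" for x using off[of "(x, s)"] that by (auto simp: mem_cylinder)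
    have Xm: "(\<lambda>x. X (x, s)) \<in> borel_measurable (lebesgue_on \<Omega>)" by (rule LpD(1)[OF W1p_0_Lp(2)[OF W1]])
    have iX: "integrable (lebesgue_on \<Omega>) (\<lambda>x. heaviside (W (x, s)) * (norm (X (x, s)))\<^sup>2)"
    proof (rule Bochner_Integration.integrable_bound[OF F.L2_of_Lp[OF Xm p2 LpD(2)[OF W1p_0_Lp(2)[OF W1]]]])
      show "AE x in lebesgue_on \<Omega>. norm (heaviside (W (x, s)) * (norm (X (x, s)))\<^sup>2) \<le> norm ((norm (X (x, s)))\<^sup>2)"
        using heaviside_bounds by (auto simp: abs_mult mult_left_le_one_le)
      show "(\<lambda>x. heaviside (W (x, s)) * (norm (X (x, s)))\<^sup>2) \<in> borel_measurable (lebesgue_on \<Omega>)"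
        by (rule measurable_restrict_space1, rule measurable_completion) simp
    qed
    have nn: "(\<integral>\<^sup>+x. f x \<partial>lebesgue_on \<Omega>) = (\<integral>\<^sup>+x. f x \<partial>lborel)"
      if "f \<in> borel_measurable borel" "\<And>x. x \<notin> \<Omega> \<Longrightarrow> f x = 0" for f :: "real^'n \<Rightarrow> ennreal"
    proof -
      have "(\<integral>\<^sup>+x. f x \<partial>lebesgue_on \<Omega>) = (\<integral>\<^sup>+x. f x * indicator \<Omega> x \<partial>lebesgue)"
        by (rule nn_integral_restrict_space) (use \<Omega>_meas in auto)
      also have "\<dots> = (\<integral>\<^sup>+x. f x \<partial>lebesgue)"
        by (intro nn_integral_cong) (use that in \<open>auto simp: indicator_def\<close>)
      finally show ?thesis by (simp add: nn_integral_completion)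
    qed
    have "(\<integral>\<^sup>+x. ennreal (max 0 (W (x, s)) powr (2 + 4 / N)) \<partial>lborel) = (\<integral>\<^sup>+x. ennreal (max 0 (W (x, s)) powr (2 + 4 / N)) \<partial>lebesgue_on \<Omega>)"
      by (rule nn[symmetric]) (use z in simp_all)
    also have "\<dots> \<le> ennreal (?k * (2 * (LINT x|lebesgue_on \<Omega>. heaviside (W (x, s)) * (norm (X (x, s)))\<^sup>2)))"
      unfolding N_def by (rule Gagliardo_Nirenberg_positive_part[OF \<Omega> p2 W1 y Y(2)])
    also have "\<dots> = ennreal (?k * 2) * ennreal (LINT x|lebesgue_on \<Omega>. heaviside (W (x, s)) * (norm (X (x, s)))\<^sup>2)"
      using k heaviside_bounds by (subst ennreal_mult[symmetric]) (auto intro!: integral_nonneg_AE simp: mult.assoc)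
    also have "ennreal (LINT x|lebesgue_on \<Omega>. heaviside (W (x, s)) * (norm (X (x, s)))\<^sup>2)
       = (\<integral>\<^sup>+x. ennreal (heaviside (W (x, s)) * (norm (X (x, s)))\<^sup>2) \<partial>lebesgue_on \<Omega>)"
      by (rule nn_integral_eq_integral[symmetric, OF iX]) (use heaviside_bounds in auto)
    also have "\<dots> = (\<integral>\<^sup>+x. ennreal (heaviside (W (x, s)) * (norm (X (x, s)))\<^sup>2) \<partial>lborel)"
      by (rule nn) (use z in simp_all)
    also have "\<dots> \<le> (\<integral>\<^sup>+x. ennreal c * ennreal (heaviside (W (x, s)) * A (x, s)) \<partial>lborel)"
    proof (intro nn_integral_mono)
      fix x
      have "heaviside (W (x, s)) * (norm (X (x, s)))\<^sup>2 \<le> heaviside (W (x, s)) * (c * A (x, s))"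
        by (intro mult_left_mono c heaviside_bounds)
      then have "ennreal (heaviside (W (x, s)) * (norm (X (x, s)))\<^sup>2) \<le> ennreal (c * (heaviside (W (x, s)) * A (x, s)))"
        by (intro ennreal_leI) (simp add: mult.left_commute)
      also have "\<dots> = ennreal c * ennreal (heaviside (W (x, s)) * A (x, s))"
        using c A(1) heaviside_bounds by (intro ennreal_mult) auto
      finally show "ennreal (heaviside (W (x, s)) * (norm (X (x, s)))\<^sup>2) \<le> \<dots>" .
    qed
    also have "\<dots> = ennreal c * (\<integral>\<^sup>+x. ennreal (heaviside (W (x, s)) * A (x, s)) \<partial>lborel)"
      by (rule nn_integral_cmult) simp
    also have "ennreal (?k * 2) * \<dots> = ennreal (?k * 2 * c) * (\<integral>\<^sup>+x. ennreal (heaviside (W (x, s)) * A (x, s)) \<partial>lborel)"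
      using k c ennreal_mult[of "?k * 2" c] by (simp add: mult.assoc)
    finally show ?thesis by (simp add: mult_left_mono)
  qed
  let ?B = "LINT z|lborel. indicator {s0<..<s1} (snd z) * (heaviside (W z) * A z)"
  have B: "?B \<ge> 0" by (rule integral_nonneg_AE) (use A(1) heaviside_bounds in auto)
  have hA: "(\<lambda>z. heaviside (W z) * A z) \<in> borel_measurable borel" by measurable
  have "(\<integral>\<^sup>+z. ennreal (indicator {s0<..<s1} (snd z) * max 0 (W z) powr (2 + 4 / N)) \<partial>lborel)
    = (\<integral>\<^sup>+s. indicator {s0<..<s1} s * (\<integral>\<^sup>+x. ennreal (max 0 (W (x, s)) powr (2 + 4 / N)) \<partial>lborel) \<partial>lborel)"
    by (rule nn_integral_time_slab) auto
  also have "\<dots> \<le> (\<integral>\<^sup>+s. ennreal (?k * 2 * c) * (indicator {s0<..<s1} s * (\<integral>\<^sup>+x. ennreal (heaviside (W (x, s)) * A (x, s)) \<partial>lborel)) \<partial>lborel)"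
  proof (rule nn_integral_mono_AE)
    show "AE s in lborel. indicator {s0<..<s1} s * (\<integral>\<^sup>+x. ennreal (max 0 (W (x, s)) powr (2 + 4 / N)) \<partial>lborel)
      \<le> ennreal (?k * 2 * c) * (indicator {s0<..<s1} s * (\<integral>\<^sup>+x. ennreal (heaviside (W (x, s)) * A (x, s)) \<partial>lborel))"
      using slice_pos_energy
    proof eventually_elim
      case (elim r)
      show ?case
      proof (cases "r \<in> {s0<..<s1}")
        case True
        then have "0 < r \<and> r < T" using s by auto
        with elim True Y(1)[of r] show ?thesis using sl[of r] by simp
      qed simp
    qed
  qed
  also have "\<dots> = ennreal (?k * 2 * c) * (\<integral>\<^sup>+s. indicator {s0<..<s1} s * (\<integral>\<^sup>+x. ennreal (heaviside (W (x, s)) * A (x, s)) \<partial>lborel) \<partial>lborel)"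
  proof (rule nn_integral_cmult)
    have "(\<lambda>z. ennreal (heaviside (W z) * A z)) \<in> borel_measurable borel"
      by (rule measurable_compose[OF hA measurable_ennreal])
    from nn_integral_iterated(2)[OF this]
    show "(\<lambda>s. indicator {s0<..<s1} s * (\<integral>\<^sup>+x. ennreal (heaviside (W (x, s)) * A (x, s)) \<partial>lborel)) \<in> borel_measurable lborel"
      by simp
  qed
  also have "(\<integral>\<^sup>+s. indicator {s0<..<s1} s * (\<integral>\<^sup>+x. ennreal (heaviside (W (x, s)) * A (x, s)) \<partial>lborel) \<partial>lborel)
    = (\<integral>\<^sup>+z. ennreal (indicator {s0<..<s1} (snd z) * (heaviside (W z) * A z)) \<partial>lborel)"
    by (rule nn_integral_time_slab[OF hA, symmetric]) (use A(1) heaviside_bounds in auto)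
  also have "\<dots> = ennreal ?B"
    by (rule nn_integral_eq_integral[OF i\<theta>A]) (use A(1) heaviside_bounds in auto)
  also have "ennreal (?k * 2 * c) * ennreal ?B = ennreal (?k * 2 * c * ?B)"
    using k c B by (intro ennreal_mult[symmetric]) auto
  finally have *: "(\<integral>\<^sup>+z. ennreal (indicator {s0<..<s1} (snd z) * max 0 (W z) powr (2 + 4 / N)) \<partial>lborel) \<le> ennreal (?k * 2 * c * ?B)" .
  have m: "(\<lambda>z. indicator {s0<..<s1} (snd z) * max 0 (W z) powr (2 + 4 / N)) \<in> borel_measurable lborel" by measurable
  have nn: "0 \<le> ?k * 2 * c * ?B" using k c B by auto
  show "integrable lborel (\<lambda>z. indicator {s0<..<s1} (snd z) * max 0 (W z) powr (2 + 4 / N))"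
    "(LINT z|lborel. indicator {s0<..<s1} (snd z) * max 0 (W z) powr (2 + 4 / N)) \<le> ?k * 2 * c * ?B"
    using LINT_le_of_nn_integral_le[OF m _ * nn] by auto
qed

end

lemma powr_interpolate_le:
  fixes a b l :: real
  assumes "0 \<le> a" "0 < b" "0 \<le> l" "l \<le> 1"
  shows "a powr l * b powr (1 - l) \<le> a + b"
proof -
  have "a powr l * b powr (1 - l) \<le> max a b powr l * max a b powr (1 - l)"
    using assms by (intro mult_mono powr_mono2) auto
  also have "\<dots> = max a b" using assms by (simp flip: powr_add)
  also have "\<dots> \<le> a + b" using assms by simp
  finally show ?thesis .
qed

text \<open>Meant for the modulus of continuity in case (B). The indicator of (0, s) converges as s
  tends to a, except at points with time coordinate a, which form a null set.\<close>

lemma LINT_slab_continuous: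
  fixes F :: "'a::euclidean_space \<times> real \<Rightarrow> real"
  assumes F: "integrable lborel F"
  shows "continuous_on S (\<lambda>s. LINT z|lborel. indicator {0<..<s} (snd z) * F z)"
  unfolding continuous_on_sequentially o_def
proof (intro allI ballI impI)
  fix x :: "nat \<Rightarrow> real" and a assume *: "(\<forall>n. x n \<in> S) \<and> x \<longlonglongrightarrow> a"
  have [measurable]: "snd \<in> borel_measurable (borel :: ('a \<times> real) measure)"
    by (intro borel_measurable_continuous_onI continuous_intros)
  show "(\<lambda>n. LINT z|lborel. indicator {0<..<x n} (snd z) * F z) \<longlonglongrightarrow> (LINT z|lborel. indicator {0<..<a} (snd z) * F z)"
  proof (rule integral_dominated_convergence[where w = "\<lambda>z. \<bar>F z\<bar>"])
    show "AE z in lborel. (\<lambda>n. indicator {0<..<x n} (snd z) * F z) \<longlonglongrightarrow> indicator {0<..<a} (snd z) * F z"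
      using AE_lborel_snd_neq[of a]
    proof eventually_elim
      case (elim z)
      have "\<forall>\<^sub>F n in sequentially. (snd z < x n) = (snd z < a)"
      proof (cases "snd z < a")
        case True
        then show ?thesis using order_tendstoD(1)[of x a sequentially "snd z"] * by auto
      next
        case False
        then have "a < snd z" using elim by simp
        then show ?thesis using order_tendstoD(2)[of x a sequentially "snd z"] * False by (auto elim: eventually_mono)
      qed
      then have "\<forall>\<^sub>F n in sequentially. indicator {0<..<x n} (snd z) * F z = indicator {0<..<a} (snd z) * F z"
        by eventually_elim (simp add: indicator_def)
      then show ?case by (rule tendsto_eventually)
    qed
    show "AE z in lborel. norm (indicator {0<..<x n} (snd z) * F z) \<le> \<bar>F z\<bar>" for n
      by (auto simp: indicator_def)
  qed (use F in auto)
qed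

lemma LINT_slab_diff:
  fixes F :: "'a::euclidean_space \<times> real \<Rightarrow> real"
  assumes F: "integrable lborel F" and s: "0 < s0" "s0 < s1"
  shows "(LINT z|lborel. indicator {s0<..<s1} (snd z) * F z)
    = (LINT z|lborel. indicator {0<..<s1} (snd z) * F z) - (LINT z|lborel. indicator {0<..<s0} (snd z) * F z)"
proof -
  have [measurable]: "snd \<in> borel_measurable (borel :: ('a \<times> real) measure)" "F \<in> borel_measurable borel"
    using F by (auto intro!: borel_measurable_continuous_onI continuous_intros)
  have i: "integrable lborel (\<lambda>z. indicator {0<..<s} (snd z) * F z)" for s
    by (rule Bochner_Integration.integrable_bound[OF F]) (auto simp: indicator_def)
  have "(LINT z|lborel. indicator {s0<..<s1} (snd z) * F z)
    = (LINT z|lborel. indicator {0<..<s1} (snd z) * F z - indicator {0<..<s0} (snd z) * F z)"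
  proof (rule integral_cong_AE)
    show "AE z in lborel. indicator {s0<..<s1} (snd z) * F z = indicator {0<..<s1} (snd z) * F z - indicator {0<..<s0} (snd z) * F z"
      using AE_lborel_snd_neq[of s0] by eventually_elim (use s in \<open>auto simp: indicator_def\<close>)
  qed measurable
  also have "\<dots> = (LINT z|lborel. indicator {0<..<s1} (snd z) * F z) - (LINT z|lborel. indicator {0<..<s0} (snd z) * F z)"
    by (rule Bochner_Integration.integral_diff[OF i i])
  finally show ?thesis .
qed

section \<open>Vanishing of the energy in each of the two cases\<close>

context parabolic_difference
begin

lemma W_full_slab: "indicator {0<..<T} (snd z) * (max 0 (W z))\<^sup>2 = (max 0 (W z))\<^sup>2"
  "indicator {0<..<T} (snd z) * max 0 (W z) powr e = max 0 (W z) powr e"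
  by (cases "z \<in> cylinder \<Omega> T"; use off[of z] in \<open>auto simp: mem_cylinder\<close>)+

text \<open>Case (A). As p < 2, replacing Z by \<eta> + Z in the weight of the dissipation only
  decreases it. In return (\<eta> + Z)^\<sigma> becomes the square root (\<eta> + Z)^((p-2)/2) of
  that weight times a power with exponent at most 0, which is bounded by a power of \<eta>. Hence g
  is a constant.\<close>

theorem pos_energy_zero_singular:
  fixes Z :: "(real^'n) \<times> real \<Rightarrow> real"
  assumes \<alpha>: "\<alpha> > 0" and \<eta>: "\<eta> > 0" and p2: "p < 2" and \<sigma>: "\<sigma> \<le> (p - 2) / 2" and C: "C \<ge> 0"
    and [measurable]: "Z \<in> borel_measurable borel" and Z: "\<And>z. norm (X z) \<le> Z z"
    and J: "AE z in lborel. \<alpha> * Z z powr (p - 2) * (norm (X z))\<^sup>2 \<le> J z \<bullet> X z"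
    and K: "AE z in lborel. \<bar>K z\<bar> \<le> C * (\<eta> + Z z) powr \<sigma> * norm (X z)"
    and init: "pos_energy 0 = 0" and t: "t \<in> {0..T}"
  shows "pos_energy t = 0"
proof -
  define A where "A z = (\<eta> + Z z) powr (p - 2) * (norm (X z))\<^sup>2" for z
  define g where "g = C * \<eta> powr (\<sigma> - (p - 2) / 2)"
  have Z0: "0 \<le> Z z" for z using order_trans[OF norm_ge_zero Z] .
  have [measurable]: "A \<in> borel_measurable borel" unfolding A_def by measurable
  have A0: "0 \<le> A z" for z by (simp add: A_def)
  have g0: "0 \<le> g" using C by (simp add: g_def)
  \<comment> \<open>Since p - 2 is negative and |X| <= \<eta> + Z, the weight is at most |X|^(p-2),
    and A inherits the integrability of |X|^p.\<close>
  have A_le: "A z \<le> norm (X z) powr p" for z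
  proof (cases "X z = 0")
    case False
    have "(\<eta> + Z z) powr (p - 2) \<le> norm (X z) powr (p - 2)"
      using False Z[of z] \<eta> p2 by (intro powr_mono2') auto
    then have "A z \<le> norm (X z) powr (p - 2) * (norm (X z))\<^sup>2" unfolding A_def by (intro mult_right_mono) auto
    also have "\<dots> = norm (X z) powr (p - 2) * norm (X z) powr 2" using False by simp
    also have "\<dots> = norm (X z) powr (p - 2 + 2)" by (rule powr_add[symmetric])
    finally show ?thesis by simp
  qed (simp add: A_def)
  have iA: "integrable lborel A"
    by (rule Bochner_Integration.integrable_bound[OF Xp]) (use A_le A0 in auto)
  have sqA: "sqrt (A z) = (\<eta> + Z z) powr ((p - 2) / 2) * norm (X z)" for z
  proof -
    have "sqrt ((\<eta> + Z z) powr (p - 2)) = (\<eta> + Z z) powr ((p - 2) / 2)"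
      by (simp add: powr_half_sqrt[symmetric] powr_powr)
    then show ?thesis by (simp add: A_def real_sqrt_mult)
  qed
  obtain Y where Y: "Y > 0" "\<forall>s\<in>{0..T}. pos_energy s \<le> Y" using pos_energy_bounded by blast
  have iW: "integrable lborel (\<lambda>z. (max 0 (W z))\<^sup>2)"
    using pos_part_L2_slab(1)[of 0 T Y] Y T unfolding W_full_slab by auto
  show ?thesis
  \<comment> \<open>With g constant, the weighted integral over a slab is at most g^2 Y times its
    length, so a linear modulus does.\<close>
  proof (rule pos_energy_zero[OF \<alpha> _ _ A0 iA g0 _ _ _ _ _ init t, where M = "\<lambda>s. g\<^sup>2 * s"])
    show "AE z in lborel. \<alpha> * A z \<le> J z \<bullet> X z"
      using J
    proof eventually_elim
      case (elim z)
      show ?case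
      proof (cases "X z = 0")
        case False
        \<comment> \<open>The decreasing power needs a positive base, as 0 powr (p - 2) is 0 and not
          infinite. Where X z = 0 both sides vanish.\<close>
        then have "Z z > 0" using Z[of z] by (meson less_le_trans zero_less_norm_iff)
        then have "(\<eta> + Z z) powr (p - 2) \<le> Z z powr (p - 2)" using \<eta> p2 by (intro powr_mono2') auto
        then have "\<alpha> * A z \<le> \<alpha> * Z z powr (p - 2) * (norm (X z))\<^sup>2"
          unfolding A_def mult.assoc using \<alpha> by (intro mult_left_mono mult_right_mono) auto
        then show ?thesis using elim by linarith
      qed (simp add: A_def)
    qed
    show "AE z in lborel. \<bar>K z\<bar> \<le> g * sqrt (A z)"
      using K
    proof eventually_elim
      case (elim z)
      have "(\<eta> + Z z) powr \<sigma> = (\<eta> + Z z) powr (\<sigma> - (p - 2) / 2) * (\<eta> + Z z) powr ((p - 2) / 2)"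
        by (simp flip: powr_add)
      also have "\<dots> \<le> \<eta> powr (\<sigma> - (p - 2) / 2) * (\<eta> + Z z) powr ((p - 2) / 2)"
        using \<eta> Z0[of z] \<sigma> by (intro mult_right_mono powr_mono2') auto
      finally have "C * (\<eta> + Z z) powr \<sigma> * norm (X z) \<le> C * (\<eta> powr (\<sigma> - (p - 2) / 2) * (\<eta> + Z z) powr ((p - 2) / 2)) * norm (X z)"
        using C by (intro mult_right_mono mult_left_mono) auto
      also have "\<dots> = g * sqrt (A z)" by (simp add: g_def sqA)
      finally show ?case using elim by linarith
    qed
    show "integrable lborel (\<lambda>z. g\<^sup>2 * (max 0 (W z))\<^sup>2)" using iW by simp
    show "continuous_on {0..T} (\<lambda>s. g\<^sup>2 * s)" by (intro continuous_intros)
    fix s0 s1 Y :: real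
    assume s: "0 < s0" "s0 < s1" "s1 \<le> T" "0 < Y" and Y: "\<And>s. s0 < s \<Longrightarrow> s < s1 \<Longrightarrow> pos_energy s \<le> Y"
    have "(LINT z|lborel. indicator {s0<..<s1} (snd z) * (g\<^sup>2 * (max 0 (W z))\<^sup>2))
      = g\<^sup>2 * (LINT z|lborel. indicator {s0<..<s1} (snd z) * (max 0 (W z))\<^sup>2)"
      by (simp add: mult.left_commute)
    also have "\<dots> \<le> g\<^sup>2 * (Y * (s1 - s0))"
      using s Y by (intro mult_left_mono pos_part_L2_slab(2)) auto
    also have "\<dots> = Y * (g\<^sup>2 * s1 - g\<^sup>2 * s0)" by (simp add: algebra_simps)
    also have "\<dots> \<le> \<alpha>\<^sup>2 * (LINT z|lborel. indicator {s0<..<s1} (snd z) * (heaviside (W z) * A z)) + \<dots>"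
    proof -
      have "0 \<le> (LINT z|lborel. indicator {s0<..<s1} (snd z) * (heaviside (W z) * A z))"
        by (rule integral_nonneg_AE) (use A0 heaviside_bounds in auto)
      then show ?thesis by simp
    qed
    finally show "(LINT z|lborel. indicator {s0<..<s1} (snd z) * (g\<^sup>2 * (max 0 (W z))\<^sup>2))
      \<le> \<alpha>\<^sup>2 * (LINT z|lborel. indicator {s0<..<s1} (snd z) * (heaviside (W z) * A z)) + Y * (g\<^sup>2 * s1 - g\<^sup>2 * s0)" .
  qed auto
qed

text \<open>Case (B). The square root of A takes the power (p - 2)/2 of the gradients; the power s
  is what can be combined with h to stay in L^(N+2); and \<sigma> exceeds neither in sum, so what is
  left has a nonpositive exponent and is bounded by a power of \<epsilon>, the constant C.\<close>

theorem pos_energy_zero_degenerate: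
  fixes Z h :: "(real^'n) \<times> real \<Rightarrow> real"
  defines "N \<equiv> real CARD('n)"
  assumes \<alpha>: "\<alpha> > 0" and \<epsilon>: "\<epsilon> > 0" and p2: "2 \<le> p" and r: "N + 2 \<le> r"
    and \<sigma>: "0 \<le> \<sigma>" "\<sigma> \<le> p * (1 / (N + 2) - 1 / r) + (p - 2) / 2"
    and [measurable]: "Z \<in> borel_measurable borel" "h \<in> borel_measurable borel"
    and Z: "\<And>z. norm (X z) \<le> Z z" "\<And>z. z \<notin> cylinder \<Omega> T \<Longrightarrow> Z z = 0 \<and> h z = 0"
    and Zp: "integrable lborel (\<lambda>z. Z z powr p)" and hr: "integrable lborel (\<lambda>z. \<bar>h z\<bar> powr r)"
    and J: "AE z in lborel. \<alpha> * (\<epsilon> + Z z) powr (p - 2) * (norm (X z))\<^sup>2 \<le> J z \<bullet> X z"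
    and K: "AE z in lborel. \<bar>K z\<bar> \<le> \<bar>h z\<bar> * Z z powr \<sigma> * norm (X z)"
    and init: "pos_energy 0 = 0" and t: "t \<in> {0..T}"
  shows "pos_energy t = 0"
proof -
  let ?Q = "cylinder \<Omega> T"
  \<comment> \<open>Then s (N + 2) = p (1 - (N + 2)/r): the share left to (\<epsilon> + Z)^p in
    Hoelder's inequality when |h|^r takes the share (N + 2)/r.\<close>
  define s where "s = p * (1 / (N + 2) - 1 / r)"
  define A where "A z = (\<epsilon> + Z z) powr (p - 2) * (norm (X z))\<^sup>2" for z
  define C where "C = \<epsilon> powr (\<sigma> - (p - 2) / 2 - s)"
  define g where "g z = C * (\<bar>h z\<bar> * (\<epsilon> + Z z) powr s)" for z
  have N: "N > 0" by (simp add: N_def)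
  have rp: "r > 0" using r N by simp
  have Z0: "0 \<le> Z z" for z using order_trans[OF norm_ge_zero Z(1)] .
  have pos: "\<epsilon> + Z z > 0" for z using Z0[of z] \<epsilon> by linarith
  have [measurable]: "A \<in> borel_measurable borel" "g \<in> borel_measurable borel" unfolding A_def g_def by measurable
  have A0: "0 \<le> A z" for z by (simp add: A_def)
  have C0: "C > 0" using \<epsilon> by (simp add: C_def)
  have g0: "0 \<le> g z" for z using C0 by (simp add: g_def)
  have iQ: "integrable lborel (\<lambda>z. indicator ?Q z * (\<epsilon> + Z z) powr p)"
  proof (rule Bochner_Integration.integrable_bound)
    show "integrable lborel (\<lambda>z. 2 powr p * (indicator ?Q z * \<epsilon> powr p + Z z powr p))"
      using Zp cylinder_meas by (auto simp: integrable_real_indicator)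
    show "AE z in lborel. norm (indicator ?Q z * (\<epsilon> + Z z) powr p) \<le> norm (2 powr p * (indicator ?Q z * \<epsilon> powr p + Z z powr p))"
      using powr_add_le[of \<epsilon> "Z _" p] \<epsilon> Z0 p by (auto simp: indicator_def)
  qed (use cylinder_meas in measurable)
  have A_le: "A z \<le> indicator ?Q z * (\<epsilon> + Z z) powr p" for z
  proof (cases "z \<in> ?Q")
    case True
    have "A z \<le> (\<epsilon> + Z z) powr (p - 2) * (\<epsilon> + Z z) powr 2"
      unfolding A_def using Z(1)[of z] \<epsilon> pos[of z] by (intro mult_left_mono) (auto intro!: power_mono)
    also have "\<dots> = (\<epsilon> + Z z) powr p" by (simp flip: powr_add)
    finally show ?thesis using True by simp
  qed (use off[of z] in \<open>simp add: A_def\<close>)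
  have iA: "integrable lborel A"
    by (rule Bochner_Integration.integrable_bound[OF iQ]) (use A_le A0 in auto)
  have sqA: "sqrt (A z) = (\<epsilon> + Z z) powr ((p - 2) / 2) * norm (X z)" for z
  proof -
    have "sqrt ((\<epsilon> + Z z) powr (p - 2)) = (\<epsilon> + Z z) powr ((p - 2) / 2)"
      by (simp add: powr_half_sqrt[symmetric] powr_powr)
    then show ?thesis by (simp add: A_def real_sqrt_mult)
  qed
  define c where "c = \<epsilon> powr (2 - p)"
  have c: "c > 0" using \<epsilon> by (simp add: c_def)
  have XA: "(norm (X z))\<^sup>2 \<le> c * A z" for z
  proof -
    have "1 = \<epsilon> powr (2 - p) * \<epsilon> powr (p - 2)" using \<epsilon> by (simp flip: powr_add)
    also have "\<dots> \<le> c * (\<epsilon> + Z z) powr (p - 2)"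
      unfolding c_def using \<epsilon> Z0[of z] p2 by (intro mult_left_mono powr_mono2) auto
    finally have "1 * (norm (X z))\<^sup>2 \<le> c * (\<epsilon> + Z z) powr (p - 2) * (norm (X z))\<^sup>2"
      by (intro mult_right_mono) auto
    then show ?thesis by (simp add: A_def mult.assoc)
  qed
  have iG: "integrable lborel (\<lambda>z. g z powr (N + 2))"
  proof (rule Bochner_Integration.integrable_bound)
    show "integrable lborel (\<lambda>z. C powr (N + 2) * (\<bar>h z\<bar> powr r + indicator ?Q z * (\<epsilon> + Z z) powr p))"
      using hr iQ by simp
    show "AE z in lborel. norm (g z powr (N + 2)) \<le> norm (C powr (N + 2) * (\<bar>h z\<bar> powr r + indicator ?Q z * (\<epsilon> + Z z) powr p))"
    proof (rule AE_I2)
      fix z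
      show "norm (g z powr (N + 2)) \<le> norm (C powr (N + 2) * (\<bar>h z\<bar> powr r + indicator ?Q z * (\<epsilon> + Z z) powr p))"
      proof (cases "z \<in> ?Q")
        case True
        let ?l = "(N + 2) / r"
        have l: "0 \<le> ?l" "?l \<le> 1" using N r rp by auto
        have "\<bar>h z\<bar> powr (N + 2) = (\<bar>h z\<bar> powr r) powr ?l" using rp by (simp add: powr_powr)
        moreover have "((\<epsilon> + Z z) powr s) powr (N + 2) = ((\<epsilon> + Z z) powr p) powr (1 - ?l)"
        proof -
          have "(1 / (N + 2) - 1 / r) * (N + 2) = 1 - ?l" using N by (simp add: left_diff_distrib)
          then have "s * (N + 2) = p * (1 - ?l)" by (simp add: s_def mult.assoc)
          then show ?thesis by (simp add: powr_powr)
        qed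
        ultimately have "\<bar>h z\<bar> powr (N + 2) * ((\<epsilon> + Z z) powr s) powr (N + 2) \<le> \<bar>h z\<bar> powr r + (\<epsilon> + Z z) powr p"
          using powr_interpolate_le[of "\<bar>h z\<bar> powr r" "(\<epsilon> + Z z) powr p" ?l] l pos[of z] by simp
        then have "g z powr (N + 2) \<le> C powr (N + 2) * (\<bar>h z\<bar> powr r + (\<epsilon> + Z z) powr p)"
          unfolding g_def powr_mult by (intro mult_left_mono) auto
        then show ?thesis using True by simp
      qed (use Z(2)[of z] N in \<open>simp add: g_def\<close>)
    qed
  qed measurable
  have KA: "AE z in lborel. \<bar>K z\<bar> \<le> g z * sqrt (A z)"
    using K
  proof eventually_elim
    case (elim z)
    have "Z z powr \<sigma> \<le> (\<epsilon> + Z z) powr \<sigma>" using \<epsilon> Z0[of z] \<sigma> by (intro powr_mono2) auto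
    also have "\<dots> = (\<epsilon> + Z z) powr (\<sigma> - (p - 2) / 2 - s) * (\<epsilon> + Z z) powr s * (\<epsilon> + Z z) powr ((p - 2) / 2)"
      by (simp flip: powr_add)
    also have "\<dots> \<le> C * (\<epsilon> + Z z) powr s * (\<epsilon> + Z z) powr ((p - 2) / 2)"
      unfolding C_def using \<epsilon> Z0[of z] \<sigma>(2) by (intro mult_right_mono powr_mono2') (auto simp: s_def)
    finally have "\<bar>h z\<bar> * Z z powr \<sigma> * norm (X z) \<le> \<bar>h z\<bar> * (C * (\<epsilon> + Z z) powr s * (\<epsilon> + Z z) powr ((p - 2) / 2)) * norm (X z)"
      by (intro mult_right_mono mult_left_mono) auto
    also have "\<dots> = g z * sqrt (A z)" by (simp add: g_def sqA)
    finally show ?case using elim by linarith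
  qed
  \<comment> \<open>Conjugate exponents for g^2 and (w^+)^2: twice the first is N + 2, the
    integrability of g, and twice the second is the Gagliardo-Nirenberg exponent 2 + 4/N.\<close>
  let ?q = "2 + 4 / N" and ?P = "(N + 2) / 2" and ?R = "(N + 2) / N"
  have PR: "?P > 1" "?R > 1" using N by (auto simp: field_simps)
  have PR1: "1 / ?P + 1 / ?R = 1"
  proof -
    have "1 / ?P + 1 / ?R = 2 / (N + 2) + N / (N + 2)"
      by (simp only: divide_divide_eq_right mult_1_left)
    also have "\<dots> = (2 + N) / (N + 2)" by (rule add_divide_distrib[symmetric])
    finally show ?thesis using N by simp
  qed
  have Yg: "(g z)\<^sup>2 * (max 0 (W z))\<^sup>2 \<le> k powr ?R * max 0 (W z) powr ?q + k powr (- ?P) * g z powr (N + 2)" if "k > 0" for k z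
  proof -
    have e: "?q / 2 = ?R" using N by (simp add: field_simps)
    have "((max 0 (W z))\<^sup>2) powr (?q / 2) = max 0 (W z) powr ?q" by (rule powr_half_power2) simp
    then have "((max 0 (W z))\<^sup>2) powr ?R = max 0 (W z) powr ?q" unfolding e .
    moreover have "((g z)\<^sup>2) powr ?P = g z powr (N + 2)" using powr_half_power2[OF g0, of z "N + 2"] by simp
    ultimately show ?thesis
      using Young_scaled[OF PR PR1, of "(max 0 (W z))\<^sup>2" "(g z)\<^sup>2" k] that by (simp add: mult.commute)
  qed
  obtain Y0 where Y0: "Y0 > 0" "\<forall>s\<in>{0..T}. pos_energy s \<le> Y0" using pos_energy_bounded by blast
  have iWq: "integrable lborel (\<lambda>z. max 0 (W z) powr ?q)"
    using pos_part_Lq_slab(1)[OF p2 _ A0 iA c XA, of 0 T Y0] Y0 T unfolding W_full_slab N_def by auto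
  have gW: "integrable lborel (\<lambda>z. (g z)\<^sup>2 * (max 0 (W z))\<^sup>2)"
  proof (rule Bochner_Integration.integrable_bound)
    show "integrable lborel (\<lambda>z. max 0 (W z) powr ?q + g z powr (N + 2))" using iWq iG by simp
    show "AE z in lborel. norm ((g z)\<^sup>2 * (max 0 (W z))\<^sup>2) \<le> norm (max 0 (W z) powr ?q + g z powr (N + 2))"
      using Yg[of 1] by simp
  qed measurable
  \<comment> \<open>The constants of \<open>pos_part_Lq_slab\<close> with the power Y^(2/N) taken
    out.\<close>
  define D where "D = gn_const N * 3 powr (2 / N) * 2 * c"
  have D: "D > 0" using N c by (simp add: D_def gn_const_def)
  have iS: "integrable lborel (\<lambda>z. indicator S (snd z) * f z)"
    if "integrable lborel f" "S \<in> sets borel" for f :: "(real^'n) \<times> real \<Rightarrow> real" and S :: "real set"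
    by (rule Bochner_Integration.integrable_bound[OF that(1)]) (use that in \<open>auto simp: indicator_def\<close>)
  define m where "m = (D / \<alpha>\<^sup>2) powr (N / 2)"
  define M where "M u = m * (LINT z|lborel. indicator {0<..<u} (snd z) * g z powr (N + 2))" for u
  have J': "AE z in lborel. \<alpha> * A z \<le> J z \<bullet> X z" using J by (simp add: A_def mult.assoc)
  show ?thesis
  proof (rule pos_energy_zero[OF \<alpha> _ _ A0 iA g0 J' KA gW _ _ init t, where M = M])
    show "continuous_on {0..T} M" unfolding M_def by (intro continuous_intros LINT_slab_continuous iG)
    fix s0 s1 Y :: real
    assume s01: "0 < s0" "s0 < s1" "s1 \<le> T" "0 < Y" and Y: "\<And>s. s0 < s \<Longrightarrow> s < s1 \<Longrightarrow> pos_energy s \<le> Y"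
    let ?I = "indicator {s0<..<s1} :: real \<Rightarrow> real"
    let ?a = "LINT z|lborel. ?I (snd z) * (heaviside (W z) * A z)"
    let ?w = "LINT z|lborel. ?I (snd z) * max 0 (W z) powr ?q"
    let ?G = "LINT z|lborel. ?I (snd z) * g z powr (N + 2)"
    \<comment> \<open>The first term of Young's inequality is to be exactly \<alpha>^2 times the
      dissipation, so \<kappa> D Y^(2/N) = \<alpha>^2. The other coefficient is then
      \<kappa>^(-N/2), where the powers of Y combine to Y itself: the linear dependence on Y that
      the Gronwall step requires.\<close>
    define \<kappa> where "\<kappa> = \<alpha>\<^sup>2 / (D * Y powr (2 / N))"
    have \<kappa>: "\<kappa> > 0" using \<alpha> D s01 by (simp add: \<kappa>_def)
    define k where "k = \<kappa> powr (1 / ?R)"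
    have k: "k > 0" using \<kappa> by (simp add: k_def)
    have kR: "k powr ?R = \<kappa>"
    proof -
      have "k powr ?R = \<kappa> powr (1 / ?R * ?R)" unfolding k_def by (rule powr_powr)
      also have "1 / ?R * ?R = 1" using PR by simp
      finally show ?thesis using \<kappa> by simp
    qed
    have kP: "k powr (- ?P) = m * Y"
    proof -
      have "k powr (- ?P) = \<kappa> powr (1 / ?R * (- ?P))" unfolding k_def by (rule powr_powr)
      also have "1 / ?R * (- ?P) = - (N / 2)" using N by (simp add: field_simps)
      also have "\<kappa> powr (- (N / 2)) = (1 / \<kappa>) powr (N / 2)" using \<kappa> by (simp add: powr_minus_divide powr_divide)
      also have "1 / \<kappa> = (D / \<alpha>\<^sup>2) * Y powr (2 / N)" by (simp add: \<kappa>_def)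
      also have "\<dots> powr (N / 2) = m * (Y powr (2 / N)) powr (N / 2)"
        unfolding m_def by (rule powr_mult)
      also have "(Y powr (2 / N)) powr (N / 2) = Y"
      proof -
        have "(Y powr (2 / N)) powr (N / 2) = Y powr (2 / N * (N / 2))" by (rule powr_powr)
        also have "2 / N * (N / 2) = 1" using N by simp
        finally show ?thesis using s01 by simp
      qed
      finally show ?thesis .
    qed
    have w: "?w \<le> D * Y powr (2 / N) * ?a"
    proof -
      have "?w \<le> gn_const N * (3 * Y) powr (2 / N) * 2 * c * ?a"
        unfolding N_def using pos_part_Lq_slab(2)[OF p2 _ A0 iA c XA, of s0 s1 Y] s01 Y by simp
      also have "\<dots> = D * Y powr (2 / N) * ?a" by (simp add: D_def powr_mult)
      finally show ?thesis .
    qed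
    have "(LINT z|lborel. ?I (snd z) * ((g z)\<^sup>2 * (max 0 (W z))\<^sup>2))
      \<le> (LINT z|lborel. k powr ?R * (?I (snd z) * max 0 (W z) powr ?q) + k powr (- ?P) * (?I (snd z) * g z powr (N + 2)))"
    proof (rule integral_mono)
      show "integrable lborel (\<lambda>z. ?I (snd z) * ((g z)\<^sup>2 * (max 0 (W z))\<^sup>2))" by (intro iS gW) simp
      show "integrable lborel (\<lambda>z. k powr ?R * (?I (snd z) * max 0 (W z) powr ?q) + k powr (- ?P) * (?I (snd z) * g z powr (N + 2)))"
        using iS[OF iWq, of "{s0<..<s1}"] iS[OF iG, of "{s0<..<s1}"] by simp
      show "?I (snd z) * ((g z)\<^sup>2 * (max 0 (W z))\<^sup>2) \<le> k powr ?R * (?I (snd z) * max 0 (W z) powr ?q) + k powr (- ?P) * (?I (snd z) * g z powr (N + 2))" for z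
        using Yg[OF k, of z] by (auto simp: indicator_def)
    qed
    also have "\<dots> = k powr ?R * ?w + k powr (- ?P) * ?G"
      using iS[OF iWq, of "{s0<..<s1}"] iS[OF iG, of "{s0<..<s1}"] by simp
    also have "\<dots> \<le> \<kappa> * (D * Y powr (2 / N) * ?a) + m * Y * ?G"
      unfolding kR kP using \<kappa> w by (intro add_right_mono mult_left_mono) auto
    also have "\<kappa> * (D * Y powr (2 / N) * ?a) = \<alpha>\<^sup>2 * ?a" using D s01 by (simp add: \<kappa>_def)
    also have "m * Y * ?G = Y * (M s1 - M s0)"
      unfolding LINT_slab_diff[OF iG s01(1,2)] M_def by (simp add: algebra_simps)
    finally show "(LINT z|lborel. ?I (snd z) * ((g z)\<^sup>2 * (max 0 (W z))\<^sup>2)) \<le> \<alpha>\<^sup>2 * ?a + Y * (M s1 - M s0)" .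
  qed auto
qed

end

section \<open>Comparison of weak solutions\<close>

lemma C_L2_diff:
  fixes u v :: "(real^'n) \<times> real \<Rightarrow> real"
  assumes u: "C_L2 \<Omega> T u" and v: "C_L2 \<Omega> T v"
  shows "C_L2 \<Omega> T (\<lambda>z. u z - v z)"
  unfolding C_L2_def
proof (intro conjI ballI)
  let ?M = "lebesgue_on \<Omega>"
  have L: "(\<lambda>x. u (x, t)) \<in> Lp \<Omega> 2" "(\<lambda>x. v (x, t)) \<in> Lp \<Omega> 2" if "t \<in> {0..T}" for t
    using u v that by (auto simp: C_L2_def)
  show "(\<lambda>x. u (x, t) - v (x, t)) \<in> Lp \<Omega> 2" if "t \<in> {0..T}" for t
    by (rule Lp_diff) (use L[OF that] in auto)
  fix s assume s: "s \<in> {0..T}"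
  let ?U = "\<lambda>t. Lp_norm \<Omega> 2 (\<lambda>x. u (x, t) - u (x, s))" and ?V = "\<lambda>t. Lp_norm \<Omega> 2 (\<lambda>x. v (x, t) - v (x, s))"
  show "((\<lambda>t. Lp_norm \<Omega> 2 (\<lambda>x. u (x, t) - v (x, t) - (u (x, s) - v (x, s)))) \<longlongrightarrow> 0) (at s within {0..T})"
  proof (rule Lim_null_comparison)
    have "((\<lambda>t. 2 * (?U t + ?V t)) \<longlongrightarrow> 2 * (0 + 0)) (at s within {0..T})"
      using u v s by (intro tendsto_intros) (auto simp: C_L2_def)
    then show "((\<lambda>t. 2 * (?U t + ?V t)) \<longlongrightarrow> 0) (at s within {0..T})" by simp
    have "norm (Lp_norm \<Omega> 2 (\<lambda>x. u (x, t) - v (x, t) - (u (x, s) - v (x, s)))) \<le> 2 * (?U t + ?V t)"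
      if t: "t \<in> {0..T}" for t
    proof -
      have nn: "0 \<le> Lp_norm S 2 f" for S and f :: "real^'n \<Rightarrow> real" by (simp add: Lp_norm_def)
      have du: "(\<lambda>x. u (x, t) - u (x, s)) \<in> Lp \<Omega> 2" "(\<lambda>x. v (x, t) - v (x, s)) \<in> Lp \<Omega> 2"
        using L[OF t] L[OF s] by (auto intro: Lp_diff)
      have "(Lp_norm \<Omega> 2 (\<lambda>x. u (x, t) - v (x, t) - (u (x, s) - v (x, s))))\<^sup>2
        = (LINT x|?M. norm ((u (x, t) - u (x, s)) - (v (x, t) - v (x, s))) powr 2)"
        by (simp add: Lp_norm_2_power2 algebra_simps)
      also have "\<dots> \<le> 2 powr 2 * ((LINT x|?M. norm (u (x, t) - u (x, s)) powr 2) + (LINT x|?M. norm (v (x, t) - v (x, s)) powr 2))"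
        by (rule integrable_powr_diff(2)) (use du in \<open>auto simp: Lp_def\<close>)
      also have "\<dots> = 4 * ((?U t)\<^sup>2 + (?V t)\<^sup>2)" by (simp add: Lp_norm_2_power2)
      finally have le: "(Lp_norm \<Omega> 2 (\<lambda>x. u (x, t) - v (x, t) - (u (x, s) - v (x, s))))\<^sup>2 \<le> 4 * ((?U t)\<^sup>2 + (?V t)\<^sup>2)" .
      have R: "norm n \<le> 2 * (y + z)" if "n\<^sup>2 \<le> 4 * (y\<^sup>2 + z\<^sup>2)" "0 \<le> y" "0 \<le> z" for n y z :: real
      proof (rule power2_le_imp_le)
        have "(norm n)\<^sup>2 = n\<^sup>2" by simp
        also have "\<dots> \<le> 4 * (y\<^sup>2 + z\<^sup>2) + 8 * (y * z)" using that(1) mult_nonneg_nonneg[OF that(2,3)] by linarith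
        also have "\<dots> = (2 * (y + z))\<^sup>2" by (simp add: power2_eq_square algebra_simps)
        finally show "(norm n)\<^sup>2 \<le> (2 * (y + z))\<^sup>2" .
      qed (use that in simp)
      show ?thesis by (rule R[OF le nn nn])
    qed
    then show "\<forall>\<^sub>F t in at s within {0..T}. norm (Lp_norm \<Omega> 2 (\<lambda>x. u (x, t) - v (x, t) - (u (x, s) - v (x, s)))) \<le> 2 * (?U t + ?V t)"
      unfolding eventually_at_filter by (intro always_eventually allI impI)
  qed
qed

lemma integrable_mult_bounded:
  fixes f g :: "'z \<Rightarrow> real"
  assumes f: "integrable M f" and g: "g \<in> borel_measurable M" and B: "\<And>z. \<bar>g z\<bar> \<le> B"
  shows "integrable M (\<lambda>z. f z * g z)"
proof (rule Bochner_Integration.integrable_bound)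
  show "integrable M (\<lambda>z. B * \<bar>f z\<bar>)" using f by simp
  show "(\<lambda>z. f z * g z) \<in> borel_measurable M" using f g by measurable
  show "AE z in M. norm (f z * g z) \<le> norm (B * \<bar>f z\<bar>)"
  proof (rule AE_I2)
    fix z
    have "norm (f z * g z) \<le> \<bar>f z\<bar> * B" by (simp add: abs_mult mult_left_mono B)
    then show "norm (f z * g z) \<le> norm (B * \<bar>f z\<bar>)" by (simp add: mult.commute)
  qed
qed

lemma cylinder_mono: "t \<le> T \<Longrightarrow> cylinder \<Omega> t \<subseteq> cylinder \<Omega> T"
  by (auto simp: mem_cylinder)

text \<open>A test function constant in time has time derivative 0, so the terms with u and v times
  that derivative drop out, and subtraction leaves fluxes, Hamiltonians and boundary terms in
  time.\<close>

lemma weak_solutions_difference: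
  fixes \<Omega> :: "(real^'n) set" and u v :: "(real^'n) \<times> real \<Rightarrow> real"
  assumes \<Omega>: "open \<Omega>" "bounded \<Omega>" and T: "T > 0" and p: "p > 1"
    and au: "(\<lambda>z. a z (Du z)) \<in> Lp (cylinder \<Omega> T) (conj_exp p)" and av: "(\<lambda>z. a z (Dv z)) \<in> Lp (cylinder \<Omega> T) (conj_exp p)"
    and Hu: "integrable (lebesgue_on (cylinder \<Omega> T)) (\<lambda>z. H z (Du z))" and Hv: "integrable (lebesgue_on (cylinder \<Omega> T)) (\<lambda>z. H z (Dv z))"
    and cu: "C_L2 \<Omega> T u" and cv: "C_L2 \<Omega> T v"
    and tu: "\<forall>t\<in>{0<..T}. \<forall>\<psi> \<psi>t D\<psi>. W12_L2 \<Omega> T \<psi> \<psi>t \<longrightarrow> Lp_W1p_0 \<Omega> T p \<psi> D\<psi> \<longrightarrow>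
          (LINT x|lebesgue_on \<Omega>. u (x, t) * \<psi> (x, t))
          + (LINT z|lebesgue_on (cylinder \<Omega> t). - (u z * \<psi>t z) + a z (Du z) \<bullet> D\<psi> z + H z (Du z) * \<psi> z)
          = (LINT x|lebesgue_on \<Omega>. u (x, 0) * \<psi> (x, 0))
          + (LINT z|lebesgue_on (cylinder \<Omega> t). f0 z * \<psi> z + F z \<bullet> D\<psi> z)"
    and tv: "\<forall>t\<in>{0<..T}. \<forall>\<psi> \<psi>t D\<psi>. W12_L2 \<Omega> T \<psi> \<psi>t \<longrightarrow> Lp_W1p_0 \<Omega> T p \<psi> D\<psi> \<longrightarrow>
          (LINT x|lebesgue_on \<Omega>. v (x, t) * \<psi> (x, t))
          + (LINT z|lebesgue_on (cylinder \<Omega> t). - (v z * \<psi>t z) + a z (Dv z) \<bullet> D\<psi> z + H z (Dv z) * \<psi> z)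
          = (LINT x|lebesgue_on \<Omega>. v (x, 0) * \<psi> (x, 0))
          + (LINT z|lebesgue_on (cylinder \<Omega> t). f0 z * \<psi> z + F z \<bullet> D\<psi> z)"
    and \<phi>: "\<phi> \<in> borel_measurable borel" "W1p_0 \<Omega> p \<phi> D\<phi>" "\<And>x. \<bar>\<phi> x\<bar> \<le> B"
    and t: "0 < t" "t \<le> T"
  shows "(LINT x|lebesgue_on \<Omega>. (u (x, t) - v (x, t)) * \<phi> x)
      + (LINT z|lebesgue_on (cylinder \<Omega> t). (a z (Du z) - a z (Dv z)) \<bullet> D\<phi> (fst z) + (H z (Du z) - H z (Dv z)) * \<phi> (fst z))
      = (LINT x|lebesgue_on \<Omega>. (u (x, 0) - v (x, 0)) * \<phi> x)"
proof -
  let ?M = "lebesgue_on \<Omega>" and ?Q = "cylinder \<Omega> T" and ?Qt = "cylinder \<Omega> t"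
  let ?q = "conj_exp p"
  have pq: "p > 1" "?q > 1" "1/p + 1/?q = 1" using p by (auto simp: conj_exp_def field_simps)
  have \<Omega>l: "\<Omega> \<in> lmeasurable" using \<Omega> by (simp add: bounded_set_imp_lmeasurable)
  interpret F: finite_measure ?M by (rule finite_measure_lebesgue_on[OF \<Omega>l])
  have \<phi>m: "\<phi> \<in> borel_measurable ?M" by (rule LpD(1)[OF W1p_0_Lp(1)[OF \<phi>(2)]])
  have \<phi>2: "\<phi> \<in> Lp \<Omega> 2" by (rule Lp_bounded[OF \<Omega>l \<phi>m, of B]) (use \<phi>(3) in auto)
  note W12 = W12_L2_const[OF \<Omega>(1) \<phi>2, of T] and LpW = Lp_W1p_0_const[OF \<Omega>(1) \<phi>(2), of T]
  have f: "(\<lambda>z. \<phi> (fst z)) \<in> borel_measurable (lebesgue_on ?Q)" "(\<lambda>z. D\<phi> (fst z)) \<in> Lp ?Q p"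
    using LpW by (auto simp: Lp_W1p_0_def Lp_def)
  have sub: "integrable (lebesgue_on ?Qt) g" if "integrable (lebesgue_on ?Q) g" for g :: "(real^'n) \<times> real \<Rightarrow> real"
    by (rule integrable_lebesgue_on_mono[OF that cylinder_borel[OF \<Omega>(1)] cylinder_borel[OF \<Omega>(1)] cylinder_mono[OF t(2)]])
  have ia: "integrable (lebesgue_on ?Qt) (\<lambda>z. g z \<bullet> D\<phi> (fst z))" if "g \<in> Lp ?Q ?q" for g
    by (rule sub, rule integrable_inner_powr(2)[OF pq LpD(1)[OF that] LpD(1)[OF f(2)] LpD(2)[OF that] LpD(2)[OF f(2)]])
  have ih: "integrable (lebesgue_on ?Qt) (\<lambda>z. g z * \<phi> (fst z))" if "integrable (lebesgue_on ?Q) g" for g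
    by (rule sub, rule integrable_mult_bounded[OF that f(1) \<phi>(3)])
  have iw: "integrable ?M (\<lambda>x. g (x, s) * \<phi> x)" if g: "C_L2 \<Omega> T g" and s: "s \<in> {0..T}" for g s
  proof -
    have L: "(\<lambda>x. g (x, s)) \<in> Lp \<Omega> 2" using g s unfolding C_L2_def by blast
    have "integrable ?M (\<lambda>x. g (x, s))"
      by (rule F.integrable_norm_of_powr(1)[OF LpD(1)[OF L] _ LpD(2)[OF L]]) simp
    then show ?thesis by (rule integrable_mult_bounded[OF _ \<phi>m \<phi>(3)])
  qed
  have st: "t \<in> {0..T}" "0 \<in> {0..T}" "t \<in> {0<..T}" using t T by auto
  have eu: "(LINT x|?M. u (x, t) * \<phi> x) + (LINT z|lebesgue_on ?Qt. a z (Du z) \<bullet> D\<phi> (fst z) + H z (Du z) * \<phi> (fst z))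
      = (LINT x|?M. u (x, 0) * \<phi> x) + (LINT z|lebesgue_on ?Qt. f0 z * \<phi> (fst z) + F z \<bullet> D\<phi> (fst z))"
    using tu[rule_format, OF st(3) W12 LpW] by (simp only: fst_conv mult_zero_right minus_zero add_0_left)
  have ev: "(LINT x|?M. v (x, t) * \<phi> x) + (LINT z|lebesgue_on ?Qt. a z (Dv z) \<bullet> D\<phi> (fst z) + H z (Dv z) * \<phi> (fst z))
      = (LINT x|?M. v (x, 0) * \<phi> x) + (LINT z|lebesgue_on ?Qt. f0 z * \<phi> (fst z) + F z \<bullet> D\<phi> (fst z))"
    using tv[rule_format, OF st(3) W12 LpW] by (simp only: fst_conv mult_zero_right minus_zero add_0_left)
  have w: "(LINT x|?M. (u (x, s) - v (x, s)) * \<phi> x) = (LINT x|?M. u (x, s) * \<phi> x) - (LINT x|?M. v (x, s) * \<phi> x)"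
    if "s \<in> {0..T}" for s
    unfolding left_diff_distrib by (rule Bochner_Integration.integral_diff[OF iw[OF cu that] iw[OF cv that]])
  have d: "(LINT z|lebesgue_on ?Qt. (a z (Du z) - a z (Dv z)) \<bullet> D\<phi> (fst z) + (H z (Du z) - H z (Dv z)) * \<phi> (fst z))
    = (LINT z|lebesgue_on ?Qt. a z (Du z) \<bullet> D\<phi> (fst z) + H z (Du z) * \<phi> (fst z))
      - (LINT z|lebesgue_on ?Qt. a z (Dv z) \<bullet> D\<phi> (fst z) + H z (Dv z) * \<phi> (fst z))"
  proof (subst Bochner_Integration.integral_diff[symmetric])
    show "integrable (lebesgue_on ?Qt) (\<lambda>z. a z (Du z) \<bullet> D\<phi> (fst z) + H z (Du z) * \<phi> (fst z))"
      by (rule Bochner_Integration.integrable_add[OF ia[OF au] ih[OF Hu]])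
    show "integrable (lebesgue_on ?Qt) (\<lambda>z. a z (Dv z) \<bullet> D\<phi> (fst z) + H z (Dv z) * \<phi> (fst z))"
      by (rule Bochner_Integration.integrable_add[OF ia[OF av] ih[OF Hv]])
  qed (intro Bochner_Integration.integral_cong refl, simp add: inner_diff_left left_diff_distrib)
  \<comment> \<open>The source integrals of the two weak forms are the same real number, denoted r
    here, and cancel as such.\<close>
  have R: "(ut - vt) + (ua - va) = u0 - v0" if "ut + ua = u0 + r" "vt + va = v0 + r" for ut vt ua va u0 v0 r :: real
    using that by linarith
  show ?thesis unfolding w[OF st(1)] w[OF st(2)] d by (rule R[OF eu ev])
qed

text \<open>Representatives of the two gradients are returned separately, because the structure
  conditions evaluate \<open>a\<close> and \<open>H\<close> at two arguments and not at their
  difference.\<close>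

lemma weak_solutions_parabolic_difference:
  fixes \<Omega> :: "(real^'n) set" and u v :: "(real^'n) \<times> real \<Rightarrow> real" and p :: real
  defines "N \<equiv> real CARD('n)"
  assumes \<Omega>: "open \<Omega>" "bounded \<Omega>" and T: "T > 0" and p: "p > 1"
    and a: "caratheodory (cylinder \<Omega> T) a" and H: "caratheodory (cylinder \<Omega> T) H"
    and a1: "a\<^sub>1 \<in> Lp (cylinder \<Omega> T) (conj_exp p)" and b: "b \<in> Lp (cylinder \<Omega> T) (N + 2)"
    and ga: "AE z in lebesgue_on (cylinder \<Omega> T). \<forall>\<xi>. norm (a z \<xi>) \<le> \<beta> * (norm \<xi> powr (p - 1) + (a\<^sub>1 z :: real))"
    and gH: "AE z in lebesgue_on (cylinder \<Omega> T). \<forall>\<xi>. \<bar>H z \<xi>\<bar> \<le> b z * norm \<xi> powr (p - (N + p) / (N + 2))"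
    and u: "weak_solution \<Omega> T p a H f0 F (\<lambda>x. u (x, 0)) u" and v: "weak_solution \<Omega> T p a H f0 F (\<lambda>x. v (x, 0)) v"
  obtains W K X J Xu Xv where "parabolic_difference \<Omega> T p (\<lambda>z. u z - v z) W K X J"
    "Xu \<in> borel_measurable borel" "Xv \<in> borel_measurable borel"
    "\<And>z. z \<notin> cylinder \<Omega> T \<Longrightarrow> Xu z = 0 \<and> Xv z = 0"
    "integrable lborel (\<lambda>z. norm (Xu z) powr p)" "integrable lborel (\<lambda>z. norm (Xv z) powr p)"
    "\<And>z. X z = Xu z - Xv z"
    "AE z in lborel. z \<in> cylinder \<Omega> T \<longrightarrow>
      W z = u z - v z \<and> J z = a z (Xu z) - a z (Xv z) \<and> K z = H z (Xu z) - H z (Xv z)"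
proof -
  let ?Q = "cylinder \<Omega> T" and ?q = "conj_exp p"
  have Q: "?Q \<in> sets borel" "?Q \<in> lmeasurable" using cylinder_borel[OF \<Omega>(1)] cylinder_lmeasurable[OF \<Omega>] .
  have \<Omega>b: "\<Omega> \<in> sets borel" using \<Omega> by simp
  have q: "?q > 0" using p by (simp add: conj_exp_def)
  have N: "N > 0" by (simp add: N_def)
  obtain Du where Du: "Lp_W1p_0 \<Omega> T p u Du" and tu: "\<forall>t\<in>{0<..T}. \<forall>\<psi> \<psi>t D\<psi>. W12_L2 \<Omega> T \<psi> \<psi>t \<longrightarrow> Lp_W1p_0 \<Omega> T p \<psi> D\<psi> \<longrightarrow>
          (LINT x|lebesgue_on \<Omega>. u (x, t) * \<psi> (x, t))
          + (LINT z|lebesgue_on (cylinder \<Omega> t). - (u z * \<psi>t z) + a z (Du z) \<bullet> D\<psi> z + H z (Du z) * \<psi> z)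
          = (LINT x|lebesgue_on \<Omega>. u (x, 0) * \<psi> (x, 0))
          + (LINT z|lebesgue_on (cylinder \<Omega> t). f0 z * \<psi> z + F z \<bullet> D\<psi> z)"
    using u unfolding weak_solution_def by blast
  obtain Dv where Dv: "Lp_W1p_0 \<Omega> T p v Dv" and tv: "\<forall>t\<in>{0<..T}. \<forall>\<psi> \<psi>t D\<psi>. W12_L2 \<Omega> T \<psi> \<psi>t \<longrightarrow> Lp_W1p_0 \<Omega> T p \<psi> D\<psi> \<longrightarrow>
          (LINT x|lebesgue_on \<Omega>. v (x, t) * \<psi> (x, t))
          + (LINT z|lebesgue_on (cylinder \<Omega> t). - (v z * \<psi>t z) + a z (Dv z) \<bullet> D\<psi> z + H z (Dv z) * \<psi> z)
          = (LINT x|lebesgue_on \<Omega>. v (x, 0) * \<psi> (x, 0))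
          + (LINT z|lebesgue_on (cylinder \<Omega> t). f0 z * \<psi> z + F z \<bullet> D\<psi> z)"
    using v unfolding weak_solution_def by blast
  have cu: "C_L2 \<Omega> T u" and cv: "C_L2 \<Omega> T v" using u v by (auto simp: weak_solution_def)
  have uL: "u \<in> Lp ?Q p" "Du \<in> Lp ?Q p" and vL: "v \<in> Lp ?Q p" "Dv \<in> Lp ?Q p"
    using Du Dv by (auto simp: Lp_W1p_0_def)
  have au: "(\<lambda>z. a z (Du z)) \<in> Lp ?Q ?q" and av: "(\<lambda>z. a z (Dv z)) \<in> Lp ?Q ?q"
    by (rule flux_Lp[OF Q(1) p a a1 ga uL(2)], rule flux_Lp[OF Q(1) p a a1 ga vL(2)])
  have p1: "p \<ge> 1" using p by simp
  have Hu: "integrable (lebesgue_on ?Q) (\<lambda>z. H z (Du z))" and Hv: "integrable (lebesgue_on ?Q) (\<lambda>z. H z (Dv z))"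
    by (rule Hamiltonian_L1[OF Q p1 N H b gH uL(2)], rule Hamiltonian_L1[OF Q p1 N H b gH vL(2)])
  have wL: "(\<lambda>z. u z - v z) \<in> Lp ?Q p" using uL vL p by (auto intro: Lp_diff)
  have JL: "(\<lambda>z. a z (Du z) - a z (Dv z)) \<in> Lp ?Q ?q" using au av q by (auto intro: Lp_diff)
  have KL: "integrable (lebesgue_on ?Q) (\<lambda>z. H z (Du z) - H z (Dv z))" using Hu Hv by simp
  obtain W where W: "W \<in> borel_measurable borel" "\<And>z. z \<notin> ?Q \<Longrightarrow> W z = 0" "AE z in lborel. z \<in> ?Q \<longrightarrow> W z = u z - v z"
    using lebesgue_on_borel_rep[OF Q(1) LpD(1)[OF wL]] by blast
  obtain J where J: "J \<in> borel_measurable borel" "\<And>z. z \<notin> ?Q \<Longrightarrow> J z = 0" "AE z in lborel. z \<in> ?Q \<longrightarrow> J z = a z (Du z) - a z (Dv z)"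
    using lebesgue_on_borel_rep[OF Q(1) LpD(1)[OF JL]] by blast
  obtain K where K: "K \<in> borel_measurable borel" "\<And>z. z \<notin> ?Q \<Longrightarrow> K z = 0" "AE z in lborel. z \<in> ?Q \<longrightarrow> K z = H z (Du z) - H z (Dv z)"
    using lebesgue_on_borel_rep[OF Q(1) borel_measurable_integrable[OF KL]] by blast
  obtain Xu where Xu: "Xu \<in> borel_measurable borel" "\<And>z. z \<notin> ?Q \<Longrightarrow> Xu z = 0" "AE z in lborel. z \<in> ?Q \<longrightarrow> Xu z = Du z"
    using lebesgue_on_borel_rep[OF Q(1) LpD(1)[OF uL(2)]] by blast
  obtain Xv where Xv: "Xv \<in> borel_measurable borel" "\<And>z. z \<notin> ?Q \<Longrightarrow> Xv z = 0" "AE z in lborel. z \<in> ?Q \<longrightarrow> Xv z = Dv z"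
    using lebesgue_on_borel_rep[OF Q(1) LpD(1)[OF vL(2)]] by blast
  define X where "X z = Xu z - Xv z" for z
  have powr_rep: "integrable lborel (\<lambda>z. norm (f' z) powr e)"
    if f: "f \<in> Lp ?Q e" and f': "f' \<in> borel_measurable borel" "\<And>z. z \<notin> ?Q \<Longrightarrow> f' z = 0" "AE z in lborel. z \<in> ?Q \<longrightarrow> f' z = f z"
    for f f' :: "(real^'n) \<times> real \<Rightarrow> real^'n" and e
  proof (subst integrable_lebesgue_on_iff(1)[OF Q(1), symmetric])
    show "integrable (lebesgue_on ?Q) (\<lambda>z. norm (f z) powr e)" by (rule LpD[OF f])
    show "(\<lambda>z. norm (f z) powr e) \<in> borel_measurable (lebesgue_on ?Q)" using LpD(1)[OF f] by measurable
    show "AE z in lborel. z \<in> ?Q \<longrightarrow> norm (f' z) powr e = norm (f z) powr e" using f'(3) by eventually_elim auto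
  qed (use f' in auto)
  have Xup: "integrable lborel (\<lambda>z. norm (Xu z) powr p)" by (rule powr_rep[OF uL(2)]) (fact Xu)+
  have Xvp: "integrable lborel (\<lambda>z. norm (Xv z) powr p)" by (rule powr_rep[OF vL(2)]) (fact Xv)+
  have Jq: "integrable lborel (\<lambda>z. norm (J z) powr ?q)" by (rule powr_rep[OF JL]) (fact J)+
  have "parabolic_difference \<Omega> T p (\<lambda>z. u z - v z) W K X J"
  proof
    show "open \<Omega>" "bounded \<Omega>" "T > 0" "p > 1" by (fact \<Omega> T p)+
    show "C_L2 \<Omega> T (\<lambda>z. u z - v z)" by (rule C_L2_diff[OF cu cv])
    show "W \<in> borel_measurable borel" "K \<in> borel_measurable borel" "J \<in> borel_measurable borel" by (fact W K J)+
    show "X \<in> borel_measurable borel" unfolding X_def using Xu(1) Xv(1) by measurable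
    show "W z = 0 \<and> K z = 0 \<and> X z = 0 \<and> J z = 0" if "z \<notin> ?Q" for z
      using W(2) K(2) J(2) Xu(2) Xv(2) that by (simp add: X_def)
    show "integrable lborel (\<lambda>z. norm (X z) powr p)"
      unfolding X_def by (rule integrable_powr_diff(1)) (use Xu(1) Xv(1) Xup Xvp p in auto)
    show "integrable lborel (\<lambda>z. norm (J z) powr ?q)" by (rule Jq)
    show "integrable lborel K"
      by (subst integrable_lebesgue_on_iff(1)[OF Q(1) K borel_measurable_integrable[OF KL], symmetric], assumption, rule KL)
    have su: "AE t in lborel. t \<in> {0<..<T} \<longrightarrow> W1p_0 \<Omega> p (\<lambda>x. u (x, t)) (\<lambda>x. Du (x, t))"
      and sv: "AE t in lborel. t \<in> {0<..<T} \<longrightarrow> W1p_0 \<Omega> p (\<lambda>x. v (x, t)) (\<lambda>x. Dv (x, t))"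
      using Du Dv by (auto simp: Lp_W1p_0_def AE_lebesgue_on_iff)
    have "AE z in lborel. z \<in> ?Q \<longrightarrow> W z = u z - v z \<and> X z = Du z - Dv z"
      using W(3) Xu(3) Xv(3) by eventually_elim (simp add: X_def)
    \<comment> \<open>On almost every slice W and X agree almost everywhere with the differences of
      the solutions and of their gradients, so membership in W_0^{1,p} carries over.\<close>
    from AE_lborel_slices[OF this] su sv
    show "AE t in lborel. 0 < t \<and> t < T \<longrightarrow> W1p_0 \<Omega> p (\<lambda>x. W (x, t)) (\<lambda>x. X (x, t)) \<and> (AE x in lebesgue_on \<Omega>. W (x, t) = u (x, t) - v (x, t))"
    proof (eventually_elim, intro impI)
      fix t
      assume ae: "AE x in lborel. (x, t) \<in> ?Q \<longrightarrow> W (x, t) = u (x, t) - v (x, t) \<and> X (x, t) = Du (x, t) - Dv (x, t)"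
        and t: "0 < t \<and> t < T"
        and W1: "t \<in> {0<..<T} \<longrightarrow> W1p_0 \<Omega> p (\<lambda>x. u (x, t)) (\<lambda>x. Du (x, t))" "t \<in> {0<..<T} \<longrightarrow> W1p_0 \<Omega> p (\<lambda>x. v (x, t)) (\<lambda>x. Dv (x, t))"
      have ae1: "AE x in lebesgue_on \<Omega>. W (x, t) = u (x, t) - v (x, t)"
        and ae2: "AE x in lebesgue_on \<Omega>. X (x, t) = Du (x, t) - Dv (x, t)"
        using ae t by (auto simp: AE_lebesgue_on_iff[OF \<Omega>b] mem_cylinder elim!: eventually_mono)
      have d: "W1p_0 \<Omega> p (\<lambda>x. u (x, t) - v (x, t)) (\<lambda>x. Du (x, t) - Dv (x, t))"
        by (rule W1p_0_diff[OF \<Omega> p1]) (use W1 t in auto)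
      have "W1p_0 \<Omega> p (\<lambda>x. W (x, t)) (\<lambda>x. X (x, t))"
      proof (rule W1p_0_cong_AE[OF \<Omega> _ d])
        show "0 \<le> p" using p by simp
        show "AE x in lebesgue_on \<Omega>. u (x, t) - v (x, t) = W (x, t)" using ae1 by eventually_elim (rule sym)
        show "AE x in lebesgue_on \<Omega>. Du (x, t) - Dv (x, t) = X (x, t)" using ae2 by eventually_elim (rule sym)
      qed
      with ae1 show "W1p_0 \<Omega> p (\<lambda>x. W (x, t)) (\<lambda>x. X (x, t)) \<and> (AE x in lebesgue_on \<Omega>. W (x, t) = u (x, t) - v (x, t))" by blast
    qed
    fix \<phi> :: "real^'n \<Rightarrow> real" and D\<phi> B t
    assume \<phi>: "\<phi> \<in> borel_measurable borel" "D\<phi> \<in> borel_measurable borel" "W1p_0 \<Omega> p \<phi> D\<phi>" "\<And>x. \<bar>\<phi> x\<bar> \<le> B" and t: "0 < t" "t \<le> T"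
    let ?Qt = "cylinder \<Omega> t"
    have fm: "fst \<in> borel_measurable (borel :: ((real^'n) \<times> real) measure)"
      "snd \<in> borel_measurable (borel :: ((real^'n) \<times> real) measure)"
      by (intro borel_measurable_continuous_onI continuous_intros)+
    note [measurable] = fm \<phi>(1,2) J(1) K(1)
    have Qt: "?Qt \<in> sets borel" by (rule cylinder_borel[OF \<Omega>(1)])
    have "(LINT z|lebesgue_on ?Qt. (a z (Du z) - a z (Dv z)) \<bullet> D\<phi> (fst z) + (H z (Du z) - H z (Dv z)) * \<phi> (fst z))
      = (LINT z|lborel. indicator {0<..<t} (snd z) * (J z \<bullet> D\<phi> (fst z) + K z * \<phi> (fst z)))"
    proof (rule integrable_lebesgue_on_iff(2)[OF Qt])
      show m: "(\<lambda>z. indicator {0<..<t} (snd z) * (J z \<bullet> D\<phi> (fst z) + K z * \<phi> (fst z))) \<in> borel_measurable borel" by measurable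
      show "indicator {0<..<t} (snd z) * (J z \<bullet> D\<phi> (fst z) + K z * \<phi> (fst z)) = 0" if "z \<notin> ?Qt" for z
        using that J(2)[of z] K(2)[of z] by (auto simp: indicator_def mem_cylinder)
      show ae: "AE z in lborel. z \<in> ?Qt \<longrightarrow> indicator {0<..<t} (snd z) * (J z \<bullet> D\<phi> (fst z) + K z * \<phi> (fst z))
          = (a z (Du z) - a z (Dv z)) \<bullet> D\<phi> (fst z) + (H z (Du z) - H z (Dv z)) * \<phi> (fst z)"
        using J(3) K(3) by eventually_elim (use t in \<open>auto simp: mem_cylinder\<close>)
      show "(\<lambda>z. (a z (Du z) - a z (Dv z)) \<bullet> D\<phi> (fst z) + (H z (Du z) - H z (Dv z)) * \<phi> (fst z)) \<in> borel_measurable (lebesgue_on ?Qt)"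
      proof (rule measurable_eq_AE_lebesgue_on[OF Qt])
        show "(\<lambda>z. indicator {0<..<t} (snd z) * (J z \<bullet> D\<phi> (fst z) + K z * \<phi> (fst z))) \<in> borel_measurable (lebesgue_on ?Qt)"
          by (rule measurable_restrict_space1, rule measurable_completion) (use m in simp)
        show "AE z in lebesgue_on ?Qt. indicator {0<..<t} (snd z) * (J z \<bullet> D\<phi> (fst z) + K z * \<phi> (fst z))
          = (a z (Du z) - a z (Dv z)) \<bullet> D\<phi> (fst z) + (H z (Du z) - H z (Dv z)) * \<phi> (fst z)"
          using ae by (simp only: AE_lebesgue_on_iff[OF Qt])
      qed
    qed
    with weak_solutions_difference[OF \<Omega> T p au av Hu Hv cu cv tu tv \<phi>(1,3,4) t]
    show "(LINT x|lebesgue_on \<Omega>. (u (x, t) - v (x, t)) * \<phi> x)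
        + (LINT z|lborel. indicator {0<..<t} (snd z) * (J z \<bullet> D\<phi> (fst z) + K z * \<phi> (fst z)))
      = (LINT x|lebesgue_on \<Omega>. (u (x, 0) - v (x, 0)) * \<phi> x)" by (simp only:)
  qed
  moreover have "AE z in lborel. z \<in> ?Q \<longrightarrow> W z = u z - v z \<and> J z = a z (Xu z) - a z (Xv z) \<and> K z = H z (Xu z) - H z (Xv z)"
    using W(3) J(3) K(3) Xu(3) Xv(3) by eventually_elim simp
  ultimately show ?thesis
    using Xu(1,2) Xv(1,2) Xup Xvp by (intro that[of W K X J Xu Xv]) (auto simp: X_def)
qed

text \<open>The slab bound over all of (0, T), taken with Y = 0, makes the integral of the squared
  positive part vanish.\<close>

lemma (in parabolic_difference) nonpositive_AE:
  assumes "\<And>t. t \<in> {0..T} \<Longrightarrow> pos_energy t = 0"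
  shows "AE z in lborel. W z \<le> 0"
proof -
  have i: "integrable lborel (\<lambda>z. (max 0 (W z))\<^sup>2)" and le: "(LINT z|lborel. (max 0 (W z))\<^sup>2) \<le> 0"
    using pos_part_L2_slab[of 0 T 0] assms T unfolding W_full_slab by auto
  have "(LINT z|lborel. (max 0 (W z))\<^sup>2) = 0"
    using le by (intro antisym) (auto intro!: integral_nonneg_AE)
  then have "AE z in lborel. (max 0 (W z))\<^sup>2 = 0"
    using integral_nonneg_eq_0_iff_AE[OF i] by auto
  then show ?thesis by eventually_elim (auto simp: max_def split: if_splits)
qed

theorem corollary2p2:
  fixes \<Omega> :: "(real^'n) set"
    and T p \<gamma> \<alpha>\<^sub>1 \<beta>\<^sub>1 \<alpha> \<epsilon> \<eta> \<sigma> N :: real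
    and a :: "(real^'n) \<times> real \<Rightarrow> real^'n \<Rightarrow> real^'n"
    and H :: "(real^'n) \<times> real \<Rightarrow> real^'n \<Rightarrow> real"
    and a\<^sub>1 b h f0 :: "(real^'n) \<times> real \<Rightarrow> real"
    and F :: "(real^'n) \<times> real \<Rightarrow> real^'n"
    and u v :: "(real^'n) \<times> real \<Rightarrow> real"
  defines "N \<equiv> real CARD('n)"
    and "\<gamma> \<equiv> p - (N + p) / (N + 2)"
  assumes "CARD('n) \<ge> 2" and "open \<Omega>" and "bounded \<Omega>" and "T > 0"
    and "caratheodory (cylinder \<Omega> T) a" and "caratheodory (cylinder \<Omega> T) H"
    and "\<alpha>\<^sub>1 > 0" and "\<beta>\<^sub>1 > 0" and "\<alpha> > 0"
    and "a\<^sub>1 \<in> Lp (cylinder \<Omega> T) (conj_exp p)"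
    and "b \<in> Lp (cylinder \<Omega> T) (N + 2)"
    and i: "AE z in lebesgue_on (cylinder \<Omega> T). \<forall>\<xi>. a z \<xi> \<bullet> \<xi> \<ge> \<alpha>\<^sub>1 * norm \<xi> powr p"
    and ii: "AE z in lebesgue_on (cylinder \<Omega> T). \<forall>\<xi>.
          norm (a z \<xi>) \<le> \<beta>\<^sub>1 * (norm \<xi> powr (p - 1) + a\<^sub>1 z)"
    and iii: "AE z in lebesgue_on (cylinder \<Omega> T). \<forall>\<xi>. \<bar>H z \<xi>\<bar> \<le> b z * norm \<xi> powr \<gamma>"
    and iv: "AE z in lebesgue_on (cylinder \<Omega> T). \<forall>\<xi> \<xi>'.
          (a z \<xi> - a z \<xi>') \<bullet> (\<xi> - \<xi>')
            \<ge> \<alpha> * (\<epsilon> + norm \<xi> + norm \<xi>') powr (p - 2) * (norm (\<xi> - \<xi>'))\<^sup>2"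
    and v: "AE z in lebesgue_on (cylinder \<Omega> T). \<forall>\<xi> \<xi>'.
          \<bar>H z \<xi> - H z \<xi>'\<bar> \<le> h z * (\<eta> + norm \<xi> + norm \<xi>') powr \<sigma> * norm (\<xi> - \<xi>')"
    and A_or_B:
      "(p > 1 \<and> 2 * N / (N + 2) \<le> p \<and> p < 2 \<and> \<epsilon> = 0 \<and> h \<in> Linf (cylinder \<Omega> T) \<and> \<eta> > 0
          \<and> \<sigma> \<le> (p - 2) / 2)
       \<or> (\<epsilon> > 0 \<and> \<eta> = 0 \<and>
          (\<exists>r\<ge>N + 2. h \<in> Lp (cylinder \<Omega> T) r
             \<and> 0 \<le> \<sigma> \<and> \<sigma> \<le> p * (1 / (N + 2) - 1 / r) + (p - 2) / 2
             \<and> 2 \<le> p \<and> p \<le> 2 * r * (N + 2) / (r * (N + 2) + 2 * (N + 2) - 2 * r)))"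
    and "f0 \<in> Lp (cylinder \<Omega> T) (conj_exp (p * (N + 2) / N))"
    and "F \<in> Lp (cylinder \<Omega> T) (conj_exp p)"
    and "weak_solution \<Omega> T p a H f0 F (\<lambda>x. u (x, 0)) u"
    and "weak_solution \<Omega> T p a H f0 F (\<lambda>x. v (x, 0)) v"
    and "AE x in lebesgue_on \<Omega>. u (x, 0) \<le> v (x, 0)"
  shows "AE z in lebesgue_on (cylinder \<Omega> T). u z \<le> v z"
proof -
  let ?Q = "cylinder \<Omega> T"
  have \<Omega>: "open \<Omega>" "bounded \<Omega>" and T: "T > 0" by fact+
  have N: "N > 0" by (simp add: N_def)
  have p: "p > 1" using A_or_B by auto
  have Qb: "?Q \<in> sets borel" by (rule cylinder_borel[OF \<Omega>(1)])
  obtain W K X J Xu Xv where PD: "parabolic_difference \<Omega> T p (\<lambda>z. u z - v z) W K X J"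
    and Xm: "Xu \<in> borel_measurable borel" "Xv \<in> borel_measurable borel"
    and offX: "\<And>z. z \<notin> ?Q \<Longrightarrow> Xu z = 0 \<and> Xv z = 0"
    and Xuv: "integrable lborel (\<lambda>z. norm (Xu z) powr p)" "integrable lborel (\<lambda>z. norm (Xv z) powr p)"
    and X: "\<And>z. X z = Xu z - Xv z"
    and rep: "AE z in lborel. z \<in> ?Q \<longrightarrow> W z = u z - v z \<and> J z = a z (Xu z) - a z (Xv z) \<and> K z = H z (Xu z) - H z (Xv z)"
    by (rule weak_solutions_parabolic_difference[OF \<Omega> T p \<open>caratheodory ?Q a\<close> \<open>caratheodory ?Q H\<close>
          \<open>a\<^sub>1 \<in> Lp ?Q (conj_exp p)\<close> \<open>b \<in> Lp ?Q (N + 2)\<close>[unfolded N_def] ii iii[unfolded \<gamma>_def N_def]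
          \<open>weak_solution \<Omega> T p a H f0 F (\<lambda>x. u (x, 0)) u\<close> \<open>weak_solution \<Omega> T p a H f0 F (\<lambda>x. v (x, 0)) v\<close>]) blast
  interpret parabolic_difference \<Omega> T p "\<lambda>z. u z - v z" W K X J by (rule PD)
  \<comment> \<open>The weights in (iv) and (v) depend on the two gradients only through this sum,
    which also dominates the norm of their difference X.\<close>
  define Z where "Z z = norm (Xu z) + norm (Xv z)" for z
  have Zm: "Z \<in> borel_measurable borel" unfolding Z_def using Xm by measurable
  have XZ: "norm (X z) \<le> Z z" for z unfolding X Z_def by (rule norm_triangle_ineq4)
  have offJ: "J z = 0" "K z = 0" "X z = 0" "Z z = 0" if "z \<notin> ?Q" for z
    using off[OF that] offX[OF that] by (auto simp: Z_def)
  have init: "pos_energy 0 = 0"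
  proof -
    have "AE x in lebesgue_on \<Omega>. (max 0 (u (x, 0) - v (x, 0)))\<^sup>2 = 0"
      using \<open>AE x in lebesgue_on \<Omega>. u (x, 0) \<le> v (x, 0)\<close> by eventually_elim simp
    then show ?thesis unfolding pos_energy_def by (rule integral_eq_zero_AE)
  qed
  have JX: "AE z in lborel. \<alpha> * (\<epsilon> + Z z) powr (p - 2) * (norm (X z))\<^sup>2 \<le> J z \<bullet> X z"
    using iv[unfolded AE_lebesgue_on_iff[OF Qb]] rep
  proof eventually_elim
    case (elim z)
    show ?case
    proof (cases "z \<in> ?Q")
      case True
      then have "(a z (Xu z) - a z (Xv z)) \<bullet> (Xu z - Xv z)
          \<ge> \<alpha> * (\<epsilon> + norm (Xu z) + norm (Xv z)) powr (p - 2) * (norm (Xu z - Xv z))\<^sup>2" using elim by blast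
      then show ?thesis using elim True by (simp add: X Z_def add.assoc)
    qed (simp add: offJ)
  qed
  \<comment> \<open>Stated relative to the cylinder, since h is arbitrary outside it. The two cases
    then replace h by a constant and by a Borel representative that vanishes there.\<close>
  have KX: "AE z in lborel. z \<in> ?Q \<longrightarrow> \<bar>K z\<bar> \<le> h z * (\<eta> + Z z) powr \<sigma> * norm (X z)"
    using v[unfolded AE_lebesgue_on_iff[OF Qb]] rep
  proof (eventually_elim, intro impI)
    fix z assume *: "z \<in> ?Q \<longrightarrow> (\<forall>\<xi> \<xi>'. \<bar>H z \<xi> - H z \<xi>'\<bar> \<le> h z * (\<eta> + norm \<xi> + norm \<xi>') powr \<sigma> * norm (\<xi> - \<xi>'))"
      "z \<in> ?Q \<longrightarrow> W z = u z - v z \<and> J z = a z (Xu z) - a z (Xv z) \<and> K z = H z (Xu z) - H z (Xv z)" "z \<in> ?Q"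
    then have "\<bar>H z (Xu z) - H z (Xv z)\<bar> \<le> h z * (\<eta> + norm (Xu z) + norm (Xv z)) powr \<sigma> * norm (Xu z - Xv z)" by blast
    then show "\<bar>K z\<bar> \<le> h z * (\<eta> + Z z) powr \<sigma> * norm (X z)" using * by (simp add: X Z_def add.assoc)
  qed
  have zero: "pos_energy t = 0" if t: "t \<in> {0..T}" for t
    using A_or_B
  proof (elim disjE conjE exE)
    assume A: "p < 2" "\<epsilon> = 0" "h \<in> Linf ?Q" "\<eta> > 0" "\<sigma> \<le> (p - 2) / 2"
    obtain C where C: "AE z in lebesgue_on ?Q. norm (h z) \<le> C" using A(3) by (auto simp: Linf_def)
    show ?thesis
    proof (rule pos_energy_zero_singular[OF \<open>\<alpha> > 0\<close> A(4,1,5) _ Zm XZ _ _ init t])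
      show "AE z in lborel. \<alpha> * Z z powr (p - 2) * (norm (X z))\<^sup>2 \<le> J z \<bullet> X z" using JX A(2) by simp
      \<comment> \<open>The essential bound C may be negative when \<Omega> is empty.\<close>
      show "0 \<le> max C 0" by simp
      show "AE z in lborel. \<bar>K z\<bar> \<le> max C 0 * (\<eta> + Z z) powr \<sigma> * norm (X z)"
        using KX C[unfolded AE_lebesgue_on_iff[OF Qb]]
      proof eventually_elim
        case (elim z)
        show ?case
        proof (cases "z \<in> ?Q")
          case True
          then have "h z \<le> max C 0" using elim by auto
          then have "h z * (\<eta> + Z z) powr \<sigma> * norm (X z) \<le> max C 0 * (\<eta> + Z z) powr \<sigma> * norm (X z)"
            by (intro mult_right_mono) auto
          then show ?thesis using elim True by auto
        qed (simp add: offJ)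
      qed
    qed
  next
    fix r assume B: "\<epsilon> > 0" "\<eta> = 0" "r \<ge> N + 2" "h \<in> Lp ?Q r" "0 \<le> \<sigma>"
      "\<sigma> \<le> p * (1 / (N + 2) - 1 / r) + (p - 2) / 2" "2 \<le> p"
    obtain h' where h': "h' \<in> borel_measurable borel" "\<And>z. z \<notin> ?Q \<Longrightarrow> h' z = 0" "AE z in lborel. z \<in> ?Q \<longrightarrow> h' z = h z"
      using lebesgue_on_borel_rep[OF Qb LpD(1)[OF B(4)]] by blast
    have hr: "integrable lborel (\<lambda>z. \<bar>h' z\<bar> powr r)"
    proof (subst integrable_lebesgue_on_iff(1)[OF Qb, symmetric])
      show "integrable (lebesgue_on ?Q) (\<lambda>z. norm (h z) powr r)" by (rule LpD[OF B(4)])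
      show "(\<lambda>z. norm (h z) powr r) \<in> borel_measurable (lebesgue_on ?Q)" using LpD(1)[OF B(4)] by measurable
      show "AE z in lborel. z \<in> ?Q \<longrightarrow> \<bar>h' z\<bar> powr r = norm (h z) powr r" using h'(3) by eventually_elim auto
    qed (use h' in auto)
    have Zp: "integrable lborel (\<lambda>z. Z z powr p)"
    proof (rule Bochner_Integration.integrable_bound)
      show "integrable lborel (\<lambda>z. 2 powr p * (norm (Xu z) powr p + norm (Xv z) powr p))" using Xuv by simp
      show "AE z in lborel. norm (Z z powr p) \<le> norm (2 powr p * (norm (Xu z) powr p + norm (Xv z) powr p))"
        using powr_add_le[of "norm (Xu _)" "norm (Xv _)" p] p by (simp add: Z_def)
    qed (use Zm in measurable)
    show ?thesis
    proof (rule pos_energy_zero_degenerate[OF \<open>\<alpha> > 0\<close> B(1,7) B(3)[unfolded N_def] B(5) B(6)[unfolded N_def] Zm h'(1) XZ _ Zp hr JX _ init t])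
      show "Z z = 0 \<and> h' z = 0" if "z \<notin> ?Q" for z using h'(2) offJ(4) that by blast
      show "AE z in lborel. \<bar>K z\<bar> \<le> \<bar>h' z\<bar> * Z z powr \<sigma> * norm (X z)"
        using KX h'(3)
      proof eventually_elim
        case (elim z)
        show ?case
        proof (cases "z \<in> ?Q")
          case True
          then have "\<bar>K z\<bar> \<le> h' z * Z z powr \<sigma> * norm (X z)" using elim B(2) by simp
          also have "\<dots> \<le> \<bar>h' z\<bar> * Z z powr \<sigma> * norm (X z)" by (intro mult_right_mono) auto
          finally show ?thesis .
        qed (simp add: offJ)
      qed
    qed
  qed
  have "AE z in lborel. W z \<le> 0" by (rule nonpositive_AE) (rule zero)
  with rep have "AE z in lborel. z \<in> ?Q \<longrightarrow> u z \<le> v z" by eventually_elim auto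
  then show ?thesis by (simp only: AE_lebesgue_on_iff[OF Qb])
qed

end
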